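(* Let $2\le\ell\le p-1$ and let $r=p^2-(p-1)\ell+p$. Let $f(X)=X^{p^2}+f_1X^{p^2-1}+\dots+f_{p^2-1}X+f_{p^2}\in\mathcal{O}_K[X]$ be an Eisenstein polynomial such that (1) $v_p(f_p)=1$, and $v_p(f_{pi})\ge 2$ for $i\in I(2,p-1)$; (2) $v_p(f_i)\ge 2$ for $i\in I(1,r-1)$, $v_p(f_r)=2$, and $v_p(f_i)\ge 3$ for $i\in I(r+1,p^2-1)$; and, putting $F_p=\overline{f_p/p}$, $F_{p^2}=\overline{f_{p^2}/p}$ and $G_i=\overline{f_i/p^2}$ for all $i\ne p,p^2$, (3) $-F_p/F_{p^2}=\bar\rho^{\,p-1}$ for some $\bar\rho\in\kappa_K^\times$; (4) $\ell G_r/(F_pF_{p^2})=\bar\eta^{\,p-1}$ for some $\bar\eta\in\kappa_K^\times$. Let $L$ be the extension of $K$ determined by $f(X)$, $\tilde L$ its normal closure over $K$, and $F$ the unique subextension of degree $p$ over $K$ contained in $L$. Then $\mathrm{Gal}(\tilde L/K)$ is a split extension of $G=\mathrm{Gal}(F/K)$ by the indecomposable $\mathbb{F}_p[G]$-module $M=\mathrm{Gal}(\tilde L/F)$. Furthermore, defining $$U(X)=\left(-F_p/F_{p^2}\right)^{\ell}X^p-\frac{\ell G_r}{F_pF_{p^2}}X-1,$$ we have: - if $U(X)$ has no root in $\kappa_K$, then $M$ has length $\ell+1$ and $\tilde L/F$ is formed by an unramified extension followed by a totally ramified extension with upper ramification breaks $1,2,\dots,\ell$; - if $U(X)$ has some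 root in $\kappa_K$, then $M$ has length $\ell$ and $\tilde L/F$ is totally ramified with upper ramification breaks $1,2,\dots,\ell$.
   Context: Throughout, $p$ is an odd prime and $K$ is a finite unramified extension of $\mathbb{Q}_p$, with ring of integers $\mathcal{O}_K$ and residue field $\kappa_K=\mathcal{O}_K/p\mathcal{O}_K$. For $x\in\mathcal{O}_K$, $\overline{x}$ is its image in $\kappa_K$; $v_p$ is the valuation on $K$ with $v_p(p)=1$. For integers $a,b$, $I(a,b)$ is the set of integers $i$ with $a\le i\le b$ and $\gcd(i,p)=1$. "The extension determined by $f$" is $L=K(\pi)$ with $\pi$ a root of $f$. The group $G=\mathrm{Gal}(F/K)$ acts on the elementary abelian $p$-group $\mathrm{Gal}(\tilde L/F)$ by conjugation, making it an $\mathbb{F}_p[G]$-module; its length is its composition length, i.e. its dimension over $\mathbb{F}_p$. *)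

theory Defs
  imports
    "HOL-Analysis.Analysis"
    "HOL-Algebra.Algebra"
    "HOL-Algebra.Algebraic_Closure_Type"
    "HOL-Number_Theory.Residues"
begin

section \<open>The ambient valued field\<close>

text \<open>All fields live inside one algebraically closed field of characteristic \<open>0\<close>, with the
  additive valuation \<open>v\<close> extending the \<open>p\<close>-adic one.  The intended
  instances are \<open>\<Omega> =\<close> an algebraic closure of \<open>\<rat>\<^sub>p\<close> and its completion.\<close>

abbreviation Omega :: "'a::field ring" where
  "Omega \<equiv> ring_of_type_algebra"

definition rat_cauchy :: "('a::field_char_0 \<Rightarrow> ereal) \<Rightarrow> (nat \<Rightarrow> rat) \<Rightarrow> bool" where
  "rat_cauchy v s \<longleftrightarrow>
     (\<forall>B::real. \<exists>M. \<forall>m\<ge>M. \<forall>n\<ge>M. ereal B \<le> v (of_rat (s m) - of_rat (s n)))"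

definition rat_limit :: "('a::field_char_0 \<Rightarrow> ereal) \<Rightarrow> (nat \<Rightarrow> rat) \<Rightarrow> 'a \<Rightarrow> bool" where
  "rat_limit v s x \<longleftrightarrow> (\<forall>B::real. \<exists>M. \<forall>n\<ge>M. ereal B \<le> v (x - of_rat (s n)))"

text \<open>The normalisation \<open>v p = 1\<close> forces \<open>v\<close> to be the \<open>p\<close>-adic valuation on the rationals;
  \<open>complete\<close> says that the completion of \<open>\<rat>\<close> is contained in the ambient field.\<close>

locale padic_valuation =
  fixes p :: nat and v :: "'a::field_char_0 \<Rightarrow> ereal"
  assumes prime_p: "Factorial_Ring.prime p"
    and val_eq_infinity: "\<And>x. v x = \<infinity> \<longleftrightarrow> x = 0"
    and val_neq_minus_infinity: "\<And>x. v x \<noteq> - \<infinity>"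
    and val_mult: "\<And>x y. v (x * y) = v x + v y"
    and val_add: "\<And>x y. min (v x) (v y) \<le> v (x + y)"
    and val_p: "v (of_nat p) = 1"
    and complete: "\<And>s. rat_cauchy v s \<Longrightarrow> \<exists>x. rat_limit v s x"

definition Qp :: "('a::field_char_0 \<Rightarrow> ereal) \<Rightarrow> 'a set" where
  "Qp v = {x. \<exists>s. rat_limit v s x}"


section \<open>Field extensions and Galois groups\<close>

definition field_ext :: "'a::field set \<Rightarrow> 'a set \<Rightarrow> bool" where
  "field_ext F E \<longleftrightarrow> subfield F Omega \<and> subfield E Omega \<and> F \<subseteq> E"

definition finite_ext :: "'a::field set \<Rightarrow> 'a set \<Rightarrow> bool" where
  "finite_ext F E \<longleftrightarrow> field_ext F E \<and> ring.finite_dimension Omega F E"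

definition ext_of_degree :: "nat \<Rightarrow> 'a::field set \<Rightarrow> 'a set \<Rightarrow> bool" where
  "ext_of_degree n F E \<longleftrightarrow> field_ext F E \<and> ring.dimension Omega n F E"

text \<open>As the ambient field is algebraically closed, a polynomial splits in \<open>N\<close> iff
  all its roots in the ambient field lie in \<open>N\<close>.\<close>

definition normal_ext :: "'a::alg_closed_field set \<Rightarrow> 'a set \<Rightarrow> bool" where
  "normal_ext K N \<longleftrightarrow> field_ext K N \<and> (\<forall>x\<in>N. \<not> ring.transcendental Omega K x) \<and>
     (\<forall>q\<in>carrier (univ_poly Omega K). ring_irreducible\<^bsub>univ_poly Omega K\<^esub> q \<longrightarrow>
        (\<exists>x\<in>N. ring.eval Omega q x = 0) \<longrightarrow> (\<forall>y. ring.eval Omega q y = 0 \<longrightarrow> y \<in> N))"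

definition normal_closure :: "'a::alg_closed_field set \<Rightarrow> 'a set \<Rightarrow> 'a set" where
  "normal_closure K L = \<Inter>{N. normal_ext K N \<and> L \<subseteq> N}"

text \<open>\<open>Gal E F\<close> is \<open>Gal(E/F)\<close>; its elements are functions that are \<open>undefined\<close> outside \<open>E\<close>.\<close>

definition Gal :: "'a::field set \<Rightarrow> 'a set \<Rightarrow> ('a \<Rightarrow> 'a) monoid" where
  "Gal E F = (BijGroup E)\<lparr>carrier :=
     {\<sigma> \<in> Bij E. \<sigma> \<in> ring_hom (Omega\<lparr>carrier := E\<rparr>) (Omega\<lparr>carrier := E\<rparr>) \<and>
        (\<forall>x\<in>F. \<sigma> x = x)}\<rparr>"

definition split_extension ::
  "('e, 'm) monoid_scheme \<Rightarrow> ('e, 'n) monoid_scheme \<Rightarrow> ('q, 'k) monoid_scheme \<Rightarrow> ('e \<Rightarrow> 'q) \<Rightarrow> bool"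
where
  "split_extension E N Q \<phi> \<longleftrightarrow> group E \<and> group N \<and> group Q \<and>
     (\<lambda>x. x) \<in> hom N E \<and> \<phi> \<in> hom E Q \<and> \<phi> ` carrier E = carrier Q \<and>
     kernel E Q \<phi> = carrier N \<and> (\<exists>s \<in> hom Q E. \<forall>x \<in> carrier Q. \<phi> (s x) = x)"

definition elementary_abelian :: "nat \<Rightarrow> ('g, 'm) monoid_scheme \<Rightarrow> bool" where
  "elementary_abelian p M \<longleftrightarrow> comm_group M \<and> (\<forall>x\<in>carrier M. x [^]\<^bsub>M\<^esub> p = \<one>\<^bsub>M\<^esub>)"


section \<open>Group algebras and modules\<close>

text \<open>Group algebra \<open>R[G]\<close> of a finite group \<open>G\<close>, with the convolution product.\<close>

definition group_algebra :: "('r, 'm) ring_scheme \<Rightarrow> ('g, 'n) monoid_scheme \<Rightarrow> ('g \<Rightarrow> 'r) ring" where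
  "group_algebra R G =
     \<lparr>carrier = carrier G \<rightarrow>\<^sub>E carrier R,
      monoid.mult = \<lambda>a b. \<lambda>g\<in>carrier G.
        (\<Oplus>\<^bsub>R\<^esub>h\<in>carrier G. a h \<otimes>\<^bsub>R\<^esub> b (m_inv G h \<otimes>\<^bsub>G\<^esub> g)),
      one = \<lambda>g\<in>carrier G. if g = \<one>\<^bsub>G\<^esub> then \<one>\<^bsub>R\<^esub> else \<zero>\<^bsub>R\<^esub>,
      ring.zero = \<lambda>g\<in>carrier G. \<zero>\<^bsub>R\<^esub>,
      ring.add = \<lambda>a b. \<lambda>g\<in>carrier G. a g \<oplus>\<^bsub>R\<^esub> b g\<rparr>"

text \<open>For \<open>K \<subseteq> F \<subseteq> N\<close>: \<open>g\<close> in \<open>Gal(F/K)\<close> acts on \<open>Gal(N/F)\<close> through conjugation by a lift of \<open>g\<close> to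
  \<open>Gal(N/K)\<close>; when \<open>Gal(N/F)\<close> is abelian, the choice of the lift does not matter.\<close>

definition conj_action ::
  "'a::field set \<Rightarrow> 'a set \<Rightarrow> 'a set \<Rightarrow> ('a \<Rightarrow> 'a) \<Rightarrow> ('a \<Rightarrow> 'a) \<Rightarrow> ('a \<Rightarrow> 'a)" where
  "conj_action K F N g m =
     (let \<sigma> = (SOME \<sigma>. \<sigma> \<in> carrier (Gal N K) \<and> restrict \<sigma> F = g)
      in \<sigma> \<otimes>\<^bsub>Gal N K\<^esub> m \<otimes>\<^bsub>Gal N K\<^esub> m_inv (Gal N K) \<sigma>)"

text \<open>\<open>Gal(N/F)\<close>, written additively, as an \<open>\<int>[Gal(F/K)]\<close>-module; when \<open>Gal(N/F)\<close> has
  exponent \<open>p\<close>, this is its structure over \<open>group_algebra (residue_ring p) (Gal F K)\<close>, whose elements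
  have their coefficients in \<open>{0..p-1}\<close>.  The multiplicative fields of the record play no
  role in a module.\<close>

definition galois_module ::
  "'a::field set \<Rightarrow> 'a set \<Rightarrow> 'a set \<Rightarrow> (('a \<Rightarrow> 'a) \<Rightarrow> int, 'a \<Rightarrow> 'a) module" where
  "galois_module K F N =
     \<lparr>carrier = carrier (Gal N F),
      monoid.mult = (\<lambda>_ _. undefined),
      one = undefined,
      ring.zero = \<one>\<^bsub>Gal N F\<^esub>,
      ring.add = (\<lambda>\<sigma> \<tau>. \<sigma> \<otimes>\<^bsub>Gal N F\<^esub> \<tau>),
      smult = (\<lambda>a m. \<Otimes>\<^bsub>Gal N F\<^esub>g\<in>carrier (Gal F K).
                 conj_action K F N g m [^]\<^bsub>Gal N F\<^esub> a g)\<rparr>"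

definition indecomposable_module ::
  "('r, 'm) ring_scheme \<Rightarrow> ('r, 'b, 'n) module_scheme \<Rightarrow> bool" where
  "indecomposable_module R M \<longleftrightarrow> Module.module R M \<and> carrier M \<noteq> {\<zero>\<^bsub>M\<^esub>} \<and>
     (\<forall>A B. submodule A R M \<and> submodule B R M \<and>
        A \<inter> B = {\<zero>\<^bsub>M\<^esub>} \<and> A <+>\<^bsub>M\<^esub> B = carrier M \<longrightarrow> A = {\<zero>\<^bsub>M\<^esub>} \<or> B = {\<zero>\<^bsub>M\<^esub>})"

definition has_composition_length ::
  "('r, 'm) ring_scheme \<Rightarrow> ('r, 'b, 'n) module_scheme \<Rightarrow> nat \<Rightarrow> bool" where
  "has_composition_length R M n \<longleftrightarrow>
     (\<exists>N :: nat \<Rightarrow> 'b set. N 0 = {\<zero>\<^bsub>M\<^esub>} \<and> N n = carrier M \<and> (\<forall>i\<le>n. submodule (N i) R M) \<and>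
        (\<forall>i<n. N i \<subset> N (Suc i) \<and>
           (\<forall>S. submodule S R M \<and> N i \<subseteq> S \<and> S \<subseteq> N (Suc i) \<longrightarrow> S = N i \<or> S = N (Suc i))))"


section \<open>Rings of integers and ramification\<close>

definition int_ring :: "('a::field \<Rightarrow> ereal) \<Rightarrow> 'a set \<Rightarrow> 'a ring" where
  "int_ring v E = Omega\<lparr>carrier := {x \<in> E. 0 \<le> v x}\<rparr>"

definition max_ideal :: "('a::field \<Rightarrow> ereal) \<Rightarrow> 'a set \<Rightarrow> 'a set" where
  "max_ideal v E = {x \<in> E. 0 < v x}"

definition value_group :: "('a::field \<Rightarrow> ereal) \<Rightarrow> 'a set \<Rightarrow> real set" where
  "value_group v E = (\<lambda>x. real_of_ereal (v x)) ` (E - {0})"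

text \<open>The number of cosets of \<open>value_group v F\<close> in \<open>value_group v E\<close>.\<close>

definition ram_index :: "('a::field \<Rightarrow> ereal) \<Rightarrow> 'a set \<Rightarrow> 'a set \<Rightarrow> nat" where
  "ram_index v F E = card ((\<lambda>c. (+) c ` value_group v F) ` value_group v E)"

text \<open>Residue fields of finite extensions of \<open>\<rat>\<^sub>p\<close> are finite, so the separability of the residue
  extension does not have to be required.\<close>

definition unramified_ext :: "('a::field \<Rightarrow> ereal) \<Rightarrow> 'a set \<Rightarrow> 'a set \<Rightarrow> bool" where
  "unramified_ext v F E \<longleftrightarrow> finite_ext F E \<and> ram_index v F E = 1"

definition totally_ramified_ext :: "('a::field \<Rightarrow> ereal) \<Rightarrow> 'a set \<Rightarrow> 'a set \<Rightarrow> bool" where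
  "totally_ramified_ext v F E \<longleftrightarrow> ext_of_degree (ram_index v F E) F E"

text \<open>The valuation of \<open>E\<close> with value group \<open>\<int>\<close>.\<close>

definition normalized_val :: "('a::field_char_0 \<Rightarrow> ereal) \<Rightarrow> 'a set \<Rightarrow> 'a \<Rightarrow> ereal" where
  "normalized_val v E x = ereal (real (ram_index v (Qp v) E)) * v x"

text \<open>Lower numbering (with real indices \<open>u \<ge> -1\<close>), Herbrand function, and upper numbering
  \<open>G^w = G_(\<psi>(w))\<close> of \<open>G = Gal(E/F)\<close>, as in Serre's Local Fields; \<open>\<psi>\<close> is the
  inverse of the Herbrand function.\<close>

definition lower_ram ::
  "('a::field_char_0 \<Rightarrow> ereal) \<Rightarrow> 'a set \<Rightarrow> 'a set \<Rightarrow> real \<Rightarrow> ('a \<Rightarrow> 'a) set" where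
  "lower_ram v E F u =
     {\<sigma> \<in> carrier (Gal E F). \<forall>x \<in> carrier (int_ring v E).
        ereal (of_int \<lceil>u\<rceil> + 1) \<le> normalized_val v E (\<sigma> x - x)}"

definition herbrand :: "('a::field_char_0 \<Rightarrow> ereal) \<Rightarrow> 'a set \<Rightarrow> 'a set \<Rightarrow> real \<Rightarrow> real" where
  "herbrand v E F u =
     (if u \<le> 0 then u
      else integral {0..u} (\<lambda>t. real (card (lower_ram v E F t)) / real (card (lower_ram v E F 0))))"

definition upper_ram ::
  "('a::field_char_0 \<Rightarrow> ereal) \<Rightarrow> 'a set \<Rightarrow> 'a set \<Rightarrow> real \<Rightarrow> ('a \<Rightarrow> 'a) set" where
  "upper_ram v E F w = lower_ram v E F (the_inv_into {-1..} (herbrand v E F) w)"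

definition upper_breaks :: "('a::field_char_0 \<Rightarrow> ereal) \<Rightarrow> 'a set \<Rightarrow> 'a set \<Rightarrow> real set" where
  "upper_breaks v E F = {w. -1 \<le> w \<and> (\<forall>\<epsilon>>0. upper_ram v E F (w + \<epsilon>) \<noteq> upper_ram v E F w)}"


section \<open>Residue field and Eisenstein polynomials\<close>

text \<open>For an unramified \<open>K\<close>: the residue field \<open>\<O>\<^sub>K/p\<O>\<^sub>K\<close> and reduction modulo \<open>p\<close>.\<close>

definition residue_field :: "nat \<Rightarrow> ('a::field \<Rightarrow> ereal) \<Rightarrow> 'a set \<Rightarrow> 'a set ring" where
  "residue_field p v K = int_ring v K Quot PIdl\<^bsub>int_ring v K\<^esub> (of_nat p)"

definition reduction :: "nat \<Rightarrow> ('a::field \<Rightarrow> ereal) \<Rightarrow> 'a set \<Rightarrow> 'a \<Rightarrow> 'a set" where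
  "reduction p v K x = PIdl\<^bsub>int_ring v K\<^esub> (of_nat p) +>\<^bsub>int_ring v K\<^esub> x"

definition eisenstein :: "('a::field \<Rightarrow> ereal) \<Rightarrow> 'a set \<Rightarrow> 'a poly \<Rightarrow> bool" where
  "eisenstein v K f \<longleftrightarrow> Polynomial.degree f > 0 \<and> Polynomial.lead_coeff f = 1 \<and>
     (\<forall>i < Polynomial.degree f. Polynomial.coeff f i \<in> max_ideal v K) \<and>
     Polynomial.coeff f 0 \<notin> ideal_prod (int_ring v K) (max_ideal v K) (max_ideal v K)"

text \<open>The coefficient \<open>f_i\<close> in \<open>f = X^n + f_1 X^(n-1) + \<dots> + f_n\<close>, with \<open>n = degree f\<close>.\<close>

definition co_coeff :: "'a::zero poly \<Rightarrow> nat \<Rightarrow> 'a" where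
  "co_coeff f i = Polynomial.coeff f (Polynomial.degree f - i)"

definition coprime_range :: "nat \<Rightarrow> nat \<Rightarrow> nat \<Rightarrow> nat set" where
  "coprime_range p a b = {i. a \<le> i \<and> i \<le> b \<and> Rings.coprime i p}"

end

theory Submission imports Defs begin

text \<open>Since \<open>v (f_p) = 1\<close>, the subfield \<open>F\<close> is cyclic over \<open>K\<close> with ramification break 1; let \<open>\<sigma>\<close> generate its group.
The extension \<open>L / F\<close> is generated by a root of an Artin-Schreier equation \<open>y^p - y = \<alpha> l\<close> with \<open>\<alpha> l\<close> of
valuation \<open>-l/p\<close>, and the iterates \<open>\<alpha> (l - i)\<close> of \<open>\<alpha> l\<close> under \<open>\<sigma> - 1\<close> have valuation \<open>(i - l)/p\<close>. The
normal closure is obtained by adjoining roots \<open>Y k\<close> for all of them: \<open>k > 0\<close> gives the break \<open>k\<close>, while \<open>\<alpha> 0\<close>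
is a unit, whose equation is unramified or split according to the roots of \<open>U\<close>. Pairing the Galois
group with the \<open>Y k\<close> shows that its submodules form a chain.\<close>

text \<open>In characteristic 0 the map \<open>x^p - x\<close> is not additive. It is additive
  modulo the maximal ideal on elements of valuation above \<open>-1/p\<close>, since
  \<open>p\<close> divides the mixed binomial coefficients, and as \<open>l < p\<close> every
  \<open>Y k\<close> lies in that range, with valuation \<open>-k/p^2\<close>. So Artin-Schreier
  theory is done with congruences, and Hensel's lemma, with the uniqueness of a root close to a
  given point, turns them back into equalities. The condition on \<rho> makes the rescaled equation
  for the conjugates of the generator of \<open>F\<close> congruent to \<open>w^p - w = 0\<close>;
  the one on \<eta> produces the Artin-Schreier equation of \<open>L\<close>. A pole order
  \<open>k\<close> over \<open>F\<close> is no longer reduced once other roots are adjoined: a step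
  with break \<open>b\<close> allows order \<open>c\<close> to be brought to
  \<open>p*c - (p-1)*b\<close>. Iterated, this gives lower breaks
  \<open>1 + p + ... + p^(k-1)\<close>, that is, upper breaks \<open>k\<close>. The bound
  \<open>l < p\<close> also gives the splitting: a lift of \<sigma> acts on the \<open>Y k\<close>
  as \<open>1 + N\<close> with \<open>N\<close> nilpotent of order at most \<open>p\<close>, so its
  p-th power is trivial.\<close>

abbreviation (input) "pcoeff \<equiv> Polynomial.coeff"
abbreviation (input) "pdeg \<equiv> Polynomial.degree"
abbreviation (input) "plead p \<equiv> Polynomial.lead_coeff p"

section \<open>Inequalities for the valuation\<close>

context padic_valuation
begin

text \<open>Comparisons with real constants keep the arithmetic of exponents in the reals.
  \<open>vge\<close> and \<open>vgt\<close> hold for 0 at every level, while \<open>val\<close>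
  never holds at 0, so \<open>val\<close> also records that the element is nonzero.\<close>

definition vge :: "real => 'a => bool" where "vge c x = (ereal c \<le> v x)"
definition vgt :: "real => 'a => bool" where "vgt c x = (ereal c < v x)"
definition val :: "real => 'a => bool" where "val c x = (v x = ereal c)"

lemma v_0 [simp]: "v 0 = \<infinity>"
	by (simp add: val_eq_infinity)

lemma val_ex: "x \<noteq> 0 ==> \<exists>c. val c x"
	unfolding val_def using val_eq_infinity[of x] val_neq_minus_infinity[of x] by (cases "v x") auto

lemma val_unique: "val a x ==> val b x ==> a = b"
	by (simp add: val_def)

lemma val_nonzero: "val a x ==> x \<noteq> 0"
	by (auto simp: val_def)

lemma vge_0 [simp]: "vge c 0" and vgt_0 [simp]: "vgt c 0"
	by (auto simp: vge_def vgt_def)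

lemma val_vge: "val a x ==> vge c x = (c \<le> a)"
	and val_vgt: "val a x ==> vgt c x = (c < a)"
	by (auto simp: val_def vge_def vgt_def)

lemma vge_mono: "vge c x ==> d \<le> c ==> vge d x"
	unfolding vge_def by (meson ereal_less_eq(3) order_trans)

lemma vgt_mono: "vgt c x ==> d \<le> c ==> vgt d x"
	unfolding vgt_def by (meson ereal_less_eq(3) order_le_less_trans)

lemma vgt_vge: "vgt c x ==> vge c x"
	by (auto simp: vge_def vgt_def)

lemma vge_vgt: "vge c x ==> d < c ==> vgt d x"
	unfolding vge_def vgt_def by (meson ereal_less(2) less_ereal.simps(1) order_less_le_trans)

lemma not_vge: "\<not> vge c x ==> \<exists>a < c. val a x"
	unfolding vge_def val_def using val_neq_minus_infinity[of x] by (cases "v x") auto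

lemma not_vgt: "\<not> vgt c x ==> \<exists>a \<le> c. val a x"
	unfolding vgt_def val_def using val_neq_minus_infinity[of x] by (cases "v x") auto

lemma vge_cases: "vge c x ==> vgt c x \<or> val c x"
	unfolding vge_def vgt_def val_def by (metis order.not_eq_order_implies_strict)

lemma vgt_obtain: assumes "vgt c x" obtains d where "c < d" "vge d x"
proof (cases "x = 0")
	case True
	show ?thesis by (rule that[of "c+1"]) (auto simp: True)
next
	case False
	then obtain a where a: "val a x" using val_ex by blast
	show ?thesis by (rule that[of a]) (use a assms in \<open>auto simp: val_vge val_vgt\<close>)
qed

lemma v_1 [simp]: "v 1 = 0"
proof -
	obtain c where c: "v 1 = ereal c" using val_ex[of 1] by (auto simp: val_def)
	show ?thesis using val_mult[of 1 1] c by simp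
qed

lemma val_1 [simp]: "val 0 1"
	by (simp add: val_def)

lemma val_mul: "val a x ==> val b y ==> val (a+b) (x*y)"
	by (simp add: val_def val_mult)

lemma vge_mul: assumes "vge a x" "vge b y" shows "vge (a+b) (x*y)"
proof -
	have "ereal a+ereal b \<le> v x + v y" using assms unfolding vge_def by (rule add_mono)
	thus ?thesis by (simp add: vge_def val_mult)
qed

lemma vgt_mul: assumes "vgt a x" "vge b y" shows "vgt (a+b) (x*y)"
proof -
	obtain d where "a < d" "vge d x" using vgt_obtain[OF assms(1)] .
	thus ?thesis using vge_mul[of d x b y] assms(2) by (auto intro: vge_vgt)
qed

lemma vgt_mul': "vge a x ==> vgt b y ==> vgt (a+b) (x*y)"
	using vgt_mul[of b y a x] by (simp add: algebra_simps)

lemma val_power: "val a x ==> val (real n*a) (x^n)"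
proof (induction n)
	case (Suc n) thus ?case using val_mul[of a x "real n*a" "x^n"] by (simp add: algebra_simps)
qed simp

lemma vge_power: "vge a x ==> vge (real n*a) (x^n)"
proof (induction n)
	case 0 thus ?case by (simp add: vge_def)
next
	case (Suc n) thus ?case using vge_mul[of a x "real n*a" "x^n"] by (simp add: algebra_simps)
qed

lemma val_neg1: "val 0 (-1)"
proof -
	obtain c where c: "val c (-1)" using val_ex[of "-1"] by auto
	from val_mul[OF c c] have "val (c + c) 1" by simp
	hence "c = 0" using val_unique[OF _ val_1] by force
	thus ?thesis using c by simp
qed

lemma v_minus [simp]: "v (- x) = v x"
	using val_mult[of "-1" x] val_neg1 by (simp add: val_def)

lemma vge_minus [simp]: "vge c (- x) = vge c x"
	and vgt_minus [simp]: "vgt c (- x) = vgt c x"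
	and val_minus [simp]: "val c (- x) = val c x"
	by (auto simp: vge_def vgt_def val_def)

lemma v_minus_commute: "v (x-y) = v (y-x)"
	by (metis minus_diff_eq v_minus)

lemma vge_minus_commute: "vge c (x-y) = vge c (y-x)"
	and vgt_minus_commute: "vgt c (x-y) = vgt c (y-x)"
	and val_minus_commute: "val c (x-y) = val c (y-x)"
	by (auto simp: vge_def vgt_def val_def v_minus_commute)

lemma vge_add: "vge c x ==> vge c y ==> vge c (x+y)"
	unfolding vge_def using val_add[of x y] by (meson min.boundedI order_trans)

lemma vgt_add: "vgt c x ==> vgt c y ==> vgt c (x+y)"
	unfolding vgt_def using val_add[of x y] by (meson min_less_iff_conj order_less_le_trans)

lemma vge_diff: "vge c x ==> vge c y ==> vge c (x-y)"
	using vge_add[of c x "- y"] by simp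

lemma vgt_diff: "vgt c x ==> vgt c y ==> vgt c (x-y)"
	using vgt_add[of c x "- y"] by simp

lemma vge_trans: "vge c (x-y) ==> vge c (y-z) ==> vge c (x-z)"
	using vge_add[of c "x-y" "y-z"] by simp

lemma vgt_trans: "vgt c (x-y) ==> vgt c (y-z) ==> vgt c (x-z)"
	using vgt_add[of c "x-y" "y-z"] by simp

lemma vgt_iff: "vgt c (x-y) ==> vgt c x = vgt c y"
	using vgt_add[of c "x-y" y] vgt_diff[of c x "x-y"] by auto

lemma vge_iff: "vge c (x-y) ==> vge c x = vge c y"
	using vge_add[of c "x-y" y] vge_diff[of c x "x-y"] by auto

lemma vge_sum: "(\<And>i. i \<in> A ==> vge c (f i)) ==> vge c (sum f A)"
	by (induction A rule: infinite_finite_induct) (auto intro: vge_add)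

lemma vgt_sum: "(\<And>i. i \<in> A ==> vgt c (f i)) ==> vgt c (sum f A)"
	by (induction A rule: infinite_finite_induct) (auto intro: vgt_add)

lemma val_plus: assumes "val a x" "vgt a y" shows "val a (x+y)"
proof -
	have "vge a (x+y)" using assms by (auto intro!: vge_add simp: val_vge vgt_vge)
	moreover have "\<not> vgt a (x+y)"
		using vgt_diff[of a "x+y" y] assms by (auto simp: val_vgt)
	ultimately show ?thesis using vge_cases by blast
qed

lemma val_plus': "vgt a x ==> val a y ==> val a (x+y)"
	using val_plus[of a y x] by (simp add: add.commute)

lemma val_diff: "val a x ==> vgt a y ==> val a (x-y)"
	using val_plus[of a x "- y"] by simp

lemma val_cong: "vgt a (x-y) ==> val a x = val a y"
	using val_diff[of a x "x-y"] val_plus[of a y "x-y"] by auto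

lemma val_inverse: "val a x ==> val (- a) (inverse x)"
proof -
	assume a: "val a x"
	hence "inverse x \<noteq> 0" using val_nonzero by auto
	then obtain c where c: "val c (inverse x)" using val_ex by blast
	have "a + c = 0" using val_mul[OF a c] val_nonzero[OF a] val_unique val_1 by simp
	thus ?thesis using c by (simp add: add_eq_0_iff)
qed

lemma val_divide: "val a x ==> val b y ==> val (a-b) (x/y)"
	using val_mul[of a x "-b" "inverse y"] val_inverse[of b y] by (simp add: divide_inverse)

lemma vge_divide: "vge a x ==> val b y ==> vge (a-b) (x/y)"
	using vge_mul[of a x "-b" "inverse y"] val_inverse[of b y] by (simp add: divide_inverse val_vge)

lemma vgt_divide: "vgt a x ==> val b y ==> vgt (a-b) (x/y)"
	using vgt_mul[of a x "-b" "inverse y"] val_inverse[of b y] by (simp add: divide_inverse val_vge)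

lemma vge_of_nat [simp]: "vge 0 (of_nat n)"
proof (induction n)
	case (Suc n) thus ?case using vge_add[of 0 1 "of_nat n"] by (simp add: val_vge[OF val_1])
qed simp

lemma vge_1 [simp]: "vge 0 1"
	by (simp add: val_vge[OF val_1])

lemma vge_of_int [simp]: "vge 0 (of_int n)"
proof (cases "n \<ge> 0")
	case True thus ?thesis using vge_of_nat[of "nat n"] by (simp del: vge_of_nat)
next
	case False thus ?thesis using vge_of_nat[of "nat (- n)"] vge_minus[of 0 "of_int n"] by (simp del: vge_of_nat vge_minus)
qed

lemma val_p' [simp]: "val 1 (of_nat p)"
	using val_p by (simp add: val_def)

lemma p_gt_1: "p > 1" and p_gt_0: "p > 0"
	using prime_p prime_gt_1_nat prime_gt_0_nat by auto

lemma vge_p_dvd: assumes "p dvd n" shows "vge 1 (of_nat n)"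
proof -
	obtain k where "n = p * k" using assms by blast
	thus ?thesis using vge_mul[of 1 "of_nat p" 0 "of_nat k"] by (simp add: val_vge[OF val_p'])
qed

lemma vge_p_dvd_int: assumes "int p dvd n" shows "vge 1 (of_int n)"
proof -
	obtain k where "n = int p * k" using assms by blast
	thus ?thesis using vge_mul[of 1 "of_nat p" 0 "of_int k"] by (simp add: val_vge[OF val_p'])
qed

text \<open>A Bezout identity \<open>a*n + b*p = 1\<close> makes \<open>a*n\<close> a unit, and then
  neither factor, both being integral, can have positive valuation.\<close>

lemma val_of_int: assumes "\<not> int p dvd n" shows "val 0 (of_int n)"
proof -
	have "Rings.coprime n (int p)"
		by (meson assms prime_p coprime_commute prime_imp_coprime prime_nat_int_transfer)
	then obtain a b where ab: "a*n+b*int p = 1"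
		using bezout_int[of n "int p"] by auto
	have "of_int a * of_int n = 1 - of_int b*(of_nat p :: 'a)"
		using arg_cong[OF ab, of "of_int :: int => 'a"] by (simp add: algebra_simps)
	moreover have "vgt 0 (of_int b*(of_nat p))"
		using vge_mul[of 0 "of_int b" 1 "of_nat p"] by (auto intro: vge_vgt simp: val_vge[OF val_p'])
	ultimately have 1: "val 0 (of_int a * of_int n)"
		using val_diff[OF val_1] by metis
	show ?thesis
	proof (rule ccontr)
		assume "\<not> ?thesis"
		hence "vgt 0 (of_int n)" using vge_cases[OF vge_of_int] by blast
		hence "vgt 0 (of_int a * of_int n)" using vgt_mul'[of 0 "of_int a" 0 "of_int n"] by simp
		thus False using 1 by (simp add: val_vgt)
	qed
qed

lemma val_of_nat: "\<not> p dvd n ==> val 0 (of_nat n)"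
	using val_of_int[of "int n"] by simp

lemma vgt_of_int_iff: "vgt 0 (of_int n) = (int p dvd n)"
	using val_of_int[of n] vge_p_dvd_int[of n] vge_vgt[of 1 "of_int n" 0] val_vgt[of 0 "of_int n" 0] by auto

lemma vgt_of_nat_iff: "vgt 0 (of_nat n) = (p dvd n)"
	using vgt_of_int_iff[of "int n"] by simp

lemma vge_binomial: "0 < k ==> k < p ==> vge 1 (of_nat (p choose k))"
	using prime_p by (intro vge_p_dvd dvd_choose_prime) auto

lemma val_power_cancel: assumes "val c (x^n)" "n > 0" shows "val (c/real n) x"
proof -
	obtain a where a: "val a x" using val_nonzero[OF assms(1)] assms(2) val_ex by auto
	hence "real n*a = c" using val_unique[OF val_power[OF a] assms(1)] by simp
	hence "a = c/real n" using assms(2) by (simp add: field_simps)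
	thus ?thesis using a by simp
qed

lemma vgt_power_cancel: assumes "vgt (real n * c) (x^n)" "n > 0" shows "vgt c x"
proof (cases "x = 0")
	case False
	then obtain a where a: "val a x" using val_ex by blast
	thus ?thesis using val_power[OF a, of n] assms by (simp add: val_vgt)
qed simp

subsection \<open>Asymptotic equality\<close>

text \<open>Equality of leading terms: the quotient is congruent to 1 modulo the maximal ideal. It
  is compatible with products and quotients but not with sums, so sums are treated through their
  dominant term (\<open>sim_add\<close>).\<close>

definition sim :: "'a => 'a => bool" where "sim x y = (y \<noteq> 0 \<and> vgt 0 (x/y-1))"

lemma simI: assumes "val a y" "vgt a (x-y)" shows "sim x y"
	using vgt_divide[OF assms(2,1)] val_nonzero[OF assms(1)] by (simp add: sim_def diff_divide_distrib)

lemma simD: assumes "sim x y" "val a y" shows "vgt a (x-y)"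
proof -
	have "vgt (0+a) ((x/y-1)*y)" using assms by (intro vgt_mul) (auto simp: sim_def val_vge)
	thus ?thesis using val_nonzero[OF assms(2)] by (simp add: algebra_simps)
qed

lemma sim_val: "sim x y ==> val a y ==> val a x"
	using simD val_cong by blast

lemma sim_sym: assumes "sim x y" shows "sim y x"
proof -
	obtain a where a: "val a y" using assms val_ex by (auto simp: sim_def)
	show ?thesis
		using simI[of a x y] sim_val[OF assms a] simD[OF assms a] by (simp add: vgt_minus_commute)
qed

lemma sim_refl: "x \<noteq> 0 ==> sim x x"
	by (simp add: sim_def)

lemma sim_nonzero: "sim x y ==> x \<noteq> 0" "sim x y ==> y \<noteq> 0"
	using sim_sym[of x y] by (simp_all add: sim_def)

lemma sim_trans: assumes "sim x y" "sim y z" shows "sim x z"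
proof -
	obtain a where a: "val a z" using assms val_ex by (auto simp: sim_def)
	show ?thesis
		by (rule simI[OF a vgt_trans[OF simD[OF assms(1) sim_val[OF assms(2) a]] simD[OF assms(2) a]]])
qed

lemma sim_mult: assumes "sim x y" "sim x' y'" shows "sim (x*x') (y*y')"
proof -
	obtain a where a: "val a y" using assms val_ex by (auto simp: sim_def)
	obtain b where b: "val b y'" using assms val_ex by (auto simp: sim_def)
	have "vgt (a+b) ((x-y)*x')"
		using simD[OF assms(1) a] sim_val[OF assms(2) b] by (intro vgt_mul) (auto simp: val_vge)
	moreover have "vgt (a+b) (y*(x'-y'))"
		using simD[OF assms(2) b] a by (intro vgt_mul') (auto simp: val_vge)
	ultimately have "vgt (a+b) ((x-y)*x'+y*(x'-y'))" by (rule vgt_add)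
	hence "vgt (a+b) (x*x'-y*y')" by (simp add: algebra_simps)
	thus ?thesis using val_mul[OF a b] by (rule simI[rotated])
qed

lemma sim_inverse: assumes "sim x y" shows "sim (inverse x) (inverse y)"
proof -
	obtain a where a: "val a y" using assms val_ex by (auto simp: sim_def)
	have "vgt (a-(a+a)) ((y-x)/(x*y))"
		using simD[OF assms a] sim_val[OF assms a] a
		by (intro vgt_divide val_mul) (auto simp: vgt_minus_commute)
	moreover have "(y-x)/(x*y) = inverse x-inverse y"
		using sim_nonzero[OF assms] by (simp add: field_simps)
	ultimately show ?thesis using simI[OF val_inverse[OF a]] by simp
qed

lemma sim_divide: "sim x y ==> sim x' y' ==> sim (x/x') (y/y')"
	unfolding divide_inverse by (intro sim_mult sim_inverse)

lemma sim_power: "sim x y ==> sim (x^n) (y^n)"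
	by (induction n) (simp_all add: sim_refl sim_mult)

lemma sim_minus: "sim x y ==> sim (- x) (- y)"
	by (simp add: sim_def)

lemma sim_add: "val a x ==> vgt a y ==> sim (x+y) x"
	by (rule simI) auto

lemma vgt_power_diff:
	assumes "vge 0 x" "vge 0 y" "vgt 0 (x-y)" shows "vgt 0 (x^n-y^n)"
proof -
	have "x^n-y^n = (x-y)*(\<Sum>i<n. y^(n-Suc i)*x^i)"
		by (rule power_diff_sumr2)
	moreover have "vge 0 (\<Sum>i<n. y^(n-Suc i)*x^i)"
	proof (rule vge_sum)
		fix i
		show "vge 0 (y^(n-Suc i)*x^i)"
			using vge_mul[OF vge_power[OF assms(2), of "n-Suc i"] vge_power[OF assms(1), of i]] by simp
	qed
	ultimately show ?thesis using vgt_mul[OF assms(3), of 0] by simp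
qed

lemma vgt_mult_diff:
	assumes "vge 0 x" "vge 0 y'" "vgt 0 (x-y)" "vgt 0 (x'-y')" shows "vgt 0 (x*x'-y*y')"
proof -
	have "vgt 0 (x*(x'-y'))" "vgt 0 ((x-y)*y')"
		using vgt_mul'[OF assms(1,4)] vgt_mul[OF assms(3,2)] by auto
	from vgt_add[OF this] show ?thesis by (simp add: algebra_simps)
qed

text \<open>After \<open>d\<close> is factored out of the difference, each of the \<open>n\<close>
  summands of the cofactor has leading term \<open>x^(n-1)\<close>; they add up without cancellation
  because \<open>p\<close> does not divide \<open>n\<close>.\<close>

lemma sim_power_diff:
	assumes x: "val a x" and d: "val b d" and ab: "a < b" and n: "\<not> p dvd n"
	shows "sim ((x+d)^n-x^n) (of_nat n*x^(n-1)*d)"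
proof -
	have n0: "n \<noteq> 0" using n by (intro notI) simp
	have xd: "sim (x+d) x" using x d ab by (intro sim_add[of a]) (auto simp: val_vgt)
	have "(x+d)^n-x^n = d*(\<Sum>i<n. x^(n-Suc i)*(x+d)^i)"
		using power_diff_sumr2[of "x+d" n x] by simp
	moreover have "sim (\<Sum>i<n. x^(n-Suc i)*(x+d)^i) (of_nat n*x^(n-1))"
	proof (rule simI)
		show V: "val (0+real (n-1)*a) (of_nat n*x^(n-1))"
			by (rule val_mul[OF val_of_nat[OF n] val_power[OF x]])
		have "(\<Sum>i<n. x^(n-Suc i)*(x+d)^i) - of_nat n*x^(n-1)
				= (\<Sum>i<n. x^(n-Suc i)*(x+d)^i-x^(n-1))"
			by (simp add: sum_subtractf)
		moreover have "vgt (0+real (n-1)*a) \<dots>"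
		proof (rule vgt_sum)
			fix i assume i: "i \<in> {..<n}"
			have "sim (x^(n-Suc i)*(x+d)^i) (x^(n-Suc i)*x^i)"
				using xd val_nonzero[OF x] by (intro sim_mult sim_power sim_refl) auto
			moreover have "x^(n-Suc i)*x^i = x^(n-1)"
				using i by (simp flip: power_add)
			ultimately show "vgt (0+real (n-1)*a) (x^(n-Suc i)*(x+d)^i-x^(n-1))"
				using simD val_power[OF x, of "n-1"] by simp
		qed
		ultimately show "vgt (0+real (n-1)*a) ((\<Sum>i<n. x^(n-Suc i)*(x+d)^i) - of_nat n*x^(n-1))"
			by simp
	qed
	from sim_mult[OF sim_refl[OF val_nonzero[OF d]] this]
	have "sim (d*(\<Sum>i<n. x^(n-Suc i)*(x+d)^i)) (of_nat n*x^(n-1)*d)"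
		by (simp only: mult.commute)
	ultimately show ?thesis by simp
qed

text \<open>The bound that survives when \<open>p\<close> divides \<open>n\<close> or when
  \<open>d\<close> is as large as \<open>x\<close>.\<close>

lemma vge_power_diff':
	assumes x: "val a x" and d: "vge b d" and ab: "a \<le> b"
	shows "vge ((real n-1)*a+b) ((x+d)^n-x^n)"
proof (cases "n = 0")
	case False
	have xd: "vge a (x+d)" using vge_add[of a x d] vge_mono[OF d ab] val_vge[OF x] by simp
	have "(x+d)^n-x^n = d*(\<Sum>i<n. x^(n-Suc i)*(x+d)^i)"
		using power_diff_sumr2[of "x+d" n x] by simp
	moreover have "vge ((real n-1)*a) (\<Sum>i<n. x^(n-Suc i)*(x+d)^i)"
	proof (rule vge_sum)
		fix i assume i: "i \<in> {..<n}"
		have "vge (real (n-Suc i)*a+real i*a) (x^(n-Suc i)*(x+d)^i)"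
			using x xd by (intro vge_mul vge_power) (simp_all add: val_vge)
		moreover have "real (n-Suc i) = real n-1-real i"
			using i by auto
		hence "real (n-Suc i)*a+real i*a = (real n-1)*a" by (simp add: left_diff_distrib)
		ultimately show "vge ((real n-1)*a) (x^(n-Suc i)*(x+d)^i)" by simp
	qed
	from vge_mul[OF d this] have "vge ((real n-1)*a+b) (d*(\<Sum>i<n. x^(n-Suc i)*(x+d)^i))"
		by (simp only: add.commute)
	ultimately show ?thesis by simp
qed simp

end

section \<open>Subfields of the ambient field\<close>

abbreviation sfield :: "'a::field set => bool" where "sfield E \<equiv> subfield E Omega"

lemma Omega_simps [simp]:
	"carrier Omega = UNIV" "monoid.mult Omega = (*)" "one Omega = 1" "ring.zero Omega = 0"
	"ring.add Omega = (+)"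
	by (auto simp: ring_of_type_algebra_def)

interpretation Om: domain "Omega :: 'a::field ring"
	by (rule field.axioms(1)[OF field_from_type_algebra])

lemma Om_a_inv [simp]: "a_inv (Omega :: 'a::field ring) x = - x"
	by (rule Om.minus_equality) auto

lemma Om_a_minus [simp]: "a_minus (Omega :: 'a::field ring) x y = x-y"
	by (simp add: a_minus_def)

lemma Om_m_inv [simp]: "x \<noteq> 0 ==> m_inv (Omega :: 'a::field ring) x = inverse x"
	by (rule Om.inv_unique'[symmetric]) auto

lemma Om_pow [simp]: "x [^]\<^bsub>(Omega :: 'a::field ring)\<^esub> (n::nat) = x^n"
	by (induction n) (auto simp: nat_pow_def)

context
	fixes E :: "'a::field set"
	assumes E: "sfield E"
begin

lemma sf_0: "0 \<in> E" and sf_1: "1 \<in> E"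
	and sf_add: "x \<in> E ==> y \<in> E ==> x+y \<in> E"
	and sf_mul: "x \<in> E ==> y \<in> E ==> x*y \<in> E"
	and sf_minus: "x \<in> E ==>-x \<in> E"
	using Om.subring_props[OF E] by auto

lemma sf_diff: "x \<in> E ==> y \<in> E ==> x-y \<in> E"
	using sf_add[of x "- y"] sf_minus by simp

lemma sf_inverse: "x \<in> E ==> inverse x \<in> E"
	using Om.subfield_m_inv(1)[OF E, of x] sf_0 by (cases "x = 0") auto

lemma sf_divide: "x \<in> E ==> y \<in> E ==> x/y \<in> E"
	using sf_mul sf_inverse by (simp add: divide_inverse)

lemma sf_power: "x \<in> E ==> x^n \<in> E"
	by (induction n) (simp_all add: sf_1 sf_mul)

lemma sf_of_nat: "of_nat n \<in> E"
	by (induction n) (simp_all add: sf_0 sf_1 sf_add)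

lemma sf_of_int: "of_int n \<in> E"
	using sf_of_nat[of "nat n"] sf_minus[OF sf_of_nat[of "nat (- n)"]] by (cases "n \<ge> 0") auto

lemma sf_sum: "(\<And>i. i \<in> A ==> f i \<in> E) ==> sum f A \<in> E"
	by (induction A rule: infinite_finite_induct) (simp_all add: sf_0 sf_add)

lemma sf_power_int: "x \<in> E ==> x powi n \<in> E"
	by (cases "n \<ge> 0") (auto simp: power_int_def sf_power sf_inverse)

end

lemmas sf_closed = sf_0 sf_1 sf_add sf_mul sf_minus sf_diff sf_inverse sf_divide sf_power sf_of_nat
	sf_of_int sf_power_int

lemma sfieldI:
	assumes "1 \<in> E" "\<And>x y. x \<in> E ==> y \<in> E ==> x-y \<in> E" "\<And>x y. x \<in> E ==> y \<in> E ==> x*y \<in> E"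
		"\<And>x. x \<in> E ==> x \<noteq> 0 ==> inverse x \<in> E"
	shows "sfield (E :: 'a::field set)"
proof (rule field.subfieldI'[OF field_from_type_algebra])
	have 0: "0 \<in> E" using assms(2)[OF assms(1,1)] by simp
	have m: "- x \<in> E" if "x \<in> E" for x using assms(2)[OF 0 that] by simp
	show "subring E Omega"
		by (rule Om.subringI) (use assms(1,3) m assms(2)[OF _ m] in force)+
qed (use assms(4) in auto)

context padic_valuation
begin

subsection \<open>Frobenius and the Artin-Schreier map modulo the maximal ideal\<close>

text \<open>Each mixed term carries a factor \<open>p\<close>; since \<open>a \<le> b\<close>, the
  least exponent among them is that of \<open>x^(p-1)*y\<close>.\<close>

lemma frob_add:
	assumes "vge a x" "vge b y" "a \<le> b"
	shows "vge (1+(real p-1)*a+b) ((x+y)^p-x^p-y^p)"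
proof -
	have "{..p} = insert 0 (insert p {1..<p})" by auto
	moreover have "(x+y)^p = (\<Sum>k\<le>p. of_nat (p choose k)*x ^ k*y^(p - k))"
		by (rule binomial_ring)
	ultimately have "(x+y)^p-x^p-y^p = (\<Sum>k\<in>{1..<p}. of_nat (p choose k)*x ^ k*y^(p - k))"
		using p_gt_0 by simp
	moreover have "vge (1+(real p-1)*a+b) \<dots>"
	proof (rule vge_sum)
		fix k assume k: "k \<in> {1..<p}"
		have "vge (1+real k*a+real (p - k)*b) (of_nat (p choose k)*x ^ k*y^(p - k))"
			using assms k by (intro vge_mul vge_power vge_binomial) auto
		moreover have "1+(real p-1)*a+b \<le> 1+real k*a+real (p - k)*b"
		proof -
			have "(real p-real k-1)*a \<le> (real p-real k-1)*b"
				using assms(3) k by (intro mult_left_mono) auto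
			thus ?thesis using k by (simp add: algebra_simps)
		qed
		ultimately show "vge (1+(real p-1)*a+b) (of_nat (p choose k)*x ^ k*y^(p - k))"
			by (rule vge_mono)
	qed
	ultimately show ?thesis by simp
qed

text \<open>The origin of the threshold \<open>-1/p\<close>: a factor \<open>p\<close> compensates
  exactly a product of \<open>p\<close> elements of valuation \<open>-1/p\<close>.\<close>

lemma frob_add_small:
	assumes "vgt (-1/p) x" "vgt (-1/p) y" shows "vgt 0 ((x+y)^p-x^p-y^p)"
proof -
	obtain a where a: "-1/p < a" "vge a x" using vgt_obtain[OF assms(1)] .
	obtain b where b: "-1/p < b" "vge b y" using vgt_obtain[OF assms(2)] .
	define c where "c = min a b"
	have c: "-1/p < c" "vge c x" "vge c y" using a b vge_mono by (auto simp: c_def)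
	have "vge (1+(real p-1) * c + c) ((x+y)^p-x^p-y^p)"
		using c by (intro frob_add) auto
	moreover have "0 < 1+(real p-1) * c + c" using c(1) p_gt_0 by (simp add: field_simps)
	ultimately show ?thesis by (rule vge_vgt)
qed

lemma vge_imp_small: "vge 0 x ==> vgt (-1/p) x"
	by (erule vge_vgt) (use p_gt_0 in simp)

lemma vgt_imp_small: "vgt 0 x ==> vgt (-1/p) x"
	by (erule vgt_mono) simp

lemma frob_sum:
	assumes "\<And>i. i \<in> A ==> vgt (-1/p) (f i)" shows "vgt 0 ((sum f A)^p-(\<Sum>i\<in>A. f i^p))"
	using assms
proof (induction A rule: infinite_finite_induct)
	case (insert x F)
	have "vgt 0 ((f x + sum f F)^p-f x^p-(sum f F)^p)"
		using insert by (intro frob_add_small vgt_sum) auto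
	from vgt_add[OF this, of "(sum f F)^p-(\<Sum>i\<in>F. f i^p)"]
	show ?case using insert by (simp add: algebra_simps)
qed (use p_gt_0 in \<open>simp_all add: power_0_left\<close>)

definition wp :: "'a => 'a" where "wp x = x^p-x"

lemma wp_0 [simp]: "wp 0 = 0" and wp_1 [simp]: "wp 1 = 0"
	using p_gt_0 by (auto simp: wp_def)

lemma wp_add: "vgt (-1/p) x ==> vgt (-1/p) y ==> vgt 0 (wp (x+y)-(wp x+wp y))"
	using frob_add_small[of x y] by (simp add: wp_def algebra_simps)

lemma wp_diff: assumes "vgt (-1/p) x" "vgt (-1/p) y" shows "vgt 0 (wp (x-y)-(wp x-wp y))"
	using wp_add[OF vgt_diff[OF assms] assms(2)] by (simp add: vgt_minus_commute algebra_simps)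

lemma vge_wp: "vge 0 x ==> vge 0 (wp x)"
	using vge_power[of 0 x p] by (auto simp: wp_def intro: vge_diff)

lemma vgt_wp: assumes "vgt 0 x" shows "vgt 0 (wp x)"
proof -
	have "vgt 0 (x^p)" using vgt_mul[OF assms vge_power[OF vgt_vge[OF assms]], of "p-1"] p_gt_0 by (simp add: power_eq_if)
	thus ?thesis unfolding wp_def using assms by (rule vgt_diff)
qed

lemma val_wp: assumes "val c x" "c < 0" shows "val (real p * c) (wp x)"
	unfolding wp_def
proof (rule val_diff)
	show "val (real p * c) (x^p)" by (rule val_power) fact
	show "vgt (real p * c) x" using assms(2) p_gt_1 assms(1) by (simp add: val_vgt)
qed

lemma wp_vgt: assumes "vgt (-1) (wp x)" shows "vgt (-1/p) x"
proof (rule ccontr)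
	assume "\<not> ?thesis"
	then obtain c where c: "c \<le> -1/p" "val c x" using not_vgt by blast
	have "-1/p < (0::real)" using p_gt_0 by simp
	hence "val (real p * c) (wp x)" using c by (intro val_wp) linarith+
	thus False using assms c(1) p_gt_0 by (simp add: val_vgt field_simps)
qed

lemma wp_vge: assumes "vge 0 (wp x)" shows "vge 0 x"
proof (rule ccontr)
	assume "\<not> ?thesis"
	then obtain c where c: "c < 0" "val c x" using not_vge by blast
	thus False using val_wp[OF c(2,1)] assms p_gt_0 by (simp add: val_vge zero_le_mult_iff)
qed

lemma wp_val: assumes "val c (wp x)" "c < 0" shows "val (c/p) x"
proof -
	obtain a where a: "a < 0" "val a x" using vge_wp[of x] assms not_vge by (auto simp: val_vge)
	have "a = c/p" using val_wp[OF a(2,1)] assms(1) val_unique p_gt_0 by (simp add: field_simps)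
	thus ?thesis using a by simp
qed

lemma wp_of_nat: "vgt 0 (wp (of_nat n))"
proof (induction n)
	case (Suc n)
	have "vgt 0 (wp (of_nat n+1)-(wp (of_nat n)+wp 1))" by (intro wp_add vge_imp_small) auto
	from vgt_add[OF this, of "wp (of_nat n)"] Suc show ?case by (simp add: add.commute)
qed simp

text \<open>The difference \<open>d\<close> of the two points satisfies
  \<open>d = (y+d)^p - y^p\<close>, and the right side has larger valuation than \<open>d\<close>:
  the mixed terms by the bound on \<open>y\<close>, and \<open>d^p\<close> because \<open>d\<close>
  has positive valuation.\<close>

lemma wp_unique:
	assumes "wp x = wp y" "vgt (-1/p) y" "vgt 0 (x-y)" shows "x = y"
proof (rule ccontr)
	assume "x \<noteq> y"
	then obtain t where t: "val t (x-y)" using val_ex[of "x-y"] by auto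
	define d where "d = x-y"
	have t0: "t > 0" using t assms(3) by (simp add: val_vgt)
	obtain a where a: "-1/p < a" "vge a y" using vgt_obtain[OF assms(2)] .
	define c where "c = min a 0"
	have c: "-1/p < c" "c \<le> 0" "vge c y" using a p_gt_0 vge_mono[of a y] by (auto simp: c_def)
	have "vge (1+(real p-1) * c+t) ((y+d)^p-y^p-d^p)"
		using c t t0 by (intro frob_add) (auto simp: d_def val_vge)
	moreover have "t < 1+(real p-1) * c+t"
	proof -
		have "1+(real p-1) * c \<ge> 1+real p * c" using c(2) by (simp add: algebra_simps)
		moreover have "1+real p * c > 0" using c(1) p_gt_0 by (simp add: field_simps)
		ultimately show ?thesis by linarith
	qed
	ultimately have "vgt t ((y+d)^p-y^p-d^p)" by (rule vge_vgt)
	moreover have "vgt t (d^p)"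
		using val_vgt[OF val_power[OF t, of p]] t0 p_gt_1 by (simp add: d_def)
	ultimately have "vgt t ((y+d)^p-y^p-d^p+d^p)" by (rule vgt_add)
	moreover have "(y+d)^p-y^p-d^p+d^p = d"
		using assms(1) by (simp add: d_def wp_def algebra_simps)
	ultimately show False using t by (simp add: d_def val_vgt)
qed

text \<open>A polynomial over the residue field with more roots than its degree vanishes; here
  congruences replace the residue field. Dividing by a linear factor at one approximate root keeps
  the others approximate roots, since the differences are units.\<close>

lemma approx_roots_bound:
	fixes P :: "'a poly"
	assumes "pdeg P \<le> n"
		and "\<And>i. i \<le> n ==> vge 0 (r i)"
		and "\<And>i j. i \<le> n ==> j \<le> n ==> i \<noteq> j ==> \<not> vgt 0 (r i-r j)"
		and "\<And>i. i \<le> n ==> vgt 0 (poly P (r i))"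
	shows "vgt 0 (pcoeff P k)"
	using assms
proof (induction n arbitrary: P k)
	case 0
	from "0.prems"(1) have "pdeg P = 0" by simp
	then obtain a where "P = [:a:]" by (rule degree_eq_zeroE)
	thus ?case using "0.prems"(4)[of 0] by (cases k) auto
next
	case (Suc n)
	define c where "c = r (Suc n)"
	define Q where "Q = synthetic_div P c"
	have P: "P = pCons (poly P c) Q-Polynomial.smult c Q"
		unfolding Q_def by (metis add_diff_cancel_right' synthetic_div_correct)
	have dQ: "pdeg Q \<le> n" using Suc.prems(1) by (simp add: Q_def degree_synthetic_div)
	have Q0: "vgt 0 (poly Q (r i))" if "i \<le> n" for i
	proof -
		have e: "(r i - c)*poly Q (r i) = poly P (r i)-poly P c" using arg_cong[OF P, of "\<lambda>R. poly R (r i)"] by (simp add: left_diff_distrib)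
		have nv: "\<not> vgt 0 (r i - c)" using Suc.prems(3)[of i "Suc n"] that by (simp add: c_def)
		moreover have "vge 0 (r i - c)" using Suc.prems(2) that by (auto simp: c_def intro!: vge_diff)
		ultimately have v: "val 0 (r i - c)" using vge_cases by blast
		have "vgt 0 (poly P (r i)-poly P c)"
			using Suc.prems(4)[of i] Suc.prems(4)[of "Suc n"] that by (auto simp: c_def intro!: vgt_diff)
		from vgt_divide[OF this v] show ?thesis
			using val_nonzero[OF v] by (simp flip: e)
	qed
	have IH: "vgt 0 (pcoeff Q k)" for k
		by (rule Suc.IH[OF dQ _ _ Q0]) (simp_all add: Suc.prems(2,3))
	have "vgt 0 (pcoeff (pCons (poly P c) Q) k)"
		using IH Suc.prems(4)[of "Suc n"] by (cases k) (auto simp: c_def)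
	moreover have "vgt 0 (c*pcoeff Q k)"
		using vgt_mul'[OF Suc.prems(2)[of "Suc n"] IH[of k]] by (simp add: c_def)
	ultimately have "vgt 0 (pcoeff (pCons (poly P c) Q) k - c*pcoeff Q k)" by (rule vgt_diff)
	also have "pcoeff (pCons (poly P c) Q) k - c*pcoeff Q k = pcoeff P k"
		using arg_cong[OF P, of "\<lambda>R. pcoeff R k"] by simp
	finally show ?case .
qed

text \<open>Otherwise \<open>x\<close> together with \<open>0, ..., p-1\<close> would give
  \<open>p+1\<close> incongruent approximate roots of \<open>X^p - X\<close>, which is monic of
  degree \<open>p\<close>.\<close>

lemma wp_small_residue:
	assumes x: "vgt 0 (wp x)" shows "\<exists>c<p. vgt 0 (x - of_nat c)"
proof (rule ccontr)
	assume c: "\<not> ?thesis"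
	have x0: "vge 0 x" by (rule wp_vge[OF vgt_vge[OF x]])
	define P :: "'a poly" where "P = [:0,1:]^p - [:0,1:]"
	define r where "r i = (if i = p then x else of_nat i)" for i
	have deg: "pdeg P \<le> p"
		unfolding P_def using p_gt_0 degree_power_le[of "[:0,1::'a:]" p]
		by (intro degree_diff_le) auto
	have cf: "pcoeff P p = 1"
	proof -
		have "[:0,1::'a:]^p = Polynomial.monom 1 p" by (simp add: Polynomial.monom_altdef)
		thus ?thesis using p_gt_1 by (simp add: P_def coeff_pCons split: nat.splits)
	qed
	have ij: "\<not> vgt 0 (of_nat i-(of_nat j :: 'a))" if "i < p" "j < p" "i \<noteq> j" for i j
	proof -
		have "\<not> int p dvd int i-int j"
			using that mod_eq_dvd_iff[of "int i" "int p" "int j"] by simp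
		thus ?thesis using vgt_of_int_iff[of "int i-int j"] by simp
	qed
	have "vgt 0 (pcoeff P p)"
	proof (rule approx_roots_bound[of P p r])
		show "vgt 0 (poly P (r i))" if "i \<le> p" for i
			using x wp_of_nat[of i] by (simp add: P_def r_def wp_def)
		show "\<not> vgt 0 (r i-r j)" if "i \<le> p" "j \<le> p" "i \<noteq> j" for i j
		proof -
			have nx: "\<not> vgt 0 (x - of_nat k)" "\<not> vgt 0 (of_nat k-x)" if "k < p" for k
				using c that vgt_minus_commute[of 0 x "of_nat k"] by blast+
			show ?thesis using that ij[of i j] nx[of i] nx[of j] unfolding r_def by (cases "i = p"; cases "j = p") auto
		qed
	qed (use deg x0 in \<open>auto simp: r_def\<close>)
	thus False by (simp add: cf val_vgt[OF val_1])
qed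

subsection \<open>Completeness and Hensel's lemma\<close>

definition vcauchy :: "(nat => 'a) => bool" where
	"vcauchy s = (\<forall>B. \<exists>M. \<forall>m\<ge>M. \<forall>n\<ge>M. vge B (s m - s n))"

definition vlim :: "(nat => 'a) => 'a => bool" where
	"vlim s x = (\<forall>B. \<exists>M. \<forall>n\<ge>M. vge B (x - s n))"

definition vcomplete :: "'a set => bool" where
	"vcomplete E = (\<forall>s. (\<forall>n. s n \<in> E) --> vcauchy s --> (\<exists>x\<in>E. vlim s x))"

lemma vge_all_zero: assumes "\<And>B. vge B x" shows "x = 0"
proof (rule ccontr)
	assume "x \<noteq> 0"
	then obtain a where "val a x" using val_ex by blast
	thus False using assms[of "a+1"] by (simp add: val_vge)
qed

lemma vcauchy_steps:
	assumes "\<epsilon> > 0" "\<And>n. vge (real n*\<epsilon>) (s (Suc n) - s n)" shows "vcauchy s"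
	unfolding vcauchy_def
proof
	fix B :: real
	have st: "vge (real m*\<epsilon>) (s n - s m)" if "m \<le> n" for m n
		using that
	proof (induction n rule: dec_induct)
		case (step n)
		have "vge (real m*\<epsilon>) (s (Suc n) - s n)"
			by (rule vge_mono[OF assms(2)]) (use step assms(1) in simp)
		thus ?case using step.IH by (rule vge_trans)
	qed simp
	obtain M where M: "real M*\<epsilon> \<ge> B" using assms(1)
		by (metis ex_less_of_nat_mult less_eq_real_def)
	have "vge B (s m - s n)" if "m \<ge> M" "n \<ge> M" for m n
		using vge_mono[OF vge_trans[of "real M*\<epsilon>" "s m" "s M" "s n"] M] st[OF that(1)] st[OF that(2)]
		by (simp add: vge_minus_commute[of _ "s M" "s n"])
	thus "\<exists>M. \<forall>m\<ge>M. \<forall>n\<ge>M. vge B (s m - s n)" by blast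
qed

text \<open>Written as \<open>x = F x\<close>, the right side has derivative 0 modulo the maximal
  ideal; hence \<open>F\<close> contracts small distances and its iterates from \<open>x0\<close>
  converge to a fixed point.\<close>

lemma hensel:
	assumes E: "sfield E" "vcomplete E"
		and r: "\<And>i. i < p ==> r i \<in> E" "\<And>i. i < p ==> vgt 0 (r i)"
		and x0: "x0 \<in> E" "vge 0 x0" "vgt 0 (wp x0)"
	shows "\<exists>x\<in>E. x^p-x+(\<Sum>i<p. r i*x^i) = 0 \<and> vgt 0 (x-x0)"
proof -
	define F where "F x = x^p+(\<Sum>i<p. r i*x^i)" for x
	\<comment> \<open>A common positive lower bound for finitely many positive valuations; it becomes
	  the gain of every iteration. The cap at 1 lets the factor \<open>p\<close> in the mixed terms
	  supply that gain.\<close>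
	have "\<exists>e. 0 < e \<and> e \<le> 1 \<and> (\<forall>i<n. vge e (r i))" if "n \<le> p" for n
		using that
	proof (induction n)
		case (Suc n)
		then obtain e where e: "0 < e" "e \<le> 1" "\<forall>i<n. vge e (r i)" by auto
		obtain d where d: "0 < d" "vge d (r n)" using vgt_obtain[OF r(2)[of n]] Suc.prems by auto
		have "vge (min e d) (r i)" if "i < Suc n" for i
			using e(3) vge_mono[OF d(2), of "min e d"] vge_mono[of e "r i" "min e d"] that
			by (cases "i = n") auto
		hence "\<forall>i<Suc n. vge (min e d) (r i)" by blast
		thus ?case using e d by (intro exI[of _ "min e d"]) auto
	qed (auto intro: exI[of _ 1])
	from this[of p] obtain e1 where e1: "0 < e1" "e1 \<le> 1" "\<And>i. i < p ==> vge e1 (r i)" by auto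
	have "vgt 0 (wp x0+(\<Sum>i<p. r i*x0^i))"
	proof (intro vgt_add vgt_sum)
		fix i assume "i \<in> {..<p}"
		thus "vgt 0 (r i*x0^i)" using vgt_mul[OF r(2)[of i] vge_power[OF x0(2), of i]] by simp
	qed fact
	then obtain e2 where e2: "0 < e2" "vge e2 (wp x0+(\<Sum>i<p. r i*x0^i))" using vgt_obtain by blast
	define e where "e = min e1 e2"
	have e: "0 < e" "e \<le> 1" using e1 e2 by (auto simp: e_def)
	have e3: "vge e (r i)" if "i < p" for i by (rule vge_mono[OF e1(3)[OF that]]) (simp add: e_def)
	have "wp x0+(\<Sum>i<p. r i*x0^i) = F x0-x0" by (simp add: F_def wp_def)
	hence e4: "vge e (F x0-x0)" using vge_mono[OF e2(2), of e] by (simp add: e_def)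
	\<comment> \<open>For differences of valuation at least \<open>e\<close> the term
	  \<open>d^p\<close> also gains \<open>e\<close>, since
	  \<open>p*t \<ge> 2*t \<ge> t + e\<close>.\<close>
	have contr: "vge (t+e) (F x-F y)" if "vge 0 x" "vge 0 y" "vge t (x-y)" "t \<ge> e" for x y t
	proof -
		define d where "d = x-y"
		have d: "vge t d" "vge 0 d" using that vge_diff[of 0 x y] by (auto simp: d_def)
		have "vge (t+e) ((y+d)^p-y^p-d^p)"
			by (rule vge_mono[OF frob_add[of 0 y t d]]) (use that d e in auto)
		moreover have "vge (t+e) (d^p)"
		proof (rule vge_mono[OF vge_power[OF d(1)]])
			have "2*t \<le> real p*t" using p_gt_1 that e by (intro mult_right_mono) auto
			thus "t+e \<le> real p*t" using that(4) by linarith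
		qed
		ultimately have 1: "vge (t+e) ((y+d)^p-y^p-d^p+d^p)" by (rule vge_add)
		have 2: "vge (t+e) (\<Sum>i<p. r i*(x^i-y^i))"
		proof (rule vge_sum)
			fix i assume i: "i \<in> {..<p}"
			have "vge 0 (\<Sum>j<i. y^(i-Suc j)*x^j)"
			proof (rule vge_sum)
				fix j show "vge 0 (y^(i-Suc j)*x^j)"
					using vge_mul[OF vge_power[OF that(2)] vge_power[OF that(1)]] by simp
			qed
			from vge_mul[OF that(3) this] have "vge t (x^i-y^i)"
				by (simp add: power_diff_sumr2[of x i y])
			from vge_mul[OF e3 this, of i] i show "vge (t+e) (r i*(x^i-y^i))"
				by (simp add: add.commute)
		qed
		have "F x-F y = (y+d)^p-y^p-d^p+d^p+(\<Sum>i<p. r i*(x^i-y^i))"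
			by (simp add: F_def d_def sum_subtractf right_diff_distrib)
		thus ?thesis using vge_add[OF 1 2] by simp
	qed
	define s where "s n = (F ^^ n) x0" for n
	have s_Suc: "s (Suc n) = F (s n)" and s_0: "s 0 = x0" for n by (auto simp: s_def)
	have F_E: "F x \<in> E" if "x \<in> E" for x
		unfolding F_def using E(1) that r(1) by (intro sf_add sf_power sf_sum sf_mul) auto
	have sE: "s n \<in> E" for n by (induction n) (auto simp: s_Suc s_0 x0 F_E)
	have st: "vge e (s n-x0) \<and> vge (real n*e+e) (s (Suc n) - s n)" for n
	proof (induction n)
		case 0 thus ?case using e4 by (simp add: s_Suc s_0)
	next
		case (Suc n)
		have "vge e (s (Suc n) - s n)" using Suc e vge_mono[of "real n*e+e" "s (Suc n) - s n" e] by simp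
		from vge_trans[OF this, of x0] have 1: "vge e (s (Suc n)-x0)" using Suc by blast
		have i: "vge 0 (s n)" "vge 0 (s (Suc n))"
			using vge_mono[of e "s n-x0" 0] vge_mono[OF 1, of 0] Suc vge_iff[of 0 "s n" x0] vge_iff[of 0 "s (Suc n)" x0] x0(2) e(1)
			by auto
		have "vge (real n*e+e+e) (F (s (Suc n))-F (s n))"
			using Suc i e by (intro contr) auto
		thus ?case using 1 by (simp add: s_Suc algebra_simps)
	qed
	have si: "vge 0 (s n)" for n
		using st[of n] vge_iff[of 0 "s n" x0] vge_mono[of e "s n-x0" 0] x0(2) e(1) by auto
	have st2: "vge (real n*e) (s (Suc n) - s n)" for n
		using vge_mono[of "real n*e+e" "s (Suc n) - s n" "real n*e"] st[of n] e(1) by simp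
	have "vcauchy s" by (rule vcauchy_steps[of e]) (use st2 e in auto)
	then obtain x where x: "x \<in> E" "vlim s x" using E(2) sE by (auto simp: vcomplete_def)
	have near: "\<exists>n. vge B (x - s n) \<and> vge B (s (Suc n) - s n)" for B
	proof -
		obtain M where M: "\<And>n. n \<ge> M ==> vge B (x - s n)" using x(2) by (auto simp: vlim_def)
		obtain M' where M': "real M'*e \<ge> B" using e(1) by (metis ex_less_of_nat_mult less_eq_real_def)
		define n where "n = max M M'"
		have "real M'*e \<le> real n*e" using e(1) by (intro mult_right_mono) (auto simp: n_def)
		hence "B \<le> real n*e+e" using M' e(1) by linarith
		hence "vge B (s (Suc n) - s n)" using vge_mono[of "real n*e+e" "s (Suc n) - s n" B] st[of n] by simp
		thus ?thesis using M[of n] by (auto simp: n_def)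
	qed
	obtain n where n: "vge e (x - s n)" using near by blast
	have xx0: "vge e (x-x0)" using vge_trans[OF n] st[of n] by blast
	have xi: "vge 0 x" using vge_iff[of 0 x x0] vge_mono[OF xx0] e(1) x0(2) by auto
	have "vge B (F x-x)" for B
	proof -
		define t where "t = max B e"
		obtain n where n: "vge t (x - s n)" "vge t (s (Suc n) - s n)" using near by blast
		have "vge (t+e) (F x-F (s n))" by (rule contr) (use xi si n in \<open>auto simp: t_def\<close>)
		hence "vge t (F x - s (Suc n))" using e(1) vge_mono[of "t+e" "F x-F (s n)" t] by (simp add: s_Suc)
		from vge_trans[OF vge_trans[OF this n(2)], of x] n(1)
		have "vge t (F x-x)" by (simp add: vge_minus_commute)
		thus ?thesis by (rule vge_mono) (simp add: t_def)
	qed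
	hence "F x-x = 0" by (rule vge_all_zero)
	hence "x^p-x+(\<Sum>i<p. r i*x^i) = 0" by (simp add: F_def algebra_simps)
	moreover have "vgt 0 (x-x0)" using vge_vgt[OF xx0 e(1)] .
	ultimately show ?thesis using x(1) by blast
qed

text \<open>After translation by \<open>x0\<close> the correction \<open>d\<close> satisfies an
  equation of the shape treated by \<open>hensel\<close>. Its coefficients
  \<open>(p choose i)*x0^(p-i)\<close> lie in the maximal ideal as soon as \<open>x0\<close> has
  valuation above \<open>-1/p\<close>, so \<open>x0\<close> may have a pole.\<close>

lemma hensel_wp:
	assumes E: "sfield E" "vcomplete E" and x0: "x0 \<in> E" "vgt (-1/p) x0"
		and a: "a \<in> E" "vgt 0 (wp x0-a)"
	shows "\<exists>x\<in>E. wp x = a \<and> vgt 0 (x-x0)"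
proof -
	define r where "r i = (if i = 0 then wp x0-a else of_nat (p choose i)*x0^(p-i))" for i
	have wpE: "wp x0 \<in> E" unfolding wp_def using E(1) x0 by (intro sf_closed) auto
	have rE: "r i \<in> E" for i
		unfolding r_def using E(1) x0(1) a(1) wpE by (auto intro!: sf_closed)
	obtain c where c: "-1/p < c" "vge c x0" using vgt_obtain[OF x0(2)] .
	define b where "b = min c 0"
	have b: "-1/p < b" "b \<le> 0" "vge b x0" using c p_gt_0 vge_mono by (auto simp: b_def)
	have rv: "vgt 0 (r i)" if "i < p" for i
	proof (cases "i = 0")
		case False
		have "vge (1+real (p-i)*b) (of_nat (p choose i)*x0^(p-i))"
			using that False b by (intro vge_mul vge_power vge_binomial) auto
		moreover have "real (p-i)*b \<ge> real p*b" using b(2) by (intro mult_right_mono_neg) auto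
		hence "1+real (p-i)*b > 0" using b(1) p_gt_0 by (simp add: field_simps)
		ultimately show ?thesis using False vge_vgt[of "1+real (p-i)*b" _ 0] by (simp add: r_def)
	qed (use a in \<open>simp add: r_def\<close>)
	obtain d where d: "d \<in> E" "d^p-d+(\<Sum>i<p. r i*d^i) = 0" "vgt 0 (d-0)"
		using hensel[OF E, of r 0] rE rv sf_0[OF E(1)] by auto
	have "(\<Sum>i<p. r i*d^i) = (\<Sum>i\<in>{..<p}. of_nat (p choose i)*d^i*x0^(p-i))-x0^p+(wp x0-a)"
	proof -
		have p: "{..<p} = insert 0 {1..<p}" using p_gt_0 by auto
		show ?thesis by (simp add: p r_def mult_ac)
	qed
	moreover have "(d+x0)^p = (\<Sum>i\<in>{..<p}. of_nat (p choose i)*d^i*x0^(p-i))+d^p"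
		by (simp add: binomial_ring lessThan_Suc_atMost[symmetric])
	ultimately have "(d+x0)^p = d^p+(\<Sum>i<p. r i*d^i)+x0^p-(wp x0-a)" by simp
	also have "d^p+(\<Sum>i<p. r i*d^i) = d" using d(2) by (simp add: algebra_simps)
	finally have "wp (d+x0) = a" by (simp add: wp_def)
	thus ?thesis using d sf_add[OF E(1) d(1) x0(1)] by (intro bexI[of _ "d+x0"]) auto
qed

end

subsection \<open>Simple extensions\<close>

definition over_field :: "'a::field set => 'a poly => bool" where
	"over_field E P = (\<forall>i. pcoeff P i \<in> E)"

definition ext :: "'a::field set => 'a => 'a set" where
	"ext E z = ring.simple_extension Omega E z"

definition lin_span :: "'a::field set => 'a => nat => 'a set" where
	"lin_span E z n = {\<Sum>i<n. c i*z^i | c. \<forall>i. c i \<in> E}"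

lemma over_0: "sfield E ==> over_field E 0"
	by (simp add: over_field_def sf_0)

lemma over_pCons [simp]: "over_field E (pCons a P) = (a \<in> E \<and> over_field E P)"
	unfolding over_field_def by (auto simp: coeff_pCons split: nat.splits)

lemma over_add: "sfield E ==> over_field E P ==> over_field E Q ==> over_field E (P+Q)"
	by (simp add: over_field_def sf_add)

lemma over_diff: "sfield E ==> over_field E P ==> over_field E Q ==> over_field E (P-Q)"
	by (simp add: over_field_def sf_diff)

lemma over_smult: "sfield E ==> a \<in> E ==> over_field E P ==> over_field E (Polynomial.smult a P)"
	by (simp add: over_field_def sf_mul)

lemma over_mult: "sfield E ==> over_field E P ==> over_field E Q ==> over_field E (P*Q)"
	unfolding over_field_def by (auto simp: coeff_mult intro!: sf_sum sf_mul)

lemma over_mono: "over_field E P ==> E \<subseteq> E' ==> over_field E' P"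
	by (auto simp: over_field_def)

lemma over_division:
	assumes E: "sfield E" and q: "over_field E q" "plead q = 1" "pdeg q = n" "n > 0"
	shows "over_field E P ==> \<exists>S T. over_field E S \<and> over_field E T \<and> P = q*S+T \<and> pdeg T < n"
proof (induction P)
	case 0
	show ?case by (rule exI[of _ 0], rule exI[of _ 0]) (use E q in \<open>auto simp: over_0\<close>)
next
	case (pCons a P)
	then obtain S T where ST: "over_field E S" "over_field E T" "P = q*S+T" "pdeg T < n"
		by auto
	define T' where "T' = pCons a T"
	define c where "c = pcoeff T' n"
	have T': "over_field E T'" "pdeg T' \<le> n"
		using ST pCons.prems by (auto simp: T'_def)
	have c: "c \<in> E" using T'(1) by (simp add: c_def over_field_def)
	define T2 where "T2 = T'-Polynomial.smult c q"
	have "pdeg T2 \<le> n"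
		unfolding T2_def using T'(2) q(3) by (intro degree_diff_le) (auto intro: order_trans[OF degree_smult_le])
	moreover have "pcoeff T2 n = 0" using q(2,3) by (simp add: T2_def c_def)
	ultimately have d: "pdeg T2 < n"
		using q(4) by (metis degree_0 le_neq_implies_less leading_coeff_0_iff)
	have "pCons a P = q*pCons 0 S+T'" using ST(3) by (simp add: T'_def)
	also have "\<dots> = q*(pCons 0 S + [:c:])+T2" by (simp add: T2_def)
	finally have "pCons a P = q*(pCons 0 S + [:c:])+T2" .
	moreover have "over_field E (pCons 0 S + [:c:])"
		using ST c E by (intro over_add) (auto simp: sf_0 over_0)
	moreover have "over_field E T2" unfolding T2_def using E T' c q by (intro over_diff over_smult)
	ultimately show ?case using d by blast
qed

context
	fixes E :: "'a::field set"
	assumes E: "sfield E"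
begin

lemma ext_poly: "ext E z = {poly P z | P. over_field E P}"
proof safe
	fix x assume "x \<in> ext E z"
	thus "\<exists>P. x = poly P z \<and> over_field E P"
		unfolding ext_def
	proof (induction rule: Om.simple_extension.induct)
		case zero show ?case by (rule exI[of _ 0]) (use E in \<open>auto simp: over_0\<close>)
	next
		case (lin k1 k2)
		then obtain P where "k1 = poly P z" "over_field E P" by blast
		thus ?case using lin by (intro exI[of _ "pCons k2 P"]) (auto simp: algebra_simps)
	qed
next
	fix P assume "over_field E P"
	thus "poly P z \<in> ext E z"
		unfolding ext_def
	proof (induction P)
		case 0 show ?case using Om.simple_extension.zero[of E z] by simp
	next
		case (pCons a P)
		thus ?case using Om.simple_extension.lin[of "poly P z" E z a] by (simp add: algebra_simps)
	qed
qed

lemma ext_incl: "E \<subseteq> ext E z"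
	using Om.simple_extension_incl[of E z] by (simp add: ext_def)

lemma ext_mem: "z \<in> ext E z"
	using Om.simple_extension_mem[OF subfieldE(1)[OF E], of z] by (simp add: ext_def)

lemma ext_least: "sfield E' ==> E \<subseteq> E' ==> z \<in> E' ==> ext E z \<subseteq> E'"
	using Om.simple_extension_subring_incl[OF subfieldE(1)] by (simp add: ext_def)

lemma lin_span_poly: "lin_span E z n = {poly P z | P. over_field E P \<and> (\<forall>i\<ge>n. pcoeff P i = 0)}"
proof safe
	fix x assume "x \<in> lin_span E z n"
	then obtain c where c: "x = (\<Sum>i<n. c i*z^i)" "\<And>i. c i \<in> E" by (auto simp: lin_span_def)
	define P where "P = (\<Sum>i<n. Polynomial.monom (c i) i)"
	have cf: "pcoeff P j = (if j < n then c j else 0)" for j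
		by (simp add: P_def Polynomial.coeff_sum)
	have "poly P z = x" by (simp add: P_def poly_sum poly_monom c)
	thus "\<exists>P. x = poly P z \<and> over_field E P \<and> (\<forall>i\<ge>n. pcoeff P i = 0)"
		using c E by (intro exI[of _ P]) (auto simp: over_field_def cf sf_0)
next
	fix P assume P: "over_field E P" "\<forall>i\<ge>n. pcoeff P i = 0"
	have "poly P z = (\<Sum>i\<le>pdeg P. pcoeff P i*z^i)" by (rule poly_altdef)
	also have "\<dots> = (\<Sum>i\<le>pdeg P+n. pcoeff P i*z^i)"
		by (rule sum.mono_neutral_left) (auto simp: coeff_eq_0)
	also have "\<dots> = (\<Sum>i<n. pcoeff P i*z^i)"
		by (rule sum.mono_neutral_right) (use P(2) in \<open>auto simp: not_less\<close>)
	finally show "poly P z \<in> lin_span E z n"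
		using P(1) by (auto simp: lin_span_def over_field_def)
qed

lemma ext_lin_span:
	assumes q: "over_field E q" "plead q = 1" "pdeg q = n" "n > 0" "poly q z = 0"
	shows "ext E z = lin_span E z n"
proof
	show "ext E z \<subseteq> lin_span E z n"
	proof
		fix x assume "x \<in> ext E z"
		then obtain P where P: "x = poly P z" "over_field E P" by (auto simp: ext_poly)
		obtain S T where ST: "over_field E T" "P = q*S+T" "pdeg T < n"
			using over_division[OF E q(1-4) P(2)] by blast
		hence "x = poly T z" using P q(5) by simp
		moreover have "\<forall>i\<ge>n. pcoeff T i = 0" using ST(3) by (auto intro: coeff_eq_0)
		ultimately show "x \<in> lin_span E z n" using ST(1) unfolding lin_span_poly by blast
	qed
	show "lin_span E z n \<subseteq> ext E z" unfolding lin_span_poly ext_poly by blast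
qed

end

lemma combine_sum:
	"length Ks = length Us ==> ring.combine Omega Ks Us = (\<Sum>i<length Us. Ks ! i*(Us ! i :: 'a::field))"
proof (induction Ks Us rule: list_induct2)
	case Nil thus ?case by simp
next
	case (Cons k Ks u Us)
	thus ?case
		by (simp add: sum.lessThan_Suc_shift del: sum.lessThan_Suc)
qed

lemma Span_powers:
	assumes "sfield (E :: 'a::field set)"
	shows "ring.Span Omega E (map (\<lambda>i. z^i) [0..<n]) = lin_span E z n"
proof -
	let ?U = "map (\<lambda>i. z^i) [0..<n]"
	have 1: "ring.Span Omega E ?U = {ring.combine Omega Ks ?U | Ks. length Ks = length ?U \<and> set Ks \<subseteq> E}"
		by (rule Om.Span_eq_combine_set_length_version[OF assms]) simp
	have 2: "ring.combine Omega Ks ?U = (\<Sum>i<n. Ks ! i*z^i)" if "length Ks = n" for Ks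
		using that by (subst combine_sum) auto
	show ?thesis
		unfolding 1 lin_span_def
	proof safe
		fix Ks assume K: "length Ks = length ?U" "set Ks \<subseteq> E"
		define c where "c i = (if i < n then Ks ! i else 0)" for i
		have "(\<Sum>i<n. Ks ! i*z^i) = (\<Sum>i<n. c i*z^i)" by (simp add: c_def)
		moreover have "\<forall>i. c i \<in> E" using K sf_0[OF assms] by (auto simp: c_def)
		ultimately show "\<exists>c. ring.combine Omega Ks ?U = (\<Sum>i<n. c i*z^i) \<and> (\<forall>i. c i \<in> E)"
			using 2[of Ks] K by auto
	next
		fix c :: "nat => 'a" assume c: "\<forall>i. c i \<in> E"
		have "(\<Sum>i<n. c i*z^i) = (\<Sum>i<n. map c [0..<n] ! i*z^i)" by simp
		thus "\<exists>Ks. (\<Sum>i<n. c i*z^i) = ring.combine Omega Ks ?U \<and> length Ks = length ?U \<and> set Ks \<subseteq> E"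
			using 2[of "map c [0..<n]"] c by (intro exI[of _ "map c [0..<n]"]) auto
	qed
qed

lemma ext_sfield:
	assumes E: "sfield E" and q: "over_field E q" "plead q = 1" "pdeg q = n" "n > 0" "poly q z = 0"
	shows "sfield (ext E z)"
proof -
	show ?thesis
		using ext_lin_span[OF assms] Span_powers[OF E] Om.Span_finite_dimension[OF E, of "map (\<lambda>i. z^i) [0..<n]"] Om.finite_dimension_simple_extension[OF E, of z] Om.simple_extension_is_subfield[OF E, of z] by (simp add: ext_def)
qed

definition lin_indep :: "'a::field set => 'a => nat => bool" where
	"lin_indep E z n = (\<forall>c. (\<forall>i<n. c i \<in> E) --> (\<Sum>i<n. c i*z^i) = 0 --> (\<forall>i<n. c i = 0))"

lemma independent_powers:
	assumes "sfield (E :: 'a::field set)" "lin_indep E z n"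
	shows "ring.independent Omega E (map (\<lambda>i. z^i) [0..<n])"
proof (rule Om.trivial_combine_imp_independent[OF assms(1)])
	let ?U = "map (\<lambda>i. z^i) [0..<n]"
	fix Ks assume K: "set Ks \<subseteq> E" "ring.combine Omega Ks ?U = \<zero>\<^bsub>Omega\<^esub>"
	\<comment> \<open>The coefficient list may have any length; it is padded or cut to length
	  \<open>n\<close> before the coefficients are compared.\<close>
	obtain Ls where L: "set (take n Ks) \<subseteq> set Ls" "set Ls \<subseteq> insert 0 (set (take n Ks))" "length Ls = n"
		"ring.combine Omega Ls ?U = 0"
		using Om.combine_normalize[of Ks ?U "0"] K by auto
	have LE: "set Ls \<subseteq> E"
		using K(1) sf_0[OF assms(1)] L(2) by (auto dest: in_set_takeD)
	have "(\<Sum>i<n. Ls ! i*z^i) = 0" using L(3,4) by (subst (asm) combine_sum) auto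
	hence z: "Ls ! i = 0" if "i < n" for i
		using assms(2) L(3) LE that unfolding lin_indep_def by (metis nth_mem subsetD)
	show "set (take (length ?U) Ks) \<subseteq> {\<zero>\<^bsub>Omega\<^esub>}" using L(1,3) z by (auto simp: in_set_conv_nth subset_iff)
qed simp

lemma ext_dimension:
	assumes E: "sfield (E :: 'a::field set)" and q: "over_field E q" "plead q = 1" "pdeg q = n" "n > 0" "poly q z = 0"
		and "lin_indep E z n"
	shows "ring.dimension Omega n E (ext E z)"
	using Om.dimensionI[OF E independent_powers[OF E assms(7)], of "ext E z"]
		Span_powers[OF E, of z n] ext_lin_span[OF assms(1-6)] by simp

context padic_valuation
begin

subsection \<open>Orthogonal bases\<close>

lemma v_add_neq: assumes "v x \<noteq> v y" shows "v (x+y) = min (v x) (v y)"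
proof -
	have *: "v (x+y) = v x" if "v x < v y" for x y
	proof -
		have "x \<noteq> 0" using that by auto
		then obtain a where a: "val a x" using val_ex by blast
		hence "vgt a y" using that by (simp add: vgt_def val_def)
		with a have "val a (x+y)" by (rule val_plus)
		thus ?thesis using a by (simp add: val_def)
	qed
	show ?thesis
		using *[of x y] *[of y x] assms by (cases "v x < v y") (auto simp: add.commute min_def)
qed

lemma sum_min:
	assumes "finite A" "A \<noteq> {}"
		and "\<And>i j. i \<in> A ==> j \<in> A ==> i \<noteq> j ==> f i \<noteq> 0 ==> f j \<noteq> 0 ==> v (f i) \<noteq> v (f j)"
	shows "\<exists>i\<in>A. v (sum f A) = v (f i) \<and> (\<forall>j\<in>A. v (f i) \<le> v (f j))"
	using assms
proof (induction A rule: finite_ne_induct)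
	case (insert x F)
	from insert.IH insert.prems obtain i where i: "i \<in> F" "v (sum f F) = v (f i)" "\<forall>j\<in>F. v (f i) \<le> v (f j)"
		by (meson insertCI)
	have s: "sum f (insert x F) = f x + sum f F" using insert by simp
	consider "f x = 0" | "f i = 0" | "f x \<noteq> 0" "f i \<noteq> 0" by blast
	thus ?case
	proof cases
		case 1
		thus ?thesis using i s by (intro bexI[of _ i]) auto
	next
		case 2
		hence "sum f F = 0" using i(2) val_eq_infinity by simp
		thus ?thesis using i 2 s by (intro bexI[of _ x]) auto
	next
		case 3
		hence ne: "v (f x) \<noteq> v (f i)" using insert.prems[of x i] i(1) insert.hyps by auto
		hence m: "v (sum f (insert x F)) = min (v (f x)) (v (f i))" using v_add_neq i(2) s by metis
		show ?thesis
		proof (cases "v (f x) < v (f i)")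
			case True
			thus ?thesis using m i(3) by (intro bexI[of _ x]) auto
		next
			case False
			thus ?thesis using m i by (intro bexI[of _ i]) (auto simp: min_def)
		qed
	qed
qed simp

text \<open>Orthogonality in the nonarchimedean sense: no cancellation occurs, so the valuation of a
  combination is the least valuation of its terms. Ramified and unramified steps both provide it;
  completeness, linear independence and invariance of the valuation under embeddings are derived
  from it.\<close>

definition orth :: "'a set => 'a => nat => bool" where
	"orth E z n = (\<forall>c. (\<forall>i. c i \<in> E) --> (\<forall>i<n. v (\<Sum>j<n. c j*z^j) \<le> v (c i*z^i)))"

lemma orthD: "orth E z n ==> (\<And>i. c i \<in> E) ==> i < n ==> v (\<Sum>j<n. c j*z^j) \<le> v (c i*z^i)"
	by (auto simp: orth_def)

lemma orth_vge: "orth E z n ==> (\<And>i. c i \<in> E) ==> i < n ==> vge a (\<Sum>j<n. c j*z^j) ==> vge a (c i*z^i)"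
	unfolding vge_def using orthD[of E z n c i] by simp

lemma orth_lin_indep:
	assumes "orth E z n" "sfield E" "z \<noteq> 0" shows "lin_indep E z n"
	unfolding lin_indep_def
proof (intro allI impI)
	fix c i assume c: "\<forall>i<n. c i \<in> E" "(\<Sum>i<n. c i*z^i) = 0" "i < n"
	define d where "d i = (if i < n then c i else 0)" for i
	have d: "d i \<in> E" for i using c(1) sf_0[OF assms(2)] by (simp add: d_def)
	show "c i = 0" using c(2) orthD[OF assms(1), of d i] d c(3) assms(3) by (simp add: val_eq_infinity d_def)
qed

lemma vcompleteD: "vcomplete E ==> (\<And>n. s n \<in> E) ==> vcauchy s ==> \<exists>x\<in>E. vlim s x"
	by (simp add: vcomplete_def)

text \<open>By orthogonality the coefficients of a Cauchy sequence are Cauchy sequences in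
  \<open>E\<close>, and their limits assemble to the limit.\<close>

lemma orth_complete:
	assumes o: "orth E z n" and E: "sfield E" "vcomplete E" and z: "z \<noteq> 0"
	shows "vcomplete (lin_span E z n)"
	unfolding vcomplete_def
proof (intro allI impI)
	fix s assume s: "\<forall>k. s k \<in> lin_span E z n" "vcauchy s"
	obtain zc where zc: "val zc z" using val_ex[OF z] by blast
	have "\<forall>k. \<exists>c. s k = (\<Sum>i<n. c i*z^i) \<and> (\<forall>i. c i \<in> E)"
		using s(1) by (auto simp: lin_span_def)
	from choice[OF this] obtain C where C: "\<And>k. s k = (\<Sum>i<n. C k i*z^i)" "\<And>k i. C k i \<in> E" by blast
	have "\<exists>x\<in>E. vlim (\<lambda>k. C k i) x" if i: "i < n" for i
	proof -
		have "vcauchy (\<lambda>k. C k i)"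
			unfolding vcauchy_def
		proof
			fix B
			obtain M where M: "\<And>m k. m \<ge> M ==> k \<ge> M ==> vge (B+real i*zc) (s m - s k)"
				using s(2) unfolding vcauchy_def by blast
			have "vge B (C m i-C k i)" if "m \<ge> M" "k \<ge> M" for m k
			proof -
				have e: "s m - s k = (\<Sum>j<n. (C m j-C k j)*z^j)"
					by (simp add: C(1) sum_subtractf left_diff_distrib)
				have "vge (B+real i*zc) ((C m i-C k i)*z^i)"
				proof (rule orth_vge[OF o _ i])
					show "C m i-C k i \<in> E" for i using sf_diff[OF E(1) C(2) C(2)] .
					show "vge (B+real i*zc) (\<Sum>j<n. (C m j-C k j)*z^j)" using M[OF that] unfolding e .
				qed
				from vge_divide[OF this val_power[OF zc, of i]] show ?thesis using z by simp
			qed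
			thus "\<exists>M. \<forall>m\<ge>M. \<forall>k\<ge>M. vge B (C m i-C k i)" by blast
		qed
		thus ?thesis by (rule vcompleteD[OF E(2) C(2)])
	qed
	hence "\<forall>i. \<exists>x. i < n --> x \<in> E \<and> vlim (\<lambda>k. C k i) x" by blast
	from choice[OF this] obtain L0 where L0: "\<And>i. i < n ==> L0 i \<in> E" "\<And>i. i < n ==> vlim (\<lambda>k. C k i) (L0 i)" by blast
	define L where "L i = (if i < n then L0 i else 0)" for i
	have L: "L i \<in> E" for i using L0 sf_0[OF E(1)] by (simp add: L_def)
	define x where "x = (\<Sum>i<n. L i*z^i)"
	have "vlim s x"
		unfolding vlim_def
	proof
		fix B
		have "\<exists>M. \<forall>k\<ge>M. vge (B-real i*zc) (L i-C k i)" if "i < n" for i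
			using L0(2)[OF that] that unfolding vlim_def L_def by auto
		hence "\<forall>i. \<exists>M. i < n --> (\<forall>k\<ge>M. vge (B-real i*zc) (L i-C k i))" by blast
		from choice[OF this] obtain N where N: "\<And>i k. i < n ==> k \<ge> N i ==> vge (B-real i*zc) (L i-C k i)" by blast
		define M where "M = (\<Sum>i<n. N i)"
		have "vge B (x - s k)" if k: "k \<ge> M" for k
		proof -
			have "x - s k = (\<Sum>i<n. (L i-C k i)*z^i)"
				by (simp add: C(1) x_def sum_subtractf left_diff_distrib)
			moreover have "vge B \<dots>"
			proof (rule vge_sum)
				fix i assume i: "i \<in> {..<n}"
				have "N i \<le> M" unfolding M_def by (rule member_le_sum) (use i in auto)
				hence "vge (B-real i*zc) (L i-C k i)" using N i k by auto
				from vge_mul[OF this vge_power[of zc z i]] show "vge B ((L i-C k i)*z^i)"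
					using zc by (simp add: val_vge)
			qed
			ultimately show ?thesis by simp
		qed
		thus "\<exists>M. \<forall>k\<ge>M. vge B (x - s k)" by blast
	qed
	moreover have "x \<in> lin_span E z n" using L by (auto simp: x_def lin_span_def)
	ultimately show "\<exists>x\<in>lin_span E z n. vlim s x" by blast
qed

subsection \<open>Complete discretely valued fields with perfect residue field\<close>

text \<open>A complete field with value group \<open>(1/e)Z\<close>. The last clause is perfectness
  of the residue field, expressed by approximate p-th roots of integral elements.\<close>

definition lf :: "'a set => nat => bool" where
	"lf E e = (sfield E \<and> vcomplete E \<and> e > 0 \<and>
		 (\<forall>x\<in>E. x \<noteq> 0 --> (\<exists>n::int. val (of_int n/real e) x)) \<and>
		 (\<exists>u\<in>E. val (1/real e) u) \<and>
		 (\<forall>x\<in>E. vge 0 x --> (\<exists>y\<in>E. vge 0 y \<and> vgt 0 (x-y^p))))"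

lemma lf_sfield: "lf E e ==> sfield E" and lf_complete: "lf E e ==> vcomplete E" and lf_pos: "lf E e ==> e > 0"
	by (simp_all add: lf_def)

lemma lf_unif: "lf E e ==> \<exists>u\<in>E. val (1/real e) u"
	by (simp add: lf_def)

lemma lf_val: assumes "lf E e" "x \<in> E" "x \<noteq> 0" obtains n :: int where "val (of_int n/real e) x"
proof -
	show thesis using assms(1) assms(2,3) that by (auto simp: lf_def)
qed

lemma lf_root: assumes "lf E e" "x \<in> E" "vge 0 x" obtains y where "y \<in> E" "vge 0 y" "vgt 0 (x-y^p)"
proof -
	show thesis using assms(1) assms(2,3) that by (auto simp: lf_def)
qed

lemma val_powi: assumes "val a x" shows "val (of_int n*a) (x powi n)"
proof (cases n rule: int_cases2)
	case (nonneg m) thus ?thesis using val_power[OF assms, of m] by simp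
next
	case (nonpos m)
	thus ?thesis using val_inverse[OF val_power[OF assms, of m]] by (simp add: power_int_minus)
qed

lemma lf_elem: assumes "lf E e" shows "\<exists>u\<in>E. val (of_int n/real e) u"
proof -
	obtain u where u: "u \<in> E" "val (1/real e) u" using lf_unif[OF assms] by blast
	show ?thesis using val_powi[OF u(2), of n] sf_power_int[OF lf_sfield[OF assms] u(1)] by auto
qed

lemma lf_vgt_vge: assumes "lf E e" "x \<in> E" "vgt (of_int n/real e) x" shows "vge (of_int (n+1)/real e) x"
proof (cases "x = 0")
	case False
	then obtain m :: int where m: "val (of_int m/real e) x" using lf_val assms by blast
	hence "real_of_int n < of_int m" using assms(3) by (simp add: val_vgt divide_less_cancel)
	hence "n+1 \<le> m" by linarith
	hence "real_of_int (n+1) \<le> of_int m" by linarith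
	hence "real_of_int (n+1)/real e \<le> of_int m/real e" by (rule divide_right_mono) simp
	thus ?thesis using m by (simp add: val_vge)
qed simp

text \<open>Two exponents below \<open>n\<close> that give the same valuation modulo
  \<open>(1/e)Z\<close> differ by a multiple of \<open>n\<close>, because \<open>c\<close> is
  invertible modulo \<open>n\<close>.\<close>

lemma frac_indep:
	fixes c k k' :: int
	assumes "Rings.coprime c (int n)" "i < n" "j < n" "e > 0"
		and eq: "of_int k/real e+real i*(of_int c/(real e*real n))
					 = of_int k'/real e+real j*(of_int c/(real e*real n))"
	shows "i = j"
proof -
	have n: "n > 0" using assms(2) by simp
	have "of_int (k*int n+int i * c) = (of_int (k'*int n+int j * c) :: real)" using eq n assms(4) by (simp add: field_simps)
	hence "k*int n+int i * c = k'*int n+int j * c" by linarith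
	hence "int n*(k - k') = (int j-int i) * c" by (simp add: algebra_simps)
	hence "int n dvd (int j-int i) * c" by (metis dvd_triv_left)
	hence "int n dvd int j-int i" using assms(1) by (simp add: coprime_dvd_mult_left_iff coprime_commute)
	thus ?thesis using assms(2,3) mod_eq_dvd_iff[of "int j" "int n" "int i"] by simp
qed

text \<open>In a totally ramified step the powers of the generator have distinct valuations
	modulo the value group of the base field.\<close>

lemma ram_term_min:
	assumes E: "lf E e" and z: "val (of_int c/(real e*real n)) z" and cn: "Rings.coprime c (int n)" "n > 0"
		and C: "\<And>i. C i \<in> E"
	shows "\<exists>i<n. v (\<Sum>j<n. C j*z^j) = v (C i*z^i) \<and>
		(\<forall>j<n. v (C i*z^i) \<le> v (C j*z^j)) \<and> (\<forall>j<n. j \<noteq> i --> C i \<noteq> 0 --> v (C i*z^i) < v (C j*z^j))"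
proof -
	have neq: "v (C i*z^i) \<noteq> v (C j*z^j)" if "i < n" "j < n" "i \<noteq> j" "C i \<noteq> 0" for i j
	proof
		assume e: "v (C i*z^i) = v (C j*z^j)"
		have "C i*z^i \<noteq> 0" using that(4) val_nonzero[OF z] by simp
		hence "C j \<noteq> 0" using e val_eq_infinity by (metis mult_zero_left)
		with that(4) obtain k k' :: int where k: "val (of_int k/real e) (C i)" and k': "val (of_int k'/real e) (C j)"
			using lf_val[OF E C] by metis
		have "val (of_int k/real e+real i*(of_int c/(real e*real n))) (C i*z^i)"
			by (rule val_mul[OF k val_power[OF z]])
		moreover have "val (of_int k'/real e+real j*(of_int c/(real e*real n))) (C j*z^j)"
			by (rule val_mul[OF k' val_power[OF z]])
		ultimately have "of_int k/real e+real i*(of_int c/(real e*real n)) = of_int k'/real e+real j*(of_int c/(real e*real n))"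
			using e by (simp add: val_def)
		thus False using frac_indep[OF cn(1) that(1,2) lf_pos[OF E]] that(3) by blast
	qed
	have "\<exists>i\<in>{..<n}. v (\<Sum>j<n. C j*z^j) = v (C i*z^i) \<and> (\<forall>j\<in>{..<n}. v (C i*z^i) \<le> v (C j*z^j))"
	proof (rule sum_min)
		fix i j assume "i \<in> {..<n}" "j \<in> {..<n}" "i \<noteq> j" "C i*z^i \<noteq> 0"
		thus "v (C i*z^i) \<noteq> v (C j*z^j)" using neq[of i j] by auto
	qed (use cn in auto)
	then obtain i where i: "i < n" "v (\<Sum>j<n. C j*z^j) = v (C i*z^i)" "\<And>j. j < n ==> v (C i*z^i) \<le> v (C j*z^j)"
		by auto
	show ?thesis
	proof (intro exI[of _ i] conjI allI impI)
		fix j assume "j < n" "j \<noteq> i" "C i \<noteq> 0"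
		thus "v (C i*z^i) < v (C j*z^j)" using i(1) i(3)[of j] neq[of i j] by simp
	qed (use i in simp_all)
qed

lemma ram_orth:
	assumes "lf E e" "val (of_int c/(real e*real n)) z" "Rings.coprime c (int n)" "n > 0"
	shows "orth E z n"
	unfolding orth_def
proof (intro allI impI)
	fix C :: "nat => 'a" and i assume C: "\<forall>i. C i \<in> E" and i: "i < n"
	have C': "\<And>i. C i \<in> E" using C by blast
	obtain k where "v (\<Sum>j<n. C j*z^j) = v (C k*z ^ k)" "\<forall>j<n. v (C k*z ^ k) \<le> v (C j*z^j)"
		using ram_term_min[of E e c n z C, OF assms C'] by blast
	thus "v (\<Sum>j<n. C j*z^j) \<le> v (C i*z^i)" using i by simp
qed

text \<open>Only the term with \<open>i = 0\<close> can have valuation 0, as the others lie in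
  nontrivial cosets of the value group of \<open>E\<close>; so the residue field does not
  grow.\<close>

lemma ram_residue:
	assumes E: "lf E e" and z: "val (of_int c/(real e*real n)) z" and cn: "Rings.coprime c (int n)" "n > 0"
		and x: "x \<in> lin_span E z n" "vge 0 x"
	shows "\<exists>y\<in>E. vge 0 y \<and> vgt 0 (x-y)"
proof -
	obtain C where C: "x = (\<Sum>i<n. C i*z^i)" "\<And>i. C i \<in> E" using x(1) by (auto simp: lin_span_def)
	have o: "orth E z n" by (rule ram_orth[OF E z cn])
	have t: "vge 0 (C i*z^i)" if "i < n" for i
		by (rule orth_vge[OF o C(2) that]) (use x(2) C(1) in simp)
	have t0: "vgt 0 (C i*z^i)" if i: "i < n" "i \<noteq> 0" for i
	proof (rule ccontr)
		assume "\<not> ?thesis"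
		hence v0: "val 0 (C i*z^i)" using t[OF i(1)] vge_cases by blast
		hence "C i \<noteq> 0" using val_nonzero by fastforce
		then obtain k :: int where k: "val (of_int k/real e) (C i)" using lf_val[OF E C(2)] by blast
		have "of_int k/real e+real i*(of_int c/(real e*real n)) = of_int 0/real e+real 0*(of_int c/(real e*real n))"
			using val_mul[OF k val_power[OF z]] v0 val_unique by fastforce
		thus False using frac_indep[OF cn(1) i(1) cn(2) lf_pos[OF E]] i(2) by blast
	qed
	have "vgt 0 (\<Sum>i\<in>{..<n} - {0}. C i*z^i)" by (rule vgt_sum) (use t0 in auto)
	moreover have "x-C 0 = (\<Sum>i\<in>{..<n} - {0}. C i*z^i)"
		using cn(2) by (simp add: C(1) sum_diff1)
	ultimately show ?thesis using t[of 0] cn(2) C(2) by (intro bexI[of _ "C 0"]) auto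
qed

lemma ext_ram:
	assumes E: "lf E e" and z: "val (of_int c/(real e*real n)) z" and cn: "Rings.coprime c (int n)" "n > 0"
		and q: "over_field E q" "plead q = 1" "pdeg q = n" "poly q z = 0"
	shows "lf (ext E z) (e*n)"
	unfolding lf_def
proof (intro conjI ballI impI)
	note Es = lf_sfield[OF E]
	have sp: "ext E z = lin_span E z n" by (rule ext_lin_span[OF Es q(1-3) cn(2) q(4)])
	have o: "orth E z n" by (rule ram_orth[OF E z cn])
	show S: "sfield (ext E z)" by (rule ext_sfield[OF Es q(1-3) cn(2) q(4)])
	show "vcomplete (ext E z)" unfolding sp by (rule orth_complete[OF o Es lf_complete[OF E] val_nonzero[OF z]])
	show "e*n > 0" using lf_pos[OF E] cn by simp
	show "\<exists>k::int. val (of_int k/real (e*n)) x" if x: "x \<in> ext E z" "x \<noteq> 0" for x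
	proof -
		obtain C where C: "x = (\<Sum>i<n. C i*z^i)" "\<And>i. C i \<in> E" using x(1) sp by (auto simp: lin_span_def)
		obtain i where i: "i < n" "v x = v (C i*z^i)" using ram_term_min[of E e c n z C, OF E z cn C(2)] unfolding C(1)[symmetric] by blast
		hence "C i \<noteq> 0" using x(2) val_eq_infinity by fastforce
		then obtain k :: int where k: "val (of_int k/real e) (C i)" using lf_val[OF E C(2)] by blast
		have "val (of_int k/real e+real i*(of_int c/(real e*real n))) (C i*z^i)"
			by (rule val_mul[OF k val_power[OF z]])
		moreover have "of_int k/real e+real i*(of_int c/(real e*real n))
			 = of_int (k*int n+int i * c)/real (e*n)"
			using lf_pos[OF E] cn(2) by (simp add: field_simps)
		ultimately show ?thesis using i(2) by (metis val_def)
	qed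
	show "\<exists>u\<in>ext E z. val (1/real (e*n)) u"
	proof -
		\<comment> \<open>The uniformizer is \<open>z^a*u\<close> with \<open>u\<close> of valuation
		  \<open>b/e\<close>: the Bezout identity makes its valuation \<open>1/(e*n)\<close>.\<close>
		obtain a b where ab: "a * c+b*int n = 1"
			using bezout_int[of c "int n"] cn(1) by auto
		obtain u where u: "u \<in> E" "val (of_int b/real e) u" using lf_elem[OF E] by blast
		have "val (of_int a*(of_int c/(real e*real n))) (z powi a)" by (rule val_powi[OF z])
		from val_mul[OF this u(2)] have "val (of_int (a * c+b*int n)/real (e*n)) (z powi a*u)"
			using lf_pos[OF E] cn(2) by (simp add: field_simps)
		hence "val (1/real (e*n)) (z powi a*u)" by (simp add: ab)
		moreover have "z powi a*u \<in> ext E z"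
			using ext_mem[OF Es, of z] ext_incl[OF Es, of z] u(1) S by (intro sf_mul sf_power_int) auto
		ultimately show ?thesis by blast
	qed
	show "\<exists>y\<in>ext E z. vge 0 y \<and> vgt 0 (x-y^p)" if x: "x \<in> ext E z" "vge 0 x" for x
	proof -
		obtain w where w: "w \<in> E" "vge 0 w" "vgt 0 (x-w)"
			using ram_residue[OF E z cn] x sp by auto
		obtain y where y: "y \<in> E" "vge 0 y" "vgt 0 (w-y^p)" using lf_root[OF E w(1,2)] .
		thus ?thesis using vgt_trans[OF w(3) y(3)] ext_incl[OF Es, of z] by blast
	qed
qed

end

context padic_valuation
begin

subsection \<open>The unramified Artin-Schreier step\<close>

definition ASpoly :: "'a => 'a poly" where "ASpoly a = Polynomial.monom 1 p - [:a, 1:]"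

lemma poly_ASpoly: "poly (ASpoly a) x = wp x-a"
	by (simp add: ASpoly_def wp_def poly_monom)

lemma coeff_ASpoly: "pcoeff (ASpoly a) i = (if i = p then 1 else if i = 1 then-1 else if i = 0 then-a else 0)"
	using p_gt_1 by (auto simp: ASpoly_def coeff_pCons split: nat.splits)

lemma ASpoly_monic: "pdeg (ASpoly a) = p" "plead (ASpoly a) = 1"
proof -
	have "pdeg (ASpoly a) \<le> p" by (rule degree_le) (use p_gt_1 in \<open>auto simp: coeff_ASpoly\<close>)
	moreover have "pdeg (ASpoly a) \<ge> p" by (rule le_degree) (simp add: coeff_ASpoly)
	ultimately show d: "pdeg (ASpoly a) = p" by simp
	show "plead (ASpoly a) = 1" unfolding d by (simp add: coeff_ASpoly)
qed

lemma over_ASpoly: "sfield E ==> a \<in> E ==> over_field E (ASpoly a)"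
	by (simp add: over_field_def coeff_ASpoly sf_0 sf_1 sf_minus)

lemma frob_diff: "vgt (-1/p) x ==> vgt (-1/p) y ==> vgt 0 ((x-y)^p-(x^p-y^p))"
	using frob_add_small[of "x-y" y] vgt_diff[of "-1/p" x y] vgt_minus_commute[of 0 "x^p-(x-y)^p" "y^p"] by (simp add: algebra_simps)

lemma wp_nat_mult: assumes "vge 0 x" shows "vgt 0 (wp (of_nat k*x) - of_nat k*wp x)"
proof -
	show ?thesis using vgt_mul[OF wp_of_nat vge_power[OF assms]] by (simp add: wp_def algebra_simps)
qed

lemma unit_inverse_mod: assumes "\<not> p dvd n" shows "\<exists>k::nat. p dvd k*n+1"
proof -
	have "Rings.coprime (int n) (int p)"
		using assms prime_p by (metis coprime_commute int_dvd_int_iff prime_imp_coprime prime_nat_int_transfer)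
	then obtain a b where ab: "a*int n+b*int p = 1"
		using bezout_int[of "int n" "int p"] by auto
	define k where "k = nat ((- a) mod int p)"
	have "[int k = - a] (mod int p)" using p_gt_0 by (simp add: k_def)
	hence "[int k*int n+1 = (- a)*int n+1] (mod int p)" by (intro cong_add cong_mult cong_refl)
	moreover have "int p dvd (- a)*int n+1"
	proof
		show "(- a)*int n+1 = int p*b" using ab by (simp add: algebra_simps)
	qed
	ultimately have "int p dvd int k*int n+1" using cong_dvd_iff by blast
	hence "int p dvd int (k*n+1)" by (simp add: algebra_simps)
	thus ?thesis by (auto simp only: int_dvd_int_iff)
qed

text \<open>If the minimal polynomial of \<open>y\<close> over the residue field had degree \<open>n < p\<close>, applying Frobenius
	and \<open>y^p = y + a\<close> would give a second one; comparing the coefficients of degree \<open>n - 1\<close>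
	solves \<open>X^p - X = a\<close>.\<close>

lemma unram_indep:
	assumes E: "sfield E" and a: "a \<in> E" "wp y = a" "vge 0 a"
		and no: "\<And>t0. t0 \<in> E ==> vge 0 t0 ==> \<not> vgt 0 (wp t0-a)"
	shows "n \<le> p ==> (\<And>i. c i \<in> E) ==> (\<And>i. vge 0 (c i)) ==> vgt 0 (\<Sum>i<n. c i*y^i) ==> i < n ==> vgt 0 (c i)"
proof (induction n arbitrary: c i)
	case 0
	thus ?case by simp
next
	case (Suc n)
	have y: "vge 0 y" by (rule wp_vge) (use a in simp)
	have np: "n < p" using Suc.prems(1) by simp
	show ?case
	proof (cases "vgt 0 (c n)")
		case True
		have "vgt 0 (c n*y^n)" using vgt_mul[OF True vge_power[OF y]] by simp
		from vgt_diff[OF Suc.prems(4) this] have "vgt 0 (\<Sum>i<n. c i*y^i)" by simp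
		hence "vgt 0 (c i)" if "i < n" using Suc.IH[of c i] Suc.prems(2,3) np that by simp
		thus ?thesis using True Suc.prems(5) by (cases "i = n") auto
	next
		case False
		hence cn: "val 0 (c n)" using vge_cases[OF Suc.prems(3)] by blast
		hence cn0: "c n \<noteq> 0" using val_nonzero by blast
		define d where "d i = c i / c n" for i
		have dn: "d n = 1" using cn0 by (simp add: d_def)
		have dE: "d i \<in> E" for i unfolding d_def by (rule sf_divide[OF E Suc.prems(2) Suc.prems(2)])
		have dv: "vge 0 (d i)" for i unfolding d_def using vge_divide[OF Suc.prems(3) cn] by simp
		have Z: "vgt 0 (\<Sum>i<Suc n. d i*y^i)" using vgt_divide[OF Suc.prems(4) cn] by (simp add: d_def sum_divide_distrib add_divide_distrib)
		show ?thesis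
		proof (cases "n = 0")
			case True
			thus ?thesis using Z dn by (simp add: val_vgt[OF val_1])
		next
			case n0: False
			have small: "vgt (-1/p) (d i*y^i)" for i
				by (rule vge_imp_small) (use vge_mul[OF dv vge_power[OF y], of i i] in simp)
			define S where "S = (\<Sum>i\<le>n. d i*y^i)"
			have S: "vgt 0 S" using Z by (simp add: S_def lessThan_Suc_atMost)
			have Sp: "vgt 0 (S^p)" using vgt_mul[OF S vge_power[OF vgt_vge[OF S]], of "p-1"] p_gt_0
				by (simp add: power_eq_if)
			have "vgt 0 (S^p-(\<Sum>i\<le>n. (d i*y^i)^p))" unfolding S_def by (rule frob_sum[OF small])
			from vgt_diff[OF Sp this] have P1: "vgt 0 (\<Sum>i\<le>n. (d i*y^i)^p)" by simp
			have yp: "y^p = y+a" using a(2) by (simp add: wp_def algebra_simps)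
			define e where "e j = (\<Sum>i\<le>n. d i^p*(of_nat (i choose j)*a^(i-j)))" for j
			have "(\<Sum>i\<le>n. (d i*y^i)^p) = (\<Sum>i\<le>n. d i^p*(y+a)^i)"
				by (simp add: power_mult_distrib yp[symmetric] flip: power_mult) (simp add: mult.commute)
			also have "\<dots> = (\<Sum>i\<le>n. \<Sum>j\<le>n. d i^p*(of_nat (i choose j)*a^(i-j))*y^j)"
			proof (rule sum.cong[OF refl])
				fix i assume i: "i \<in> {..n}"
				have "(y+a)^i = (\<Sum>j\<le>i. of_nat (i choose j)*y^j*a^(i-j))" by (rule binomial_ring)
				also have "\<dots> = (\<Sum>j\<le>n. of_nat (i choose j)*y^j*a^(i-j))"
					by (rule sum.mono_neutral_left) (use i in \<open>auto simp: binomial_eq_0\<close>)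
				finally show "d i^p*(y+a)^i = (\<Sum>j\<le>n. d i^p*(of_nat (i choose j)*a^(i-j))*y^j)"
					by (simp add: sum_distrib_left mult_ac)
			qed
			also have "\<dots> = (\<Sum>j\<le>n. e j*y^j)"
				by (subst sum.swap) (simp add: e_def sum_distrib_right)
			finally have P2: "vgt 0 (\<Sum>j\<le>n. e j*y^j)" using P1 by simp
			have en: "e n = 1"
			proof -
				have "e n = (\<Sum>i\<in>{n}. d i^p*(of_nat (i choose n)*a^(i-n)))"
					unfolding e_def by (rule sum.mono_neutral_right) (auto simp: binomial_eq_0)
				thus ?thesis by (simp add: dn)
			qed
			have en1: "e (n-1) = d (n-1)^p + of_nat n*a"
			proof -
				have "e (n-1) = (\<Sum>i\<in>{n-1, n}. d i^p*(of_nat (i choose (n-1))*a^(i-(n-1))))"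
					unfolding e_def by (rule sum.mono_neutral_right) (auto simp: binomial_eq_0)
				moreover have "n choose (n-1) = n" using n0 binomial_symmetric[of 1 n] by simp
				ultimately show ?thesis using n0 by (simp add: dn)
			qed
			have eE: "e j \<in> E" for j
				unfolding e_def by (rule sf_sum[OF E]) (intro sf_mul[OF E] sf_power[OF E] sf_of_nat[OF E] dE a(1))
			have ev: "vge 0 (e j)" for j
				unfolding e_def
			proof (rule vge_sum)
				fix i
				show "vge 0 (d i^p*(of_nat (i choose j)*a^(i-j)))"
					using vge_mul[OF vge_power[OF dv[of i], of p] vge_mul[OF vge_of_nat vge_power[OF a(3)]]] by simp
			qed
			have "vgt 0 ((\<Sum>j\<le>n. e j*y^j)-S)" by (rule vgt_diff[OF P2 S])
			also have "(\<Sum>j\<le>n. e j*y^j)-S = (\<Sum>j<n. (e j-d j)*y^j)"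
				by (simp add: S_def lessThan_Suc_atMost[symmetric] en dn sum_subtractf left_diff_distrib)
			finally have P3: "vgt 0 (\<Sum>j<n. (e j-d j)*y^j)" .
			have "vgt 0 (e (n-1)-d (n-1))"
				by (rule Suc.IH[OF _ _ _ P3]) (use np n0 sf_diff[OF E eE dE] vge_diff[OF ev dv] in simp_all)
			moreover have "e (n-1)-d (n-1) = wp (d (n-1)) + of_nat n*a" unfolding en1 wp_def by simp
			ultimately have P4: "vgt 0 (wp (d (n-1)) + of_nat n*a)" by simp
			\<comment> \<open>\<open>k\<close> is the inverse of \<open>-n\<close> modulo \<open>p\<close>.
			  From \<open>wp d + n*a\<close> congruent to 0, with \<open>d\<close> the coefficient of degree
			  \<open>n-1\<close>, it follows that \<open>wp (k*d)\<close> is congruent to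
			  \<open>-k*n*a\<close>, that is, to \<open>a\<close>.\<close>
			obtain k where k: "p dvd k*n+1" using n0 np unit_inverse_mod by (meson dvd_imp_le linorder_not_le neq0_conv)
			define t0 where "t0 = of_nat k*d (n-1)"
			have t0: "t0 \<in> E" "vge 0 t0"
				unfolding t0_def using sf_mul[OF E sf_of_nat[OF E] dE] vge_mul[OF vge_of_nat dv] by simp_all
			have 1: "vgt 0 (wp t0 - of_nat k*wp (d (n-1)))" unfolding t0_def by (rule wp_nat_mult[OF dv])
			have 2: "vgt 0 (of_nat k*(wp (d (n-1)) + of_nat n*a))" using vgt_mul'[OF vge_of_nat P4] by simp
			have "vgt 0 (of_nat (k*n+1))" using vgt_of_nat_iff k by blast
			from vgt_mul[OF this a(3)] have 3: "vgt 0 (of_nat (k*n+1)*a)" by simp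
			show ?thesis using vgt_diff[OF vgt_add[OF 1 2] 3] no[OF t0] by (simp add: algebra_simps)
		qed
	qed
qed

lemma finite_min_v:
	assumes "n > 0" shows "\<exists>i<n. \<forall>j<(n::nat). v (c i) \<le> v (c j)"
proof -
	have "Min ((\<lambda>i. v (c i)) ` {..<n}) \<in> (\<lambda>i. v (c i)) ` {..<n}" using assms by (intro Min_in) auto
	then obtain i where i: "i < n" "v (c i) = Min ((\<lambda>i. v (c i)) ` {..<n})" by auto
	have "v (c i) \<le> v (c j)" if "j < n" for j unfolding i(2) by (rule Min_le) (use that in auto)
	thus ?thesis using i(1) by blast
qed

text \<open>Dividing by a coefficient of least valuation reduces to integral coefficients, one of
  them 1, and then \<open>unram_indep\<close> forbids a sum in the maximal ideal.\<close>

lemma unram_min: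
	assumes E: "sfield E" and a: "a \<in> E" "wp y = a" "vge 0 a"
		and no: "\<And>t0. t0 \<in> E ==> vge 0 t0 ==> \<not> vgt 0 (wp t0-a)" and c: "\<And>i. c i \<in> E"
	shows "\<exists>i<p. (\<forall>j<p. v (c i) \<le> v (c j)) \<and> v (\<Sum>j<p. c j*y^j) = v (c i)"
proof -
	obtain i where i: "i < p" "\<And>j. j < p ==> v (c i) \<le> v (c j)" using finite_min_v[OF p_gt_0] by blast
	have y: "vge 0 y" by (rule wp_vge) (use a in simp)
	have "v (\<Sum>j<p. c j*y^j) = v (c i)"
	proof (cases "c i = 0")
		case True
		hence "c j = 0" if "j < p" for j using i(2)[OF that] val_eq_infinity by simp
		thus ?thesis using True by simp
	next
		case False
		then obtain b where b: "val b (c i)" using val_ex by blast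
		have cb: "vge b (c j)" if "j < p" for j using i(2)[OF that] b by (simp add: vge_def val_def)
		have ge: "vge b (\<Sum>j<p. c j*y^j)"
		proof (rule vge_sum)
			fix j assume "j \<in> {..<p}"
			thus "vge b (c j*y^j)" using vge_mul[OF cb vge_power[OF y], of j j] by simp
		qed
		have "\<not> vgt b (\<Sum>j<p. c j*y^j)"
		proof
			assume g: "vgt b (\<Sum>j<p. c j*y^j)"
			define d where "d j = (if j < p then c j / c i else 0)" for j
			have dE: "d j \<in> E" for j unfolding d_def using sf_divide[OF E c c] sf_0[OF E] by simp
			have dv: "vge 0 (d j)" for j unfolding d_def using vge_divide[OF cb b] by simp
			have "vgt 0 (\<Sum>j<p. d j*y^j)" using vgt_divide[OF g b] by (simp add: d_def sum_divide_distrib)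
			from unram_indep[OF E a no order_refl dE dv this i(1)] have "vgt 0 (d i)" by blast
			thus False using False i(1) by (simp add: d_def val_vgt[OF val_1])
		qed
		hence "val b (\<Sum>j<p. c j*y^j)" using ge vge_cases by blast
		thus ?thesis using b by (simp add: val_def)
	qed
	thus ?thesis using i by blast
qed

lemma unram_orth:
	assumes E: "sfield E" and a: "a \<in> E" "wp y = a" "vge 0 a"
		and no: "\<And>t0. t0 \<in> E ==> vge 0 t0 ==> \<not> vgt 0 (wp t0-a)"
	shows "orth E y p"
	unfolding orth_def
proof (intro allI impI)
	fix c :: "nat => 'a" and i assume c: "\<forall>i. c i \<in> E" and i: "i < p"
	have y: "vge 0 y" by (rule wp_vge) (use a in simp)
	obtain k where k: "\<forall>j<p. v (c k) \<le> v (c j)" "v (\<Sum>j<p. c j*y^j) = v (c k)"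
		using unram_min[of E a y c, OF E a no] c by blast
	have "v (c i) \<le> v (c i*y^i)"
	proof (cases "c i = 0")
		case False
		then obtain b where b: "val b (c i)" using val_ex by blast
		show ?thesis using vge_mul[of b "c i" 0 "y^i"] b vge_power[OF y, of i] by (simp add: vge_def val_def)
	qed simp
	thus "v (\<Sum>j<p. c j*y^j) \<le> v (c i*y^i)" using k i order_trans by metis
qed

lemma ext_unram:
	assumes E: "lf E e" and a: "a \<in> E" "wp y = a" "vge 0 a"
		and no: "\<And>t0. t0 \<in> E ==> vge 0 t0 ==> \<not> vgt 0 (wp t0-a)"
	shows "lf (ext E y) e"
	unfolding lf_def
proof (intro conjI ballI impI)
	note Es = lf_sfield[OF E]
	have y: "vge 0 y" by (rule wp_vge) (use a in simp)
	have q: "over_field E (ASpoly a)" "plead (ASpoly a) = 1" "pdeg (ASpoly a) = p" "p > 0" "poly (ASpoly a) y = 0"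
		using over_ASpoly[OF Es a(1)] ASpoly_monic p_gt_0 a(2) by (simp_all add: poly_ASpoly)
	have sp: "ext E y = lin_span E y p" by (rule ext_lin_span[OF Es q])
	have o: "orth E y p" by (rule unram_orth[OF Es a no])
	have y0: "y \<noteq> 0"
	proof
		assume "y = 0"
		hence "a = 0" using a(2) by simp
		thus False using no[of 0] sf_0[OF Es] by simp
	qed
	show "sfield (ext E y)" by (rule ext_sfield[OF Es q])
	show "vcomplete (ext E y)" unfolding sp by (rule orth_complete[OF o Es lf_complete[OF E] y0])
	show "e > 0" by (rule lf_pos[OF E])
	show "\<exists>k::int. val (of_int k/real e) x" if x: "x \<in> ext E y" "x \<noteq> 0" for x
	proof -
		obtain C where C: "x = (\<Sum>i<p. C i*y^i)" "\<And>i. C i \<in> E" using x(1) sp by (auto simp: lin_span_def)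
		obtain i where i: "v x = v (C i)"
			using unram_min[of E a y C, OF Es a no C(2)] unfolding C(1)[symmetric] by blast
		hence "C i \<noteq> 0" using x(2) val_eq_infinity by fastforce
		then obtain k :: int where k: "val (of_int k/real e) (C i)" using lf_val[OF E C(2)] by blast
		thus ?thesis using i by (auto simp: val_def)
	qed
	show "\<exists>u\<in>ext E y. val (1/real e) u" using lf_unif[OF E] ext_incl[OF Es] by blast
	show "\<exists>w\<in>ext E y. vge 0 w \<and> vgt 0 (x-w^p)" if x: "x \<in> ext E y" "vge 0 x" for x
	proof -
		obtain C where C: "x = (\<Sum>i<p. C i*y^i)" "\<And>i. C i \<in> E" using x(1) sp by (auto simp: lin_span_def)
		obtain i where i: "\<forall>j<p. v (C i) \<le> v (C j)" "v x = v (C i)"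
			using unram_min[of E a y C, OF Es a no C(2)] unfolding C(1)[symmetric] by blast
		have Cv: "vge 0 (C j)" if "j < p" for j using i that x(2) order_trans unfolding vge_def by metis
		have "\<forall>j. \<exists>d. j < p --> d \<in> E \<and> vge 0 d \<and> vgt 0 (C j-d^p)" using lf_root[OF E C(2) Cv] by metis
		from choice[OF this] obtain d where d: "\<And>j. j < p ==> d j \<in> E" "\<And>j. j < p ==> vge 0 (d j)" "\<And>j. j < p ==> vgt 0 (C j-d j^p)"
			by blast
		obtain a1 where a1: "a1 \<in> E" "vge 0 a1" "vgt 0 (a-a1^p)" using lf_root[OF E a(1,3)] .
		\<comment> \<open>A p-th root of \<open>y\<close> modulo the maximal ideal:
		  \<open>y = y^p - a\<close> and \<open>a\<close> is congruent to \<open>a1^p\<close>, so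
		  \<open>y\<close> is congruent to \<open>(y - a1)^p\<close>.\<close>
		define t where "t = y-a1"
		have t: "vge 0 t" unfolding t_def by (rule vge_diff[OF y a1(2)])
		have "vgt 0 (t^p-(y^p-a1^p))"
			unfolding t_def by (rule frob_diff[OF vge_imp_small[OF y] vge_imp_small[OF a1(2)]])
		moreover have "vgt 0 ((y^p-a1^p)-y)" using a1(3) a(2) by (simp add: wp_def algebra_simps)
		ultimately have ty: "vgt 0 (t^p-y)" by (rule vgt_trans)
		define w where "w = (\<Sum>j<p. d j*t^j)"
		have wv: "vge 0 (d j*t^j)" if "j < p" for j using vge_mul[OF d(2)[OF that] vge_power[OF t]] by simp
		have "vgt 0 (w^p-(\<Sum>j<p. (d j*t^j)^p))"
			unfolding w_def by (rule frob_sum) (use wv vge_imp_small in auto)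
		moreover have "vgt 0 ((\<Sum>j<p. (d j*t^j)^p)-x)"
		proof -
			have "(\<Sum>j<p. (d j*t^j)^p)-x = (\<Sum>j<p. d j^p*(t^p)^j-C j*y^j)"
				by (simp add: C(1) sum_subtractf power_mult_distrib mult.commute flip: power_mult)
			moreover have "vgt 0 \<dots>"
			proof (rule vgt_sum)
				fix j assume j: "j \<in> {..<p}"
				show "vgt 0 (d j^p*(t^p)^j-C j*y^j)"
				proof (rule vgt_mult_diff)
					show "vge 0 (d j^p)" using vge_power[OF d(2), of j p] j by simp
					show "vge 0 (y^j)" using vge_power[OF y, of j] by simp
					show "vgt 0 (d j^p-C j)" using d(3)[of j] j by (simp add: vgt_minus_commute)
					show "vgt 0 ((t^p)^j-y^j)"
						by (rule vgt_power_diff[OF _ y ty]) (use vge_power[OF t, of p] in simp)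
				qed
			qed
			ultimately show ?thesis by simp
		qed
		ultimately have "vgt 0 (w^p-x)" by (rule vgt_trans)
		moreover have "w \<in> ext E y"
			unfolding w_def t_def
			using ext_incl[OF Es, of y] ext_mem[OF Es, of y] d(1) a1(1) \<open>sfield (ext E y)\<close>
			by (intro sf_sum sf_mul sf_power sf_diff) auto
		moreover have "vge 0 w" unfolding w_def by (rule vge_sum) (use wv in auto)
		ultimately show ?thesis by (auto simp: vgt_minus_commute)
	qed
qed

end

subsection \<open>Embeddings\<close>

text \<open>A homomorphism into the ambient field. The image need not lie in \<open>E\<close>, so
  that conjugates can be compared before \<open>E\<close> is known to be stable.\<close>

definition emb :: "'a::field set => ('a => 'a) => bool" where
	"emb E h = ((\<forall>x\<in>E. \<forall>y\<in>E. h (x+y) = h x+h y \<and> h (x*y) = h x*h y) \<and> h 1 = 1)"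

lemma emb_subset: "emb E h ==> E' \<subseteq> E ==> emb E' h"
	unfolding emb_def by blast

lemma emb_cong: "emb E h ==> sfield E ==> (\<And>x. x \<in> E ==> g x = h x) ==> emb E g"
	unfolding emb_def by (simp add: sf_closed)

context
	fixes E :: "'a::field set" and h
	assumes E: "sfield E" and h: "emb E h"
begin

lemma emb_add: "x \<in> E ==> y \<in> E ==> h (x+y) = h x+h y"
	and emb_mul: "x \<in> E ==> y \<in> E ==> h (x*y) = h x*h y"
	and emb_1: "h 1 = 1"
	using h by (simp_all add: emb_def)

lemma emb_0: "h 0 = 0"
	using emb_add[of 0 0] sf_0[OF E] by (metis add_cancel_right_right)

lemma emb_minus: "x \<in> E ==> h (- x) = - h x"
	using emb_add[of x "- x"] sf_minus[OF E] emb_0 by (simp add: eq_neg_iff_add_eq_0 add.commute)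

lemma emb_diff: "x \<in> E ==> y \<in> E ==> h (x-y) = h x-h y"
	using emb_add[of x "- y"] sf_minus[OF E] emb_minus by simp

lemma emb_inverse: "x \<in> E ==> h (inverse x) = inverse (h x)"
	using emb_mul[of x "inverse x"] sf_inverse[OF E, of x] emb_1 emb_0
	by (cases "x = 0") (auto intro: inverse_unique[symmetric])

lemma emb_divide: "x \<in> E ==> y \<in> E ==> h (x/y) = h x/h y"
	using emb_mul[of x "inverse y"] sf_inverse[OF E] emb_inverse by (simp add: divide_inverse)

lemma emb_power: "x \<in> E ==> h (x^n) = h x^n"
	by (induction n) (simp_all add: emb_1 emb_mul sf_power[OF E])

lemma emb_sum: "(\<And>i. i \<in> A ==> f i \<in> E) ==> h (sum f A) = (\<Sum>i\<in>A. h (f i))"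
	by (induction A rule: infinite_finite_induct) (simp_all add: emb_0 emb_add sf_sum[OF E])

lemma emb_of_nat: "h (of_nat n) = of_nat n"
	by (induction n) (simp_all add: emb_0 emb_1 emb_add sf_1[OF E] sf_of_nat[OF E])

lemma emb_eq_0: "x \<in> E ==> (h x = 0) = (x = 0)"
	using emb_mul[of x "inverse x"] sf_inverse[OF E, of x] emb_1 emb_0 by (cases "x = 0") auto

lemma emb_inj: "inj_on h E"
	by (rule inj_onI) (metis emb_diff emb_eq_0 eq_iff_diff_eq_0 sf_diff[OF E])

lemma coeff_map_emb: "pcoeff (map_poly h P) i = h (pcoeff P i)"
	by (rule coeff_map_poly) (rule emb_0)

lemma emb_poly: "over_field E P ==> x \<in> E ==> h (poly P x) = poly (map_poly h P) (h x)"
proof (induction P)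
	case (pCons a P)
	have "poly P x \<in> E" using pCons(2,3,4) ext_poly[OF E, of x] ext_least[OF E E order_refl, of x]
		by auto
	thus ?case using pCons by (simp add: emb_add emb_mul sf_mul[OF E] map_poly_pCons[of h] emb_0)
qed (simp add: emb_0)

lemma map_emb_add: "over_field E P ==> over_field E Q ==> map_poly h (P+Q) = map_poly h P + map_poly h Q"
	by (rule poly_eqI) (simp add: coeff_map_emb emb_add over_field_def)

lemma map_emb_mult: "over_field E P ==> over_field E Q ==> map_poly h (P*Q) = map_poly h P * map_poly h Q"
	by (rule poly_eqI) (simp add: coeff_map_emb coeff_mult emb_sum emb_mul sf_mul[OF E] over_field_def)

text \<open>The image of \<open>poly P z\<close> is the conjugated polynomial at \<open>z'\<close>.
  It does not depend on \<open>P\<close>: by independence of the powers of \<open>z\<close>, every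
  \<open>P\<close> vanishing at \<open>z\<close> is a multiple of \<open>q\<close>, and conjugation
  preserves this.\<close>

lemma emb_extend:
	assumes q: "over_field E q" "plead q = 1" "pdeg q = n" "n > 0" "poly q z = 0"
		and li: "lin_indep E z n" and z': "poly (map_poly h q) z' = 0"
	shows "\<exists>g. emb (ext E z) g \<and> (\<forall>x\<in>E. g x = h x) \<and> g z = z'"
proof -
	have wd0: "poly (map_poly h P) z' = 0" if P: "over_field E P" "poly P z = 0" for P
	proof -
		obtain S T where ST: "over_field E S" "over_field E T" "P = q*S+T" "pdeg T < n"
			using over_division[OF E q(1-4) P(1)] by blast
		have "poly T z = 0" using P(2) ST(3) q(5) by simp
		hence "(\<Sum>i\<le>pdeg T. pcoeff T i*z^i) = 0" by (simp add: poly_altdef)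
		also have "(\<Sum>i\<le>pdeg T. pcoeff T i*z^i) = (\<Sum>i<n. pcoeff T i*z^i)"
			by (rule sum.mono_neutral_left) (use ST(4) in \<open>auto simp: coeff_eq_0\<close>)
		finally have "\<forall>i<n. pcoeff T i = 0"
			using li ST(2) unfolding lin_indep_def over_field_def by blast
		hence "T = 0" using ST(4) by (metis leading_coeff_0_iff)
		hence "map_poly h P = map_poly h q * map_poly h S"
			using ST(1,3) q(1) by (simp add: map_emb_mult)
		thus ?thesis using z' by simp
	qed
	have wd: "poly (map_poly h P) z' = poly (map_poly h Q) z'"
		if "over_field E P" "over_field E Q" "poly P z = poly Q z" for P Q
	proof -
		have o: "over_field E (P-Q)" using over_diff[OF E] that by blast
		show ?thesis using map_emb_add[OF o that(2)] wd0[OF o] that(3) by simp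
	qed
	define g where "g x = poly (map_poly h (SOME P. over_field E P \<and> x = poly P z)) z'" for x
	have g: "g (poly P z) = poly (map_poly h P) z'" if P: "over_field E P" for P
	proof -
		have "over_field E (SOME Q. over_field E Q \<and> poly P z = poly Q z) \<and> poly P z = poly (SOME Q. over_field E Q \<and> poly P z = poly Q z) z"
			by (rule someI[of _ P]) (use P in simp)
		thus ?thesis unfolding g_def using wd[OF _ P] by metis
	qed
	have "emb (ext E z) g"
		unfolding emb_def
	proof (intro conjI ballI)
		fix x y assume "x \<in> ext E z" "y \<in> ext E z"
		then obtain P Q where PQ: "x = poly P z" "over_field E P" "y = poly Q z" "over_field E Q"
			by (auto simp: ext_poly[OF E])
		show "g (x+y) = g x+g y"
			using g[OF PQ(2)] g[OF PQ(4)] g[OF over_add[OF E PQ(2,4)]] PQ by (simp add: map_emb_add)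
		show "g (x*y) = g x*g y"
			using g[OF PQ(2)] g[OF PQ(4)] g[OF over_mult[OF E PQ(2,4)]] PQ by (simp add: map_emb_mult)
	next
		show "g 1 = 1" using g[of "[:1:]"] sf_1[OF E] by (simp add: over_0[OF E] map_poly_pCons[of h] emb_0 emb_1)
	qed
	moreover have "g x = h x" if "x \<in> E" for x
		using g[of "[:x:]"] that by (simp add: over_0[OF E] map_poly_pCons[of h] emb_0)
	moreover have "g z = z'"
		using g[of "[:0,1:]"] by (simp add: over_0[OF E] map_poly_pCons[of h] emb_0 emb_1 sf_0[OF E] sf_1[OF E])
	ultimately show ?thesis by blast
qed

end

context padic_valuation
begin

definition vpres :: "'a set => ('a => 'a) => bool" where
	"vpres E h = (\<forall>x\<in>E. v (h x) = v x)"

lemma vpres_val: "vpres E h ==> x \<in> E ==> val a (h x) = val a x"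
	and vpres_vge: "vpres E h ==> x \<in> E ==> vge a (h x) = vge a x"
	and vpres_vgt: "vpres E h ==> x \<in> E ==> vgt a (h x) = vgt a x"
	by (auto simp: vpres_def val_def vge_def vgt_def)

text \<open>Termwise on the orthogonal basis, the hypothesis on \<open>h z\<close> yields
  \<open>v (h x) \<ge> v x\<close> for every \<open>x\<close>; the same inequality for
  \<open>inverse x\<close> gives equality.\<close>

lemma vpres_ext:
	assumes o: "orth E z n" and sp: "ext E z = lin_span E z n" and S: "sfield (ext E z)" and E: "sfield E"
		and h: "emb (ext E z) h" and vp: "vpres E h" and zz: "val zc z" "vge zc (h z)"
	shows "vpres (ext E z) h"
proof -
	have EE: "E \<subseteq> ext E z" "z \<in> ext E z" using ext_incl[OF E] ext_mem[OF E] by auto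
	have ge: "vge a (h x)" if x: "x \<in> ext E z" "val a x" for a x
	proof -
		obtain C where C: "x = (\<Sum>i<n. C i*z^i)" "\<And>i. C i \<in> E" using x(1) sp by (auto simp: lin_span_def)
		have CE: "C i \<in> ext E z" for i using C(2) EE(1) by blast
		have "h x = (\<Sum>i<n. h (C i)*h z^i)"
			unfolding C(1) using EE(2) CE
			by (subst emb_sum[OF S h]) (simp_all add: emb_mul[OF S h] emb_power[OF S h] sf_mul[OF S] sf_power[OF S])
		moreover have "vge a \<dots>"
		proof (rule vge_sum)
			fix i assume i: "i \<in> {..<n}"
			show "vge a (h (C i)*h z^i)"
			proof (cases "C i = 0")
				case True thus ?thesis by (simp add: emb_0[OF S h])
			next
				case False
				then obtain k where k: "val k (C i)" using val_ex by blast
				have "vge a (C i*z^i)" by (rule orth_vge[OF o C(2)]) (use i x(2) C(1) in \<open>auto simp: val_vge\<close>)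
				hence "a \<le> k+real i*zc" using val_vge[OF val_mul[OF k val_power[OF zz(1), of i]]] by simp
				moreover have "vge (k+real i*zc) (h (C i)*h z^i)"
					using k vpres_val[OF vp C(2)] by (intro vge_mul vge_power zz(2)) (auto simp: val_vge)
				ultimately show ?thesis using vge_mono by blast
			qed
		qed
		ultimately show ?thesis by simp
	qed
	show ?thesis
		unfolding vpres_def
	proof
		fix x assume x: "x \<in> ext E z"
		show "v (h x) = v x"
		proof (cases "x = 0")
			case True thus ?thesis by (simp add: emb_0[OF S h])
		next
			case False
			then obtain a where a: "val a x" using val_ex by blast
			obtain b where b: "val b (h x)" using emb_eq_0[OF S h x] False val_ex by blast
			have "a \<le> b" using ge[OF x a] b by (simp add: val_vge)
			moreover have "vge (- a) (h (inverse x))" by (rule ge[OF sf_inverse[OF S x] val_inverse[OF a]])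
			hence "- a \<le>-b" using val_vge[OF val_inverse[OF b]] by (simp add: emb_inverse[OF S h x])
			ultimately have "a = b" by simp
			thus ?thesis using a b by (simp add: val_def)
		qed
	qed
qed

subsection \<open>The ramification break of an automorphism\<close>

abbreviation (input) "rp e \<equiv> real e*real p"

text \<open>The automorphism has lower ramification number \<open>b\<close>. Elements of every
  valuation are included, poles too, because the property is applied to constants of Artin-Schreier
  equations. Exactness is limited to \<open>n\<close> prime to \<open>p\<close>, since passing from
  \<open>x\<close> to \<open>x^n\<close> multiplies the leading term of \<open>s x/x - 1\<close> by
  \<open>n\<close>.\<close>

definition has_break :: "'a set => nat => ('a => 'a) => real => bool" where
	"has_break E e s b = (\<forall>x\<in>E. \<forall>n::int. val (of_int n/real e) x -->
		 vge ((of_int n+b)/real e) (s x-x) \<and>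
		 (\<not> int p dvd n --> val ((of_int n+b)/real e) (s x-x)))"

lemma has_breakD: "has_break E e s b ==> x \<in> E ==> val (of_int n/real e) x ==> vge ((of_int n+b)/real e) (s x-x)"
	"has_break E e s b ==> x \<in> E ==> val (of_int n/real e) x ==> \<not> int p dvd n ==> val ((of_int n+b)/real e) (s x-x)"
	by (simp_all add: has_break_def)

text \<open>The shift of a term \<open>C*z^i\<close> with \<open>0 < i < p\<close> comes from
  \<open>z\<close>: the leading term of \<open>(s z)^i - z^i\<close> is
  \<open>i*z^(i-1)*(s z - z)\<close>, while the movement of the coefficient \<open>C\<close> is
  negligible by the last hypothesis. As the terms have distinct valuations, the dominant one
  decides.\<close>

lemma has_break_step:
	assumes E: "lf E e" and z: "val (of_int c/rp e) z" and c: "\<not> int p dvd c"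
		and sp: "ext E z = lin_span E z p" and S: "sfield (ext E z)" and s: "emb (ext E z) s"
		and B: "B > 0" "val ((of_int c+B)/rp e) (s z-z)"
		and sE: "\<And>x n. x \<in> E ==> val (of_int n/real e) x ==> vgt (of_int n/real e+B/rp e) (s x-x)"
	shows "has_break (ext E z) (e*p) s B"
	unfolding has_break_def
proof (intro ballI allI impI)
	fix x n assume x: "x \<in> ext E z" and n: "val (of_int n/real (e*p)) x"
	have e0: "e > 0" by (rule lf_pos[OF E])
	have EE: "E \<subseteq> ext E z" "z \<in> ext E z" using ext_incl[OF lf_sfield[OF E]] ext_mem[OF lf_sfield[OF E]] by auto
	have cp: "Rings.coprime c (int p)"
		using c prime_p by (metis coprime_commute prime_imp_coprime prime_nat_int_transfer)
	define q where "q = B/rp e"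
	have q: "q > 0" using B(1) e0 p_gt_0 by (simp add: q_def)
	define zc where "zc = of_int c/rp e"
	define d where "d = s z-z"
	have zv: "val zc z" using z by (simp add: zc_def)
	have dv: "val (zc+q) d" using B(2) by (simp add: d_def zc_def q_def add_divide_distrib)
	obtain C where C: "x = (\<Sum>i<p. C i*z^i)" "\<And>i. C i \<in> E" using x sp by (auto simp: lin_span_def)
	have CE: "C i \<in> ext E z" for i using C(2) EE(1) by blast
	define T where "T i = s (C i*z^i)-C i*z^i" for i
	have sx: "s x-x = (\<Sum>i<p. T i)"
		unfolding C(1) T_def using EE(2) CE
		by (subst emb_sum[OF S s]) (simp_all add: sum_subtractf sf_mul[OF S] sf_power[OF S])
	have sz: "s z = z+d" by (simp add: d_def)
	have szv: "val zc (z+d)" by (rule val_plus[OF zv]) (use dv q in \<open>simp add: val_vgt\<close>)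
	have T0: "T i = 0" if "C i = 0" for i using that by (simp add: T_def emb_0[OF S s])
	have T1: "vge (k+real i*zc+q) (T i) \<and> (i > 0 --> val (k+real i*zc+q) (T i))"
		if i: "i < p" and k: "val k (C i)" for i k
	proof -
		have "C i \<noteq> 0" using val_nonzero[OF k] .
		then obtain m :: int where m: "val (of_int m/real e) (C i)" using lf_val[OF E C(2)] by blast
		have km: "k = of_int m/real e" using val_unique[OF k m] .
		have Te: "T i = (s (C i)-C i)*(z+d)^i+C i*((z+d)^i-z^i)"
			using EE(2) CE by (simp add: T_def emb_mul[OF S s] emb_power[OF S s] sf_power[OF S] sz algebra_simps)
		have "vgt (k+q) (s (C i)-C i)" using sE[OF C(2) m] by (simp add: km q_def)
		from vgt_mul[OF this vge_power, of zc "z+d" i] szv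
		have 1: "vgt (k+real i*zc+q) ((s (C i)-C i)*(z+d)^i)" by (simp add: val_vge algebra_simps)
		show ?thesis
		proof (cases "i = 0")
			case True
			thus ?thesis using 1 Te by (auto intro: vgt_vge)
		next
			case False
			have "\<not> p dvd i" using False i by (meson dvd_imp_le linorder_not_le neq0_conv)
			from sim_power_diff[OF zv dv _ this] q
			have "sim ((z+d)^i-z^i) (of_nat i*z^(i-1)*d)" by simp
			moreover have "val (0+real (i-1)*zc+(zc+q)) (of_nat i*z^(i-1)*d)"
				using \<open>\<not> p dvd i\<close> by (intro val_mul val_of_nat val_power zv dv)
			moreover have "0+real (i-1)*zc+(zc+q) = real i*zc+q"
				using False by (simp add: algebra_simps)
			ultimately have "val (real i*zc+q) ((z+d)^i-z^i)" using sim_val by metis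
			from val_mul[OF k this] have "val (k+real i*zc+q) (C i*((z+d)^i-z^i))"
				by (simp add: algebra_simps)
			from val_plus'[OF 1 this] have "val (k+real i*zc+q) (T i)" by (simp add: Te)
			thus ?thesis by (simp add: val_vge)
		qed
	qed
	obtain i0 where i0: "i0 < p" "v (\<Sum>j<p. C j*z^j) = v (C i0*z^i0)"
		"\<forall>j<p. v (C i0*z^i0) \<le> v (C j*z^j)" "\<forall>j<p. j \<noteq> i0 --> C i0 \<noteq> 0 --> v (C i0*z^i0) < v (C j*z^j)"
		using ram_term_min[of E e c p z C, OF E z cp p_gt_0 C(2)] by blast
	have xv: "val (of_int n/real (e*p)) (C i0*z^i0)" using i0(2) C(1) n by (simp add: val_def)
	hence C0: "C i0 \<noteq> 0" using val_nonzero by force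
	obtain k0 :: int where k0: "val (of_int k0/real e) (C i0)" using lf_val[OF E C(2) C0] .
	have ne: "of_int n/real (e*p) = of_int k0/real e+real i0*zc"
		using val_unique[OF xv val_mul[OF k0 val_power[OF zv]]] .
	have ng: "(of_int n+B)/real (e*p) = of_int n/real (e*p)+q"
		by (simp add: q_def add_divide_distrib)
	have Tj: "vgt (of_int n/real (e*p)+q) (T j)" if j: "j < p" "j \<noteq> i0" for j
	proof (cases "C j = 0")
		case False
		then obtain k where k: "val k (C j)" using val_ex by blast
		have "of_int n/real (e*p) < k+real j*zc"
			using i0(4) j C0 xv val_mul[OF k val_power[OF zv, of j]] by (auto simp: val_def)
		thus ?thesis using T1[OF j(1) k] by (intro vge_vgt[of "k+real j*zc+q"]) auto
	qed (simp add: T0)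
	have s0: "(\<Sum>i<p. T i) = T i0+(\<Sum>i\<in>{..<p}-{i0}. T i)" using i0(1) by (simp add: sum.remove)
	have r: "vgt (of_int n/real (e*p)+q) (\<Sum>i\<in>{..<p}-{i0}. T i)"
		by (rule vgt_sum) (use Tj in auto)
	show "vge ((of_int n+B)/real (e*p)) (s x-x) \<and>
		 (\<not> int p dvd n --> val ((of_int n+B)/real (e*p)) (s x-x))"
	proof (intro conjI impI)
		show "vge ((of_int n+B)/real (e*p)) (s x-x)"
			unfolding ng sx s0 by (rule vge_add[OF conjunct1[OF T1[OF i0(1) k0, folded ne]] vgt_vge[OF r]])
		assume "\<not> int p dvd n"
		\<comment> \<open>For \<open>n\<close> prime to \<open>p\<close> the valuation is outside the
		  value group of \<open>E\<close>, so the dominant term involves \<open>z\<close>.\<close>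
		have "i0 \<noteq> 0"
		proof
			assume "i0 = 0"
			hence "of_int n/real (e*p) = of_int k0/real e" using ne by simp
			hence "real_of_int n = of_int (k0*int p)" using e0 p_gt_0 by (simp add: field_simps)
			hence "n = k0*int p" by linarith
			thus False using \<open>\<not> int p dvd n\<close> by simp
		qed
		hence "val (of_int n/real (e*p)+q) (T i0)" using T1[OF i0(1) k0, folded ne] by blast
		thus "val ((of_int n+B)/real (e*p)) (s x-x)"
			unfolding ng sx s0 using r by (rule val_plus)
	qed
qed

subsection \<open>Reducing Artin-Schreier constants after a ramified step\<close>

text \<open>\<open>B\<close> is first compared with \<open>d^p*h^p*A^i\<close> in \<open>E\<close>,
  where \<open>i\<close> and the valuation of \<open>h\<close> are chosen so that the pole orders
  agree; then \<open>A^i\<close> is replaced by \<open>(z^p)^i\<close>, which makes the product a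
  p-th power in the larger field. As \<open>z^p\<close> is \<open>A + z\<close> up to the maximal
  ideal, the replacement costs \<open>R\<close>, with leading term
  \<open>d^p*h^p*i*A^(i-1)*z\<close>. Its valuation is exact when \<open>i\<close> is nonzero, that
  is, when \<open>p\<close> does not divide \<open>c\<close>.\<close>

lemma approx_pth_step:
	assumes E: "lf E e" and E': "sfield E'" "E \<subseteq> E'" "z \<in> E'"
		and z: "val (- real b/rp e) z" and b: "b > 0" "\<not> p dvd b"
		and A: "A \<in> E" "val (- real b/real e) A" "vgt 0 (wp z-A)"
		and B: "B \<in> E" "val (- real c/real e) B"
	shows "\<exists>u\<in>E'. \<exists>B1\<in>E. \<exists>R. val (- real c/rp e) u \<and> B-u^p = B1 - R \<and>
		vge ((1-real c)/real e) B1 \<and> vge (- real c/real e+(real p-1)*real b/rp e) R \<and>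
		(\<not> p dvd c --> val (- real c/real e+(real p-1)*real b/rp e) R)"
proof -
	have e0: "e > 0" by (rule lf_pos[OF E])
	note Es = lf_sfield[OF E]
	have "Rings.coprime (int b) (int p)"
		using b(2) prime_p by (metis coprime_commute int_dvd_int_iff prime_imp_coprime prime_nat_int_transfer)
	then obtain x0 y0 where xy: "x0*int b+y0*int p = 1"
		using bezout_int[of "int b" "int p"] by auto
	define i where "i = nat ((int c*x0) mod int p)"
	have i: "int i = (int c*x0) mod int p" "i < p" using p_gt_0 by (simp_all add: i_def nat_less_iff)
	have "[int i*int b = (int c*x0)*int b] (mod int p)"
		using i(1) by (intro cong_mult cong_refl) (simp add: cong_def)
	moreover have "(int c*x0)*int b = int c-int p*(int c*y0)"
	proof -
		have "int c*(x0*int b) = int c*(1-y0*int p)" using xy by simp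
		thus ?thesis by (simp add: algebra_simps)
	qed
	ultimately have "[int i*int b = int c-int p*(int c*y0)] (mod int p)" by simp
	hence "int p dvd int i*int b-(int c-int p*(int c*y0))" by (simp add: cong_iff_dvd_diff)
	hence "int p dvd (int i*int b-(int c-int p*(int c*y0)))-int p*(int c*y0)" by (rule dvd_diff) simp
	hence dv: "int p dvd int i*int b-int c" by simp
	then obtain k where k: "int i*int b-int c = int p * k" by blast
	hence k': "real p * of_int k = real i*real b-real c"
		by (metis of_int_diff of_int_mult of_int_of_nat_eq)
	obtain h where h: "h \<in> E" "val (of_int k/real e) h" using lf_elem[OF E] by blast
	define W where "W = h^p*A^i"
	have "val (real p*(of_int k/real e)+real i*(- real b/real e)) W"
		unfolding W_def by (intro val_mul val_power h A)
	moreover have "real p*(of_int k/real e)+real i*(- real b/real e) = - real c/real e"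
		using e0 k' by (simp add: field_simps)
	ultimately have Wv: "val (- real c/real e) W" by simp
	have WE: "W \<in> E" unfolding W_def using h A by (intro sf_mul[OF Es] sf_power[OF Es])
	have BW: "val 0 (B/W)" using val_divide[OF B(2) Wv] by simp
	obtain d where d: "d \<in> E" "vge 0 d" "vgt 0 (B/W-d^p)"
		using lf_root[OF E sf_divide[OF Es B(1) WE]] BW by (auto simp: val_vge)
	have dv0: "val 0 d" using val_cong[OF d(3)] BW val_power_cancel[of 0 d p] p_gt_0 by simp
	define u where "u = d*(h*z^i)"
	define B1 where "B1 = B-d^p*W"
	define R where "R = d^p*h^p*((z^p)^i-A^i)"
	have "u^p = d^p*W + R"
		by (simp add: u_def W_def R_def algebra_simps flip: power_mult)
	hence 1: "B-u^p = B1 - R" by (simp add: B1_def)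
	have uE: "u \<in> E'" unfolding u_def using d h E' by (intro sf_mul[OF E'(1)] sf_power[OF E'(1)]) auto
	have "val (0+(of_int k/real e+real i*(- real b/rp e))) u"
		unfolding u_def by (intro val_mul val_power h z dv0)
	moreover have "0+(of_int k/real e+real i*(- real b/rp e)) = - real c/rp e"
	proof -
		have "of_int k/real e = (real p * of_int k)/rp e" using p_gt_0 by simp
		thus ?thesis unfolding k' by (simp add: diff_divide_distrib)
	qed
	ultimately have uv: "val (- real c/rp e) u" by simp
	have B1E: "B1 \<in> E" unfolding B1_def using B d WE by (intro sf_diff[OF Es] sf_mul[OF Es] sf_power[OF Es])
	have B1e: "B1 = (B/W-d^p)*W" using val_nonzero[OF Wv] by (simp add: B1_def algebra_simps)
	have "vge (1/real e) (B/W-d^p)"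
		using lf_vgt_vge[OF E sf_diff[OF Es sf_divide[OF Es B(1) WE] sf_power[OF Es d(1)]], of 0] d(3) by simp
	from vge_mul[OF this, of "- real c/real e" W] Wv
	have B1v: "vge ((1-real c)/real e) B1" by (simp add: B1e val_vge diff_divide_distrib)
	define g where "g = z+(wp z-A)"
	have zp: "z^p = A+g" by (simp add: g_def wp_def)
	have zneg: "- real b/rp e < 0" using b e0 p_gt_0 by simp
	have gv: "val (- real b/rp e) g"
		unfolding g_def by (rule val_plus[OF z vgt_mono[OF A(3)]]) (use zneg in simp)
	have lt: "- real b/real e < - real b/rp e"
	proof -
		have "real b/rp e = real b/real e/real p" by simp
		also have "\<dots> < real b/real e" using b(1) e0 p_gt_1 by (simp add: divide_less_eq)
		finally show ?thesis by simp
	qed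
	have hp: "val (real p*(of_int k/real e)) (d^p*h^p)"
		using val_mul[OF val_power[OF dv0, of p] val_power[OF h(2), of p]] by simp
	have tgt: "real p*(of_int k/real e)+((real i-1)*(- real b/real e) + - real b/rp e)
			= - real c/real e+(real p-1)*real b/rp e"
	proof -
		have "real p*(of_int k/real e) = (real i*real b-real c)/real e" by (simp flip: k')
		moreover have "(real p-1)*real b/rp e = real b/real e-real b/rp e"
			using p_gt_0 e0 by (simp add: field_simps)
		ultimately show ?thesis by (simp only:) (simp add: diff_divide_distrib left_diff_distrib)
	qed
	have "vge ((real i-1)*(- real b/real e) + - real b/rp e) ((A+g)^i-A^i)"
		by (rule vge_power_diff'[OF A(2)]) (use gv lt in \<open>auto simp: val_vge\<close>)
	from vge_mul[OF _ this, of "real p*(of_int k/real e)" "d^p*h^p"] hp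
	have Rv: "vge (- real c/real e+(real p-1)*real b/rp e) R"
		unfolding tgt by (simp add: R_def zp val_vge)
	have Rv': "val (- real c/real e+(real p-1)*real b/rp e) R" if "\<not> p dvd c"
	proof -
		have "i \<noteq> 0"
		proof
			assume "i = 0"
			hence "int p dvd int c" using dv by simp
			thus False using that by (simp only: int_dvd_int_iff)
		qed
		hence "\<not> p dvd i" using i(2) by (meson dvd_imp_le linorder_not_le neq0_conv)
		from sim_power_diff[OF A(2) gv lt this]
		have "sim ((A+g)^i-A^i) (of_nat i*A^(i-1)*g)" .
		moreover have "val (0+real (i-1)*(- real b/real e) + - real b/rp e) (of_nat i*A^(i-1)*g)"
			by (intro val_mul val_of_nat val_power A gv \<open>\<not> p dvd i\<close>)
		moreover have "real (i-1) = real i-1" using \<open>i \<noteq> 0\<close> by simp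
		ultimately have "val ((real i-1)*(- real b/real e) + - real b/rp e) ((A+g)^i-A^i)"
			using sim_val by simp
		from val_mul[OF hp this] show ?thesis unfolding tgt by (simp add: R_def zp)
	qed
	show ?thesis using uE B1E uv 1 B1v Rv Rv' by blast
qed

text \<open>The remainder \<open>B1\<close> of one step stays in \<open>E\<close> and has pole order
  smaller by one, so the step can be repeated. The mixed terms between successive p-th powers stay
  integral because \<open>c < e\<close>.\<close>

lemma approx_pth:
	assumes E: "lf E e" and E': "sfield E'" "E \<subseteq> E'" "z \<in> E'"
		and z: "val (- real b/rp e) z" and b: "b > 0" "\<not> p dvd b"
		and A: "A \<in> E" "val (- real b/real e) A" "vgt 0 (wp z-A)"
		and t: "t \<le> 0"
	shows "c < e ==> B \<in> E ==> vge (- real c/real e) B ==> t \<le>-real c/real e+(real p-1)*real b/rp e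
		==> \<exists>u\<in>E'. vge (- real c/rp e) u \<and> vge t (B-u^p)"
proof (induction c arbitrary: B)
	case 0
	thus ?case using sf_0[OF E'(1)] t p_gt_0 by (intro bexI[of _ 0]) (auto intro: vge_mono simp: power_0_left)
next
	case (Suc c)
	have mono: "- real (Suc c)/real e \<le>-real c/real e" "- real (Suc c)/rp e \<le>-real c/rp e"
		by (intro divide_right_mono; simp)+
	have tc: "t \<le>-real c/real e+(real p-1)*real b/rp e"
		using Suc.prems(4) mono(1) by linarith
	show ?case
	proof (cases "vgt (- real (Suc c)/real e) B")
		case True
		hence "vge (- real c/real e) B"
			using lf_vgt_vge[OF E Suc.prems(2), of "- int (Suc c)"] by simp
		from Suc.IH[OF _ Suc.prems(2) this tc] Suc.prems(1)
		obtain u where "u \<in> E'" "vge (- real c/rp e) u" "vge t (B-u^p)" by auto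
		thus ?thesis using vge_mono[OF _ mono(2)] by blast
	next
		case False
		hence Bv: "val (- real (Suc c)/real e) B" using vge_cases[OF Suc.prems(3)] by blast
		obtain u B1 R where u: "u \<in> E'" "B1 \<in> E" "val (- real (Suc c)/rp e) u" "B-u^p = B1 - R"
			"vge ((1-real (Suc c))/real e) B1" "vge (- real (Suc c)/real e+(real p-1)*real b/rp e) R"
			using approx_pth_step[OF E E' z b A Suc.prems(2) Bv] by blast
		have "vge (- real c/real e) B1" using u(5) by simp
		from Suc.IH[OF _ u(2) this tc] Suc.prems(1)
		obtain w where w: "w \<in> E'" "vge (- real c/rp e) w" "vge t (B1-w^p)" by auto
		have "vge (1+(real p-1)*(- real (Suc c)/rp e) + - real c/rp e) ((u+w)^p-u^p-w^p)"
			by (rule frob_add) (use u(3) w(2) mono(2) in \<open>auto simp: val_vge\<close>)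
		moreover have "0 \<le> 1+(real p-1)*(- real (Suc c)/rp e) + - real c/rp e"
		proof -
			have "(real p-1)*real (Suc c)+real c \<le> real p*real (Suc c)" by (simp add: algebra_simps)
			also have "\<dots> \<le> real p*real e" using Suc.prems(1) by (intro mult_left_mono) auto
			finally have "((real p-1)*real (Suc c)+real c)/rp e \<le> 1"
				using p_gt_0 lf_pos[OF E] by (simp add: mult.commute)
			hence "(real p-1)*real (Suc c)/rp e+real c/rp e \<le> 1" by (simp only: add_divide_distrib)
			moreover have g: "a*(- x/y) = - (a*x/y)" for a x y :: real by simp
			have "(real p-1)*(- real (Suc c)/rp e) = - ((real p-1)*real (Suc c)/rp e)"
				by (rule g)
			moreover have "- real c/rp e = - (real c/rp e)" by simp
			ultimately show ?thesis by linarith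
		qed
		ultimately have cr: "vge t ((u+w)^p-u^p-w^p)" using t by (meson vge_mono order_trans)
		have "vge t R" by (rule vge_mono[OF u(6) Suc.prems(4)])
		from vge_diff[OF vge_diff[OF w(3) this] cr]
		have "vge t (B1-w^p - R-((u+w)^p-u^p-w^p))" .
		moreover have "B1 = B-u^p + R" using u(4) by simp
		hence "B1-w^p - R-((u+w)^p-u^p-w^p) = B-(u+w)^p" by simp
		ultimately have "vge t (B-(u+w)^p)" by simp
		moreover have "vge (- real (Suc c)/rp e) (u+w)"
			using u(3) vge_mono[OF w(2) mono(2)] by (intro vge_add) (simp_all add: val_vge)
		ultimately show ?thesis using sf_add[OF E'(1) u(1) w(1)] by blast
	qed
qed

text \<open>Once p-th powers are removed, the dominant part is the error \<open>R\<close> of the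
  first step: \<open>c > b\<close> places its valuation below that of \<open>u\<close>, and all
  later errors have larger valuation. The new pole order \<open>p*c - (p-1)*b = b + p*(c-b)\<close>
  is the Herbrand function psi of a degree \<open>p\<close> extension with break \<open>b\<close>,
  evaluated at \<open>c\<close>.\<close>

lemma AS_reduce:
	assumes E: "lf E e" and E': "sfield E'" "E \<subseteq> E'" "z \<in> E'"
		and z: "val (- real b/rp e) z" and b: "b > 0" "\<not> p dvd b"
		and A: "A \<in> E" "val (- real b/real e) A" "vgt 0 (wp z-A)"
		and B: "B \<in> E" "val (- real c/real e) B" and c: "b < c" "\<not> p dvd c" "c < e"
	shows "\<exists>u\<in>E'. vgt (-1/p) u \<and> val (- (real p*real c-(real p-1)*real b)/rp e) (B-wp u)"
proof -
	have e0: "e > 0" by (rule lf_pos[OF E])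
	define T where "T = - real c/real e+(real p-1)*real b/rp e"
	have Te: "- (real p*real c-(real p-1)*real b)/rp e = T"
		using e0 p_gt_0 by (simp add: T_def field_simps)
	have Te2: "T = (- real c-(real p-1)*(real c-real b))/rp e"
		unfolding Te[symmetric] by (simp add: algebra_simps)
	have cb: "real c-real b > 0" "real p-1 > 0" using c(1) p_gt_1 by simp_all
	have TL: "T < - real c/rp e"
		unfolding Te2 using cb e0 p_gt_0 by (intro divide_strict_right_mono) auto
	have L0: "- real c/rp e < 0" using c(1) e0 p_gt_0 by simp
	have L1: "- 1/real p < - real c/rp e"
		using c(3) p_gt_0 by (simp add: field_simps)
	obtain u B1 R where u: "u \<in> E'" "B1 \<in> E" "val (- real c/rp e) u" "B-u^p = B1 - R"
		"vge ((1-real c)/real e) B1" "val T R"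
		using approx_pth_step[OF E E' z b A B] c(2) unfolding T_def[symmetric] by blast
	\<comment> \<open>Any accuracy strictly better than \<open>T\<close> suffices for the remainder.
	  The second round reaches \<open>T + 1/e\<close>, as the pole order has dropped by one; the cap at
	  0 is the range of \<open>approx_pth\<close>.\<close>
	define t where "t = min 0 (T+1/real e)"
	have t: "t \<le> 0" "T < t" using TL L0 e0 by (auto simp: t_def)
	have c0: "c > 0" using c(1) by simp
	have B1v: "vge (- real (c-1)/real e) B1" using u(5) c0 by simp
	have "t \<le>-real (c-1)/real e+(real p-1)*real b/rp e"
		using c0 by (simp add: t_def T_def diff_divide_distrib)
	moreover have "c-1 < e" using c(3) by simp
	ultimately obtain w where w: "w \<in> E'" "vge (- real (c-1)/rp e) w" "vge t (B1-w^p)"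
		using approx_pth[OF E E' z b A t(1) _ u(2) B1v] by blast
	have wc: "vge (- real c/rp e) w"
		by (rule vge_mono[OF w(2)]) (intro divide_right_mono; simp)
	have us: "vgt (-1/p) u" using u(3) L1 by (simp add: val_vgt)
	have ws: "vgt (-1/p) w" by (rule vge_vgt[OF wc L1])
	have cr: "vgt T ((u+w)^p-u^p-w^p)"
		by (rule vgt_mono[OF frob_add_small[OF us ws]]) (use TL L0 in simp)
	have uw: "vgt T (u+w)"
		by (rule vge_vgt[OF _ TL]) (use u(3) wc in \<open>auto intro!: vge_add simp: val_vge\<close>)
	have "vgt T ((B1-w^p)-((u+w)^p-u^p-w^p)+(u+w))"
		by (rule vgt_add[OF vgt_diff[OF vge_vgt[OF w(3) t(2)] cr] uw])
	from val_diff[OF u(6) this]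
	have "val T (R-(B1-w^p-((u+w)^p-u^p-w^p)+(u+w)))" .
	moreover have "B1 = B-u^p + R" using u(4) by simp
	hence "R-(B1-w^p-((u+w)^p-u^p-w^p)+(u+w)) = - (B-wp (u+w))"
		by (simp add: wp_def)
	ultimately have "val T (- (B-wp (u+w)))" by simp
	hence "val T (B-wp (u+w))" by (simp only: val_minus)
	thus ?thesis unfolding Te using sf_add[OF E'(1) u(1) w(1)] vgt_add[OF us ws] by blast
qed

end

context padic_valuation
begin

subsection \<open>The field \<open>Qp\<close> and its unramified extensions\<close>

lemma rat_limit_iff: "rat_limit v s x = (\<forall>B. \<exists>M. \<forall>n\<ge>M. vge B (x - of_rat (s n)))"
	by (simp add: rat_limit_def vge_def)

lemma rat_cauchy_iff: "rat_cauchy v s = vcauchy (\<lambda>n. of_rat (s n))"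
	by (simp add: rat_cauchy_def vcauchy_def vge_def)

lemma Qp_approx: assumes "x \<in> Qp v" shows "\<exists>q. vge B (x - of_rat q)"
proof -
	obtain s where s: "rat_limit v s x" using assms by (auto simp: Qp_def)
	then obtain M where "\<forall>n\<ge>M. vge B (x - of_rat (s n))" unfolding rat_limit_iff by blast
	thus ?thesis by blast
qed

text \<open>A Cauchy sequence of limits is replaced by rationals approximating its members ever more
  closely; their limit exists by the axiom of the locale.\<close>

lemma vcomplete_Qp: "vcomplete (Qp v)"
	unfolding vcomplete_def
proof (intro allI impI)
	fix s assume s: "\<forall>n. s n \<in> Qp v" "vcauchy s"
	have "\<forall>n. \<exists>q. vge (real n) (s n - of_rat q)" using Qp_approx s(1) by blast
	from choice[OF this] obtain q where q: "\<And>n. vge (real n) (s n - of_rat (q n))" by blast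
	have big: "\<exists>M. \<forall>n\<ge>M. vge B (s n - of_rat (q n))" for B
	proof -
		obtain M :: nat where M: "B \<le> real M" using real_arch_simple by blast
		have "vge B (s n - of_rat (q n))" if "n \<ge> M" for n
			by (rule vge_mono[OF q]) (use M that in linarith)
		thus ?thesis by blast
	qed
	have "vcauchy (\<lambda>n. of_rat (q n))"
		unfolding vcauchy_def
	proof
		fix B
		obtain M1 where M1: "\<And>m n. m \<ge> M1 ==> n \<ge> M1 ==> vge B (s m - s n)" using s(2) unfolding vcauchy_def by blast
		obtain M2 where M2: "\<And>n. n \<ge> M2 ==> vge B (s n - of_rat (q n))" using big by blast
		have "vge B (of_rat (q m) - of_rat (q n))" if "m \<ge> max M1 M2" "n \<ge> max M1 M2" for m n
		proof -
			have 1: "vge B (of_rat (q m) - s m)" using M2[of m] that(1) by (simp add: vge_minus_commute)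
			have 2: "vge B (s m - s n)" using M1 that by simp
			have 3: "vge B (s n - of_rat (q n))" using M2[of n] that(2) by simp
			show ?thesis by (rule vge_trans[OF vge_trans[OF 1 2] 3])
		qed
		thus "\<exists>M. \<forall>m\<ge>M. \<forall>n\<ge>M. vge B (of_rat (q m) - of_rat (q n))" by blast
	qed
	then obtain x where x: "rat_limit v q x" using complete[of q] unfolding rat_cauchy_iff by blast
	have "vlim s x"
		unfolding vlim_def
	proof
		fix B
		obtain M1 where M1: "\<And>n. n \<ge> M1 ==> vge B (x - of_rat (q n))" using x unfolding rat_limit_iff by blast
		obtain M2 where M2: "\<And>n. n \<ge> M2 ==> vge B (s n - of_rat (q n))" using big by blast
		have "vge B (x - s n)" if "n \<ge> max M1 M2" for n
		proof -
			have 1: "vge B (x - of_rat (q n))" using M1 that by simp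
			have 2: "vge B (of_rat (q n) - s n)" using M2[of n] that by (simp add: vge_minus_commute)
			show ?thesis by (rule vge_trans[OF 1 2])
		qed
		thus "\<exists>M. \<forall>n\<ge>M. vge B (x - s n)" by blast
	qed
	moreover have "x \<in> Qp v" using x by (auto simp: Qp_def)
	ultimately show "\<exists>x\<in>Qp v. vlim s x" by blast
qed

lemma val_int_ex: "n \<noteq> 0 ==> \<exists>k::nat. val (real k) (of_int n)"
proof (induction "nat \<bar>n\<bar>" arbitrary: n rule: less_induct)
	case less
	show ?case
	proof (cases "int p dvd n")
		case True
		then obtain m where m: "n = int p * m" by blast
		hence m0: "m \<noteq> 0" using less.prems by auto
		have lt: "nat \<bar>m\<bar> < nat \<bar>n\<bar>" using m m0 p_gt_1 by (simp add: abs_mult)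
		obtain k where "val (real k) (of_int m)" using less.hyps[OF lt m0] by blast
		from val_mul[OF val_p' this] have "val (real (Suc k)) (of_int n)" by (simp add: m)
		thus ?thesis by blast
	next
		case False
		thus ?thesis using val_of_int[OF False] by (intro exI[of _ 0]) simp
	qed
qed

lemma val_rat_ex: assumes "q \<noteq> 0" shows "\<exists>k::int. val (of_int k) (of_rat q)"
proof -
	obtain a b where ab: "q = Rat.Fract a b" "b > 0" by (cases q) auto
	have "a \<noteq> 0" using assms ab by (auto simp: rat_number_collapse)
	then obtain k where k: "val (real k) (of_int a)" using val_int_ex by blast
	obtain j where j: "val (real j) (of_int b)" using val_int_ex[of b] ab by auto
	have "val (of_int (int k-int j)) (of_rat q)"
		using val_divide[OF k j] ab by (simp add: of_rat_rat)
	thus ?thesis by blast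
qed

lemma val_Qp_ex: assumes "x \<in> Qp v" "x \<noteq> 0" shows "\<exists>k::int. val (of_int k) x"
proof -
	obtain a where a: "val a x" using val_ex[OF assms(2)] by blast
	obtain q where q: "vge (a+1) (x - of_rat q)" using Qp_approx[OF assms(1)] by blast
	have "vgt a (x - of_rat q)" by (rule vge_vgt[OF q]) simp
	from val_cong[OF this] a have aq: "val a (of_rat q)" by blast
	hence "q \<noteq> 0" using val_nonzero by fastforce
	then obtain k :: int where "val (of_int k) (of_rat q)" using val_rat_ex by blast
	hence "val (of_int k) x" using val_unique[OF aq] a by blast
	thus ?thesis by blast
qed

text \<open>For a close rational approximation in lowest terms the denominator is prime to
  \<open>p\<close>, hence invertible modulo \<open>p\<close> by a natural number.\<close>

lemma Qp_residue: assumes "x \<in> Qp v" "vge 0 x" shows "\<exists>n::nat. vgt 0 (x - of_nat n)"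
proof -
	obtain q where q: "vge 1 (x - of_rat q)" using Qp_approx[OF assms(1)] by blast
	obtain a b where ab: "q = Rat.Fract a b" "b > 0" "Rings.coprime a b" using Rat_cases by blast
	have qe: "of_rat q = of_int a/(of_int b :: 'a)" using ab by (simp add: of_rat_rat)
	have pb: "\<not> int p dvd b"
	proof
		assume d: "int p dvd b"
		have "\<not> int p dvd a"
		proof
			assume "int p dvd a"
			hence "is_unit (int p)" using d ab(3) by (meson coprime_common_divisor)
			thus False using p_gt_1 by simp
		qed
		hence va: "val 0 (of_int a)" by (rule val_of_int)
		obtain j where j: "val j (of_int b)" using val_ex[of "of_int b"] ab(2) by auto
		have "j \<ge> 1" using vge_p_dvd_int[OF d] j by (simp add: val_vge)
		moreover have "val (0-j) (of_rat q)" unfolding qe by (rule val_divide[OF va j])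
		ultimately show False using vge_iff[OF vge_mono[OF q, of 0]] assms(2) by (simp add: val_vge)
	qed
	have "\<not> p dvd nat b"
	proof
		assume "p dvd nat b"
		hence "int p dvd int (nat b)" by (simp only: int_dvd_int_iff)
		thus False using pb ab(2) by simp
	qed
	then obtain k where k: "p dvd k*nat b+1" using unit_inverse_mod by blast
	define c where "c = - a*int k"
	have "of_rat q - of_int c = of_int a * of_nat (k*nat b+1)/(of_int b :: 'a)"
		using ab(2) by (simp add: qe c_def field_simps)
	moreover have "vge (0+1-0) (of_int a * of_nat (k*nat b+1)/(of_int b :: 'a))"
		by (intro vge_divide vge_mul vge_of_int vge_p_dvd k val_of_int pb)
	ultimately have 1: "vgt 0 (of_rat q - of_int c)" using vge_vgt[of 1 _ 0] by simp
	define n where "n = nat (c mod int p)"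
	have n: "int n = c mod int p" using p_gt_0 by (simp add: n_def)
	have "int p dvd c-int n" unfolding n by simp
	hence "vgt 0 (of_int (c-int n))" using vgt_of_int_iff by blast
	hence "vgt 0 (of_int c - of_nat n)" by simp
	from vgt_trans[OF 1 this] have "vgt 0 (of_rat q - of_nat n)" .
	from vgt_trans[OF vge_vgt[OF q] this] show ?thesis by auto
qed

lemma vcauchy_diff: assumes "vcauchy s" "vcauchy t" shows "vcauchy (\<lambda>n. s n-t n)"
	unfolding vcauchy_def
proof
	fix B
	obtain M1 where M1: "\<And>m n. m \<ge> M1 ==> n \<ge> M1 ==> vge B (s m - s n)" using assms(1) unfolding vcauchy_def by blast
	obtain M2 where M2: "\<And>m n. m \<ge> M2 ==> n \<ge> M2 ==> vge B (t m-t n)" using assms(2) unfolding vcauchy_def by blast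
	have "vge B ((s m-t m)-(s n-t n))" if "m \<ge> max M1 M2" "n \<ge> max M1 M2" for m n
	proof -
		have "vge B ((s m - s n)-(t m-t n))" by (rule vge_diff) (use M1[of m n] M2[of m n] that in auto)
		thus ?thesis by (simp add: algebra_simps)
	qed
	thus "\<exists>M. \<forall>m\<ge>M. \<forall>n\<ge>M. vge B ((s m-t m)-(s n-t n))" by blast
qed

lemma vcauchy_scale: assumes "vcauchy s" "val c u" shows "vcauchy (\<lambda>n. s n*u)"
	unfolding vcauchy_def
proof
	fix B
	obtain M where M: "\<And>m n. m \<ge> M ==> n \<ge> M ==> vge (B - c) (s m - s n)" using assms(1) unfolding vcauchy_def by blast
	have "vge B (s m*u - s n*u)" if "m \<ge> M" "n \<ge> M" for m n
		using vge_mul[OF M[OF that], of c u] assms(2) by (simp add: val_vge algebra_simps)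
	thus "\<exists>M. \<forall>m\<ge>M. \<forall>n\<ge>M. vge B (s m*u - s n*u)" by blast
qed

lemma vlim_lincomb:
	assumes "vlim s x" "vlim t y" "val c u" shows "vlim (\<lambda>n. s n*u+t n) (x*u+y)"
	unfolding vlim_def
proof
	fix B
	obtain M1 where M1: "\<And>n. n \<ge> M1 ==> vge (B - c) (x - s n)" using assms(1) unfolding vlim_def by blast
	obtain M2 where M2: "\<And>n. n \<ge> M2 ==> vge B (y-t n)" using assms(2) unfolding vlim_def by blast
	have "vge B (x*u+y-(s n*u+t n))" if "n \<ge> max M1 M2" for n
	proof -
		have "vge (B - c + c) ((x - s n)*u)" using M1[of n] that assms(3) by (intro vge_mul) (auto simp: val_vge)
		from vge_add[OF this, of "y-t n"] M2[of n] that show ?thesis by (simp add: algebra_simps)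
	qed
	thus "\<exists>M. \<forall>n\<ge>M. vge B (x*u+y-(s n*u+t n))" by blast
qed

text \<open>When a vector \<open>u\<close> is added to a complete subspace \<open>D\<close>, its
  coefficient is controlled by the distance from \<open>u\<close> to \<open>D\<close>, which is
  positive because \<open>D\<close> is complete and does not contain \<open>u\<close>.\<close>

lemma dimension_complete:
	assumes Q: "sfield Q" "vcomplete Q" shows "ring.dimension Omega n Q E ==> vcomplete E"
proof (induction n arbitrary: E)
	case 0
	hence "E = {0}" using Om.dimension_zero[OF Q(1)] by simp
	thus ?case unfolding vcomplete_def vlim_def by auto
next
	case (Suc n)
	obtain u D where D: "ring.dimension Omega n Q D" "u \<notin> D" "E = ring.line_extension Omega Q u D"
		using Om.dimension_backwards[OF Q(1) Suc.prems] by blast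
	have Dc: "vcomplete D" by (rule Suc.IH[OF D(1)])
	note Dp = Om.space_subgroup_props[OF Q(1) D(1), simplified]
	have Ee: "(x \<in> E) = (\<exists>k\<in>Q. \<exists>w\<in>D. x = k*u+w)" for x
		unfolding D(3) by (simp add: Om.line_extension_mem_iff)
	have u0: "u \<noteq> 0" using D(2) Dp(2) by auto
	then obtain cu where cu: "val cu u" using val_ex by blast
	have Ddiff: "a-b \<in> D" if "a \<in> D" "b \<in> D" for a b using Dp(3)[OF that(1) Dp(4)[OF that(2)]] by simp
	\<comment> \<open>If \<open>D\<close> came arbitrarily close to \<open>- u\<close>, the
	  approximants would form a Cauchy sequence converging in \<open>D\<close> to
	  \<open>- u\<close>.\<close>
	have "\<exists>C. \<forall>w\<in>D. \<not> vgt C (u+w)"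
	proof (rule ccontr)
		assume "\<not> ?thesis"
		hence "\<forall>n::nat. \<exists>w. w \<in> D \<and> vgt (real n) (u+w)" by blast
		from choice[OF this] obtain w where w: "\<And>n. w n \<in> D" "\<And>n. vgt (real n) (u+w n)" by blast
		have wk: "vge (real n) (u+w m)" if "m \<ge> n" for m n
			by (rule vgt_vge[OF vgt_mono[OF w(2)]]) (use that in simp)
		have "vcauchy w"
			unfolding vcauchy_def
		proof
			fix B
			obtain M :: nat where M: "B \<le> real M" using real_arch_simple by blast
			have "vge B (w m-w n)" if "m \<ge> M" "n \<ge> M" for m n
				using vge_mono[OF vge_diff[OF wk[OF that(1)] wk[OF that(2)]] M] by simp
			thus "\<exists>M. \<forall>m\<ge>M. \<forall>n\<ge>M. vge B (w m-w n)" by blast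
		qed
		then obtain x where x: "x \<in> D" "vlim w x" using vcompleteD[of D w, OF Dc w(1)] by blast
		have "vge B (u+x)" for B
		proof -
			obtain M :: nat where M: "B \<le> real M" using real_arch_simple by blast
			obtain N where N: "\<And>n. n \<ge> N ==> vge B (x-w n)" using x(2) unfolding vlim_def by blast
			have "vge B (x-w (max M N))" using N by simp
			moreover have "vge B (u+w (max M N))" by (rule vge_mono[OF wk[of M]]) (use M in auto)
			ultimately have "vge B ((x-w (max M N))+(u+w (max M N)))" by (rule vge_add)
			thus ?thesis by (simp add: add.commute)
		qed
		hence "u+x = 0" by (rule vge_all_zero)
		hence "u = - x" by (simp add: eq_neg_iff_add_eq_0)
		thus False using D(2) Dp(4)[OF x(1)] by simp
	qed
	then obtain C where C: "\<And>w. w \<in> D ==> \<not> vgt C (u+w)" by blast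
	have bound: "vge (B-C) k" if k: "k \<in> Q" "w \<in> D" "vge B (k*u+w)" for k w B
	proof (cases "k = 0")
		case False
		then obtain a where a: "val a k" using val_ex by blast
		have "vge (B-a) ((k*u+w) / k)" by (rule vge_divide[OF k(3) a])
		moreover have "(k*u+w) / k = u+inverse k*w" using False by (simp add: field_simps)
		moreover have "inverse k*w \<in> D" using Dp(5)[OF sf_inverse[OF Q(1) k(1)] k(2)] .
		ultimately have "B-a \<le> C" using C[of "inverse k*w"] vge_vgt[of "B-a" _ C] by force
		thus ?thesis using a by (simp add: val_vge)
	qed simp
	show ?case
		unfolding vcomplete_def
	proof (intro allI impI)
		fix s assume s: "\<forall>n. s n \<in> E" "vcauchy s"
		have "\<forall>n. \<exists>kw. fst kw \<in> Q \<and> snd kw \<in> D \<and> s n = fst kw*u + snd kw"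
		proof
			fix n
			obtain k w where "k \<in> Q" "w \<in> D" "s n = k*u+w" using s(1) Ee by blast
			thus "\<exists>kw. fst kw \<in> Q \<and> snd kw \<in> D \<and> s n = fst kw*u + snd kw" by (intro exI[of _ "(k, w)"]) simp
		qed
		from choice[OF this] obtain kw where kw: "\<And>n. fst (kw n) \<in> Q" "\<And>n. snd (kw n) \<in> D" "\<And>n. s n = fst (kw n)*u + snd (kw n)"
			by blast
		define k w where "k n = fst (kw n)" and "w n = snd (kw n)" for n
		have kwp: "k n \<in> Q" "w n \<in> D" "s n = k n*u+w n" for n using kw[of n] by (simp_all add: k_def w_def)
		have kc: "vcauchy k"
			unfolding vcauchy_def
		proof
			fix B
			obtain M where M: "\<And>m n. m \<ge> M ==> n \<ge> M ==> vge (B+C) (s m - s n)" using s(2) unfolding vcauchy_def by blast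
			have "vge B (k m - k n)" if "m \<ge> M" "n \<ge> M" for m n
			proof -
				show ?thesis using M[OF that] bound[of "k m - k n" "w m-w n" "B+C", OF sf_diff[OF Q(1) kwp(1) kwp(1)] Ddiff[OF kwp(2) kwp(2)]] by (simp add: kwp(3) algebra_simps)
			qed
			thus "\<exists>M. \<forall>m\<ge>M. \<forall>n\<ge>M. vge B (k m - k n)" by blast
		qed
		then obtain k0 where k0: "k0 \<in> Q" "vlim k k0" using vcompleteD[of Q k, OF Q(2) kwp(1)] by blast
		have "vcauchy (\<lambda>n. s n - k n*u)" by (rule vcauchy_diff[OF s(2) vcauchy_scale[OF kc cu]])
		moreover have "s n - k n*u = w n" for n by (simp add: kwp(3))
		ultimately have "vcauchy w" by simp
		then obtain w0 where w0: "w0 \<in> D" "vlim w w0" using vcompleteD[of D w, OF Dc kwp(2)] by blast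
		show "\<exists>x\<in>E. vlim s x" using vlim_lincomb[OF k0(2) w0(2) cu] Ee k0 w0 by (auto simp: kwp(3)[symmetric])
	qed
qed

lemma frob_nat_sum:
	assumes "\<And>i. i \<in> A ==> vge 0 (x i)"
	shows "vgt 0 ((\<Sum>i\<in>A. of_nat (d i)*x i)^p-(\<Sum>i\<in>A. of_nat (d i)*x i^p))"
proof -
	have "vgt 0 ((\<Sum>i\<in>A. of_nat (d i)*x i)^p-(\<Sum>i\<in>A. (of_nat (d i)*x i)^p))"
	proof (rule frob_sum)
		fix i assume "i \<in> A"
		thus "vgt (-1/p) (of_nat (d i)*x i)" using vge_mul[OF vge_of_nat assms] by (intro vge_imp_small) simp
	qed
	moreover have "vgt 0 ((\<Sum>i\<in>A. (of_nat (d i)*x i)^p)-(\<Sum>i\<in>A. of_nat (d i)*x i^p))"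
		unfolding sum_subtractf[symmetric]
	proof (rule vgt_sum)
		fix i assume "i \<in> A"
		hence "vgt (0+0) (wp (of_nat (d i))*x i^p)" using vge_power[OF assms, of i p] by (intro vgt_mul wp_of_nat) simp
		thus "vgt 0 ((of_nat (d i)*x i)^p - of_nat (d i)*x i^p)"
			by (simp add: wp_def power_mult_distrib left_diff_distrib)
	qed
	ultimately show ?thesis by (rule vgt_trans)
qed

text \<open>Coefficients in the prime field are fixed by Frobenius. If the first one vanishes modulo
  \<open>p\<close>, the relation is a p-th power and its root is a shorter relation; otherwise it
  can be solved for \<open>x\<close>, which becomes a p-th power. Natural-number coefficients keep
  the root inside every subfield containing \<open>x\<close>.\<close>

lemma perfect_from_relation:
	assumes x: "vge 0 x"
	shows "i \<le> n ==> \<not> p dvd d i ==> vgt 0 (\<Sum>i\<le>n. of_nat (d i)*x^(p^i)) ==>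
		\<exists>P. over_field (range of_nat) P \<and> vgt 0 (x-poly P x^p)"
proof (induction n arbitrary: d i)
	case 0
	have "vgt (0-0) (of_nat (d 0)*x / of_nat (d 0))" by (rule vgt_divide) (use 0 val_of_nat in auto)
	moreover have "of_nat (d 0) \<noteq> (0::'a)" using val_nonzero[OF val_of_nat[of "d 0"]] 0 by auto
	ultimately have "vgt 0 x" by simp
	moreover have "over_field (range of_nat) (0 :: 'a poly)"
		unfolding over_field_def by simp
	ultimately show ?case using p_gt_0 by (intro exI[of _ 0]) (simp add: power_0_left)
next
	case (Suc n)
	define y where "y i = x^(p^i)" for i
	have y: "vge 0 (y i)" for i using vge_power[OF x, of "p^i"] by (simp add: y_def)
	have yS: "x^(p^Suc i) = y i^p" for i by (simp add: y_def flip: power_mult) (simp add: mult.commute)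
	define S where "S = (\<Sum>i\<le>n. of_nat (d (Suc i))*y i)"
	have e: "(\<Sum>i\<le>Suc n. of_nat (d i)*x^(p^i)) = of_nat (d 0)*x+(\<Sum>i\<le>n. of_nat (d (Suc i))*y i^p)"
		by (subst sum.atMost_Suc_shift) (simp only: yS power_0 power_one_right)
	have S: "vgt 0 (S^p-(\<Sum>i\<le>n. of_nat (d (Suc i))*y i^p))" unfolding S_def by (rule frob_nat_sum[OF y])
	from vgt_add[OF Suc.prems(3) S] have r: "vgt 0 (of_nat (d 0)*x+S^p)" unfolding e by simp
	show ?case
	proof (cases "p dvd d 0")
		case True
		hence "vgt 0 (of_nat (d 0)*x)" using vgt_mul[of 0 "of_nat (d 0)" 0 x] x vgt_of_nat_iff by simp
		from vgt_diff[OF r this] have "vgt (real p*0) (S^p)" by simp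
		hence "vgt 0 S" by (rule vgt_power_cancel[OF _ p_gt_0])
		moreover obtain j where "i = Suc j" "j \<le> n" using True Suc.prems(1,2) by (cases i) auto
		ultimately show ?thesis using Suc.IH[of j "\<lambda>i. d (Suc i)"] Suc.prems(2) by (simp add: S_def y_def)
	next
		case False
		then obtain k where k: "p dvd k*d 0+1" using unit_inverse_mod by blast
		have 1: "vgt 0 (of_nat k*(of_nat (d 0)*x+S^p))" using vgt_mul'[OF vge_of_nat r] by simp
		have "vgt 0 (of_nat (k*d 0+1))" using vgt_of_nat_iff k by blast
		from vgt_mul[OF this x] have 2: "vgt 0 (of_nat (k*d 0+1)*x)" by simp
		have Sv: "vge 0 S" unfolding S_def by (rule vge_sum) (use vge_mul[OF vge_of_nat y] in simp)
		have "vgt (0+0) (wp (of_nat k)*S^p)" using vge_power[OF Sv, of p] by (intro vgt_mul wp_of_nat) simp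
		hence 3: "vgt 0 ((of_nat k*S)^p - of_nat k*S^p)"
			by (simp add: wp_def power_mult_distrib left_diff_distrib)
		have 4: "vgt 0 (x-(of_nat k*S)^p)" using vgt_diff[OF vgt_diff[OF 2 1] 3] by (simp add: algebra_simps)
		define P where "P = (\<Sum>i\<le>n. Polynomial.monom (of_nat (k*d (Suc i)) :: 'a) (p^i))"
		have "poly P x = of_nat k*S" by (simp add: P_def S_def y_def poly_sum poly_monom sum_distrib_left mult_ac)
		moreover have "over_field (range of_nat) P"
			unfolding over_field_def
		proof
			fix j
			have "pcoeff P j = of_nat (\<Sum>i\<le>n. if p^i = j then k*d (Suc i) else 0)"
				unfolding P_def Polynomial.coeff_sum of_nat_sum by (rule sum.cong) auto
			thus "pcoeff P j \<in> range of_nat" by (simp only: rangeI)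
		qed
		ultimately show ?thesis using 4 by (intro exI[of _ P]) simp
	qed
qed

lemma poly_nat_closed: "sfield E ==> over_field (range of_nat) P ==> x \<in> E ==> poly P x \<in> E"
	by (induction P) (auto simp: sf_0 intro!: sf_add sf_mul sf_of_nat)

lemma poly_nat_vge: "over_field (range of_nat) P ==> vge 0 x ==> vge 0 (poly P x)"
proof (induction P)
	case (pCons a P)
	hence "vge (0+0) (x*poly P x)" by (intro vge_mul) auto
	thus ?case using pCons by (auto intro!: vge_add)
qed simp

text \<open>Perfectness comes from linear dependence: more powers \<open>x^(p^i)\<close> than the
  dimension of \<open>K\<close> are dependent over \<open>Qp v\<close>, and the relation, divided by
  a coefficient of least valuation, reduces to one over the prime field.\<close>

lemma lf_unramified:
	assumes "unramified_ext v (Qp v) K" shows "lf K 1"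
proof -
	have Q: "sfield (Qp v)" and K: "sfield K" and QK: "Qp v \<subseteq> K" and fd: "ring.finite_dimension Omega (Qp v) K"
		and ri: "ram_index v (Qp v) K = 1"
		using assms by (auto simp: unramified_ext_def finite_ext_def field_ext_def)
	obtain n where n: "ring.dimension Omega n (Qp v) K"
		using fd by auto
	have Kc: "vcomplete K" by (rule dimension_complete[OF Q vcomplete_Qp n])
	have Kv: "\<exists>k::int. val (of_int k) x" if x: "x \<in> K" "x \<noteq> 0" for x
	proof -
		obtain a where a: "val a x" using val_ex[OF x(2)] by blast
		let ?V = "value_group v (Qp v)"
		have V0: "0 \<in> ?V" unfolding value_group_def using sf_1[OF Q] by (intro image_eqI[of _ _ 1]) auto
		have VK1: "0 \<in> value_group v K" unfolding value_group_def using sf_1[OF K] by (intro image_eqI[of _ _ 1]) auto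
		have VK2: "a \<in> value_group v K"
			unfolding value_group_def using x a by (intro image_eqI[of _ _ x]) (auto simp: val_def)
		obtain A where A: "(\<lambda>c. (+) c ` ?V) ` value_group v K = {A}" using ri unfolding ram_index_def by (metis card_1_singletonE)
		have "(+) a ` ?V = A" "(+) 0 ` ?V = A" using A VK1 VK2 by blast+
		hence "(+) a ` ?V = ?V" by simp
		hence "a \<in> ?V" using V0 by (metis add.right_neutral imageI)
		then obtain y where y: "y \<in> Qp v" "y \<noteq> 0" "a = real_of_ereal (v y)" by (auto simp: value_group_def)
		obtain k :: int where "val (of_int k) y" using val_Qp_ex[OF y(1,2)] by blast
		hence "a = of_int k" using y(3) by (simp add: val_def)
		thus ?thesis using a by blast
	qed
	have perf: "\<exists>y\<in>K. vge 0 y \<and> vgt 0 (x-y^p)" if x: "x \<in> K" "vge 0 x" for x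
	proof -
		let ?U = "map (\<lambda>i. x^(p^i)) [0..<Suc n]"
		have U: "set ?U \<subseteq> K" using sf_power[OF K x(1)] by auto
		have dep: "\<not> ring.independent Omega (Qp v) ?U"
			using Om.independent_length_le_dimension[OF Q n _ U] by auto
		obtain Ks where Ks: "length Ks = length ?U" "ring.combine Omega Ks ?U = \<zero>\<^bsub>Omega\<^esub>" "set Ks \<subseteq> Qp v" "set Ks \<noteq> {\<zero>\<^bsub>Omega\<^esub>}"
			by (rule Om.dependent_imp_non_trivial_combine[OF Q _ dep]) simp_all
		have lK: "length Ks = Suc n" using Ks(1) by simp
		have s0: "(\<Sum>i<Suc n. Ks ! i*x^(p^i)) = 0"
			using Ks(2) unfolding combine_sum[OF Ks(1)] by (simp only: length_map length_upt Omega_simps) (simp add: nth_append)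
		obtain i where i: "i < Suc n" "\<forall>j<Suc n. v (Ks ! i) \<le> v (Ks ! j)" using finite_min_v[of "Suc n" "\<lambda>i. Ks ! i"] by auto
		have nz: "Ks ! i \<noteq> 0"
		proof
			assume "Ks ! i = 0"
			hence "Ks ! j = 0" if "j < Suc n" for j using i(2) that val_eq_infinity by force
			hence "set Ks \<subseteq> {0}" using lK by (auto simp: in_set_conv_nth)
			moreover have "Ks \<noteq> []" using lK by auto
			ultimately have "set Ks = {0}" by (metis set_empty subset_singletonD)
			thus False using Ks(4) by simp
		qed
		then obtain b where b: "val b (Ks ! i)" using val_ex by blast
		have KQ: "Ks ! j \<in> Qp v" if "j < Suc n" for j using Ks(3) lK that by (metis nth_mem subsetD)
		have Kb: "vge b (Ks ! j)" if "j < Suc n" for j using i(2) that b by (simp add: vge_def val_def)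
		have "\<forall>j. \<exists>d::nat. j < Suc n --> vgt 0 (Ks ! j/Ks ! i - of_nat d)"
			using Qp_residue[OF sf_divide[OF Q KQ KQ[OF i(1)]]] vge_divide[OF Kb b] by auto
		from choice[OF this] obtain d :: "nat => nat" where d: "\<And>j. j < Suc n ==> vgt 0 (Ks ! j/Ks ! i - of_nat (d j))" by blast
		have di: "\<not> p dvd d i" using d[OF i(1)] nz vgt_iff[of 0 1 "of_nat (d i)"] val_vgt[OF val_1, of 0] vgt_of_nat_iff by simp
		have "vgt 0 (\<Sum>j<Suc n. (Ks ! j/Ks ! i - of_nat (d j))*x^(p^j))"
		proof (rule vgt_sum)
			fix j assume "j \<in> {..<Suc n}"
			thus "vgt 0 ((Ks ! j/Ks ! i - of_nat (d j))*x^(p^j))"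
				using vgt_mul[OF d vge_power[OF x(2)], of j "p^j"] by simp
		qed
		also have "(\<Sum>j<Suc n. (Ks ! j/Ks ! i - of_nat (d j))*x^(p^j))
				= (\<Sum>j<Suc n. Ks ! j*x^(p^j))/Ks ! i-(\<Sum>j<Suc n. of_nat (d j)*x^(p^j))"
			by (simp only: left_diff_distrib sum_subtractf sum_divide_distrib times_divide_eq_left)
		finally have "vgt 0 (\<Sum>j\<le>n. of_nat (d j)*x^(p^j))"
			unfolding s0 by (simp only: lessThan_Suc_atMost div_0 diff_0 vgt_minus)
		from perfect_from_relation[OF x(2) _ di this] i(1)
		obtain P where "over_field (range of_nat) P" "vgt 0 (x-poly P x^p)" by auto
		thus ?thesis using poly_nat_closed[OF K _ x(1)] poly_nat_vge[OF _ x(2)] by blast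
	qed
	show ?thesis
		unfolding lf_def
	proof (intro conjI ballI impI)
		show "\<exists>u\<in>K. val (1/real 1) u" by (rule bexI[of _ "of_nat p"]) (simp_all add: sf_of_nat[OF K])
	qed (use K Kc Kv perf in simp_all)
qed

end

section \<open>Roots of Eisenstein polynomials and the setting of the theorem\<close>

context padic_valuation
begin

text \<open>A root of nonpositive valuation is impossible, as \<open>x^N\<close> would dominate; for
  positive valuation every term other than \<open>x^N\<close> and the constant one has valuation
  greater than 1.\<close>

lemma eisenstein_root_val:
	assumes q: "pdeg q = N" "N > 0" "plead q = 1"
		"\<And>n. n < N ==> vge 1 (pcoeff q n)" "val 1 (pcoeff q 0)" and x: "poly q x = 0"
	shows "val (1/real N) x" "sim (x^N) (- pcoeff q 0)"
proof -
	have e: "x^N = - (\<Sum>n<N. pcoeff q n*x^n)" using q(1,3) x by (simp add: poly_altdef lessThan_Suc_atMost[symmetric] eq_neg_iff_add_eq_0 add.commute)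
	have "x \<noteq> 0" using val_nonzero[OF q(5)] x by (auto simp: poly_0_coeff_0)
	then obtain a where a: "val a x" using val_ex by blast
	have a0: "a > 0"
	proof (rule ccontr)
		assume "\<not> a > 0"
		hence a0: "a \<le> 0" by simp
		have "vge (1+real N*a) (\<Sum>n<N. pcoeff q n*x^n)"
		proof (rule vge_sum)
			fix n assume n: "n \<in> {..<N}"
			have "real N*a \<le> real n*a" using n a0 by (intro mult_right_mono_neg) auto
			thus "vge (1+real N*a) (pcoeff q n*x^n)"
				using vge_mono[OF vge_mul[OF q(4) vge_power[of a x n]], of n "1+real N*a"] n a by (simp add: val_vge)
		qed
		hence "vge (1+real N*a) (x^N)" unfolding e by simp
		thus False using val_vge[OF val_power[OF a, of N]] by simp
	qed
	have "vgt 1 (\<Sum>n\<in>{..<N}-{0}. pcoeff q n*x^n)"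
	proof (rule vgt_sum)
		fix n assume n: "n \<in> {..<N} - {0}"
		hence "1 < 1+real n*a" using a0 by simp
		thus "vgt 1 (pcoeff q n*x^n)"
			using vge_vgt[OF vge_mul[OF q(4) vge_power[of a x n]], of n 1] n a by (simp add: val_vge)
	qed
	moreover have "x^N = - pcoeff q 0-(\<Sum>n\<in>{..<N}-{0}. pcoeff q n*x^n)"
		unfolding e using q(2) by (subst sum.remove[of _ 0]) auto
	ultimately have "vgt 1 (x^N-(- pcoeff q 0))" by simp
	thus s: "sim (x^N) (- pcoeff q 0)" using q(5) by (intro simI[of 1]) simp_all
	have "val 1 (x^N)" by (rule sim_val[OF s]) (use q(5) in simp)
	thus "val (1/real N) x" using val_power_cancel q(2) by blast
qed

end

lemmas (in padic_valuation) [trans] = sim_trans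

text \<open>The data of the theorem lifted from the residue field: equations there become
  \<open>sim\<close> statements in \<open>K\<close>. The coefficient of \<open>X^n\<close> is
  \<open>f_(p^2-n)\<close>, so \<open>f_p\<close> stands at \<open>p*(p-1)\<close> and
  \<open>f_r\<close> at \<open>m = p^2 - r = (p-1)*l - p\<close>.\<close>

locale eis = padic_valuation p v for p :: nat and v :: "'a::{alg_closed_field, field_char_0} => ereal" +
	fixes K :: "'a set" and l m :: nat and f :: "'a poly" and \<pi> \<rho> \<eta> :: 'a
	assumes odd_p: "odd p" and K: "lf K 1" and l: "2 \<le> l" "l \<le> p-1" and m: "m+p = (p-1)*l"
		and f_deg: "pdeg f = p^2" and f_lead: "plead f = 1"
		and f_K: "over_field K f"
		and f_0: "val 1 (pcoeff f 0)"
		and f_p: "val 1 (pcoeff f (p*(p-1)))"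
		and f_pj: "\<And>j. 1 \<le> j ==> j \<le> p-2 ==> vge 2 (pcoeff f (p*j))"
		and f_m: "val 2 (pcoeff f m)"
		and f_hi: "\<And>n. m < n ==> n < p^2 ==> \<not> p dvd n ==> vge 2 (pcoeff f n)"
		and f_lo: "\<And>n. n < m ==> \<not> p dvd n ==> vge 3 (pcoeff f n)"
		and rho: "\<rho> \<in> K" "val 0 \<rho>" "sim (- (pcoeff f (p*(p-1))/pcoeff f 0)) (\<rho>^(p-1))"
		and eta: "\<eta> \<in> K" "val 0 \<eta>"
			"sim (of_nat l*pcoeff f m/(pcoeff f (p*(p-1))*pcoeff f 0)) (\<eta>^(p-1))"
		and root: "poly f \<pi> = 0"
begin

definition "A0 = pcoeff f 0"
definition "A1 = pcoeff f (p*(p-1))"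
definition "Am = pcoeff f m"

lemma p3: "p \<ge> 3" using odd_p p_gt_1 by (cases "p = 2") auto

lemma A_val: "val 1 A0" "val 1 A1" "val 2 Am"
	using f_0 f_p f_m by (simp_all add: A0_def A1_def Am_def)

lemma l_ndvd: assumes "0 < i" "i \<le> l" shows "\<not> p dvd i"
proof
	assume "p dvd i"
	hence "p \<le> i" using assms(1) by (rule dvd_imp_le)
	thus False using assms l by linarith
qed

lemma m_ndvd: "\<not> p dvd m"
proof
	assume "p dvd m"
	hence "p dvd (p-1)*l" by (metis dvd_add_triv_right_iff m)
	moreover have "Rings.coprime p (p-1)" using p_gt_1 using coprime_Suc_right_nat[of "p-1"] by (simp add: coprime_commute)
	ultimately have "p dvd l" by (simp add: coprime_dvd_mult_right_iff)
	thus False using l_ndvd[of l] l by simp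
qed

lemma m_less: "m < p^2"
proof -
	have "(p-1)*l \<le> p*p" using l by (intro mult_le_mono) auto
	thus ?thesis using m p_gt_0 by (simp add: power2_eq_square)
qed

lemma m_real: "real m = (real p-1)*real l-real p"
proof -
	have "real m+real p = real ((p-1)*l)" by (metis m of_nat_add)
	thus ?thesis using p_gt_0 by simp
qed

text \<open>\<open>g0\<close>, evaluated at \<open>X^p\<close>, collects the terms of
  \<open>f\<close> whose exponent is divisible by \<open>p\<close>. It is Eisenstein of degree
  \<open>p\<close> and approximately satisfied by \<open>\<pi>^p\<close>; a true root nearby will
  generate \<open>F\<close>.\<close>

definition "g0 = (\<Sum>j\<le>p. Polynomial.monom (pcoeff f (p*j)) j)"

lemma coeff_g0: "pcoeff g0 j = (if j \<le> p then pcoeff f (p*j) else 0)"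
	by (simp add: g0_def Polynomial.coeff_sum)

lemma g0_p: "pcoeff g0 p = 1"
	using f_lead f_deg by (simp add: coeff_g0 power2_eq_square)

lemma g0_deg: "pdeg g0 = p" "plead g0 = 1"
proof -
	have "pdeg g0 \<le> p" by (rule degree_le) (auto simp: coeff_g0)
	moreover have "pdeg g0 \<ge> p" by (rule le_degree) (simp add: g0_p)
	ultimately show d: "pdeg g0 = p" by simp
	show "plead g0 = 1" unfolding d by (rule g0_p)
qed

lemma g0_over: "over_field K g0"
	using f_K sf_0[OF lf_sfield[OF K]] by (simp add: over_field_def coeff_g0)

lemma g0_0: "pcoeff g0 0 = A0" and g0_p1: "pcoeff g0 (p-1) = A1"
	by (simp_all add: coeff_g0 A0_def A1_def)

lemma g0_mid: "1 \<le> j ==> j \<le> p-2 ==> vge 2 (pcoeff g0 j)"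
	using f_pj by (simp add: coeff_g0)

lemma g0_vge: "j < p ==> vge 1 (pcoeff g0 j)"
proof -
	assume j: "j < p"
	consider "j = 0" | "j = p-1" | "1 \<le> j" "j \<le> p-2" using j by linarith
	thus ?thesis
	proof cases
		case 1 thus ?thesis using val_vge[OF A_val(1)] by (simp add: g0_0)
	next
		case 2 show ?thesis unfolding 2 g0_p1 using val_vge[OF A_val(2)] by simp
	next
		case 3 thus ?thesis using vge_mono[OF g0_mid[OF 3], of 1] by simp
	qed
qed

lemma f_vge: "n < p^2 ==> vge 1 (pcoeff f n)"
proof -
	assume n: "n < p^2"
	show ?thesis
	proof (cases "p dvd n")
		case True
		then obtain j where j: "n = p*j" by blast
		hence "j < p" using n by (simp add: power2_eq_square)
		thus ?thesis using g0_vge[of j] by (simp add: coeff_g0 j)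
	next
		case False
		consider "n = m" | "n < m" | "m < n" by linarith
		thus ?thesis
		proof cases
			case 1 thus ?thesis using A_val(3) by (simp add: Am_def val_vge)
		next
			case 2 thus ?thesis using vge_mono[OF f_lo[OF 2 False], of 1] by simp
		next
			case 3 thus ?thesis using vge_mono[OF f_hi[OF 3 n False], of 1] by simp
		qed
	qed
qed

lemma pi_val: "val (1/real (p^2)) \<pi>" and pi_pow: "sim (\<pi>^(p^2)) (- A0)"
	using eisenstein_root_val[OF f_deg _ f_lead f_vge f_0 root] p_gt_0 by (simp_all add: A0_def)

definition "L = ext K \<pi>"

lemma pi_q: "over_field K f" "plead f = 1" "pdeg f = p^2" "p^2 > 0" "poly f \<pi> = 0"
	using f_K f_lead f_deg root p_gt_0 by simp_all

lemma pi_ram: "val (of_int 1/(real 1*real (p^2))) \<pi>" "Rings.coprime 1 (int (p^2))"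
	using pi_val by simp_all

lemma L_lf: "lf L (p^2)"
	using ext_ram[OF K pi_ram pi_q(4) pi_q(1,2,3,5)] by (simp add: L_def)

lemma KL: "K \<subseteq> L" and piL: "\<pi> \<in> L"
	using ext_incl[OF lf_sfield[OF K]] ext_mem[OF lf_sfield[OF K]] by (auto simp: L_def)

lemma L_span: "L = lin_span K \<pi> (p^2)"
	unfolding L_def by (rule ext_lin_span[OF lf_sfield[OF K] pi_q])

lemma L_residue: "x \<in> L ==> vge 0 x ==> \<exists>y\<in>K. vge 0 y \<and> vgt 0 (x-y)"
	using ram_residue[OF K pi_ram pi_q(4)] L_span by blast

definition "R = (\<Sum>n\<in>{n. n < p^2 \<and> \<not> p dvd n}. pcoeff f n*\<pi>^n)"

lemma g0_pi: "poly g0 (\<pi>^p) = - R"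
proof -
	have "0 = (\<Sum>n\<le>p^2. pcoeff f n*\<pi>^n)" using root f_deg by (simp add: poly_altdef)
	also have "\<dots> = (\<Sum>n\<in>{n. n \<le> p^2 \<and> p dvd n}. pcoeff f n*\<pi>^n)
			+ (\<Sum>n\<in>{n. n \<le> p^2 \<and> \<not> p dvd n}. pcoeff f n*\<pi>^n)"
		by (subst sum.union_disjoint[symmetric]) (auto intro: sum.cong)
	also have "{n. n \<le> p^2 \<and> \<not> p dvd n} = {n. n < p^2 \<and> \<not> p dvd n}"
		by (auto simp: le_less)
	also have "(\<Sum>n\<in>{n. n \<le> p^2 \<and> p dvd n}. pcoeff f n*\<pi>^n) = (\<Sum>j\<le>p. pcoeff f (p*j)*\<pi>^(p*j))"
		by (rule sum.reindex_bij_witness[of _ "\<lambda>j. p*j" "\<lambda>n. n div p"]) (use p_gt_0 in \<open>auto simp: power2_eq_square\<close>)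
	also have "\<dots> = poly g0 (\<pi>^p)"
		by (simp add: g0_def poly_sum poly_monom power_mult)
	finally show ?thesis by (simp add: R_def eq_neg_iff_add_eq_0)
qed

text \<open>The hypotheses on the coefficients single out index \<open>m\<close>: below it the
  coefficient gains a full 1 while the power of \<pi> loses less than 1, and above it the power of
  \<pi> is larger.\<close>

lemma R_sim: "sim R (Am*\<pi> ^ m)" and R_val: "val (2+real m/real (p^2)) R"
proof -
	have v: "val (2+real m/real (p^2)) (Am*\<pi> ^ m)"
		using val_mul[OF A_val(3) val_power[OF pi_val, of m]] by simp
	have "vgt (2+real m/real (p^2)) (\<Sum>n\<in>{n. n < p^2 \<and> \<not> p dvd n} - {m}. pcoeff f n*\<pi>^n)"
	proof (rule vgt_sum)
		fix n assume "n \<in> {n. n < p^2 \<and> \<not> p dvd n} - {m}"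
		hence n: "n < p^2" "\<not> p dvd n" "n \<noteq> m" by auto
		have pn: "vge (real n/real (p^2)) (\<pi>^n)" using val_power[OF pi_val, of n] by (simp add: val_vge)
		show "vgt (2+real m/real (p^2)) (pcoeff f n*\<pi>^n)"
		proof (cases "n < m")
			case True
			have "real m/real (p^2) < 1" using m_less p_gt_0 by (simp add: divide_less_eq_1 del: of_nat_power)
			hence "2+real m/real (p^2) < 3+real n/real (p^2)"
				using divide_nonneg_nonneg[of "real n" "real (p^2)", OF of_nat_0_le_iff of_nat_0_le_iff] by linarith
			thus ?thesis by (rule vge_vgt[OF vge_mul[OF f_lo[OF True n(2)] pn]])
		next
			case False
			hence mn: "m < n" using n(3) by simp
			hence "real m/real (p^2) < real n/real (p^2)" using p_gt_0 by (intro divide_strict_right_mono) auto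
			hence "2+real m/real (p^2) < 2+real n/real (p^2)" by simp
			thus ?thesis by (rule vge_vgt[OF vge_mul[OF f_hi[OF mn n(1,2)] pn]])
		qed
	qed
	moreover have "R = Am*\<pi> ^ m+(\<Sum>n\<in>{n. n < p^2 \<and> \<not> p dvd n} - {m}. pcoeff f n*\<pi>^n)"
		unfolding R_def Am_def using m_less m_ndvd by (subst sum.remove[of _ m]) auto
	ultimately show s: "sim R (Am*\<pi> ^ m)" using sim_add[OF v] by simp
	show "val (2+real m/real (p^2)) R" by (rule sim_val[OF s v])
qed

subsection \<open>Taylor expansion of the degree \<open>p\<close> polynomial\<close>

definition "tay t i = (\<Sum>j\<le>p. pcoeff g0 j * of_nat (j choose i)*t^(j-i))"

lemma g0_taylor: "poly g0 (t+e) = (\<Sum>i\<le>p. tay t i*e^i)"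
proof -
	have "poly g0 (t+e) = (\<Sum>j\<le>p. pcoeff g0 j*(e+t)^j)"
		by (simp add: poly_altdef g0_deg add.commute)
	also have "\<dots> = (\<Sum>j\<le>p. \<Sum>i\<le>p. pcoeff g0 j * of_nat (j choose i)*t^(j-i)*e^i)"
	proof (rule sum.cong[OF refl])
		fix j assume j: "j \<in> {..p}"
		have "(e+t)^j = (\<Sum>i\<le>j. of_nat (j choose i)*e^i*t^(j-i))" by (rule binomial_ring)
		also have "\<dots> = (\<Sum>i\<le>p. of_nat (j choose i)*e^i*t^(j-i))"
			by (rule sum.mono_neutral_left) (use j in \<open>auto simp: binomial_eq_0\<close>)
		finally show "pcoeff g0 j*(e+t)^j = (\<Sum>i\<le>p. pcoeff g0 j * of_nat (j choose i)*t^(j-i)*e^i)"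
			by (simp add: sum_distrib_left mult_ac)
	qed
	also have "\<dots> = (\<Sum>i\<le>p. tay t i*e^i)"
		by (subst sum.swap) (simp add: tay_def sum_distrib_right)
	finally show ?thesis .
qed

lemma tay_0: "tay t 0 = poly g0 t"
	using g0_taylor[of t 0] p_gt_0 by (simp add: power_0_left sum.delta if_distrib[of "\<lambda>x. _*x"] cong: if_cong)

lemma tay_p: "tay t p = 1"
proof -
	have "tay t p = (\<Sum>j\<in>{p}. pcoeff g0 j * of_nat (j choose p)*t^(j-p))"
		unfolding tay_def by (rule sum.mono_neutral_right) (auto simp: binomial_eq_0)
	thus ?thesis by (simp add: g0_p)
qed

lemma tay_vge:
	assumes t: "val (1/real p) t" and i: "2 \<le> i" "i < p"
	shows "vge (2-(1+real i)/real p) (tay t i)"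
	unfolding tay_def
proof (rule vge_sum)
	fix j assume j: "j \<in> {..p}"
	have tp: "vge (real (j-i)/real p) (t^(j-i))" using val_power[OF t, of "j-i"] by (simp add: val_vge)
	consider "j < i" | "j = p" | "j = p-1" "i \<le> j" | "i \<le> j" "j \<le> p-2" using j by force
	thus "vge (2-(1+real i)/real p) (pcoeff g0 j * of_nat (j choose i)*t^(j-i))"
	proof cases
		case 1 thus ?thesis by (simp add: binomial_eq_0)
	next
		case 2
		have "vge (1+real (j-i)/real p) (of_nat (p choose i)*t^(j-i))"
			using i by (intro vge_mul tp vge_binomial) auto
		moreover have "2-(1+real i)/real p \<le> 1+real (j-i)/real p"
			using i 2 by (simp add: field_simps)
		ultimately show ?thesis using vge_mono 2 by (simp add: g0_p)
	next
		case 3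
		have "vge (1+0+real (j-i)/real p) (A1 * of_nat (j choose i)*t^(j-i))"
			using A_val by (intro vge_mul tp) (auto simp: val_vge)
		moreover have "2-(1+real i)/real p \<le> 1+0+real (j-i)/real p"
			using i 3 by (simp add: field_simps)
		ultimately show ?thesis using vge_mono 3 g0_p1 by simp
	next
		case 4
		have "vge (2+0+real (j-i)/real p) (pcoeff g0 j * of_nat (j choose i)*t^(j-i))"
			using 4 i by (intro vge_mul tp g0_mid) auto
		moreover have "0 \<le> (1+real i)/real p" "0 \<le> real (j-i)/real p" by simp_all
		hence "2-(1+real i)/real p \<le> 2+0+real (j-i)/real p" by linarith
		ultimately show ?thesis by (rule vge_mono)
	qed
qed

text \<open>The derivative is governed by \<open>f_p\<close>: as \<open>A1\<close> has valuation 1,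
  the term \<open>(p-1)*A1*t^(p-2)\<close> has smaller valuation than \<open>p*t^(p-1)\<close>. This
  is what makes the break of \<open>F\<close> equal to 1.\<close>

lemma tay_1:
	assumes t: "val (1/real p) t"
	shows "sim (tay t 1) (- A1*t^(p-2))" "val (2-2/real p) (tay t 1)"
proof -
	have v: "val (2-2/real p) (- A1*t^(p-2))"
	proof -
		have "val (1+real (p-2)*(1/real p)) (- A1*t^(p-2))"
			using A_val by (intro val_mul val_power t) simp
		moreover have "1+real (p-2)*(1/real p) = 2-2/real p" using p3 by (simp add: field_simps)
		ultimately show ?thesis by simp
	qed
	have p: "{..p} = insert p (insert (p-1) {..p-2})" by auto
	have "tay t 1 = of_nat p*t^(p-1)+A1 * of_nat (p-1)*t^(p-2)
			+ (\<Sum>j\<le>p-2. pcoeff g0 j * of_nat j*t^(j-1))"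
	proof -
		have n: "p-1 \<notin> {..p-2}" "p \<notin> insert (p-1) {..p-2}" using p3 by auto
		have "tay t 1 = pcoeff g0 p * of_nat (p choose 1)*t^(p-1)+(pcoeff g0 (p-1) * of_nat ((p-1) choose 1)*t^(p-1-1)
			+ (\<Sum>j\<le>p-2. pcoeff g0 j * of_nat (j choose 1)*t^(j-1)))"
			unfolding tay_def p using n by (simp only: sum.insert finite_insert finite_atMost not_False_eq_True)
		moreover have "p-1-1 = p-2" by simp
		ultimately show ?thesis by (simp only: g0_p g0_p1 choose_one mult_1_left add.assoc)
	qed
	also have "A1 * of_nat (p-1)*t^(p-2) = - A1*t^(p-2) + of_nat p*(A1*t^(p-2))"
		using p_gt_0 by (simp add: algebra_simps)
	finally have e: "tay t 1 = - A1*t^(p-2)+(of_nat p*t^(p-1) + of_nat p*(A1*t^(p-2))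
			+ (\<Sum>j\<le>p-2. pcoeff g0 j * of_nat j*t^(j-1)))" by simp
	have "vgt (2-2/real p) (of_nat p*t^(p-1) + of_nat p*(A1*t^(p-2))
			+ (\<Sum>j\<le>p-2. pcoeff g0 j * of_nat j*t^(j-1)))"
	proof (intro vgt_add vgt_sum)
		have "val (1+real (p-1)*(1/real p)) (of_nat p*t^(p-1))" by (intro val_mul val_power t val_p')
		from val_vgt[OF this] show "vgt (2-2/real p) (of_nat p*t^(p-1))"
			using p3 by (simp add: field_simps)
		have "val (1+(2-2/real p)) (of_nat p*(- A1*t^(p-2)))" by (intro val_mul v val_p')
		hence "val (1+(2-2/real p)) (of_nat p*(A1*t^(p-2)))"
			by simp
		from val_vgt[OF this] show "vgt (2-2/real p) (of_nat p*(A1*t^(p-2)))" by simp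
	next
		fix j assume j: "j \<in> {..p-2}"
		show "vgt (2-2/real p) (pcoeff g0 j * of_nat j*t^(j-1))"
		proof (cases "j = 0")
			case False
			have "vge (2+0+real (j-1)*(1/real p)) (pcoeff g0 j * of_nat j*t^(j-1))"
				using j False t by (intro vge_mul vge_power g0_mid) (auto simp: val_vge)
			thus ?thesis
			proof (rule vge_vgt)
				have "0 < 2/real p" "0 \<le> real (j-1)*(1/real p)" using p_gt_0 by simp_all
				thus "2-2/real p < 2+0+real (j-1)*(1/real p)" by linarith
			qed
		qed simp
	qed
	thus s: "sim (tay t 1) (- A1*t^(p-2))" unfolding e by (rule sim_add[OF v])
	show "val (2-2/real p) (tay t 1)" by (rule sim_val[OF s v])
qed

text \<open>With \<open>lam = \<rho>*t^2\<close> as unit of length, the Taylor expansion at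
  \<open>t\<close> divided by \<open>lam^p\<close> becomes congruent to \<open>w^p - w\<close>.
  Hensel's lemma then gives a root of \<open>g0\<close> near \<open>t + c*lam\<close> for every
  \<open>c\<close> in the prime field; \<open>c = 0\<close> refines an approximate root to a true
  one.\<close>

lemma root_near:
	assumes E: "sfield E" "vcomplete E" "K \<subseteq> E" and t: "t \<in> E" "val (1/real p) t" "sim (t^p) (- A0)"
		and g: "vgt 2 (poly g0 t)"
	shows "\<exists>w\<in>E. poly g0 w = 0 \<and> vgt (2/real p) (w-t - of_nat c*\<rho>*t^2)"
proof -
	define lam where "lam = \<rho>*t^2"
	have lamE: "lam \<in> E" unfolding lam_def using rho(1) E t by (intro sf_mul[OF E(1)] sf_power[OF E(1)]) auto
	have lv: "val (2/real p) lam" unfolding lam_def using val_mul[OF rho(2) val_power[OF t(2), of 2]] by simp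
	have lam0: "lam \<noteq> 0" by (rule val_nonzero[OF lv])
	have lp: "val 2 (lam^p)" using val_power[OF lv, of p] p_gt_0 by simp
	have tE: "tay t i \<in> E" for i
		unfolding tay_def using g0_over E t
		by (intro sf_sum[OF E(1)] sf_mul[OF E(1)] sf_power[OF E(1)] sf_of_nat[OF E(1)]) (auto simp: over_field_def)
	define rr where "rr i = tay t i*lam^i/lam^p+(if i = 1 then 1 else 0)" for i
	have rE: "rr i \<in> E" for i
		unfolding rr_def using sf_0[OF E(1)] sf_1[OF E(1)]
		by (intro sf_add[OF E(1)] sf_divide[OF E(1)] sf_mul[OF E(1)] sf_power[OF E(1)] tE lamE) auto
	have rv: "vgt 0 (rr i)" if i: "i < p" for i
	proof -
		consider "i = 0" | "i = 1" | "2 \<le> i" by linarith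
		thus ?thesis
		proof cases
			case 1
			thus ?thesis using vgt_divide[OF g lp] by (simp add: rr_def tay_0)
		next
			case 2
			\<comment> \<open>The linear coefficient is congruent to -1 because \<open>\<rho>^(p-1)\<close>
			  is congruent to \<open>-A1/A0\<close> and \<open>t^p\<close> has leading term
			  \<open>-A0\<close>; this is the use of the condition on \<rho>.\<close>
			have "sim (tay t 1*lam/lam^p) (- A1*t^(p-2)*lam/lam^p)"
				using lam0 tay_1(1)[OF t(2)] by (intro sim_divide sim_mult sim_refl) auto
			also have "- A1*t^(p-2)*lam/lam^p = - A1/(\<rho>^(p-1)*t^p)"
			proof -
				have "lam^p = lam*(\<rho>^(p-1)*(t^(p-2)*t^p))"
				proof -
					have "2*(p-1) = (p-2)+p" using p3 by simp
					hence "(t^2)^(p-1) = t^(p-2)*t^p" by (simp only: power_mult[symmetric] power_add[symmetric])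
					hence "lam^(p-1) = \<rho>^(p-1)*(t^(p-2)*t^p)" by (simp add: lam_def power_mult_distrib)
					thus ?thesis using p_gt_0 by (metis power_minus_mult mult.commute)
				qed
				thus ?thesis using lam0 by simp
			qed
			also have "sim (- A1/(\<rho>^(p-1)*t^p)) (- A1/(- (A1/A0) * - A0))"
			proof (intro sim_divide sim_mult t(3) sim_refl)
				show "sim (\<rho>^(p-1)) (- (A1/A0))" using rho(3) by (simp add: sim_sym A0_def A1_def)
			qed (use val_nonzero[OF A_val(2)] in simp)
			also have "- A1/(- (A1/A0) * - A0) = - 1" using val_nonzero[OF A_val(1)] val_nonzero[OF A_val(2)] by simp
			finally have "sim (tay t 1*lam/lam^p) (- 1)" .
			hence "vgt 0 (tay t 1*lam/lam^p-(- 1))" by (rule simD) simp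
			thus ?thesis using 2 by (simp add: rr_def)
		next
			case 3
			have "vge (2-(1+real i)/real p+real i*(2/real p)-2) (tay t i*lam^i/lam^p)"
				using lv by (intro vge_divide[OF _ lp] vge_mul tay_vge[OF t(2) 3 i] vge_power) (simp add: val_vge)
			moreover have "0 < 2-(1+real i)/real p+real i*(2/real p)-2"
				using 3 p_gt_0 by (simp add: field_simps)
			ultimately show ?thesis using vge_vgt 3 by (simp add: rr_def)
		qed
	qed
	obtain w where w: "w \<in> E" "w^p-w+(\<Sum>i<p. rr i*w^i) = 0" "vgt 0 (w - of_nat c)"
		using hensel[OF E(1,2), of rr "of_nat c", OF rE rv sf_of_nat[OF E(1)] vge_of_nat wp_of_nat] by blast
	have "(\<Sum>i<p. rr i*w^i) = (\<Sum>i<p. tay t i*lam^i/lam^p*w^i)+w"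
	proof -
		have "(\<Sum>i<p. rr i*w^i) = (\<Sum>i<p. tay t i*lam^i/lam^p*w^i+(if i = 1 then w else 0))"
			by (rule sum.cong) (auto simp: rr_def algebra_simps)
		thus ?thesis using p_gt_1 by (simp add: sum.distrib)
	qed
	hence "0 = w^p+(\<Sum>i<p. tay t i*lam^i/lam^p*w^i)" using w(2) by simp
	also have "\<dots> = (\<Sum>i\<le>p. tay t i*lam^i/lam^p*w^i)"
		using lam0 by (simp add: lessThan_Suc_atMost[symmetric] tay_p)
	also have "\<dots> = (\<Sum>i\<le>p. tay t i*(lam*w)^i)/lam^p"
		by (simp add: sum_divide_distrib power_mult_distrib mult_ac)
	also have "\<dots> = poly g0 (t+lam*w)/lam^p" by (simp add: g0_taylor)
	finally have "poly g0 (t+lam*w) = 0" using lam0 by simp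
	moreover have "vgt (0+2/real p) ((w - of_nat c)*lam)" using w(3) lv by (intro vgt_mul) (simp_all add: val_vge)
	hence "vgt (2/real p) (t+lam*w-t - of_nat c*\<rho>*t^2)" by (simp add: lam_def algebra_simps)
	moreover have "t+lam*w \<in> E" by (rule sf_add[OF E(1) t(1) sf_mul[OF E(1) lamE w(1)]])
	ultimately show ?thesis by blast
qed

end

context eis
begin

subsection \<open>The subfield of degree \<open>p\<close>\<close>

lemma pip_val: "val (1/real p) (\<pi>^p)"
	using val_power[OF pi_val, of p] p_gt_0 by (simp add: power2_eq_square)

lemma theta_ex: "\<exists>w. w \<in> L \<and> poly g0 w = 0 \<and> vgt (2/real p) (w-\<pi>^p)"
proof -
	have "sim ((\<pi>^p)^p) (- A0)" using pi_pow by (simp add: power2_eq_square power_mult)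
	moreover have "m > 0" using m_ndvd by (intro gr0I) simp
	hence "0 < real m/real (p^2)" using p_gt_0 by simp
	hence "2 < 2+real m/real (p^2)" by simp
	hence "vgt 2 R" using R_val val_vgt by blast
	hence "vgt 2 (poly g0 (\<pi>^p))" by (simp add: g0_pi)
	ultimately obtain w where "w \<in> L" "poly g0 w = 0" "vgt (2/real p) (w-\<pi>^p - of_nat 0*\<rho>*(\<pi>^p)^2)"
		using root_near[OF lf_sfield[OF L_lf] lf_complete[OF L_lf] KL sf_power[OF lf_sfield[OF L_lf] piL] pip_val, where c = 0] by blast
	thus ?thesis by auto
qed

text \<open>Differences of distinct conjugates of this root have valuation exactly
  \<open>2/p\<close>, so the required closeness to \<open>\<pi>^p\<close> singles it out among
  them.\<close>

definition "\<theta> = (SOME w. w \<in> L \<and> poly g0 w = 0 \<and> vgt (2/real p) (w-\<pi>^p))"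

lemma theta: "\<theta> \<in> L" "poly g0 \<theta> = 0" "vgt (2/real p) (\<theta>-\<pi>^p)"
	using someI_ex[OF theta_ex] unfolding \<theta>_def by blast+

lemma theta_val: "val (1/real p) \<theta>" and theta_pow: "sim (\<theta>^p) (- A0)"
	using eisenstein_root_val[OF g0_deg(1) p_gt_0 g0_deg(2) g0_vge _ theta(2)] A_val(1) by (simp_all add: g0_0)

definition "F = ext K \<theta>"

lemma theta_q: "over_field K g0" "plead g0 = 1" "pdeg g0 = p" "p > 0" "poly g0 \<theta> = 0"
	using g0_over g0_deg theta(2) p_gt_0 by simp_all

lemma theta_ram: "val (of_int 1/(real 1*real p)) \<theta>" "Rings.coprime 1 (int p)"
	using theta_val by simp_all

lemma F_lf: "lf F p"
	using ext_ram[OF K theta_ram theta_q(4) theta_q(1,2,3,5)] by (simp add: F_def)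

lemmas K_sf = lf_sfield[OF K] and L_sf = lf_sfield[OF L_lf] and F_sf = lf_sfield[OF F_lf]

lemma KF: "K \<subseteq> F" and thetaF: "\<theta> \<in> F"
	using ext_incl[OF K_sf] ext_mem[OF K_sf] by (auto simp: F_def)

lemma FL: "F \<subseteq> L"
	unfolding F_def by (rule ext_least[OF K_sf L_sf KL theta(1)])

lemma F_span: "F = lin_span K \<theta> p"
	unfolding F_def by (rule ext_lin_span[OF K_sf theta_q])

lemma F_residue: "x \<in> F ==> vge 0 x ==> \<exists>y\<in>K. vge 0 y \<and> vgt 0 (x-y)"
	using ram_residue[OF K theta_ram theta_q(4)] F_span by blast

lemma F_orth: "orth K \<theta> p"
	by (rule ram_orth[OF K theta_ram theta_q(4)])

lemma theta_indep: "lin_indep K \<theta> p"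
	by (rule orth_lin_indep[OF F_orth K_sf val_nonzero[OF theta_val]])

lemma th_ex: "\<exists>w. w \<in> F \<and> poly g0 w = 0 \<and> vgt (2/real p) (w-\<theta> - of_nat c*\<rho>*\<theta>^2)"
	using root_near[OF F_sf lf_complete[OF F_lf] KF thetaF theta_val theta_pow, of c] theta(2) by auto

definition "th c = (SOME w. w \<in> F \<and> poly g0 w = 0 \<and> vgt (2/real p) (w-\<theta> - of_nat c*\<rho>*\<theta>^2))"

lemma th: "th c \<in> F" "poly g0 (th c) = 0" "vgt (2/real p) (th c-\<theta> - of_nat c*\<rho>*\<theta>^2)"
	using someI_ex[OF th_ex[of c]] unfolding th_def by blast+

lemma rt2_val: "val (2/real p) (\<rho>*\<theta>^2)"
	using val_mul[OF rho(2) val_power[OF theta_val, of 2]] by simp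

lemma near_class_unique:
	assumes "vgt (2/real p) (x-\<theta> - of_nat c*\<rho>*\<theta>^2)" "vgt (2/real p) (x-\<theta> - of_nat d*\<rho>*\<theta>^2)"
	shows "[c = d] (mod p)"
proof -
	have "vgt (2/real p) ((x-\<theta> - of_nat d*\<rho>*\<theta>^2)-(x-\<theta> - of_nat c*\<rho>*\<theta>^2))"
		by (rule vgt_diff[OF assms(2,1)])
	hence "vgt (2/real p) (of_int (int c-int d)*(\<rho>*\<theta>^2))" by (simp add: algebra_simps)
	from vgt_divide[OF this rt2_val] val_nonzero[OF rt2_val] have "vgt 0 (of_int (int c-int d))" by simp
	hence "int p dvd int c-int d" using vgt_of_int_iff by blast
	hence "[int c = int d] (mod int p)" by (simp add: cong_iff_dvd_diff)
	thus ?thesis by (simp add: cong_int_iff)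
qed

lemma th_inj: "inj_on th {..<p}"
proof (rule inj_onI)
	fix c d assume cd: "c \<in> {..<p}" "d \<in> {..<p}" "th c = th d"
	show "c = d" using near_class_unique[of "th c" c d] th(3)[of c] th(3)[of d] cd(3) cd by (simp add: cong_less_modulus_unique_nat)
qed

text \<open>The \<open>p\<close> elements \<open>th c\<close> are distinct and so exhaust the roots
  of a polynomial of degree \<open>p\<close>; as they lie in \<open>F\<close>, every embedding over
  \<open>K\<close> maps \<open>F\<close> to itself.\<close>

lemma g0_roots: "{x. poly g0 x = 0} = th ` {..<p}"
proof (rule sym, rule card_seteq)
	have g: "g0 \<noteq> 0" using g0_deg by auto
	show "finite {x. poly g0 x = 0}" by (rule poly_roots_finite[OF g])
	show "th ` {..<p} \<subseteq> {x. poly g0 x = 0}" using th(2) by blast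
	show "card {x. poly g0 x = 0} \<le> card (th ` {..<p})" using card_poly_roots_bound[OF g] g0_deg card_image[OF th_inj] by simp
qed

definition "embK E h = (emb E h \<and> (\<forall>x\<in>K. h x = x))"

lemma map_K: "sfield E ==> K \<subseteq> E ==> embK E h ==> over_field K q ==> map_poly h q = q"
	by (rule poly_eqI) (simp add: coeff_map_emb[of E h] embK_def over_field_def)

lemma embK_root: "sfield E ==> K \<subseteq> E ==> embK E h ==> over_field K q ==> x \<in> E ==> poly q x = 0 ==> poly q (h x) = 0"
	using emb_poly[of E h q x] map_K[of E h q] over_mono[of K q E] emb_0[of E h] by (simp add: embK_def)

lemma embK_subset: "embK E h ==> E' \<subseteq> E ==> embK E' h"
	using emb_subset by (auto simp: embK_def)

lemma F_emb_root: assumes "embK F h" obtains c where "c < p" "h \<theta> = th c"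
proof -
	have "poly g0 (h \<theta>) = 0" by (rule embK_root[OF F_sf KF assms g0_over thetaF theta(2)])
	hence "h \<theta> \<in> th ` {..<p}" using g0_roots by blast
	thus thesis using that by blast
qed

lemma F_emb_sum: assumes "embK F h" "\<And>i. c i \<in> K" shows "h (\<Sum>i<p. c i*\<theta>^i) = (\<Sum>i<p. c i*h \<theta>^i)"
proof -
	have h: "emb F h" "\<And>x. x \<in> K ==> h x = x" using assms(1) by (auto simp: embK_def)
	have cF: "c i \<in> F" for i using assms(2) KF by blast
	show ?thesis
		using cF thetaF assms(2) h(2)
		by (subst emb_sum[OF F_sf h(1)]) (simp_all add: sf_mul[OF F_sf] sf_power[OF F_sf] emb_mul[OF F_sf h(1)] emb_power[OF F_sf h(1)])
qed

lemma F_emb_eq: assumes "embK F h" "embK F g" "h \<theta> = g \<theta>" "x \<in> F" shows "h x = g x"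
proof -
	obtain c where c: "x = (\<Sum>i<p. c i*\<theta>^i)" "\<And>i. c i \<in> K" using assms(4) F_span by (auto simp: lin_span_def)
	show ?thesis unfolding c(1) using F_emb_sum[OF assms(1) c(2)] F_emb_sum[OF assms(2) c(2)] assms(3) by simp
qed

lemma F_emb_mem: assumes "embK F h" "x \<in> F" shows "h x \<in> F"
proof -
	obtain c where c: "x = (\<Sum>i<p. c i*\<theta>^i)" "\<And>i. c i \<in> K" using assms(2) F_span by (auto simp: lin_span_def)
	obtain d where "h \<theta> = th d" using F_emb_root[OF assms(1)] by blast
	hence "h \<theta> \<in> F" using th(1) by simp
	thus ?thesis unfolding c(1) F_emb_sum[OF assms(1) c(2)] using c(2) KF
		by (intro sf_sum[OF F_sf] sf_mul[OF F_sf] sf_power[OF F_sf]) auto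
qed

lemma F_emb_vpres: assumes "embK F h" shows "vpres F h"
proof -
	have h: "emb (ext K \<theta>) h" "vpres K h" using assms by (auto simp: embK_def F_def vpres_def)
	have "poly g0 (h \<theta>) = 0" by (rule embK_root[OF F_sf KF assms g0_over thetaF theta(2)])
	from eisenstein_root_val(1)[OF g0_deg(1) p_gt_0 g0_deg(2) g0_vge _ this] have "val (1/real p) (h \<theta>)"
		using A_val(1) by (simp add: g0_0)
	hence "vge (1/real p) (h \<theta>)" by (simp add: val_vge)
	thus ?thesis
		using vpres_ext[OF F_orth _ _ K_sf h theta_val] F_span F_sf by (simp add: F_def)
qed

lemma sigma_ex: "\<exists>h. embK F h \<and> h \<theta> = th c"
proof -
	have i: "emb K (\<lambda>x. x)" by (simp add: emb_def)
	have "map_poly (\<lambda>x. x) g0 = g0" by (rule poly_eqI) (simp add: coeff_map_poly)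
	hence "poly (map_poly (\<lambda>x. x) g0) (th c) = 0" using th(2) by simp
	from emb_extend[OF K_sf i theta_q theta_indep this] show ?thesis by (auto simp: embK_def F_def)
qed

definition "\<sigma> = (SOME h. embK F h \<and> h \<theta> = th 1)"

lemma sigma: "embK F \<sigma>" "\<sigma> \<theta> = th 1"
	using someI_ex[OF sigma_ex[of 1]] unfolding \<sigma>_def by blast+

lemma sigma_emb: "emb F \<sigma>" and sigma_K: "x \<in> K ==> \<sigma> x = x"
	using sigma(1) by (auto simp: embK_def)

lemma sigma_near: "vgt (2/real p) (\<sigma> \<theta>-\<theta>-\<rho>*\<theta>^2)"
	using th(3)[of 1] sigma(2) by simp

lemma sigma_diff: "sim (\<sigma> \<theta>-\<theta>) (\<rho>*\<theta>^2)"
	by (rule simI[OF rt2_val sigma_near])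

lemma sigma_diff_val: "val (2/real p) (\<sigma> \<theta>-\<theta>)"
	by (rule sim_val[OF sigma_diff rt2_val])

lemma sigma_break: "has_break F p \<sigma> 1"
proof -
	have "has_break (ext K \<theta>) (1*p) \<sigma> 1"
	proof (rule has_break_step[OF K theta_ram(1)])
		show "\<not> int p dvd 1" using p_gt_1 by simp
		show "ext K \<theta> = lin_span K \<theta> p" using F_span F_def by simp
		show "sfield (ext K \<theta>)" "emb (ext K \<theta>) \<sigma>" using F_sf sigma_emb by (simp_all add: F_def)
		show "val ((of_int 1+1)/(real 1*real p)) (\<sigma> \<theta>-\<theta>)" using sigma_diff_val by simp
		show "vgt (of_int n/real 1+1/(real 1*real p)) (\<sigma> x-x)" if "x \<in> K" for x n
			using sigma_K[OF that] by simp
	qed simp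
	thus ?thesis by (simp add: F_def)
qed

text \<open>As \<sigma> fixes \<rho> and moves \<theta> by \<open>\<rho>*\<theta>^2\<close> to first
  order, its iterates add up these displacements; hence its powers reach every \<open>th c\<close>
  and it has order \<open>p\<close>.\<close>

lemma sigma_pow: "embK F (\<sigma> ^^ k) \<and> vgt (2/real p) ((\<sigma> ^^ k) \<theta>-\<theta> - of_nat k*\<rho>*\<theta>^2)"
proof (induction k)
	case 0 show ?case by (simp add: embK_def emb_def)
next
	case (Suc k)
	define x where "x = (\<sigma> ^^ k) \<theta>"
	have xF: "x \<in> F" using F_emb_mem[of "\<sigma> ^^ k"] Suc thetaF by (simp add: x_def)
	have "emb F (\<sigma> \<circ> (\<sigma> ^^ k))"
		using Suc sigma_emb F_emb_mem[of "\<sigma> ^^ k"] unfolding emb_def embK_def by auto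
	hence 1: "embK F (\<sigma> ^^ Suc k)" using Suc sigma_K by (simp add: embK_def)
	define y where "y = x-\<theta> - of_nat k*\<rho>*\<theta>^2"
	have rK: "of_nat k*\<rho> \<in> K" by (intro sf_mul[OF K_sf] sf_of_nat[OF K_sf] rho(1))
	have rF: "of_nat k*\<rho>*\<theta>^2 \<in> F" by (rule sf_mul[OF F_sf subsetD[OF KF rK] sf_power[OF F_sf thetaF]])
	have yF: "y \<in> F" unfolding y_def by (intro sf_diff[OF F_sf] xF thetaF rF)
	have yv: "vgt (2/real p) (\<sigma> y)"
		using Suc vpres_vgt[OF F_emb_vpres[OF sigma(1)] yF] by (simp add: y_def x_def)
	have "\<sigma> (of_nat k*\<rho>*\<theta>^2) = of_nat k*\<rho>*\<sigma> \<theta>^2"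
		using emb_mul[OF F_sf sigma_emb, of "of_nat k*\<rho>" "\<theta>^2"] rK KF sf_power[OF F_sf thetaF]
			emb_power[OF F_sf sigma_emb thetaF] sigma_K[OF rK] by auto
	hence "\<sigma> y = \<sigma> x-\<sigma> \<theta> - of_nat k*\<rho>*\<sigma> \<theta>^2"
		unfolding y_def using xF thetaF rF by (simp add: emb_diff[OF F_sf sigma_emb] sf_diff[OF F_sf])
	hence e: "\<sigma> x-\<theta> - of_nat (Suc k)*\<rho>*\<theta>^2 = \<sigma> y+(\<sigma> \<theta>-\<theta>-\<rho>*\<theta>^2) + of_nat k*\<rho>*((\<sigma> \<theta>-\<theta>)*(\<sigma> \<theta>+\<theta>))"
		by (simp add: algebra_simps power2_eq_square)
	have "vge (1/real p) (\<sigma> \<theta>)" using vpres_vge[OF F_emb_vpres[OF sigma(1)] thetaF] theta_val by (simp add: val_vge)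
	hence "vge (0+0+(2/real p+1/real p)) (of_nat k*\<rho>*((\<sigma> \<theta>-\<theta>)*(\<sigma> \<theta>+\<theta>)))"
		using rho(2) sigma_diff_val theta_val by (intro vge_mul vge_add) (simp_all add: val_vge)
	hence "vgt (2/real p) (of_nat k*\<rho>*((\<sigma> \<theta>-\<theta>)*(\<sigma> \<theta>+\<theta>)))"
		by (rule vge_vgt) (use p_gt_0 in \<open>simp add: divide_strict_right_mono\<close>)
	from vgt_add[OF vgt_add[OF yv sigma_near] this]
	have "vgt (2/real p) (\<sigma> x-\<theta> - of_nat (Suc k)*\<rho>*\<theta>^2)" unfolding e .
	moreover have "(\<sigma> ^^ Suc k) \<theta> = \<sigma> x" by (simp add: x_def)
	ultimately show ?case using 1 by (simp only:)
qed

lemma sigma_pow_th: "(\<sigma> ^^ c) \<theta> = th (c mod p)"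
proof -
	obtain d where d: "d < p" "(\<sigma> ^^ c) \<theta> = th d" using F_emb_root sigma_pow[of c] by blast
	show ?thesis using near_class_unique[of "th d" c d] sigma_pow[of c] th(3)[of d] d(2) d(1) by (simp add: cong_def)
qed

lemma F_emb_sigma_pow: assumes "embK F h" obtains c where "c < p" "\<And>x. x \<in> F ==> h x = (\<sigma> ^^ c) x"
proof -
	obtain c where c: "c < p" "h \<theta> = th c" using F_emb_root[OF assms] .
	have "h x = (\<sigma> ^^ c) x" if "x \<in> F" for x
		using F_emb_eq[OF assms conjunct1[OF sigma_pow] _ that] c sigma_pow_th[of c] by simp
	thus thesis using that c(1) by blast
qed

lemma sigma_p: "x \<in> F ==> (\<sigma> ^^ p) x = x"
	using F_emb_eq[OF conjunct1[OF sigma_pow[of p]] conjunct1[OF sigma_pow[of 0]], of x]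
		sigma_pow_th[of p] sigma_pow_th[of 0] by simp

subsection \<open>The Artin-Schreier generator of \<open>L\<close> over the subfield\<close>

definition "\<delta> = \<pi>^p-\<theta>"

lemma pi0: "\<pi> \<noteq> 0" and theta0: "\<theta> \<noteq> 0"
	using val_nonzero pi_val theta_val by blast+

lemma theta_sim: "sim \<theta> (\<pi>^p)"
	by (rule simI[OF pip_val vgt_mono[OF theta(3)]]) (simp add: divide_right_mono)

text \<open>In the Taylor expansion of \<open>poly g0 (\<theta> + \<delta>) = - R\<close> the linear
  term dominates, because \<delta> has valuation greater than \<open>2/p\<close>; so \<delta> has
  the leading term of \<open>R/(A1*\<theta>^(p-2))\<close>.\<close>

lemma delta: "sim \<delta> (Am*\<pi> ^ m/(A1*\<theta>^(p-2)))"
	and delta_val: "val (((real p-1)*real l+real p)/real p^2) \<delta>"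
proof -
	have s: "(\<Sum>i\<le>p. tay \<theta> i*\<delta>^i) = - R" using g0_taylor[of \<theta> \<delta>] g0_pi by (simp add: \<delta>_def)
	have d0: "\<delta> \<noteq> 0"
	proof
		assume d: "\<delta> = 0"
		have "(\<Sum>i\<le>p. tay \<theta> i*\<delta>^i) = (\<Sum>i\<in>{0}. tay \<theta> i*\<delta>^i)"
			by (rule sum.mono_neutral_right) (auto simp: d power_0_left)
		thus False using s val_nonzero[OF R_val] by (simp add: tay_0 theta(2))
	qed
	then obtain d where d: "val d \<delta>" using val_ex by blast
	have d2: "2/real p < d" using d theta(3) by (simp add: \<delta>_def vgt_minus_commute val_vgt)
	have t1: "val (2-2/real p+d) (tay \<theta> 1*\<delta>)" by (rule val_mul[OF tay_1(2)[OF theta_val] d])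
	have "vgt (2-2/real p+d) (\<Sum>i\<in>{2..p}. tay \<theta> i*\<delta>^i)"
	proof (rule vgt_sum)
		fix i assume i: "i \<in> {2..p}"
		show "vgt (2-2/real p+d) (tay \<theta> i*\<delta>^i)"
		proof (cases "i = p")
			case True
			have "(real p-1)*(2/real p) < (real p-1)*d" using d2 p_gt_1 by (intro mult_strict_left_mono) auto
			moreover have "(real p-1)*(2/real p) = 2-2/real p" using p_gt_0 by (simp add: field_simps)
			ultimately have "2-2/real p+d < real p*d" by (simp add: algebra_simps)
			thus ?thesis using val_power[OF d, of p] True by (simp add: tay_p val_vgt)
		next
			case False
			have "vge (2-(1+real i)/real p+real i*d) (tay \<theta> i*\<delta>^i)"
				using i False d by (intro vge_mul tay_vge[OF theta_val] vge_power) (auto simp: val_vge)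
			moreover have "2-2/real p+d < 2-(1+real i)/real p+real i*d"
			proof -
				have "(real i-1)*(1/real p) < (real i-1)*d"
				proof (rule mult_strict_left_mono)
					have "1/real p < 2/real p" using p_gt_0 by (intro divide_strict_right_mono) auto
					thus "1/real p < d" using d2 by linarith
				qed (use i in auto)
				moreover have "2-(1+real i)/real p = 2-2/real p-(real i-1)*(1/real p)"
					using p_gt_0 by (simp add: field_simps)
				ultimately show ?thesis by (simp add: algebra_simps)
			qed
			ultimately show ?thesis by (rule vge_vgt)
		qed
	qed
	moreover have "(\<Sum>i\<le>p. tay \<theta> i*\<delta>^i) = tay \<theta> 1*\<delta>+(\<Sum>i\<in>{2..p}. tay \<theta> i*\<delta>^i)"
	proof -
		have "{..p} = insert 0 (insert 1 {2..p})" using p_gt_1 by auto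
		thus ?thesis by (simp add: tay_0 theta(2))
	qed
	ultimately have "sim (- R) (tay \<theta> 1*\<delta>)" using sim_add[OF t1] s by simp
	hence r: "sim (tay \<theta> 1*\<delta>) (- R)" by (rule sim_sym)
	have "sim (tay \<theta> 1*\<delta>/tay \<theta> 1) (- R/(- A1*\<theta>^(p-2)))"
		by (rule sim_divide[OF r tay_1(1)[OF theta_val]])
	also have "tay \<theta> 1*\<delta>/tay \<theta> 1 = \<delta>" using val_nonzero[OF tay_1(2)[OF theta_val]] by simp
	also have "- R/(- A1*\<theta>^(p-2)) = R/(A1*\<theta>^(p-2))" by simp
	also have "sim (R/(A1*\<theta>^(p-2))) (Am*\<pi> ^ m/(A1*\<theta>^(p-2)))"
		using theta0 val_nonzero[OF A_val(2)] by (intro sim_divide R_sim sim_refl) simp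
	finally show s1: "sim \<delta> (Am*\<pi> ^ m/(A1*\<theta>^(p-2)))" .
	have "val (2+real m*(1/real (p^2))-(1+real (p-2)*(1/real p))) (Am*\<pi> ^ m/(A1*\<theta>^(p-2)))"
		by (intro val_divide val_mul val_power A_val pi_val theta_val)
	moreover have "2+real m*(1/real (p^2))-(1+real (p-2)*(1/real p)) = ((real p-1)*real l+real p)/real p^2"
		unfolding m_real using p3 by (simp add: power2_eq_square field_simps)
	ultimately show "val (((real p-1)*real l+real p)/real p^2) \<delta>" using sim_val[OF s1] by simp
qed

lemma delta_gt: "1/real p < ((real p-1)*real l+real p)/real p^2"
proof -
	have "0 < (real p-1)*real l" using l by simp
	hence "real p/real p^2 < ((real p-1)*real l+real p)/real p^2"
		using p_gt_0 by (intro divide_strict_right_mono) auto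
	thus ?thesis using p_gt_0 by (simp add: power2_eq_square)
qed

lemma inv_theta_diff:
	assumes j: "0 < j" "j \<le> l"
	shows "sim (1/\<pi>^(p*j)-1/\<theta>^j) (- of_nat j*\<delta>/(\<pi>^(p*j)*\<theta>))"
proof -
	have s: "sim (\<pi>^(p*j)-\<theta>^j) (of_nat j*\<theta>^(j-1)*\<delta>)" using sim_power_diff[OF theta_val delta_val delta_gt l_ndvd[OF j]] by (simp add: \<delta>_def power_mult)
	have "1/\<pi>^(p*j)-1/\<theta>^j = - (\<pi>^(p*j)-\<theta>^j)/(\<pi>^(p*j)*\<theta>^j)"
		using pi0 theta0 by (simp add: field_simps)
	also have "sim \<dots> (- (of_nat j*\<theta>^(j-1)*\<delta>)/(\<pi>^(p*j)*\<theta>^j))"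
		using pi0 theta0 by (intro sim_divide sim_minus s sim_refl) simp
	also have "- (of_nat j*\<theta>^(j-1)*\<delta>)/(\<pi>^(p*j)*\<theta>^j) = - of_nat j*\<delta>/(\<pi>^(p*j)*\<theta>)"
	proof -
		have "\<theta>^j = \<theta>*\<theta>^(j-1)" using j(1) by (simp add: power_eq_if)
		thus ?thesis by simp
	qed
	finally show ?thesis .
qed

text \<open>The sign of this valuation matters: it is \<open>-l/p^2\<close> for
  \<open>j = l\<close>, and positive for \<open>j < l\<close> since \<open>l < p\<close>. So
  \<open>1/\<pi>^(p*j)\<close> may be replaced by \<open>1/\<theta>^j\<close> modulo the maximal
  ideal except at the top pole order.\<close>

lemma inv_theta_diff_val:
	assumes j: "0 < j" "j \<le> l"
	shows "val (((real p-1)*real l-real p*real j)/real p^2) (1/\<pi>^(p*j)-1/\<theta>^j)"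
proof -
	have "val (0+((real p-1)*real l+real p)/real p^2-(real (p*j)*(1/real (p^2))+1/real p))
		(- of_nat j*\<delta>/(\<pi>^(p*j)*\<theta>))"
		using val_of_nat[OF l_ndvd[OF j]] by (intro val_divide val_mul val_power delta_val pi_val theta_val) simp
	moreover have "0+((real p-1)*real l+real p)/real p^2-(real (p*j)*(1/real (p^2))+1/real p)
		= ((real p-1)*real l-real p*real j)/real p^2"
		by (simp add: field_simps power2_eq_square)
	ultimately show ?thesis using sim_val[OF inv_theta_diff[OF j]] by simp
qed

text \<open>With \<theta> replaced by \<open>\<pi>^p\<close> and \<open>\<pi>^(p^2)\<close> by
  \<open>-A0\<close>, the powers of \<pi> collect to \<open>1/\<pi>^l\<close>. The remaining factor
  is \<open>l*Am/(A1*A0)\<close>, the quantity that the hypothesis on \<eta> makes a power with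
  exponent \<open>p-1\<close>.\<close>

lemma D_sim: "sim (1/\<pi>^(p*l)-1/\<theta>^l) (\<eta>^(p-1)/\<pi>^l)"
proof -
	have l0: "0 < l" using l by simp
	have "sim (1/\<pi>^(p*l)-1/\<theta>^l) (- of_nat l*\<delta>/(\<pi>^(p*l)*\<theta>))"
		by (rule inv_theta_diff[OF l0 order_refl])
	also have "sim \<dots> (- of_nat l*(Am*\<pi> ^ m/(A1*(\<pi>^p)^(p-2)))/(\<pi>^(p*l)*\<pi>^p))"
	proof (intro sim_divide sim_mult sim_refl theta_sim)
		have "sim (A1*\<theta>^(p-2)) (A1*(\<pi>^p)^(p-2))"
			using val_nonzero[OF A_val(2)] by (intro sim_mult sim_power theta_sim sim_refl)
		hence "sim (Am*\<pi> ^ m/(A1*\<theta>^(p-2))) (Am*\<pi> ^ m/(A1*(\<pi>^p)^(p-2)))"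
			using val_nonzero[OF A_val(3)] pi0 by (intro sim_divide sim_refl) simp_all
		with delta show "sim \<delta> (Am*\<pi> ^ m/(A1*(\<pi>^p)^(p-2)))" by (rule sim_trans)
	qed (use pi0 val_nonzero[OF val_of_nat[OF l_ndvd[OF l0 order_refl]]] in simp_all)
	also have "- of_nat l*(Am*\<pi> ^ m/(A1*(\<pi>^p)^(p-2)))/(\<pi>^(p*l)*\<pi>^p)
		 = of_nat l*Am/(A1 * - (\<pi>^(p^2)))/\<pi>^l"
	proof -
		have "m+(p^2+l) = p*(p-2)+(p*l+p)"
		proof -
			have "m+p+l = p*l"
			proof -
				have "m+p+l = (p-1)*l+l" using m by simp
				also have "\<dots> = p*l" using p_gt_0 by (metis Suc_pred' mult_Suc add.commute)
				finally show ?thesis .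
			qed
			moreover have "p*(p-2)+2*p = p^2"
			proof -
				have "p-2+2 = p" using p3 by simp
				hence "p*(p-2)+p*2 = p*p" by (metis distrib_left)
				thus ?thesis by (simp add: power2_eq_square)
			qed
			ultimately show ?thesis by linarith
		qed
		hence "\<pi> ^ m*(\<pi>^(p^2)*\<pi>^l) = (\<pi>^p)^(p-2)*(\<pi>^(p*l)*\<pi>^p)"
			by (simp only: power_add[symmetric] power_mult[symmetric])
		thus ?thesis using pi0 val_nonzero[OF A_val(2)] by (simp add: field_simps)
	qed
	also have "sim \<dots> (of_nat l*Am/(A1 * - (- A0))/\<pi>^l)"
		using pi0 val_nonzero[OF A_val(2)] val_nonzero[OF A_val(3)] val_nonzero[OF val_of_nat[OF l_ndvd[OF l0 order_refl]]]
		by (intro sim_divide sim_mult sim_minus pi_pow sim_refl) simp_all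
	also have "sim \<dots> (\<eta>^(p-1)/\<pi>^l)"
		using eta(3) pi0 by (intro sim_divide sim_refl) (simp_all add: A0_def A1_def Am_def)
	finally show ?thesis .
qed

text \<open>The leading term \<open>c/\<pi>^i\<close> is peeled off: its p-th power is congruent to
  \<open>c^p/\<theta>^i\<close> because \<open>i < l\<close>, and what is left has smaller pole
  order.\<close>

lemma wp_pole_F:
	"j < l ==> x \<in> L ==> vge (- real j/real p^2) x ==> \<exists>b\<in>F. vge (- real j/real p) b \<and> vgt 0 (x^p-b)"
proof (induction j arbitrary: x)
	case 0
	then obtain c where c: "c \<in> K" "vge 0 c" "vgt 0 (x - c)" using L_residue by auto
	have "vgt 0 (x^p - c^p)" by (rule vgt_power_diff) (use 0 c in simp_all)
	moreover have "c^p \<in> F" using c KF by (intro sf_power[OF F_sf]) auto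
	moreover have "vge 0 (c^p)" using vge_power[OF c(2), of p] by simp
	ultimately show ?case by auto
next
	case (Suc j)
	define i where "i = Suc j"
	have ri: "real j = real i-1" by (simp add: i_def)
	note prems = Suc.prems[folded i_def]
	define y where "y = x*\<pi>^i"
	have "vge (- real (i)/real p^2+real (i)*(1/real (p^2))) y"
		unfolding y_def using prems(3) pi_val by (intro vge_mul vge_power) (auto simp: val_vge)
	hence yv: "vge 0 y" by simp
	have yL: "y \<in> L" unfolding y_def by (intro sf_mul[OF L_sf] sf_power[OF L_sf] prems(2) piL)
	obtain c where c: "c \<in> K" "vge 0 c" "vgt 0 (y - c)" using L_residue[OF yL yv] by blast
	define u where "u = c/\<pi>^i"
	define w where "w = x-u"
	have uL: "u \<in> L" unfolding u_def using c(1) KL piL by (intro sf_divide[OF L_sf] sf_power[OF L_sf]) auto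
	have wL: "w \<in> L" unfolding w_def by (rule sf_diff[OF L_sf prems(2) uL])
	have we: "w = (y - c)/\<pi>^i" using pi0 by (simp add: w_def u_def y_def field_simps)
	have "vgt (0-real (i)*(1/real (p^2))) w" unfolding we by (intro vgt_divide c(3) val_power pi_val)
	hence "vgt (of_int (- int (i))/real (p^2)) w" by simp
	from lf_vgt_vge[OF L_lf wL this] have wv: "vge (- real j/real p^2) w" by (simp add: ri)
	obtain b where b: "b \<in> F" "vge (- real j/real p) b" "vgt 0 (w^p-b)"
		using Suc.IH[OF _ wL wv] prems(1) i_def by auto
	have j: "0 < i" "i \<le> l" using prems(1) i_def by auto
	have lp: "real l < real p" using l by linarith
	have small: "- 1/real p < - real (i)/real p^2" "- 1/real p < - real j/real p^2"
	proof -
		have "real (i) < real p" "real j < real p" using j lp ri by linarith+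
		thus "- 1/real p < - real (i)/real p^2" "- 1/real p < - real j/real p^2"
			by (simp_all add: field_simps power2_eq_square)
	qed
	have uv: "vge (- real (i)/real p^2) u"
		using vge_divide[OF c(2) val_power[OF pi_val, of "i"]] by (simp add: u_def)
	have 1: "vgt 0 (x^p-(u^p+w^p))"
		using frob_add_small[OF vge_vgt[OF uv small(1)] vge_vgt[OF wv small(2)]] by (simp add: w_def algebra_simps)
	have "0 < ((real p-1)*real l-real p*real (i))/real p^2"
	proof -
		have "real p*real (i) \<le> real p*(real l-1)"
			using prems(1) by (intro mult_left_mono) auto
		hence "real p*real (i) < (real p-1)*real l"
		proof -
			assume a: "real p*real (i) \<le> real p*(real l-1)"
			have "real p*(real l-1) < (real p-1)*real l" using lp by (simp add: algebra_simps)
			with a show ?thesis by linarith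
		qed
		thus ?thesis using p_gt_0 by simp
	qed
	hence "vgt 0 (1/\<pi>^(p*i)-1/\<theta>^i)" using inv_theta_diff_val[OF j] val_vgt by blast
	from vgt_mul'[OF vge_power[OF c(2), of p] this]
	have 2: "vgt 0 (u^p - c^p/\<theta>^i)"
		by (simp add: u_def power_divide right_diff_distrib power_mult[symmetric] mult.commute)
	define b' where "b' = c^p/\<theta>^i+b"
	have "vgt 0 (x^p-b')"
	proof -
		have "x^p-b' = (x^p-(u^p+w^p))+(u^p - c^p/\<theta>^i)+(w^p-b)" by (simp add: b'_def)
		thus ?thesis using vgt_add[OF vgt_add[OF 1 2] b(3)] by (simp only:)
	qed
	moreover have "b' \<in> F" unfolding b'_def using c(1) KF thetaF b(1)
		by (intro sf_add[OF F_sf] sf_divide[OF F_sf] sf_power[OF F_sf]) auto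
	moreover have "vge (- real (i)/real p) b'"
		unfolding b'_def
	proof (rule vge_add)
		show "vge (- real (i)/real p) (c^p/\<theta>^i)"
			using vge_divide[OF vge_power[OF c(2), of p] val_power[OF theta_val, of "i"]] by simp
		show "vge (- real (i)/real p) b" by (rule vge_mono[OF b(2)]) (intro divide_right_mono; simp add: ri)
	qed
	ultimately show ?case unfolding i_def[symmetric] by blast
qed

text \<open>Chosen so that \<open>s^p*\<eta>^(p-1) = s\<close>: multiplying the difference in
  \<open>D_sim\<close> by \<open>s^p\<close> gives the leading term
  \<open>s/\<pi>^l\<close>.\<close>

definition "s = inverse \<eta>"

lemma s: "s \<in> K" "val 0 s" "s*\<eta> = 1"
	using sf_inverse[OF K_sf eta(1)] val_inverse[OF eta(2)] val_nonzero[OF eta(2)] by (simp_all add: s_def)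

lemma lp: "real l < real p"
	using l by linarith

text \<open>The constant of the Artin-Schreier equation comes from \<open>\<pi>^(-lp) = \<theta>^(-l) + D\<close>, where \<open>D\<close> is
	equivalent to \<open>\<eta>^(p-1) \<pi>^(-l)\<close>: after scaling by \<open>s^p\<close> the element \<open>D\<close> becomes the root.\<close>

lemma AS_generator: "\<exists>a\<in>F. \<exists>y\<in>L. wp y = a \<and> sim a (s^p/\<theta>^l)"
proof -
	define D where "D = 1/\<pi>^(p*l)-1/\<theta>^l"
	define x where "x = s^p*D"
	have sp: "val 0 (s^p)" using val_power[OF s(2), of p] by simp
	have lv: "val (- real l/real p^2) (s/\<pi>^l)" using val_divide[OF s(2) val_power[OF pi_val, of l]] by simp
	have "sim x (s^p*(\<eta>^(p-1)/\<pi>^l))"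
		unfolding x_def D_def by (intro sim_mult sim_refl D_sim val_nonzero[OF sp])
	also have "s^p*(\<eta>^(p-1)/\<pi>^l) = s/\<pi>^l"
	proof -
		have "s^p = s * s^(p-1)" using p_gt_0 by (metis power_minus_mult mult.commute)
		hence "s^p*\<eta>^(p-1) = s*(s*\<eta>)^(p-1)" by (simp add: power_mult_distrib)
		thus ?thesis using s(3) by simp
	qed
	finally have xs: "sim x (s/\<pi>^l)" .
	have DL: "D \<in> L" unfolding D_def using piL theta(1) by (intro sf_diff[OF L_sf] sf_divide[OF L_sf] sf_1[OF L_sf] sf_power[OF L_sf])
	have xL: "x \<in> L" unfolding x_def using s(1) KL DL by (intro sf_mul[OF L_sf] sf_power[OF L_sf]) auto
	\<comment> \<open>\<open>x\<close> and \<open>s/\<pi>^l\<close> share the leading term but need not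
	  be congruent; their difference has pole order below \<open>l\<close>, so its p-th power still has
	  a representative in \<open>F\<close>.\<close>
	define w where "w = x - s/\<pi>^l"
	have wL: "w \<in> L" unfolding w_def using xL s(1) KL piL by (intro sf_diff[OF L_sf] sf_divide[OF L_sf] sf_power[OF L_sf]) auto
	have "vgt (- real l/real p^2) w" unfolding w_def by (rule simD[OF xs lv])
	hence "vgt (of_int (- int l)/real (p^2)) w" by simp
	from lf_vgt_vge[OF L_lf wL this] have wv: "vge (- real (l-1)/real p^2) w" using l by simp
	have "l-1 < l" using l by simp
	from wp_pole_F[OF this wL wv] obtain b where b: "b \<in> F" "vge (- real (l-1)/real p) b" "vgt 0 (w^p-b)" by blast
	have small: "- 1/real p < - real l/real p^2" "- 1/real p < - real (l-1)/real p^2"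
	proof -
		have "real l < real p" "real (l-1) < real p" using lp by linarith+
		thus "- 1/real p < - real l/real p^2" "- 1/real p < - real (l-1)/real p^2"
			by (simp_all add: field_simps power2_eq_square)
	qed
	have xsm: "vgt (-1/real p) x" using small(1) sim_val[OF xs lv] by (simp add: val_vgt)
	have 1: "vgt 0 (x^p-((s/\<pi>^l)^p+w^p))"
	proof -
		have "vgt (-1/real p) (s/\<pi>^l)" using lv small(1) by (simp add: val_vgt)
		from frob_add_small[OF this vge_vgt[OF wv small(2)]] show ?thesis by (simp add: w_def algebra_simps)
	qed
	define a where "a = s^p/\<theta>^l+b"
	have sE: "(s/\<pi>^l)^p = s^p*D + s^p/\<theta>^l"
		by (simp add: D_def power_divide algebra_simps flip: power_mult)
	have "wp x-a = (x^p-((s/\<pi>^l)^p+w^p))+(w^p-b)"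
		unfolding sE a_def wp_def by (simp add: x_def)
	hence wa: "vgt 0 (wp x-a)" using vgt_add[OF 1 b(3)] by simp
	have aF: "a \<in> F" unfolding a_def using s(1) KF thetaF b(1)
		by (intro sf_add[OF F_sf] sf_divide[OF F_sf] sf_power[OF F_sf]) auto
	obtain y where y: "y \<in> L" "wp y = a"
		using hensel_wp[OF L_sf lf_complete[OF L_lf] xL xsm _ wa] aF FL by blast
	have tv: "val (- real l/real p) (s^p/\<theta>^l)"
		using val_divide[OF sp val_power[OF theta_val, of l]] by simp
	have "vgt (- real l/real p) b"
	proof (rule vge_vgt[OF b(2)])
		have "real (l-1) < real l" using l by simp
		thus "- real l/real p < - real (l-1)/real p" using p_gt_0 by (intro divide_strict_right_mono) auto
	qed
	hence "sim a (s^p/\<theta>^l)" unfolding a_def by (rule sim_add[OF tv])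
	thus ?thesis using aF y by blast
qed

text \<open>To first order \<sigma> sends \<theta> to \<open>\<theta> + \<rho>*\<theta>^2\<close>,
  so \<open>\<sigma> - 1\<close> acts on \<open>c/\<theta>^i\<close> like the derivation with value
  \<open>\<rho>*\<theta>^2\<close> at \<theta>: the pole order drops by one with factor
  \<open>-\<rho>*i\<close>, a unit. The rest of \<open>x\<close> stays negligible because the break
  is 1.\<close>

lemma sigma_diff_pole:
	assumes x: "x \<in> F" "sim x (c/\<theta>^i)" and c: "c \<in> K" "val 0 c" and i: "0 < i" "i \<le> l"
	shows "sim (\<sigma> x-x) (- \<rho> * of_nat i * c/\<theta>^(i-1))"
proof -
	have cF: "c \<in> F" using c(1) KF by blast
	define y where "y = c/\<theta>^i"
	have yF: "y \<in> F" unfolding y_def by (intro sf_divide[OF F_sf] sf_power[OF F_sf] cF thetaF)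
	have yv: "val (- real i/real p) y" unfolding y_def using val_divide[OF c(2) val_power[OF theta_val, of i]] by simp
	define w where "w = x-y"
	have wF: "w \<in> F" unfolding w_def by (rule sf_diff[OF F_sf x(1) yF])
	have ws: "vgt ((1-real i)/real p) (\<sigma> w-w)"
	proof (cases "w = 0")
		case True thus ?thesis by (simp add: emb_0[OF F_sf sigma_emb])
	next
		case False
		then obtain n :: int where n: "val (of_int n/real p) w" using lf_val[OF F_lf wF] by blast
		have "real_of_int (- int i) < of_int n"
			using val_vgt[OF n] simD[OF x(2)[folded y_def] yv] divide_less_cancel[of "of_int (- int i)" "real p" "of_int n"] by (simp add: w_def)
		hence "- int i < n" by linarith
		hence "- int i+1 \<le> n" by simp
		hence "real_of_int (- int i+1) \<le> of_int n" by linarith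
		hence "(1-real i)/real p < (of_int n+1)/real p"
			using p_gt_0 by (intro divide_strict_right_mono) auto
		thus ?thesis by (rule vge_vgt[OF has_breakD(1)[OF sigma_break wF n]])
	qed
	define e where "e = \<sigma> \<theta>-\<theta>"
	have se: "\<sigma> \<theta> = \<theta>+e" by (simp add: e_def)
	have "sim (\<sigma> \<theta>) \<theta>"
		unfolding se by (rule sim_add[OF theta_val]) (use sigma_diff_val p_gt_0 in \<open>simp add: e_def val_vgt divide_strict_right_mono\<close>)
	have "1/real p < 2/real p" using p_gt_0 by (simp add: divide_strict_right_mono)
	from sim_power_diff[OF theta_val sigma_diff_val[folded e_def] this l_ndvd[OF i]]
	have sp: "sim (\<sigma> \<theta>^i-\<theta>^i) (of_nat i*\<theta>^(i-1)*e)" by (simp add: se)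
	have "\<sigma> y-y = - c*(\<sigma> \<theta>^i-\<theta>^i)/(\<sigma> \<theta>^i*\<theta>^i)"
	proof -
		have "\<sigma> y = c/\<sigma> \<theta>^i" unfolding y_def using emb_divide[OF F_sf sigma_emb cF sf_power[OF F_sf thetaF]]
				emb_power[OF F_sf sigma_emb thetaF] sigma_K[OF c(1)] by simp
		thus ?thesis using theta0 emb_eq_0[OF F_sf sigma_emb thetaF] by (simp add: y_def field_simps)
	qed
	also have "sim \<dots> (- c*(of_nat i*\<theta>^(i-1)*(\<rho>*\<theta>^2))/(\<theta>^i*\<theta>^i))"
	proof (intro sim_divide sim_mult sim_refl sim_power \<open>sim (\<sigma> \<theta>) \<theta>\<close>)
		show "sim (\<sigma> \<theta>^i-\<theta>^i) (of_nat i*\<theta>^(i-1)*(\<rho>*\<theta>^2))"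
			by (rule sim_trans[OF sp]) (use theta0 val_nonzero[OF val_of_nat[OF l_ndvd[OF i]]] sigma_diff in \<open>auto simp: e_def intro!: sim_mult sim_refl\<close>)
	qed (use val_nonzero[OF c(2)] theta0 in simp_all)
	also have "- c*(of_nat i*\<theta>^(i-1)*(\<rho>*\<theta>^2))/(\<theta>^i*\<theta>^i) = - \<rho> * of_nat i * c/\<theta>^(i-1)"
	proof -
		show ?thesis using i(1) theta0 by (simp add: power_eq_if)
	qed
	finally have sy: "sim (\<sigma> y-y) (- \<rho> * of_nat i * c/\<theta>^(i-1))" .
	have "val (0+0+0-real (i-1)*(1/real p)) (- \<rho> * of_nat i * c/\<theta>^(i-1))"
		using rho(2) val_of_nat[OF l_ndvd[OF i]] c(2) by (intro val_divide val_mul val_power theta_val) simp_all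
	hence tv: "val ((1-real i)/real p) (- \<rho> * of_nat i * c/\<theta>^(i-1))" using i by (simp add: diff_divide_distrib)
	have yv2: "val ((1-real i)/real p) (\<sigma> y-y)" by (rule sim_val[OF sy tv])
	have "\<sigma> x-x = (\<sigma> y-y)+(\<sigma> w-w)"
		using emb_add[OF F_sf sigma_emb yF wF] by (simp add: w_def)
	hence "sim (\<sigma> x-x) (\<sigma> y-y)" using sim_add[OF yv2 ws] by simp
	thus ?thesis using sy by (rule sim_trans)
qed

text \<open>\<open>\<alpha> k\<close> is the iterate of order \<open>l-k\<close> of
  \<open>\<sigma> - 1\<close> on the constant of the equation of \<open>L\<close>. The factors
  \<open>l-j\<close> met on the way multiply to a number prime to \<open>p\<close>, and the factors
  \<open>-\<rho>\<close> to the power in \<open>\<alpha> 0\<close>; from that residue comes the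
  polynomial \<open>U\<close>.\<close>

lemma alpha_ex:
	"\<exists>\<alpha>. (\<forall>k\<le>l. \<alpha> k \<in> F \<and> val (- real k/real p) (\<alpha> k)) \<and> (\<forall>k<l. \<sigma> (\<alpha> (Suc k)) = \<alpha> (Suc k)+\<alpha> k) \<and>
		 (\<exists>y\<in>L. wp y = \<alpha> l) \<and> (\<exists>n. \<not> p dvd n \<and> sim (\<alpha> 0) (of_nat n*(- \<rho>)^l * s^p))"
proof -
	obtain a y where a: "a \<in> F" "y \<in> L" "wp y = a" "sim a (s^p/\<theta>^l)" using AS_generator by blast
	define it where "it j = ((\<lambda>x. \<sigma> x-x) ^^ j) a" for j
	have it: "it j \<in> F \<and> (\<exists>n. \<not> p dvd n \<and> sim (it j) (of_nat n*(- \<rho>)^j * s^p/\<theta>^(l-j)))" if "j \<le> l" for j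
		using that
	proof (induction j)
		case 0
		have "\<not> p dvd 1" using p_gt_1 by simp
		thus ?case using a by (auto simp: it_def intro!: exI[of _ 1])
	next
		case (Suc j)
		then obtain n where n: "it j \<in> F" "\<not> p dvd n" "sim (it j) (of_nat n*(- \<rho>)^j * s^p/\<theta>^(l-j))" by auto
		define c where "c = of_nat n*(- \<rho>)^j * s^p"
		have cK: "c \<in> K" unfolding c_def by (intro sf_mul[OF K_sf] sf_power[OF K_sf] sf_of_nat[OF K_sf] sf_minus[OF K_sf] rho(1) s(1))
		have "val (0+real j*0+real p*0) c"
			unfolding c_def using rho(2) by (intro val_mul val_power val_of_nat n(2) s(2)) simp
		hence cv: "val 0 c" by simp
		have i: "0 < l-j" "l-j \<le> l" using Suc.prems by auto
		have sS: "sim (\<sigma> (it j)-it j) (- \<rho> * of_nat (l-j) * c/\<theta>^(l-j-1))"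
			by (rule sigma_diff_pole[OF n(1) n(3)[folded c_def] cK cv i])
		have "it (Suc j) = \<sigma> (it j)-it j" by (simp add: it_def)
		have "- \<rho> * of_nat (l-j) * c/\<theta>^(l-j-1) = of_nat (n*(l-j))*(- \<rho>)^Suc j * s^p/\<theta>^(l-Suc j)"
			by (simp add: c_def)
		hence "sim (it (Suc j)) (of_nat (n*(l-j))*(- \<rho>)^Suc j * s^p/\<theta>^(l-Suc j))"
			using sS \<open>it (Suc j) = \<sigma> (it j) - it j\<close> by (simp only:)
		moreover have "\<not> p dvd n*(l-j)" using n(2) l_ndvd[OF i] prime_p prime_dvd_mult_iff by blast
		moreover have "it (Suc j) \<in> F"
			using \<open>it (Suc j) = \<sigma> (it j) - it j\<close> n(1) F_emb_mem[OF sigma(1) n(1)] sf_diff[OF F_sf] by simp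
		ultimately show ?case by blast
	qed
	define \<alpha> where "\<alpha> k = it (l - k)" for k
	have "\<alpha> k \<in> F \<and> val (- real k/real p) (\<alpha> k)" if "k \<le> l" for k
	proof -
		obtain n where n: "it (l - k) \<in> F" "\<not> p dvd n" "sim (it (l - k)) (of_nat n*(- \<rho>)^(l - k) * s^p/\<theta>^(l-(l - k)))"
			using it[of "l - k"] by auto
		have "val (0+real (l - k)*0+real p*0-real k*(1/real p)) (of_nat n*(- \<rho>)^(l - k) * s^p/\<theta> ^ k)"
			using rho(2) by (intro val_divide val_mul val_power val_of_nat n(2) s(2) theta_val) simp
		hence "val (- real k/real p) (of_nat n*(- \<rho>)^(l - k) * s^p/\<theta>^(l-(l - k)))" using that by simp
		from sim_val[OF n(3) this] show ?thesis using n(1) by (simp add: \<alpha>_def)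
	qed
	moreover have "\<sigma> (\<alpha> (Suc k)) = \<alpha> (Suc k)+\<alpha> k" if "k < l" for k
	proof -
		have "l - k = Suc (l-Suc k)" using that by simp
		thus ?thesis by (simp add: \<alpha>_def it_def)
	qed
	moreover have "\<alpha> l = a" by (simp add: \<alpha>_def it_def)
	moreover have "\<exists>n. \<not> p dvd n \<and> sim (\<alpha> 0) (of_nat n*(- \<rho>)^l * s^p)"
		using it[of l] by (simp add: \<alpha>_def)
	ultimately show ?thesis using a(2,3) by (intro exI[of _ \<alpha>]) auto
qed

end

section \<open>Linear algebra over subfields and membership of Artin-Schreier roots\<close>

lemma ext_self: assumes "sfield E" "z \<in> E" shows "ext E z = E"
	using ext_incl[OF assms(1), of z] ext_least[OF assms(1,1) order_refl assms(2)] by blast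

lemma lin_indep_poly:
	assumes "sfield E" "lin_indep E z n" "over_field E P" "pdeg P < n" "poly P z = 0"
	shows "P = 0"
proof -
	have "poly P z = (\<Sum>i\<le>pdeg P. pcoeff P i*z^i)" by (rule poly_altdef)
	also have "\<dots> = (\<Sum>i<n. pcoeff P i*z^i)"
		by (rule sum.mono_neutral_left) (use assms(4) in \<open>auto simp: coeff_eq_0\<close>)
	finally have "\<forall>i<n. pcoeff P i = 0"
		using assms(2,3,5) unfolding lin_indep_def over_field_def by simp
	thus ?thesis using assms(4) by (metis leading_coeff_0_iff)
qed

lemma over_pcompose: "sfield E ==> over_field E P ==> over_field E Q ==> over_field E (pcompose P Q)"
proof (induction P)
	case (pCons a P)
	thus ?case by (simp add: pcompose_pCons over_add over_mult over_0)
qed (simp add: over_0)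

lemma lin_indep_shift:
	assumes E: "sfield E" and li: "lin_indep E z n" and u: "u \<in> E" shows "lin_indep E (z+u) n"
	unfolding lin_indep_def
proof (intro allI impI)
	fix c i assume c: "\<forall>i<n. c i \<in> E" "(\<Sum>i<n. c i*(z+u)^i) = 0" "i < n"
	define P where "P = (\<Sum>i<n. Polynomial.monom (c i) i)"
	have cf: "pcoeff P j = (if j < n then c j else 0)" for j
		by (simp add: P_def Polynomial.coeff_sum)
	have oP: "over_field E P" using c(1) sf_0[OF E] by (simp add: over_field_def cf)
	have dP: "pdeg P < n"
		using c(3) by (intro degree_lessI) (auto simp: cf)
	have "poly (pcompose P [:u, 1:]) z = 0" using c(2) by (simp add: P_def poly_sum poly_monom poly_pcompose add.commute)
	moreover have "over_field E (pcompose P [:u, 1:])"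
		using E u by (intro over_pcompose oP) (simp_all add: sf_1 over_0)
	moreover have "pdeg (pcompose P [:u, 1:]) < n" using dP by (simp add: degree_pcompose)
	ultimately have "pcompose P [:u, 1:] = 0" using lin_indep_poly[OF E li] by blast
	hence "P = 0" by (rule pcompose_eq_0) simp
	thus "c i = 0" using cf[of i] c(3) by simp
qed

lemma dimension_subset_eq:
	assumes K: "sfield K" and "ring.dimension Omega n K E" "ring.dimension Omega n K E'" "E \<subseteq> E'"
	shows "E = E'"
proof -
	obtain Vs where Vs: "set Vs \<subseteq> carrier Omega" "ring.independent Omega K Vs" "length Vs = n" "ring.Span Omega K Vs = E"
		using Om.exists_base[OF K assms(2)] by blast
	show ?thesis using Om.Span_base_incl[OF K Vs(1)] Vs(4) assms(4) Om.independent_length_eq_dimension[OF K assms(3) Vs(2)] Vs(3) by simp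
qed

lemma combine_map_emb:
	assumes E: "sfield E" and K: "K \<subseteq> E" "\<And>x. x \<in> K ==> g x = x" and g: "emb E g"
	shows "length Ks = length Us ==> set Ks \<subseteq> K ==> set Us \<subseteq> E ==>
		ring.combine Omega Ks (map g Us) = g (ring.combine Omega Ks Us) \<and> ring.combine Omega Ks Us \<in> E"
proof (induction Ks Us rule: list_induct2)
	case Nil
	thus ?case using emb_0[OF E g] sf_0[OF E] by simp
next
	case (Cons k Ks u Us)
	hence "k \<in> E" "u \<in> E" "g k = k" using K by auto
	thus ?case using Cons
		by (simp add: emb_add[OF E g] emb_mul[OF E g] sf_add[OF E] sf_mul[OF E])
qed

text \<open>The image of a basis is again independent, so by dimension it spans.\<close>

lemma emb_surj:
	assumes Ks: "sfield K" and E: "sfield E" and K: "K \<subseteq> E" "\<And>x. x \<in> K ==> g x = x" and g: "emb E g" "g ` E \<subseteq> E"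
		and dim: "ring.dimension Omega n K E"
	shows "g ` E = E"
proof -
	obtain Vs where Vs: "ring.independent Omega K Vs" "length Vs = n" "ring.Span Omega K Vs = E"
		using Om.exists_base[OF Ks dim] by blast
	have VE: "set Vs \<subseteq> E" using Om.Span_base_incl[OF Ks, of Vs] Vs(3) by simp
	have ind: "ring.independent Omega K (map g Vs)"
	proof (rule Om.trivial_combine_imp_independent[OF Ks])
		fix Ls assume L: "set Ls \<subseteq> K" "ring.combine Omega Ls (map g Vs) = \<zero>\<^bsub>Omega\<^esub>"
		obtain Ms where M: "set (take n Ls) \<subseteq> set Ms" "set Ms \<subseteq> insert 0 (set (take n Ls))" "length Ms = n"
			"ring.combine Omega Ms (map g Vs) = 0"
			using Om.combine_normalize[of Ls "map g Vs" 0] L Vs(2) by auto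
		have MK: "set Ms \<subseteq> K" using M(2) L(1) sf_0[OF Ks] by (auto dest: in_set_takeD)
		have "g (ring.combine Omega Ms Vs) = 0" "ring.combine Omega Ms Vs \<in> E"
			using combine_map_emb[OF E K g(1), of Ms Vs] M(3,4) Vs(2) MK VE by auto
		hence "ring.combine Omega Ms Vs = \<zero>\<^bsub>Omega\<^esub>" using emb_eq_0[OF E g(1)] by simp
		from Om.independent_imp_trivial_combine[OF Ks Vs(1) MK this] have "set Ms \<subseteq> {0}" using M(3) Vs(2) by simp
		thus "set (take (length (map g Vs)) Ls) \<subseteq> {\<zero>\<^bsub>Omega\<^esub>}" using M(1) Vs(2) by auto
	qed simp
	have sub: "set (map g Vs) \<subseteq> E" using VE g(2) by auto
	have "ring.Span Omega K (map g Vs) = E"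
		by (rule iffD1[OF Om.independent_length_eq_dimension[OF Ks dim ind sub]]) (simp add: Vs(2))
	moreover have "ring.Span Omega K (map g Vs) \<subseteq> g ` E"
	proof
		fix x assume "x \<in> ring.Span Omega K (map g Vs)"
		then obtain Ls where "set Ls \<subseteq> K" "length Ls = length (map g Vs)" "x = ring.combine Omega Ls (map g Vs)"
			using Om.Span_mem_iff_length_version[OF Ks, of "map g Vs" x] by auto
		thus "x \<in> g ` E" using combine_map_emb[OF E K g(1), of Ls Vs] VE by auto
	qed
	ultimately show ?thesis using g(2) by blast
qed

context padic_valuation
begin

text \<open>A criterion of Krasner type: Hensel's lemma in \<open>E\<close> produces a root
  congruent to \<open>y\<close>, and \<open>wp_unique\<close> identifies it with
  \<open>y\<close>.\<close>

lemma AS_root_in: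
	assumes E: "sfield E" "vcomplete E" and x0: "x0 \<in> E" "vgt (-1/p) x0" and y: "wp y \<in> E" "vgt 0 (y-x0)"
	shows "y \<in> E"
proof -
	have ys: "vgt (-1/p) y" using vgt_iff[OF vgt_imp_small[OF y(2)]] x0(2) by simp
	have "vgt 0 (wp x0-wp y)"
	proof -
		have "vgt 0 (wp (x0+(y-x0))-(wp x0+wp (y-x0)))" by (rule wp_add[OF x0(2) vgt_imp_small[OF y(2)]])
		from vgt_add[OF this vgt_wp[OF y(2)]] have "vgt 0 (wp y-wp x0)" by simp
		thus ?thesis by (simp add: vgt_minus_commute)
	qed
	then obtain x where x: "x \<in> E" "wp x = wp y" "vgt 0 (x-x0)"
		using hensel_wp[OF E x0 y(1)] by blast
	have "vgt 0 (x-y)" using vgt_trans[OF x(3), of y] y(2) by (simp add: vgt_minus_commute)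
	from wp_unique[OF x(2) ys this] show ?thesis using x(1) by simp
qed

lemma AS_root_residue:
	assumes "vgt (-1/p) y" "vgt (-1/p) t" "vgt 0 (wp y-wp t)" obtains c where "c < p" "vgt 0 (y-(t + of_nat c))"
proof -
	have "vgt 0 (wp (y-t)-(wp y-wp t))" by (rule wp_diff[OF assms(1,2)])
	from vgt_add[OF this assms(3)] have "vgt 0 (wp (y-t))" by simp
	then obtain c where "c < p" "vgt 0 (y-t - of_nat c)" using wp_small_residue by blast
	thus thesis using that[of c] by (simp add: diff_diff_eq)
qed

text \<open>Congruent constants suffice, because \<open>y - t\<close> is then congruent to an
  element of the prime field.\<close>

lemma AS_roots_in:
	assumes E: "sfield E" "vcomplete E" and t: "t \<in> E" "vgt (-1/p) t" and y: "vgt (-1/p) y" "wp y \<in> E" "vgt 0 (wp y-wp t)"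
	shows "y \<in> E"
proof -
	obtain c where c: "vgt 0 (y-(t + of_nat c))" using AS_root_residue[OF y(1) t(2) y(3)] by blast
	have "vgt (-1/p) (t + of_nat c)" by (rule vgt_add[OF t(2) vge_imp_small[OF vge_of_nat]])
	thus ?thesis using AS_root_in[OF E sf_add[OF E(1) t(1) sf_of_nat[OF E(1)]] _ y(2) c] by blast
qed

end

context eis
begin

subsection \<open>The tower\<close>

definition "\<alpha> = (SOME a. (\<forall>k\<le>l. a k \<in> F \<and> val (- real k/real p) (a k)) \<and> (\<forall>k<l. \<sigma> (a (Suc k)) = a (Suc k)+a k) \<and>
		 (\<exists>y\<in>L. wp y = a l) \<and> (\<exists>n. \<not> p dvd n \<and> sim (a 0) (of_nat n*(- \<rho>)^l * s^p)))"

lemma alpha_all: "(\<forall>k\<le>l. \<alpha> k \<in> F \<and> val (- real k/real p) (\<alpha> k)) \<and> (\<forall>k<l. \<sigma> (\<alpha> (Suc k)) = \<alpha> (Suc k)+\<alpha> k) \<and>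
		 (\<exists>y\<in>L. wp y = \<alpha> l) \<and> (\<exists>n. \<not> p dvd n \<and> sim (\<alpha> 0) (of_nat n*(- \<rho>)^l * s^p))"
	unfolding \<alpha>_def by (rule someI_ex[OF alpha_ex])

lemma alpha_F: "k \<le> l ==> \<alpha> k \<in> F" and alpha_val: "k \<le> l ==> val (- real k/real p) (\<alpha> k)"
	and sigma_alpha: "k < l ==> \<sigma> (\<alpha> (Suc k)) = \<alpha> (Suc k)+\<alpha> k"
	and alpha_l: "\<exists>y\<in>L. wp y = \<alpha> l"
	and alpha_0: "\<exists>n. \<not> p dvd n \<and> sim (\<alpha> 0) (of_nat n*(- \<rho>)^l * s^p)"
	using alpha_all by simp_all

text \<open>For \<open>k = l\<close> the root has to lie in \<open>L\<close>, which it generates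
  over \<open>F\<close>; for the other indices any root will do.\<close>

definition "Y k = (if k = l then SOME y. y \<in> L \<and> wp y = \<alpha> l else SOME y. wp y = \<alpha> k)"

lemma wp_surj: "\<exists>y. wp y = a"
proof -
	obtain y where "poly (ASpoly a) y = 0" using ASpoly_monic(1)[of a] p_gt_0 alg_closed_imp_poly_has_root by force
	hence "wp y = a" by (simp add: poly_ASpoly)
	thus ?thesis by blast
qed

lemma Y_l: "Y l \<in> L" and wp_Y: "wp (Y k) = \<alpha> k"
proof -
	have 1: "Y l \<in> L \<and> wp (Y l) = \<alpha> l"
		using someI_ex[of "\<lambda>y. y \<in> L \<and> wp y = \<alpha> l"] alpha_l by (auto simp: Y_def)
	thus "Y l \<in> L" by blast
	show "wp (Y k) = \<alpha> k"
	proof (cases "k = l")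
		case False
		thus ?thesis using someI_ex[OF wp_surj[of "\<alpha> k"]] by (simp add: Y_def)
	qed (use 1 in simp)
qed

lemma kp: "k \<le> l ==> real k < real p"
	using lp by linarith

lemma alpha_small: "k \<le> l ==> vgt (-1) (\<alpha> k)"
	using alpha_val[of k] kp[of k] by (simp add: val_vgt)

lemma Y_small: "k \<le> l ==> vgt (-1/p) (Y k)"
	using wp_vgt[of "Y k"] alpha_small by (simp add: wp_Y)

lemma Y_val: "0 < k ==> k \<le> l ==> val (- real k/real p/real p) (Y k)"
	using wp_val[of "- real k/real p" "Y k"] alpha_val[of k] p_gt_0 by (simp add: wp_Y)

lemma alpha0_vge: "vge 0 (\<alpha> 0)" and Y0_vge: "vge 0 (Y 0)" and Y0_val: "val 0 (Y 0)"
proof -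
	show 1: "vge 0 (\<alpha> 0)" using alpha_val[of 0] by (simp add: val_vge)
	thus 2: "vge 0 (Y 0)" using wp_vge[of "Y 0"] by (simp add: wp_Y)
	show "val 0 (Y 0)" using vgt_wp[of "Y 0"] alpha_val[of 0] vge_cases[OF 2] by (auto simp: wp_Y val_vgt)
qed

text \<open>Solvability of the equation for \<open>\<alpha> 0\<close> in the residue field. It
  decides whether \<open>T 1\<close> equals \<open>F\<close> or is unramified of degree
  \<open>p\<close> over it.\<close>

definition "splits = (\<exists>w\<in>F. vge 0 w \<and> vgt 0 (wp w-\<alpha> 0))"

lemma Y0_F: assumes splits shows "Y 0 \<in> F"
proof -
	obtain w where w: "w \<in> F" "vge 0 w" "vgt 0 (wp w-\<alpha> 0)" using assms by (auto simp: splits_def)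
	show ?thesis
		by (rule AS_roots_in[OF F_sf lf_complete[OF F_lf] w(1) vge_imp_small[OF w(2)] vge_imp_small[OF Y0_vge]])
			(use w(3) alpha_F[of 0] in \<open>simp_all add: wp_Y vgt_minus_commute\<close>)
qed

primrec T :: "nat => 'a set" where "T 0 = F" | "T (Suc k) = ext (T k) (Y k)"

text \<open>The sum \<open>1 + p + ... + p^(n-1)\<close> is the lower break that corresponds to the
  upper break \<open>n\<close> when the upper breaks are \<open>1, ..., l\<close> and each jump has
  index \<open>p\<close>.\<close>

definition "bb n = (\<Sum>i<n. p^i)"

lemma bb_0 [simp]: "bb 0 = 0" and bb_Suc: "bb (Suc n) = bb n+p^n" and bb_Suc': "bb (Suc n) = 1+p*bb n"
proof -
	show "bb 0 = 0" "bb (Suc n) = bb n+p^n" by (simp_all add: bb_def)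
	show "bb (Suc n) = 1+p*bb n"
		unfolding bb_def by (subst sum.lessThan_Suc_shift) (simp add: sum_distrib_left)
qed

lemma bb_ndvd: "0 < n ==> \<not> p dvd bb n"
proof -
	assume "0 < n"
	then obtain k where "n = Suc k" by (cases n) auto
	hence "bb n = 1+p*bb k" by (simp only: bb_Suc')
	thus ?thesis using p_gt_1 dvd_add_left_iff[of p "p*bb k" 1] by simp
qed

lemma bb_less: "bb n < p^n"
proof (induction n)
	case (Suc n)
	have "bb n+p^n < 2*p^n" using Suc by simp
	also have "\<dots> \<le> p*p^n" using p_gt_1 by (intro mult_right_mono) auto
	finally show ?case by (simp add: bb_Suc)
qed simp

lemma bb_mult: "(real p-1)*real (bb n) = real p^n-1"
proof (induction n)
	case (Suc n) thus ?case by (simp add: bb_Suc distrib_left) (simp add: algebra_simps)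
qed simp

lemma F_sub_T: "F \<subseteq> T j" and T_sf: "j \<le> Suc l ==> sfield (T j)"
proof -
	have *: "j \<le> Suc l ==> sfield (T j) \<and> F \<subseteq> T j" for j
	proof (induction j)
		case 0 thus ?case using F_sf by simp
	next
		case (Suc j)
		hence IH: "sfield (T j)" "F \<subseteq> T j" by auto
		have "over_field (T j) (ASpoly (\<alpha> j))" using over_ASpoly[OF IH(1)] alpha_F[of j] IH(2) Suc.prems by auto
		from ext_sfield[OF IH(1) this ASpoly_monic(2,1) p_gt_0, of "Y j"]
		show ?case using ext_incl[OF IH(1), of "Y j"] IH(2) by (auto simp: poly_ASpoly wp_Y)
	qed
	show "j \<le> Suc l ==> sfield (T j)" using * by blast
	have "F \<subseteq> T j" for j
	proof (induction j)
		case (Suc j)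
		have "x \<in> ext (T j) (Y j)" if "x \<in> T j" for x
			using Om.simple_extension_incl[of "T j" "Y j"] that by (auto simp: ext_def)
		thus ?case using Suc by auto
	qed simp
	thus "F \<subseteq> T j" .
qed

lemma T_Suc: "j \<le> l ==> T j \<subseteq> T (Suc j)" and Y_T: "j \<le> l ==> Y j \<in> T (Suc j)"
	using ext_incl[OF T_sf[of j]] ext_mem[OF T_sf[of j]] by auto

lemma T_mono: "i \<le> j ==> j \<le> Suc l ==> T i \<subseteq> T j"
proof (induction j rule: dec_induct)
	case (step n) thus ?case using T_Suc[of n] by auto
qed simp

lemma Y_T': "k < j ==> j \<le> Suc l ==> Y k \<in> T j"
	using Y_T[of k] T_mono[of "Suc k" j] by auto

lemma K_sub_T: "K \<subseteq> T j" using KF F_sub_T by blast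

lemma T1_lf: "lf (T 1) p"
proof (cases splits)
	case True
	thus ?thesis using ext_self[OF F_sf Y0_F[OF True]] F_lf by simp
next
	case False
	have "lf (ext F (Y 0)) p"
		by (rule ext_unram[OF F_lf alpha_F[of 0, simplified] wp_Y alpha0_vge]) (use False in \<open>auto simp: splits_def\<close>)
	thus ?thesis by simp
qed

text \<open>The pole order, in units of \<open>1/p^j\<close>, to which \<open>\<alpha> k\<close> is
  brought over \<open>T j\<close> by subtracting values of \<open>wp\<close>. It is the Herbrand
  function psi of \<open>T j\<close> over \<open>T 1\<close>, with upper breaks
  \<open>1, ..., j-1\<close>, at the point \<open>k\<close>.\<close>

definition "pole j k = bb (j-1)+p^(j-1)*(k-j+1)"

lemma pole_diag: "0 < j ==> pole j j = bb j"
	using bb_Suc[of "j-1"] by (simp add: pole_def)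

text \<open>The last equation says that \<open>AS_reduce\<close> with \<open>b = bb j\<close> and
  \<open>c = pole j k\<close> leads from level \<open>j\<close> to level \<open>j+1\<close>. Since
  \<open>k \<le> l < p\<close>, the orders stay below \<open>p^j\<close>, as is required
  there.\<close>

lemma pole_facts:
	assumes "0 < j" "j \<le> k" "k \<le> l"
	shows "\<not> p dvd pole j k" "pole j k < p^j" "j < k ==> bb j < pole j k"
		"real p*real (pole j k)-(real p-1)*real (bb j) = real (bb j)+real (p^j)*real (k-j)"
proof -
	obtain i where i: "j = Suc i" using assms(1) by (cases j) auto
	show "\<not> p dvd pole j k"
	proof (cases "i = 0")
		case True
		hence "pole j k = k" using i assms by (simp add: pole_def)
		thus ?thesis using l_ndvd[of k] assms by simp
	next
		case False
		show ?thesis using False bb_ndvd[of i] i by (simp add: pole_def dvd_add_left_iff)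
	qed
	have "k-j+1 \<le> p-1" using assms l by linarith
	hence "p^i*(k-j+1) \<le> p^i*(p-1)" by (rule mult_left_mono) simp
	moreover have "p^i*(p-1)+p^i = p^Suc i" using p_gt_0 by (simp add: diff_mult_distrib2)
	ultimately show "pole j k < p^j" using bb_less[of i] i by (simp add: pole_def)
	show "bb j < pole j k" if "j < k" using that i bb_Suc[of i] p_gt_0 by (simp add: pole_def)
	have "real p*real (bb i) = real (bb j)-1" using bb_Suc'[of i] i by simp
	moreover have "real (pole j k) = real (bb i)+real (p^i)*(real (k-j)+1)"
	proof -
		have "pole j k = bb i+p^i*(k-j+1)" using i by (simp add: pole_def)
		thus ?thesis by (simp only: of_nat_add of_nat_mult of_nat_1)
	qed
	moreover have "real p^j = real p*real (p^i)" using i by simp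
	moreover have "x*(b+P*(d+1))-(x*P-1) = (x*b+1)+x*P*d" for x b P d :: real
		by (simp add: algebra_simps)
	ultimately show "real p*real (pole j k)-(real p-1)*real (bb j) = real (bb j)+real (p^j)*real (k-j)"
		unfolding bb_mult by (simp only: of_nat_power)
qed

text \<open>Once \<open>u\<close> has brought the pole order of the constant to \<open>bb j\<close>,
  which is prime to \<open>p\<close>, the valuation of the shifted root has denominator exactly
  \<open>p^(j+1)\<close>; so the step is totally ramified.\<close>

lemma T_step:
	assumes E: "lf (T j) (p^j)" and j: "0 < j" "j \<le> l" and u: "u \<in> T j" "vgt (-1/p) u"
		and A: "val (- real (bb j)/real (p^j)) (\<alpha> j-wp u)"
	shows "val (- real (bb j)/(real (p^j)*real p)) (Y j-u)" "vgt 0 (wp (Y j-u)-(\<alpha> j-wp u))"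
		"T (Suc j) = ext (T j) (Y j-u)" "T (Suc j) = lin_span (T j) (Y j-u) p" "lf (T (Suc j)) (p^Suc j)"
proof -
	note Es = lf_sfield[OF E]
	show w: "vgt 0 (wp (Y j-u)-(\<alpha> j-wp u))" using wp_diff[OF Y_small[OF j(2)] u(2)] by (simp add: wp_Y)
	have neg: "- real (bb j)/real (p^j) < 0" using bb_ndvd[OF j(1)] p_gt_0 by (intro divide_neg_pos) (auto intro: gr0I)
	have "val (- real (bb j)/real (p^j)) (wp (Y j-u))"
		using val_cong[OF vgt_mono[OF w]] A by simp
	from wp_val[OF this neg] show g: "val (- real (bb j)/(real (p^j)*real p)) (Y j-u)" by simp
	define q where "q = pcompose (ASpoly (\<alpha> j)) [:u, 1:]"
	have "over_field (T j) (ASpoly (\<alpha> j))" using over_ASpoly[OF Es] alpha_F[OF j(2)] F_sub_T by blast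
	hence q1: "over_field (T j) q"
		unfolding q_def using u(1) by (intro over_pcompose Es) (simp_all add: sf_1[OF Es] over_0[OF Es])
	have q2: "plead q = 1"
		unfolding q_def using lead_coeff_comp[of "[:u, 1:]" "ASpoly (\<alpha> j)"] ASpoly_monic(2)[of "\<alpha> j"] by simp
	have q3: "pdeg q = p" unfolding q_def by (simp add: degree_pcompose ASpoly_monic(1))
	have q4: "poly q (Y j-u) = 0" unfolding q_def by (simp add: poly_pcompose poly_ASpoly wp_Y)
	note q = q1 q2 q3 q4
	have z: "val (of_int (- int (bb j))/(real (p^j)*real p)) (Y j-u)" using g by simp
	have cp: "Rings.coprime (- int (bb j)) (int p)"
	proof -
		have "\<not> int p dvd-int (bb j)" using bb_ndvd[OF j(1)] by simp
		thus ?thesis using prime_p by (metis coprime_commute prime_imp_coprime prime_nat_int_transfer)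
	qed
	have lf': "lf (ext (T j) (Y j-u)) (p^j*p)" by (rule ext_ram[OF E z cp p_gt_0 q])
	note S' = lf_sfield[OF lf']
	have "(Y j-u)+u \<in> ext (T j) (Y j-u)"
		by (rule sf_add[OF S' ext_mem[OF Es] subsetD[OF ext_incl[OF Es] u(1)]])
	hence "Y j \<in> ext (T j) (Y j-u)" by simp
	moreover have "Y j-u \<in> T (Suc j)"
		using Y_T[OF j(2)] T_Suc[OF j(2)] u(1) sf_diff[OF T_sf[of "Suc j"]] j(2) by auto
	ultimately show e: "T (Suc j) = ext (T j) (Y j-u)"
		using ext_least[OF Es S' ext_incl[OF Es], of "Y j"] ext_least[OF Es T_sf[of "Suc j"] T_Suc[OF j(2)], of "Y j-u"] j(2)
		by auto
	show "lf (T (Suc j)) (p^Suc j)" using lf' unfolding e by (simp add: mult.commute)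
	show "T (Suc j) = lin_span (T j) (Y j-u) p" unfolding e by (rule ext_lin_span[OF Es q(1-3) p_gt_0 q(4)])
qed

text \<open>All constants \<open>\<alpha> k\<close> with \<open>k \<ge> j\<close> are reduced
  together, as each reduction over \<open>T (j+1)\<close> starts from the one over
  \<open>T j\<close>; the case \<open>k = j\<close> makes the next step ramified.\<close>

lemma T_stage:
	"0 < j ==> j \<le> Suc l ==> lf (T j) (p^j) \<and>
		(\<forall>k. j \<le> k --> k \<le> l --> (\<exists>u\<in>T j. vgt (-1/p) u \<and> val (- real (pole j k)/real (p^j)) (\<alpha> k-wp u)))"
proof (induction j)
	case (Suc j)
	show ?case
	proof (cases "j = 0")
		case True
		\<comment> \<open>Over \<open>T 1\<close> nothing has to be subtracted: the target
		  \<open>pole 1 k\<close> is \<open>k\<close>.\<close>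
		have "\<exists>u\<in>T 1. vgt (-1/p) u \<and> val (- real (pole 1 k)/real (p^1)) (\<alpha> k-wp u)" if "1 \<le> k" "k \<le> l" for k
			using alpha_val[OF that(2)] that sf_0[OF T_sf[of 1]] by (intro bexI[of _ 0]) (simp_all add: pole_def)
		thus ?thesis using True T1_lf by simp
	next
		case False
		hence j: "0 < j" "j \<le> l" using Suc.prems by auto
		hence IH: "lf (T j) (p^j)" "\<And>k. j \<le> k ==> k \<le> l ==> \<exists>u\<in>T j. vgt (-1/p) u \<and> val (- real (pole j k)/real (p^j)) (\<alpha> k-wp u)"
			using Suc.IH by auto
		obtain u where u: "u \<in> T j" "vgt (-1/p) u" "val (- real (bb j)/real (p^j)) (\<alpha> j-wp u)"
			using IH(2)[OF order_refl j(2)] pole_diag[OF j(1)] by auto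
		note st = T_step[OF IH(1) j u]
		note Ts = T_sf[of "Suc j", OF Suc.prems(2)] and Es = lf_sfield[OF IH(1)]
		have "\<exists>u\<in>T (Suc j). vgt (-1/p) u \<and> val (- real (pole (Suc j) k)/real (p^Suc j)) (\<alpha> k-wp u)" if k: "Suc j \<le> k" "k \<le> l" for k
		proof -
			obtain t where t: "t \<in> T j" "vgt (-1/p) t" "val (- real (pole j k)/real (p^j)) (\<alpha> k-wp t)"
				using IH(2)[of k] k by auto
			have pf: "\<not> p dvd pole j k" "pole j k < p^j" "bb j < pole j k"
				"real p*real (pole j k)-(real p-1)*real (bb j) = real (bb j)+real (p^j)*real (k-j)"
				using pole_facts[OF j(1) _ k(2)] k by auto
			have wE: "wp x \<in> T j" if "x \<in> T j" for x unfolding wp_def using that by (intro sf_diff[OF Es] sf_power[OF Es])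
			have aE: "\<alpha> i \<in> T j" if "i \<le> l" for i using alpha_F[OF that] F_sub_T by blast
			have bpos: "bb j > 0" using bb_ndvd[OF j(1)] by (intro gr0I) simp
			have zT: "Y j-u \<in> T (Suc j)" unfolding st(3) by (rule ext_mem[OF Es])
			obtain x where x: "x \<in> T (Suc j)" "vgt (-1/p) x"
				"val (- (real p*real (pole j k)-(real p-1)*real (bb j))/(real (p^j)*real p)) (\<alpha> k-wp t-wp x)"
				using AS_reduce[OF IH(1) Ts T_Suc[OF j(2)] zT st(1) bpos bb_ndvd[OF j(1)]
						sf_diff[OF Es aE[OF j(2)] wE[OF u(1)]] u(3) st(2) sf_diff[OF Es aE[OF k(2)] wE[OF t(1)]] t(3) pf(3,1,2)]
				by blast
			have "pole (Suc j) k = bb j+p^j*(k-j)" using k by (simp add: pole_def Suc_diff_le[symmetric])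
			hence e: "- (real p*real (pole j k)-(real p-1)*real (bb j))/(real (p^j)*real p) = - real (pole (Suc j) k)/real (p^Suc j)"
				unfolding pf(4) by simp
			have neg: "- real (pole (Suc j) k)/real (p^Suc j) \<le> 0" by simp
			have "vgt 0 (wp (t+x)-(wp t+wp x))" by (rule wp_add[OF t(2) x(2)])
			hence "vgt 0 ((\<alpha> k-wp t-wp x)-(\<alpha> k-wp (t+x)))" by (simp add: algebra_simps)
			from val_cong[OF vgt_mono[OF this neg]] x(3)[unfolded e]
			have "val (- real (pole (Suc j) k)/real (p^Suc j)) (\<alpha> k-wp (t+x))" by simp
			moreover have "t+x \<in> T (Suc j)" using sf_add[OF Ts _ x(1)] t(1) T_Suc[OF j(2)] by blast
			ultimately show ?thesis using vgt_add[OF t(2) x(2)] by blast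
		qed
		thus ?thesis using st(5) by blast
	qed
qed simp

lemma T_lf: "0 < j ==> j \<le> Suc l ==> lf (T j) (p^j)"
	using T_stage by blast

lemma T_complete: "j \<le> Suc l ==> vcomplete (T j)"
	using lf_complete[OF T_lf[of j]] lf_complete[OF F_lf] by (cases j) auto

definition "u j = (SOME u. u \<in> T j \<and> vgt (-1/p) u \<and> val (- real (bb j)/real (p^j)) (\<alpha> j-wp u))"
text \<open>\<open>Y j\<close> has valuation \<open>-j/p^2\<close>, which for
  \<open>j \<ge> 2\<close> already lies in the value group of \<open>T j\<close>; the shifted root
  has a new valuation, and its powers are orthogonal.\<close>

definition "G j = Y j-u j"

lemma u: assumes "0 < j" "j \<le> l" shows "u j \<in> T j" "vgt (-1/p) (u j)" "val (- real (bb j)/real (p^j)) (\<alpha> j-wp (u j))"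
proof -
	have "\<exists>u. u \<in> T j \<and> vgt (-1/p) u \<and> val (- real (bb j)/real (p^j)) (\<alpha> j-wp u)"
	proof -
		from T_stage[of j] assms have "\<exists>u\<in>T j. vgt (-1/p) u \<and> val (- real (pole j j)/real (p^j)) (\<alpha> j-wp u)" by simp
		thus ?thesis unfolding pole_diag[OF assms(1)] by blast
	qed
	from someI_ex[OF this] show "u j \<in> T j" "vgt (-1/p) (u j)" "val (- real (bb j)/real (p^j)) (\<alpha> j-wp (u j))"
		unfolding u_def by blast+
qed

lemma G: assumes "0 < j" "j \<le> l"
	shows "val (- real (bb j)/(real (p^j)*real p)) (G j)" "vgt 0 (wp (G j)-(\<alpha> j-wp (u j)))"
		"T (Suc j) = ext (T j) (G j)" "T (Suc j) = lin_span (T j) (G j) p"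
	using T_step[OF T_lf[OF assms(1)] assms u[OF assms]] assms(2) unfolding G_def by auto

lemma G_ram: assumes "0 < j" "j \<le> l"
	shows "val (of_int (- int (bb j))/(real (p^j)*real p)) (G j)" "\<not> int p dvd-int (bb j)"
		"Rings.coprime (- int (bb j)) (int p)"
proof -
	show "val (of_int (- int (bb j))/(real (p^j)*real p)) (G j)" using G(1)[OF assms] by simp
	show n: "\<not> int p dvd-int (bb j)" using bb_ndvd[OF assms(1)] by simp
	thus "Rings.coprime (- int (bb j)) (int p)"
		using prime_p by (metis coprime_commute prime_imp_coprime prime_nat_int_transfer)
qed

lemma G_orth: assumes "0 < j" "j \<le> l" shows "orth (T j) (G j) p"
	by (rule ram_orth[OF T_lf[OF assms(1)] G_ram(1)[OF assms] G_ram(3)[OF assms] p_gt_0]) (use assms in simp)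

lemma Y0_orth: assumes "\<not> splits" shows "orth F (Y 0) p"
	by (rule unram_orth[OF F_sf alpha_F[of 0, simplified] wp_Y alpha0_vge]) (use assms in \<open>auto simp: splits_def\<close>)

lemma Y_indep: assumes "j \<le> l" "0 < j \<or> \<not> splits" shows "lin_indep (T j) (Y j) p"
proof (cases "j = 0")
	case True
	thus ?thesis using orth_lin_indep[OF Y0_orth F_sf val_nonzero[OF Y0_val]] assms by simp
next
	case False
	hence j: "0 < j" "j \<le> l" using assms by auto
	have Ts: "sfield (T j)" using T_sf assms(1) by simp
	have "lin_indep (T j) (G j+u j) p"
		by (rule lin_indep_shift[OF Ts orth_lin_indep[OF G_orth[OF j] Ts val_nonzero[OF G(1)[OF j]]] u(1)[OF j]])
	thus ?thesis by (simp add: G_def)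
qed

lemma ASpoly_T: "j \<le> l ==> over_field (T j) (ASpoly (\<alpha> j))"
	using over_ASpoly[OF T_sf[of j]] alpha_F[of j] F_sub_T by auto

lemma T_dim: assumes "j \<le> l" "0 < j \<or> \<not> splits" shows "ring.dimension Omega p (T j) (T (Suc j))"
	using ext_dimension[OF T_sf ASpoly_T ASpoly_monic(2,1) p_gt_0 _ Y_indep] assms by (simp add: poly_ASpoly wp_Y)

lemma T1_splits: "splits ==> T 1 = F"
	using ext_self[OF F_sf Y0_F] by simp

lemma F_dim: "ring.dimension Omega p K F"
	using ext_dimension[OF K_sf theta_q theta_indep] by (simp add: F_def)

lemma L_dim: "ring.dimension Omega (p^2) K L"
	unfolding L_def by (rule ext_dimension[OF K_sf pi_q orth_lin_indep[OF ram_orth[OF K pi_ram pi_q(4)] K_sf pi0]])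

lemma T_dim_K: "\<exists>n. ring.dimension Omega n K (T j)" if "j \<le> Suc l"
	using that
proof (induction j)
	case 0 thus ?case using F_dim by auto
next
	case (Suc j)
	then obtain n where n: "ring.dimension Omega n K (T j)" by auto
	show ?case
	proof (cases "0 < j \<or> \<not> splits")
		case True
		thus ?thesis using Om.telescopic_base[OF K_sf T_sf n T_dim] Suc.prems by auto
	next
		case False
		hence "T (Suc j) = T j" using T1_splits by simp
		thus ?thesis using n by metis
	qed
qed

lemma Yl_ram: "val (of_int (- int l)/(real p*real p)) (Y l)" "\<not> int p dvd-int l" "Rings.coprime (- int l) (int p)"
proof -
	show "val (of_int (- int l)/(real p*real p)) (Y l)" using Y_val[of l] l by simp
	show n: "\<not> int p dvd-int l" using l_ndvd[of l] l by simp
	thus "Rings.coprime (- int l) (int p)"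
		using prime_p by (metis coprime_commute prime_imp_coprime prime_nat_int_transfer)
qed

lemma Yl_q: "over_field F (ASpoly (\<alpha> l))" "plead (ASpoly (\<alpha> l)) = 1" "pdeg (ASpoly (\<alpha> l)) = p" "p > 0" "poly (ASpoly (\<alpha> l)) (Y l) = 0"
	using over_ASpoly[OF F_sf alpha_F] ASpoly_monic p_gt_0 by (simp_all add: poly_ASpoly wp_Y)

lemma FYl_dim: "ring.dimension Omega p F (ext F (Y l))"
	by (rule ext_dimension[OF F_sf Yl_q orth_lin_indep[OF ram_orth[OF F_lf Yl_ram(1,3) p_gt_0] F_sf val_nonzero[OF Yl_ram(1)]]])

lemma L_eq: "L = ext F (Y l)"
proof (rule dimension_subset_eq[OF K_sf _ _ , symmetric])
	show "ring.dimension Omega (p^2) K (ext F (Y l))"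
		using Om.telescopic_base[OF K_sf F_sf F_dim FYl_dim] by (simp add: power2_eq_square)
	show "ring.dimension Omega (p^2) K L" by (rule L_dim)
	show "ext F (Y l) \<subseteq> L" by (rule ext_least[OF F_sf L_sf FL Y_l])
qed

lemma L_sub_T: "L \<subseteq> T (Suc l)"
	unfolding L_eq by (rule ext_least[OF F_sf T_sf F_sub_T]) (use Y_T[of l] in auto)

end

context eis
begin

declare T.simps(2) [simp del]

subsection \<open>Embeddings of the tower\<close>

abbreviation "TT \<equiv> T (Suc l)"

lemma TT_sf: "sfield TT" and TT_complete: "vcomplete TT"
	using T_sf T_complete by auto

lemma Y_TT: "k \<le> l ==> Y k \<in> TT"
	using Y_T'[of k "Suc l"] by simp

lemma T_sub_TT: "j \<le> Suc l ==> T j \<subseteq> TT"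
	by (rule T_mono) auto

lemma wp_emb: "sfield E ==> emb E g ==> x \<in> E ==> g (wp x) = wp (g x)"
	by (simp add: wp_def emb_diff[of E g] emb_power[of E g] sf_power)

lemma embK_emb: "embK E g ==> emb E g" and embK_K: "embK E g ==> x \<in> K ==> g x = x"
	by (auto simp: embK_def)

lemma embK_T_F: "embK (T j) g ==> embK F g"
	by (rule embK_subset[OF _ F_sub_T])

lemma emb_T_eq:
	assumes "j \<le> Suc l" "emb (T j) g" "emb (T j) h" "\<And>x. x \<in> F ==> g x = h x" "\<And>k. k < j ==> g (Y k) = h (Y k)" "x \<in> T j"
	shows "g x = h x"
	using assms
proof (induction j arbitrary: x)
	case (Suc j)
	have Es: "sfield (T j)" "sfield (T (Suc j))" using T_sf Suc.prems(1) by auto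
	have sub: "T j \<subseteq> T (Suc j)" by (rule T_Suc) (use Suc.prems in simp)
	have IH: "g y = h y" if "y \<in> T j" for y
		by (rule Suc.IH) (use Suc.prems that sub emb_subset in auto)
	obtain P where P: "x = poly P (Y j)" "over_field (T j) P" using Suc.prems(6) ext_poly[OF Es(1)] by (auto simp: T.simps)
	have P': "over_field (T (Suc j)) P" by (rule over_mono[OF P(2) sub])
	have yT: "Y j \<in> T (Suc j)" by (rule Y_T) (use Suc.prems in simp)
	have "map_poly g P = map_poly h P"
		by (rule poly_eqI) (use IH P(2) in \<open>simp add: coeff_map_emb[OF Es(2) Suc.prems(2)] coeff_map_emb[OF Es(2) Suc.prems(3)] over_field_def\<close>)
	thus ?case
		unfolding P(1) emb_poly[OF Es(2) Suc.prems(2) P' yT] emb_poly[OF Es(2) Suc.prems(3) P' yT]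
		using Suc.prems(5)[of j] by simp
qed simp

lemma F_emb_alpha: "embK F g ==> k \<le> l ==> g (\<alpha> k) \<in> F \<and> val (- real k/real p) (g (\<alpha> k))"
	using F_emb_mem[of g "\<alpha> k"] alpha_F[of k] vpres_val[OF F_emb_vpres, of g "\<alpha> k"] alpha_val[of k] by simp

lemma emb_Y_small: assumes "embK (T j) g" "j \<le> Suc l" "k < j" shows "vgt (-1/p) (g (Y k))" "wp (g (Y k)) = g (\<alpha> k)"
proof -
	have "Y k \<in> T j" by (rule Y_T'[OF assms(3,2)])
	from wp_emb[OF T_sf[OF assms(2)] embK_emb[OF assms(1)] this]
	show e: "wp (g (Y k)) = g (\<alpha> k)" by (simp add: wp_Y)
	have k: "k \<le> l" using assms by simp
	have "val (- real k/real p) (wp (g (Y k)))" using F_emb_alpha[OF embK_T_F[OF assms(1)] k] e by simp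
	thus "vgt (-1/p) (g (Y k))" using kp[OF k] p_gt_0 by (intro wp_vgt) (simp add: val_vgt)
qed

text \<open>The image of \<open>G j\<close> is controlled by its equation: \<open>wp\<close> of it
  is congruent to the image of the reduced constant, whose valuation is preserved by induction. Then
  \<open>vpres_ext\<close> applies.\<close>

lemma vpres_T: "j \<le> Suc l ==> embK (T j) g ==> vpres (T j) g"
proof (induction j)
	case 0 thus ?case using F_emb_vpres by simp
next
	case (Suc j)
	have j: "j \<le> l" using Suc.prems by simp
	have Es: "sfield (T j)" "sfield (T (Suc j))" using T_sf Suc.prems(1) by auto
	have sub: "T j \<subseteq> T (Suc j)" by (rule T_Suc[OF j])
	have IH: "vpres (T j) g" using Suc.IH Suc.prems embK_subset[OF _ sub] by simp
	have ge: "emb (T (Suc j)) g" by (rule embK_emb[OF Suc.prems(2)])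
	have yT: "Y j \<in> T (Suc j)" by (rule Y_T[OF j])
	note gy = emb_Y_small[OF Suc.prems(2,1) lessI]
	show ?case
	proof (cases "j = 0")
		case False
		hence j': "0 < j" by simp
		have uT: "u j \<in> T j" "vgt (-1/p) (u j)" using u[OF j' j] by auto
		define A where "A = \<alpha> j-wp (u j)"
		have wuT: "wp (u j) \<in> T j" unfolding wp_def by (intro sf_diff[OF Es(1)] sf_power[OF Es(1)] uT)
		have aT: "\<alpha> j \<in> T j" using alpha_F[OF j] F_sub_T by blast
		have AT: "A \<in> T j" unfolding A_def by (rule sf_diff[OF Es(1) aT wuT])
		have gA: "g A = g (\<alpha> j)-wp (g (u j))"
			unfolding A_def emb_diff[OF Es(2) ge subsetD[OF sub aT] subsetD[OF sub wuT]] wp_emb[OF Es(2) ge subsetD[OF sub uT(1)]] ..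
		have gG: "g (G j) = g (Y j)-g (u j)"
			unfolding G_def by (rule emb_diff[OF Es(2) ge yT subsetD[OF sub uT(1)]])
		have gu: "vgt (-1/p) (g (u j))" using vpres_vgt[OF IH uT(1)] uT(2) by simp
		have "vgt 0 (wp (g (Y j)-g (u j))-(wp (g (Y j))-wp (g (u j))))" by (rule wp_diff[OF gy(1) gu])
		hence w: "vgt 0 (wp (g (G j))-g A)" by (simp add: gG gA gy(2))
		have neg: "- real (bb j)/real (p^j) < 0" using bb_ndvd[OF j'] p_gt_0 by (intro divide_neg_pos) (auto intro: gr0I)
		have "val (- real (bb j)/real (p^j)) (wp (g (G j)))" using vpres_val[OF IH AT] u(3)[OF j' j] val_cong[OF vgt_mono[OF w]] by (simp add: A_def)
		from wp_val[OF this neg] have "vge (- real (bb j)/(real (p^j)*real p)) (g (G j))" by (simp add: val_vge)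
		thus ?thesis
			using vpres_ext[OF G_orth[OF j' j] _ _ Es(1) _ IH G(1)[OF j' j]] G(3,4)[OF j' j] Es(2) ge by simp
	next
		case True
		show ?thesis
		proof (cases splits)
			case True
			hence "T (Suc j) = T j" using T1_splits \<open>j = 0\<close> by simp
			thus ?thesis using IH by metis
		next
			case False
			have sp: "ext F (Y 0) = lin_span F (Y 0) p"
				by (rule ext_lin_span[OF F_sf, of "ASpoly (\<alpha> 0)"])
					(use over_ASpoly[OF F_sf alpha_F[of 0]] ASpoly_monic p_gt_0 in \<open>simp_all add: poly_ASpoly wp_Y\<close>)
			have "val 0 (wp (g (Y 0)))" using gy(2) F_emb_alpha[OF embK_T_F[OF Suc.prems(2)], of 0] \<open>j = 0\<close> by simp
			hence "vge 0 (g (Y 0))" by (intro wp_vge[of "g (Y 0)"]) (simp add: val_vge)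
			thus ?thesis
				using vpres_ext[OF Y0_orth[OF False] sp _ F_sf _ _ Y0_val, of g] Es(2) ge IH \<open>j = 0\<close> by (simp add: T.simps)
		qed
	qed
qed

lemma map_ASpoly: "sfield E ==> emb E g ==> a \<in> E ==> map_poly g (ASpoly a) = ASpoly (g a)"
	by (rule poly_eqI) (simp add: coeff_map_emb[of E g] coeff_ASpoly emb_0[of E g] emb_1[of E g] emb_minus[of E g] sf_1)

text \<open>Prescribed approximate images \<open>t k\<close> are corrected by Hensel's lemma to
  roots of the conjugated equations, to which the embedding extends one level at a time. In the
  split case \<open>Y 0\<close> lies in \<open>F\<close> and its image is already fixed by
  \<open>h\<close>, whence the extra hypothesis.\<close>

lemma extend_T:
	assumes h: "embK F h" and t: "\<And>k. k \<le> l ==> t k \<in> TT" "\<And>k. k \<le> l ==> vgt (-1/p) (t k)"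
			"\<And>k. k \<le> l ==> vgt 0 (wp (t k)-h (\<alpha> k))" and t0: "splits ==> vgt 0 (h (Y 0)-t 0)"
	shows "j \<le> Suc l ==> \<exists>g. embK (T j) g \<and> (\<forall>x\<in>F. g x = h x) \<and> (\<forall>k<j. vgt 0 (g (Y k)-t k))"
proof (induction j)
	case 0 thus ?case using h by auto
next
	case (Suc j)
	then obtain g where g: "embK (T j) g" "\<And>x. x \<in> F ==> g x = h x" "\<And>k. k < j ==> vgt 0 (g (Y k)-t k)" by auto
	have j: "j \<le> l" using Suc.prems by simp
	have Es: "sfield (T j)" using T_sf Suc.prems(1) by simp
	have ge: "emb (T j) g" by (rule embK_emb[OF g(1)])
	show ?case
	proof (cases "j = 0 \<and> splits")
		case True
		hence e: "T (Suc j) = T j" using T1_splits by simp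
		have "vgt 0 (g (Y k)-t k)" if "k < Suc j" for k using g(2) Y0_F True that t0 by simp
		thus ?thesis unfolding e using g(1,2) by blast
	next
		case False
		have aF: "\<alpha> j \<in> T j" using alpha_F[OF j] F_sub_T by blast
		have ga: "g (\<alpha> j) = h (\<alpha> j)" using g(2) alpha_F[OF j] by blast
		obtain y where y: "y \<in> TT" "wp y = h (\<alpha> j)" "vgt 0 (y-t j)"
			using F_emb_mem[OF h alpha_F[OF j]] F_sub_T hensel_wp[OF TT_sf TT_complete t(1,2) _ t(3)] j by blast
		have "poly (map_poly g (ASpoly (\<alpha> j))) y = 0" by (simp add: map_ASpoly[OF Es ge aF] poly_ASpoly ga y(2))
		from emb_extend[OF Es ge ASpoly_T[OF j] ASpoly_monic(2,1) p_gt_0 _ Y_indep[OF j] this] False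
		obtain \<tau> where \<tau>: "emb (T (Suc j)) \<tau>" "\<And>x. x \<in> T j ==> \<tau> x = g x" "\<tau> (Y j) = y"
			by (auto simp: poly_ASpoly wp_Y T.simps)
		have "\<tau> x = x" if "x \<in> K" for x using \<tau>(2)[OF subsetD[OF K_sub_T that]] embK_K[OF g(1) that] by simp
		hence "embK (T (Suc j)) \<tau>" using \<tau>(1) by (simp add: embK_def)
		moreover have "\<tau> x = h x" if "x \<in> F" for x using \<tau>(2)[of x] g(2)[OF that] F_sub_T that by auto
		moreover have "vgt 0 (\<tau> (Y k)-t k)" if "k < Suc j" for k
		proof (cases "k = j")
			case True thus ?thesis using \<tau>(3) y(3) by simp
		next
			case ne: False
			hence "k < j" using that by simp
			thus ?thesis using \<tau>(2)[OF Y_T'[of k j]] g(3) j by simp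
		qed
		ultimately show ?thesis by blast
	qed
qed

lemma sigma_unit: "x \<in> F ==> vge 0 x ==> vgt 0 (\<sigma> x-x)"
proof (cases "x = 0")
	case True thus ?thesis by (simp add: emb_0[OF F_sf sigma_emb])
next
	case False
	assume x: "x \<in> F" "vge 0 x"
	obtain n :: int where n: "val (of_int n/real p) x" using lf_val[OF F_lf x(1) False] .
	have "0 < (of_int n+1)/real p" using n x(2) p_gt_0 by (simp add: val_vge add_divide_distrib add_nonneg_pos)
	thus ?thesis using has_breakD(1)[OF sigma_break x(1) n] by (rule vge_vgt[rotated])
qed

text \<open>As \<sigma> adds \<open>\<alpha> (k-1)\<close> to \<open>\<alpha> k\<close>, and moves
  \<open>\<alpha> 0\<close> only inside the maximal ideal, approximate roots for the conjugated
  constants are sums of those already available. This makes \<open>TT\<close> stable under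
  embeddings over \<open>K\<close>.\<close>

lemma sigma_pow_approx: "k \<le> l ==> \<exists>t\<in>TT. vgt (-1/p) t \<and> vgt 0 (wp t-(\<sigma> ^^ c) (\<alpha> k))"
proof (induction c arbitrary: k)
	case 0
	thus ?case using Y_TT[OF 0] Y_small[OF 0] by (intro bexI[of _ "Y k"]) (simp_all add: wp_Y)
next
	case (Suc c)
	have e: "(\<sigma> ^^ Suc c) (\<alpha> k) = (\<sigma> ^^ c) (\<sigma> (\<alpha> k))" by (simp add: funpow_swap1)
	note sc = conjunct1[OF sigma_pow[of c]]
	obtain t where t: "t \<in> TT" "vgt (-1/p) t" "vgt 0 (wp t-(\<sigma> ^^ c) (\<alpha> k))" using Suc by blast
	show ?case
	proof (cases k)
		case 0
		define d where "d = \<sigma> (\<alpha> 0)-\<alpha> 0"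
		have dF: "d \<in> F" unfolding d_def using alpha_F[of 0] F_emb_mem[OF sigma(1)] sf_diff[OF F_sf] by simp
		have "vgt 0 ((\<sigma> ^^ c) d)" using vpres_vgt[OF F_emb_vpres[OF sc] dF] sigma_unit[OF alpha_F[of 0] alpha0_vge] by (simp add: d_def)
		moreover have "(\<sigma> ^^ c) (\<sigma> (\<alpha> 0)) = (\<sigma> ^^ c) (\<alpha> 0)+(\<sigma> ^^ c) d"
			using emb_add[OF F_sf embK_emb[OF sc] alpha_F[of 0] dF] by (simp add: d_def)
		ultimately have "vgt 0 (wp t-(\<sigma> ^^ Suc c) (\<alpha> k))"
			unfolding e using vgt_diff[OF t(3), of "(\<sigma> ^^ c) d"] 0 by (simp add: diff_diff_eq)
		thus ?thesis using t by blast
	next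
		case (Suc i)
		have i: "i < l" "i \<le> l" using Suc Suc.prems by auto
		obtain w where w: "w \<in> TT" "vgt (-1/p) w" "vgt 0 (wp w-(\<sigma> ^^ c) (\<alpha> i))" using Suc.IH[OF i(2)] by blast
		have s: "(\<sigma> ^^ c) (\<sigma> (\<alpha> k)) = (\<sigma> ^^ c) (\<alpha> k)+(\<sigma> ^^ c) (\<alpha> i)"
			using sigma_alpha[OF i(1)] Suc emb_add[OF F_sf embK_emb[OF sc] alpha_F[of k] alpha_F[OF i(2)]] Suc.prems by simp
		have "vgt 0 (wp (t+w)-(wp t+wp w))" by (rule wp_add[OF t(2) w(2)])
		from vgt_add[OF vgt_add[OF this t(3)] w(3)]
		have "vgt 0 (wp (t+w)-(\<sigma> ^^ Suc c) (\<alpha> k))" unfolding e s by (simp add: algebra_simps)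
		thus ?thesis using sf_add[OF TT_sf t(1) w(1)] vgt_add[OF t(2) w(2)] by blast
	qed
qed

lemma emb_TT_Y: assumes "embK TT g" "k \<le> l" shows "g (Y k) \<in> TT"
proof -
	obtain c where c: "\<And>x. x \<in> F ==> g x = (\<sigma> ^^ c) x" using F_emb_sigma_pow[OF embK_T_F[OF assms(1)]] by blast
	obtain t where t: "t \<in> TT" "vgt (-1/p) t" "vgt 0 (wp t-(\<sigma> ^^ c) (\<alpha> k))" using sigma_pow_approx[OF assms(2)] by blast
	have gY: "vgt (-1/p) (g (Y k))" "wp (g (Y k)) = g (\<alpha> k)"
		using emb_Y_small[OF assms(1) order_refl, of k] assms(2) by auto
	have "wp (g (Y k)) \<in> TT" unfolding gY(2) using F_emb_mem[OF embK_T_F[OF assms(1)] alpha_F[OF assms(2)]] F_sub_T by blast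
	moreover have "vgt 0 (wp (g (Y k))-wp t)" using t(3) gY(2) c[OF alpha_F[OF assms(2)]] by (simp add: vgt_minus_commute)
	ultimately show ?thesis by (rule AS_roots_in[OF TT_sf TT_complete t(1,2) gY(1)])
qed

lemma emb_TT_T: "embK TT g ==> j \<le> Suc l ==> x \<in> T j ==> g x \<in> TT"
proof (induction j arbitrary: x)
	case 0
	thus ?case using F_emb_mem[OF embK_T_F[OF 0(1)]] F_sub_T[of "Suc l"] by (metis T.simps(1) subsetD)
next
	case (Suc j)
	have j: "j \<le> l" using Suc.prems by simp
	have Es: "sfield (T j)" using T_sf Suc.prems(2) by simp
	obtain P where P: "x = poly P (Y j)" "over_field (T j) P" using Suc.prems(3) ext_poly[OF Es] by (auto simp: T.simps)
	have P': "over_field TT P" by (rule over_mono[OF P(2) T_sub_TT]) (use j in simp)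
	have ge: "emb TT g" by (rule embK_emb[OF Suc.prems(1)])
	have "over_field TT (map_poly g P)"
		unfolding over_field_def
	proof
		fix i show "pcoeff (map_poly g P) i \<in> TT"
			using Suc.IH[OF Suc.prems(1)] P(2) j by (simp add: coeff_map_emb[OF TT_sf ge] over_field_def)
	qed
	hence "poly (map_poly g P) (g (Y j)) \<in> ext TT (g (Y j))" using ext_poly[OF TT_sf] by blast
	thus ?case unfolding P(1) emb_poly[OF TT_sf ge P' Y_TT[OF j]]
		using ext_self[OF TT_sf emb_TT_Y[OF Suc.prems(1) j]] by simp
qed

lemma emb_TT_image: assumes "embK TT g" shows "g ` TT = TT"
proof -
	obtain n where n: "ring.dimension Omega n K TT" using T_dim_K[of "Suc l"] by blast
	show ?thesis
		by (rule emb_surj[OF K_sf TT_sf K_sub_T _ embK_emb[OF assms] _ n])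
			(use emb_TT_T[OF assms, of "Suc l"] embK_K[OF assms] in auto)
qed

lemma emb_TT_mem: "embK TT g ==> x \<in> TT ==> g x \<in> TT"
	by (rule emb_TT_T[OF _ order_refl])

lemma embK_comp: assumes "embK TT g" "embK TT h" shows "embK TT (g \<circ> h)"
	using assms emb_TT_mem[OF assms(2)] unfolding embK_def emb_def by simp

lemma embK_funpow: "embK TT g ==> embK TT (g ^^ n)"
proof (induction n)
	case 0 show ?case by (simp add: embK_def emb_def)
next
	case (Suc n) thus ?case unfolding funpow.simps(2) by (intro embK_comp)
qed

lemma embK_inv: assumes "embK TT g" shows "embK TT (inv_into TT g)"
proof -
	define h where "h = inv_into TT g"
	have ge: "emb TT g" by (rule embK_emb[OF assms])
	have hT: "h x \<in> TT" if "x \<in> TT" for x unfolding h_def by (rule inv_into_into) (use emb_TT_image[OF assms] that in simp)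
	have gh: "g (h x) = x" if "x \<in> TT" for x unfolding h_def by (rule f_inv_into_f) (use emb_TT_image[OF assms] that in simp)
	have inj: "x = y" if "g x = g y" "x \<in> TT" "y \<in> TT" for x y using emb_inj[OF TT_sf ge] that by (simp add: inj_on_def)
	have hg: "h (g x) = x" if "x \<in> TT" for x
		by (rule inj) (use gh[OF emb_TT_mem[OF assms that]] hT[OF emb_TT_mem[OF assms that]] that in simp_all)
	have add: "h (x+y) = h x+h y" if xy: "x \<in> TT" "y \<in> TT" for x y
	proof (rule inj)
		show "g (h (x+y)) = g (h x+h y)"
			unfolding gh[OF sf_add[OF TT_sf xy]] emb_add[OF TT_sf ge hT[OF xy(1)] hT[OF xy(2)]] gh[OF xy(1)] gh[OF xy(2)] ..
	qed (intro hT sf_add[OF TT_sf] xy)+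
	have mul: "h (x*y) = h x*h y" if xy: "x \<in> TT" "y \<in> TT" for x y
	proof (rule inj)
		show "g (h (x*y)) = g (h x*h y)"
			unfolding gh[OF sf_mul[OF TT_sf xy]] emb_mul[OF TT_sf ge hT[OF xy(1)] hT[OF xy(2)]] gh[OF xy(1)] gh[OF xy(2)] ..
	qed (intro hT sf_mul[OF TT_sf] xy)+
	have hx: "h x = x" if "x \<in> K" for x using hg[OF subsetD[OF K_sub_T that]] embK_K[OF assms that] by simp
	show ?thesis unfolding h_def[symmetric] embK_def emb_def using add mul hx hx[OF sf_1[OF K_sf]] by simp
qed

subsection \<open>The pairing\<close>

definition "embF g = (embK TT g \<and> (\<forall>x\<in>F. g x = x))"

lemma embF_K: "embF g ==> embK TT g" and embF_F: "embF g ==> x \<in> F ==> g x = x"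
	by (auto simp: embF_def)

lemma embK_vge: "embK TT g ==> x \<in> TT ==> vge a (g x) = vge a x"
	and embK_vgt: "embK TT g ==> x \<in> TT ==> vgt a (g x) = vgt a x"
	using vpres_vge[OF vpres_T[OF order_refl]] vpres_vgt[OF vpres_T[OF order_refl]] by blast+

text \<open>The Artin-Schreier pairing of \<open>g\<close> with \<open>\<alpha> k\<close>, as a
  representative below \<open>p\<close>. In characteristic 0 the difference
  \<open>g (Y k) - Y k\<close> is merely congruent to an element of the prime field.\<close>

definition "cc g k = (SOME c. c < p \<and> vgt 0 (g (Y k)-Y k - of_nat c))"

lemma cc_ex: assumes "embF g" "k \<le> l" shows "\<exists>c. c < p \<and> vgt 0 (g (Y k)-Y k - of_nat c)"
proof -
	have gY: "vgt (-1/p) (g (Y k))" "wp (g (Y k)) = \<alpha> k"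
		using emb_Y_small[OF embF_K[OF assms(1)] order_refl, of k] assms(2) embF_F[OF assms(1) alpha_F[OF assms(2)]] by auto
	obtain c where "c < p" "vgt 0 (g (Y k)-(Y k + of_nat c))"
		using AS_root_residue[OF gY(1) Y_small[OF assms(2)]] gY(2) by (auto simp: wp_Y)
	thus ?thesis by (auto simp: diff_diff_eq)
qed

lemma cc: assumes "embF g" "k \<le> l" shows "cc g k < p" "vgt 0 (g (Y k)-Y k - of_nat (cc g k))"
	using someI_ex[OF cc_ex[OF assms]] unfolding cc_def by blast+

lemma nat_near_cong: "vgt 0 (x - of_nat c) ==> vgt 0 (x - of_nat d) ==> [c = d] (mod p)"
proof -
	assume "vgt 0 (x - of_nat c)" "vgt 0 (x - of_nat d)"
	hence "vgt 0 ((x - of_nat d)-(x - of_nat c))" by (rule vgt_diff[rotated])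
	hence "vgt 0 (of_int (int c-int d))" by simp
	hence "int p dvd int c-int d" using vgt_of_int_iff by blast
	thus ?thesis by (simp add: cong_iff_dvd_diff flip: cong_int_iff)
qed

lemma cc_cong: "embF g ==> k \<le> l ==> vgt 0 (g (Y k)-Y k - of_nat c) ==> [cc g k = c] (mod p)"
	using nat_near_cong[OF cc(2)] by blast

lemma cc_splits: assumes "embF g" splits shows "cc g 0 = 0"
proof -
	have "g (Y 0) = Y 0" by (rule embF_F[OF assms(1) Y0_F[OF assms(2)]])
	hence "[cc g 0 = 0] (mod p)" using cc_cong[OF assms(1), of 0 0] by simp
	thus ?thesis using cc(1)[OF assms(1), of 0] by (simp add: cong_def)
qed

text \<open>By \<open>wp_unique\<close>, an automorphism over \<open>F\<close> that moves a root by
  less than a unit does not move it at all.\<close>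

lemma cc_fix: assumes g: "embF g" and j: "j \<le> Suc l" and c: "\<And>k. k < j ==> cc g k = 0" and x: "x \<in> T j" shows "g x = x"
proof -
	have gY: "g (Y k) = Y k" if k: "k < j" for k
	proof (rule wp_unique)
		have kl: "k \<le> l" using k j by simp
		show "wp (g (Y k)) = wp (Y k)"
			using emb_Y_small(2)[OF embF_K[OF g] order_refl, of k] embF_F[OF g alpha_F[OF kl]] kl by (simp add: wp_Y)
		show "vgt (-1/p) (Y k)" by (rule Y_small[OF kl])
		show "vgt 0 (g (Y k)-Y k)" using cc(2)[OF g kl] c[OF k] by simp
	qed
	have "emb (T j) (\<lambda>x. x)" by (simp add: emb_def)
	from emb_T_eq[OF j emb_subset[OF embK_emb[OF embF_K[OF g]] T_sub_TT[OF j]] this _ _ x] embF_F[OF g] gY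
	show ?thesis by blast
qed

lemma cc_of_fix: assumes "embF g" "k \<le> l" "g (Y k) = Y k" shows "cc g k = 0"
proof -
	show ?thesis using cc_cong[OF assms(1,2), of 0] assms(3) cc(1)[OF assms(1,2)] by (simp add: cong_def)
qed

lemma embF_comp: "embF g ==> embF h ==> embF (g \<circ> h)"
	using embK_comp[of g h] by (simp add: embF_def)

lemma cc_comp: assumes g: "embF g" and h: "embF h" and k: "k \<le> l" shows "[cc (g \<circ> h) k = cc g k + cc h k] (mod p)"
proof (rule cc_cong[OF embF_comp[OF g h] k])
	define d where "d = h (Y k)-Y k - of_nat (cc h k)"
	have ge: "emb TT g" by (rule embK_emb[OF embF_K[OF g]])
	have hT: "h (Y k) \<in> TT" by (rule emb_TT_Y[OF embF_K[OF h] k])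
	have dT: "d \<in> TT" unfolding d_def by (intro sf_diff[OF TT_sf] hT Y_TT[OF k] sf_of_nat[OF TT_sf])
	have "vgt 0 (g d)" using embK_vgt[OF embF_K[OF g] dT] cc(2)[OF h k] by (simp add: d_def)
	moreover have "g d = g (h (Y k))-g (Y k) - of_nat (cc h k)"
		unfolding d_def using hT Y_TT[OF k] by (simp add: emb_diff[OF TT_sf ge] sf_diff[OF TT_sf] sf_of_nat[OF TT_sf] emb_of_nat[OF TT_sf ge])
	ultimately have 1: "vgt 0 (g (h (Y k))-g (Y k) - of_nat (cc h k))" by simp
	have "(g \<circ> h) (Y k)-Y k - of_nat (cc g k + cc h k) = (g (h (Y k))-g (Y k) - of_nat (cc h k))+(g (Y k)-Y k - of_nat (cc g k))"
		by simp
	thus "vgt 0 ((g \<circ> h) (Y k)-Y k - of_nat (cc g k + cc h k))" by (rule ssubst) (rule vgt_add[OF 1 cc(2)[OF g k]])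
qed

lemma embK_id: "embK TT (\<lambda>x. x)"
	by (simp add: embK_def emb_def)

text \<open>Each translate \<open>Y k + c k\<close> is an approximate root of the same equation, so
  \<open>extend_T\<close> over the identity of \<open>F\<close> realizes any family of values; in
  the split case the value at 0 is forced.\<close>

lemma cc_exists: assumes "splits ==> p dvd c 0"
	obtains g where "embF g" "\<And>k. k \<le> l ==> [cc g k = c k] (mod p)"
proof -
	have h: "embK F (\<lambda>x. x)" by (simp add: embK_def emb_def)
	have "\<exists>g. embK TT g \<and> (\<forall>x\<in>F. g x = x) \<and> (\<forall>k<Suc l. vgt 0 (g (Y k)-(Y k + of_nat (c k))))"
	proof (rule extend_T[OF h])
		show "Y k + of_nat (c k) \<in> TT" if "k \<le> l" for k by (rule sf_add[OF TT_sf Y_TT[OF that] sf_of_nat[OF TT_sf]])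
		show "vgt (-1/p) (Y k + of_nat (c k))" if "k \<le> l" for k
			by (rule vgt_add[OF Y_small[OF that] vge_imp_small[OF vge_of_nat]])
		show "vgt 0 (wp (Y k + of_nat (c k))-\<alpha> k)" if "k \<le> l" for k
		proof -
			show ?thesis using vgt_add[OF wp_add[OF Y_small[OF that] vge_imp_small[OF vge_of_nat[of "c k"]]] wp_of_nat[of "c k"]] by (simp add: wp_Y)
		qed
		show "vgt 0 (Y 0-(Y 0 + of_nat (c 0)))" if splits using assms[OF that] vgt_of_nat_iff[of "c 0"] by simp
	qed simp
	then obtain g where g: "embF g" "\<And>k. k < Suc l ==> vgt 0 (g (Y k)-(Y k + of_nat (c k)))" unfolding embF_def by blast
	have "[cc g k = c k] (mod p)" if "k \<le> l" for k
		by (rule cc_cong[OF g(1) that]) (use g(2)[of k] that in \<open>simp add: diff_diff_eq\<close>)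
	thus thesis using that g(1) by blast
qed

text \<open>The predecessor of \<open>Y k\<close>; the value 0 at \<open>k = 0\<close> reflects that
  \<sigma> moves \<open>\<alpha> 0\<close> only inside the maximal ideal.\<close>

definition "Yp k = (case k of 0 => 0 | Suc i => Y i)"

lemma Yp_small: "k \<le> l ==> vgt (-1/p) (Yp k)" and Yp_TT: "k \<le> l ==> Yp k \<in> TT"
	using Y_small Y_TT sf_0[OF TT_sf] by (auto simp: Yp_def split: nat.splits)

text \<open>An arbitrary extension of \<sigma> sends \<open>Y k\<close> to \<open>Y k + Yp k\<close>
  plus an element of the prime field. Normalizing these constants to 0 is what gives the lift order
  \<open>p\<close>.\<close>

definition "lifts g = (embK TT g \<and> (\<forall>x\<in>F. g x = \<sigma> x) \<and> (\<forall>k\<le>l. vgt 0 (g (Y k)-Y k-Yp k)))"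

lemma lift_ex: "\<exists>g. lifts g"
proof -
	have "\<exists>g. embK TT g \<and> (\<forall>x\<in>F. g x = \<sigma> x) \<and> (\<forall>k<Suc l. vgt 0 (g (Y k)-(Y k+Yp k)))"
	proof (rule extend_T[OF sigma(1)])
		show "Y k+Yp k \<in> TT" if "k \<le> l" for k by (rule sf_add[OF TT_sf Y_TT[OF that] Yp_TT[OF that]])
		show "vgt (-1/p) (Y k+Yp k)" if "k \<le> l" for k by (rule vgt_add[OF Y_small[OF that] Yp_small[OF that]])
		show "vgt 0 (wp (Y k+Yp k)-\<sigma> (\<alpha> k))" if "k \<le> l" for k
		proof (cases k)
			case 0
			thus ?thesis using sigma_unit[OF alpha_F[of 0] alpha0_vge] by (simp add: Yp_def wp_Y vgt_minus_commute)
		next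
			case (Suc i)
			thus ?thesis using wp_add[OF Y_small[OF that] Yp_small[OF that]] sigma_alpha[of i] that by (simp add: Yp_def wp_Y)
		qed
		show "vgt 0 (\<sigma> (Y 0)-(Y 0+Yp 0))" if splits using sigma_unit[OF Y0_F[OF that] Y0_vge] by (simp add: Yp_def)
	qed simp
	then obtain g where "embK TT g" "\<forall>x\<in>F. g x = \<sigma> x" "\<forall>k<Suc l. vgt 0 (g (Y k)-(Y k+Yp k))" by blast
	hence "lifts g" unfolding lifts_def by (auto simp: diff_diff_eq)
	thus ?thesis by blast
qed

text \<open>Up to the maximal ideal the lift is \<open>1 + N\<close> with \<open>N\<close> the shift
  from \<open>Y k\<close> to \<open>Y (k-1)\<close>, so its powers follow the binomial
  formula.\<close>

lemma lift_pow_Y: assumes g: "lifts g" shows "k \<le> l ==> vgt 0 ((g ^^ n) (Y k)-(\<Sum>i\<le>k. of_nat (n choose i)*Y (k-i)))"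
proof (induction n)
	case 0
	have "(\<Sum>i\<le>k. of_nat (0 choose i)*Y (k-i)) = (\<Sum>i\<in>{0}. of_nat (0 choose i)*Y (k-i))"
		by (rule sum.mono_neutral_right) (auto simp: binomial_eq_0)
	thus ?case by simp
next
	case (Suc n)
	have gK: "embK TT g" using g by (simp add: lifts_def)
	have ge: "emb TT g" by (rule embK_emb[OF gK])
	define S where "S = (\<Sum>i\<le>k. of_nat (n choose i)*Y (k-i))"
	have ST: "S \<in> TT" unfolding S_def by (intro sf_sum[OF TT_sf] sf_mul[OF TT_sf] sf_of_nat[OF TT_sf] Y_TT) (use Suc.prems in simp)
	have gnT: "(g ^^ n) (Y k) \<in> TT" by (rule emb_TT_Y[OF embK_funpow[OF gK] Suc.prems])
	have "vgt 0 (g ((g ^^ n) (Y k)-S))"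
		using embK_vgt[OF gK sf_diff[OF TT_sf gnT ST]] Suc by (simp add: S_def)
	hence 1: "vgt 0 ((g ^^ Suc n) (Y k)-g S)" by (simp add: emb_diff[OF TT_sf ge gnT ST])
	have gS: "g S = (\<Sum>i\<le>k. of_nat (n choose i)*g (Y (k-i)))"
		unfolding S_def using Suc.prems
		by (subst emb_sum[OF TT_sf ge]) (simp_all add: emb_mul[OF TT_sf ge] emb_of_nat[OF TT_sf ge] sf_mul[OF TT_sf] sf_of_nat[OF TT_sf] Y_TT)
	have "vgt 0 (\<Sum>i\<le>k. of_nat (n choose i)*(g (Y (k-i))-Y (k-i)-Yp (k-i)))"
	proof (rule vgt_sum)
		fix i
		have "vgt 0 (g (Y (k-i))-Y (k-i)-Yp (k-i))" using g Suc.prems unfolding lifts_def by simp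
		thus "vgt 0 (of_nat (n choose i)*(g (Y (k-i))-Y (k-i)-Yp (k-i)))" using vgt_mul'[OF vge_of_nat] by force
	qed
	hence 2: "vgt 0 (g S-(\<Sum>i\<le>k. of_nat (n choose i)*(Y (k-i)+Yp (k-i))))"
		unfolding gS sum_subtractf[symmetric] by (simp add: algebra_simps)
	have 3: "(\<Sum>i\<le>k. of_nat (n choose i)*(Y (k-i)+Yp (k-i))) = (\<Sum>i\<le>k. of_nat (Suc n choose i)*Y (k-i))"
	proof -
		have A: "(\<Sum>i\<le>k. of_nat (n choose i)*Yp (k-i)) = (\<Sum>i<k. of_nat (n choose i)*Y (k-Suc i))"
		proof -
			have "(\<Sum>i\<le>k. of_nat (n choose i)*Yp (k-i)) = (\<Sum>i<k. of_nat (n choose i)*Yp (k-i))"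
				by (simp add: lessThan_Suc_atMost[symmetric] Yp_def)
			also have "\<dots> = (\<Sum>i<k. of_nat (n choose i)*Y (k-Suc i))"
			proof (rule sum.cong[OF refl])
				fix i assume "i \<in> {..<k}"
				hence "k-i = Suc (k-Suc i)" by auto
				thus "of_nat (n choose i)*Yp (k-i) = of_nat (n choose i)*Y (k-Suc i)" by (simp add: Yp_def)
			qed
			finally show ?thesis .
		qed
		have B: "(\<Sum>i\<le>k. c i*Y (k-i)) = c 0*Y k+(\<Sum>i<k. c (Suc i)*Y (k-Suc i))" for c
			by (subst lessThan_Suc_atMost[symmetric], subst sum.lessThan_Suc_shift) simp
		have "(\<Sum>i\<le>k. of_nat (Suc n choose i)*Y (k-i)) = Y k+(\<Sum>i<k. (of_nat (n choose i) + of_nat (n choose Suc i))*Y (k-Suc i))"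
			by (subst B) simp
		also have "\<dots> = Y k+(\<Sum>i<k. of_nat (n choose Suc i)*Y (k-Suc i))+(\<Sum>i<k. of_nat (n choose i)*Y (k-Suc i))"
			by (simp add: distrib_right sum.distrib)
		also have "\<dots> = (\<Sum>i\<le>k. of_nat (n choose i)*Y (k-i))+(\<Sum>i\<le>k. of_nat (n choose i)*Yp (k-i))"
			unfolding A by (subst B) simp
		finally show ?thesis by (simp add: distrib_left sum.distrib)
	qed
	show ?case by (rule vgt_trans[OF 1]) (use 2 3 in simp)
qed

text \<open>For \<open>0 < i \<le> k \<le> l < p\<close> the number \<open>p choose i\<close> is
  divisible by \<open>p\<close>, and \<open>p*Y (k-i)\<close> lies in the maximal ideal. So the p-th
  power moves no \<open>Y k\<close> by a unit, and it fixes \<open>F\<close>; this is what splits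
  the extension.\<close>

lemma lift_pow_p: assumes g: "lifts g" and x: "x \<in> TT" shows "(g ^^ p) x = x"
proof -
	have gK: "embK TT g" using g by (simp add: lifts_def)
	have gF: "(g ^^ n) x = (\<sigma> ^^ n) x" if "x \<in> F" for n x
	proof (induction n)
		case (Suc n)
		have "(\<sigma> ^^ n) x \<in> F" using F_emb_mem[OF conjunct1[OF sigma_pow] that] .
		thus ?case using Suc g by (simp add: lifts_def)
	qed simp
	have e: "embF (g ^^ p)" unfolding embF_def using embK_funpow[OF gK] gF sigma_p by auto
	have "cc (g ^^ p) k = 0" if k: "k < Suc l" for k
	proof -
		have kl: "k \<le> l" using k by simp
		have "vgt 0 (\<Sum>i\<in>{1..k}. of_nat (p choose i)*Y (k-i))"
		proof (rule vgt_sum)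
			fix i assume i: "i \<in> {1..k}"
			have "vge 1 (of_nat (p choose i))" using i kl l p_gt_0 by (intro vge_binomial) auto
			moreover have "vgt (-1/p) (Y (k-i))" by (rule Y_small) (use kl in simp)
			ultimately have "vgt (1 + -1/p) (of_nat (p choose i)*Y (k-i))" by (rule vgt_mul')
			moreover have "0 \<le> 1 + -1/real p" using p_gt_0 by simp
			ultimately show "vgt 0 (of_nat (p choose i)*Y (k-i))" by (rule vgt_mono)
		qed
		moreover have "(\<Sum>i\<le>k. of_nat (p choose i)*Y (k-i)) = Y k+(\<Sum>i\<in>{1..k}. of_nat (p choose i)*Y (k-i))"
		proof -
			have "{..k} = insert 0 {1..k}" by auto
			thus ?thesis by simp
		qed
		ultimately have "vgt 0 ((g ^^ p) (Y k)-Y k)" using vgt_add[OF lift_pow_Y[OF g kl, of p]] by force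
		hence "[cc (g ^^ p) k = 0] (mod p)" using cc_cong[OF e kl, of 0] by simp
		thus ?thesis using cc(1)[OF e kl] by (simp add: cong_def)
	qed
	thus ?thesis by (rule cc_fix[OF e order_refl _ x])
qed

text \<open>Conjugation by an element acting on \<open>Y k\<close> as \<open>Y k \<mapsto> Y k + Y (k - 1)\<close> up to constants.\<close>

lemma cc_conj:
	assumes g: "embK TT g" and \<tau>: "embF \<tau>" and k: "k \<le> l" and n: "vgt 0 (g (Y k)-Y k-Yp k - of_nat n)"
	shows "embF (inv_into TT g \<circ> \<tau> \<circ> g)"
		"[cc (inv_into TT g \<circ> \<tau> \<circ> g) k = cc \<tau> k+(case k of 0 => 0 | Suc i => cc \<tau> i)] (mod p)"
proof -
	define h where "h = inv_into TT g"
	have hK: "embK TT h" unfolding h_def by (rule embK_inv[OF g])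
	have he: "emb TT h" and fe: "emb TT \<tau>" and fK: "embK TT \<tau>" using embK_emb[OF hK] embF_K[OF \<tau>] embK_emb by blast+
	have hg: "h (g x) = x" if "x \<in> TT" for x
		unfolding h_def by (rule inv_into_f_f[OF emb_inj[OF TT_sf embK_emb[OF g]] that])
	have "(h \<circ> \<tau> \<circ> g) x = x" if "x \<in> F" for x
	proof -
		have "\<tau> (g x) = g x" using F_emb_mem[OF embK_T_F[OF g] that] by (rule embF_F[OF \<tau>])
		moreover have "x \<in> TT" using that F_sub_T by blast
		ultimately show ?thesis using hg by simp
	qed
	hence e: "embF (h \<circ> \<tau> \<circ> g)" unfolding embF_def using embK_comp[OF embK_comp[OF hK fK] g] by simp
	thus "embF (inv_into TT g \<circ> \<tau> \<circ> g)" by (simp add: h_def)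
	define c where "c = (case k of 0 => 0 | Suc i => cc \<tau> i)"
	have fYp: "vgt 0 (\<tau> (Yp k)-Yp k - of_nat c)"
		using cc(2)[OF \<tau>] k emb_0[OF TT_sf fe] by (auto simp: Yp_def c_def split: nat.splits)
	define d where "d = g (Y k)-Y k-Yp k - of_nat n"
	have gT: "g (Y k) \<in> TT" by (rule emb_TT_Y[OF g k])
	have dT: "d \<in> TT" unfolding d_def by (intro sf_diff[OF TT_sf] gT Y_TT[OF k] Yp_TT[OF k] sf_of_nat[OF TT_sf])
	have d0: "vgt 0 d" using n by (simp add: d_def)
	have fd: "vgt 0 (\<tau> d)" using embK_vgt[OF fK dT] d0 by simp
	have fd_e: "\<tau> d = \<tau> (g (Y k))-\<tau> (Y k)-\<tau> (Yp k) - of_nat n"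
		unfolding d_def using gT Y_TT[OF k] Yp_TT[OF k]
		by (simp add: emb_diff[OF TT_sf fe] sf_diff[OF TT_sf] sf_of_nat[OF TT_sf] emb_of_nat[OF TT_sf fe])
	define w where "w = \<tau> (g (Y k))-g (Y k) - of_nat (cc \<tau> k + c)"
	have fgT: "\<tau> (g (Y k)) \<in> TT" by (rule emb_TT_mem[OF fK gT])
	have wT: "w \<in> TT" unfolding w_def by (intro sf_diff[OF TT_sf] fgT gT sf_of_nat[OF TT_sf])
	have "w = \<tau> d-d+(\<tau> (Y k)-Y k - of_nat (cc \<tau> k))+(\<tau> (Yp k)-Yp k - of_nat c)"
		unfolding fd_e w_def by (simp add: d_def)
	hence "vgt 0 w" using vgt_add[OF vgt_add[OF vgt_diff[OF fd d0] cc(2)[OF \<tau> k]] fYp] by simp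
	hence "vgt 0 (h w)" using embK_vgt[OF hK wT] by simp
	moreover have "h w = h (\<tau> (g (Y k)))-Y k - of_nat (cc \<tau> k + c)"
		unfolding w_def using fgT gT hg[OF Y_TT[OF k]]
		by (simp add: emb_diff[OF TT_sf he] sf_diff[OF TT_sf] sf_of_nat[OF TT_sf] emb_of_nat[OF TT_sf he] del: of_nat_add)
	ultimately have "vgt 0 ((h \<circ> \<tau> \<circ> g) (Y k)-Y k - of_nat (cc \<tau> k + c))" by simp
	from cc_cong[OF e k this] show "[cc (inv_into TT g \<circ> \<tau> \<circ> g) k = cc \<tau> k+(case k of 0 => 0 | Suc i => cc \<tau> i)] (mod p)"
		unfolding h_def c_def .
qed

text \<open>At level \<open>i\<close> the automorphism fixes \<open>T i\<close> and moves
  \<open>G i\<close>, of pole order \<open>bb i\<close>, by a unit: a shift of \<open>bb i\<close>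
  steps. At a later level \<open>n\<close> the constant has pole order \<open>bb n\<close>, prime to
  \<open>p\<close>, so it is shifted by exactly \<open>bb i\<close> steps; as
  \<open>bb i < bb n\<close> the difference is still a pole, and the equation passes the same number
  of steps, in the finer units, to \<open>G n\<close>.\<close>

lemma emb_break:
	assumes \<tau>: "embF \<tau>" and i: "0 < i" "i \<le> l" and c: "\<And>k. k < i ==> cc \<tau> k = 0" "cc \<tau> i \<noteq> 0"
	shows "i \<le> j ==> j \<le> l ==> has_break (T (Suc j)) (p^Suc j) \<tau> (real (bb i))"
proof (induction j rule: dec_induct)
	case base
	have fe: "emb (T (Suc i)) \<tau>" using emb_subset[OF embK_emb[OF embF_K[OF \<tau>]] T_sub_TT] i by simp
	have fx: "\<tau> x = x" if "x \<in> T i" for x using cc_fix[OF \<tau> _ c(1) that] i by simp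
	have Gi: "\<tau> (G i)-G i = \<tau> (Y i)-Y i"
	proof -
		have "\<tau> (Y i-u i) = \<tau> (Y i)-\<tau> (u i)"
			by (rule emb_diff[OF TT_sf embK_emb[OF embF_K[OF \<tau>]] Y_TT[OF i(2)]]) (use u(1)[OF i] T_sub_TT[of i] i in auto)
		thus ?thesis using fx[OF u(1)[OF i]] by (simp add: G_def)
	qed
	have "\<not> p dvd cc \<tau> i" using c(2) cc(1)[OF \<tau> i(2)] by auto
	hence "val 0 (\<tau> (Y i)-Y i)"
		using val_cong[OF cc(2)[OF \<tau> i(2)]] val_of_nat by blast
	hence Gv: "val 0 (\<tau> (G i)-G i)" by (simp add: Gi)
	have b0: "0 < real (bb i)" using bb_ndvd[OF i(1)] by (simp, intro gr0I) simp
	have "has_break (ext (T i) (G i)) (p^i*p) \<tau> (real (bb i))"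
	proof (rule has_break_step[OF T_lf[OF i(1)] G_ram(1)[OF i] G_ram(2)[OF i]])
		show "ext (T i) (G i) = lin_span (T i) (G i) p" "sfield (ext (T i) (G i))" "emb (ext (T i) (G i)) \<tau>"
			using G(3,4)[OF i] T_sf[of "Suc i"] i fe by auto
		show "val ((of_int (- int (bb i))+real (bb i))/(real (p^i)*real p)) (\<tau> (G i)-G i)" using Gv by simp
		show "vgt (of_int n/real (p^i)+real (bb i)/(real (p^i)*real p)) (\<tau> x-x)" if "x \<in> T i" for x n
			using fx[OF that] by simp
	qed (use i b0 in auto)
	thus ?case using G(3)[OF i] by (simp add: mult.commute)
next
	case (step j)
	define n where "n = Suc j"
	have n: "0 < n" "n \<le> l" using step by (auto simp: n_def)
	have IH: "has_break (T n) (p^n) \<tau> (real (bb i))" using step by (simp add: n_def)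
	have fK: "embK TT \<tau>" and fe: "emb TT \<tau>" using embF_K[OF \<tau>] embK_emb by auto
	have ne: "emb (T (Suc n)) \<tau>" using emb_subset[OF fe T_sub_TT] n by simp
	define A where "A = \<alpha> n-wp (u n)"
	have Ts: "sfield (T n)" using T_sf n by simp
	have uT: "u n \<in> T n" by (rule u(1)[OF n])
	have AT: "A \<in> T n" unfolding A_def wp_def
		by (intro sf_diff[OF Ts] sf_power[OF Ts] uT) (use alpha_F[OF n(2)] F_sub_T in blast)
	have ATT: "A \<in> TT" using AT T_sub_TT[of n] n by auto
	have Av: "val (of_int (- int (bb n))/real (p^n)) A" using u(3)[OF n] by (simp add: A_def)
	have fA: "val ((of_int (- int (bb n))+real (bb i))/real (p^n)) (\<tau> A-A)"
		by (rule has_breakD(2)[OF IH AT Av G_ram(2)[OF n]])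
	have lt: "bb i < bb n"
	proof -
		have "{..<i} \<subset> {..<n}" using step by (auto simp: n_def)
		thus ?thesis unfolding bb_def by (intro sum_strict_mono2[of _ _ i]) (use step p_gt_0 in \<open>auto simp: n_def\<close>)
	qed
	hence neg: "(of_int (- int (bb n))+real (bb i))/real (p^n) < 0" using p_gt_0 by (intro divide_neg_pos) auto
	have GT: "G n \<in> TT" using ext_mem[OF Ts, of "G n"] G(3)[OF n] T_sub_TT[of "Suc n"] n by auto
	have wGT: "wp (G n) \<in> TT" unfolding wp_def by (intro sf_diff[OF TT_sf] sf_power[OF TT_sf] GT)
	have m: "vgt 0 (wp (G n)-A)" using G(2)[OF n] by (simp add: A_def)
	have fm: "vgt 0 (wp (\<tau> (G n))-\<tau> A)"
		using embK_vgt[OF fK sf_diff[OF TT_sf wGT ATT]] m by (simp add: emb_diff[OF TT_sf fe wGT ATT] wp_emb[OF TT_sf fe GT])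
	have bg: "- 1/real p < - real (bb n)/(real (p^n)*real p)"
	proof -
		have "real (bb n) < real (p^n)" using bb_less[of n] by (simp only: of_nat_less_iff)
		hence "real (bb n)/(real (p^n)*real p) < real (p^n)/(real (p^n)*real p)"
			using p_gt_0 by (intro divide_strict_right_mono) auto
		thus ?thesis using p_gt_0 by simp
	qed
	have Gs: "vgt (-1/p) (G n)" using G(1)[OF n] bg by (simp add: val_vgt)
	have fGs: "vgt (-1/p) (\<tau> (G n))" using embK_vgt[OF fK GT] Gs by simp
	have "vgt 0 (wp (\<tau> (G n)-G n)-(wp (\<tau> (G n))-wp (G n)))" by (rule wp_diff[OF fGs Gs])
	from vgt_add[OF this vgt_diff[OF fm m]] have "vgt 0 (wp (\<tau> (G n)-G n)-(\<tau> A-A))" by (simp add: algebra_simps)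
	hence "vgt ((of_int (- int (bb n))+real (bb i))/real (p^n)) (wp (\<tau> (G n)-G n)-(\<tau> A-A))"
		by (rule vgt_mono) (use neg in simp)
	from val_cong[OF this] fA have "val ((of_int (- int (bb n))+real (bb i))/real (p^n)) (wp (\<tau> (G n)-G n))" by blast
	from wp_val[OF this neg]
	have dv: "val ((of_int (- int (bb n))+real (bb i))/(real (p^n)*real p)) (\<tau> (G n)-G n)" by simp
	have b0: "0 < real (bb i)" using bb_ndvd[OF i(1)] by (simp, intro gr0I) simp
	have "has_break (ext (T n) (G n)) (p^n*p) \<tau> (real (bb i))"
	proof (rule has_break_step[OF T_lf[OF n(1)] G_ram(1)[OF n] G_ram(2)[OF n]])
		show "ext (T n) (G n) = lin_span (T n) (G n) p" "sfield (ext (T n) (G n))" "emb (ext (T n) (G n)) \<tau>"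
			using G(3,4)[OF n] T_sf[of "Suc n"] n ne by auto
		show "vgt (of_int k/real (p^n)+real (bb i)/(real (p^n)*real p)) (\<tau> x-x)"
			if "x \<in> T n" "val (of_int k/real (p^n)) x" for x k
		proof (rule vge_vgt[OF has_breakD(1)[OF IH that]])
			have "real (bb i)/(real (p^n)*real p) = real (bb i)/real (p^n)/real p" by simp
			also have "\<dots> < real (bb i)/real (p^n)" using b0 p_gt_1 by (simp add: divide_less_eq)
			finally show "of_int k/real (p^n)+real (bb i)/(real (p^n)*real p) < (of_int k+real (bb i))/real (p^n)"
				by (simp add: add_divide_distrib)
		qed
	qed (use n b0 dv in auto)
	thus ?case using G(3)[OF n] by (simp add: mult.commute n_def)
qed

end

subsection \<open>Normal extensions\<close>

text \<open>Coefficient lists of \<open>univ_poly\<close> begin with the leading coefficient, those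
  of \<open>Poly\<close> with the constant one.\<close>

lemma eval_Poly: "ring.eval Omega q x = poly (Poly (rev q)) (x :: 'a::field)"
proof (induction q)
	case (Cons a q)
	thus ?case
		by (simp add: Poly_snoc poly_monom)
qed (simp add: ring.eval.simps[OF ring_from_type_algebra])

lemma over_Poly:
	assumes "sfield (E :: 'a::field set)" "q \<in> carrier (univ_poly Omega E)" shows "over_field E (Poly (rev q))"
proof -
	have "set q \<subseteq> E" using assms(2) unfolding univ_poly_carrier[symmetric] polynomial_def by auto
	thus ?thesis
		using sf_0[OF assms(1)] nth_mem[of _ "rev q"] by (auto simp: over_field_def nth_default_def simp del: nth_mem)
qed

lemma Poly_rev_nonzero:
	assumes "q \<in> carrier (univ_poly Omega E)" "(q :: 'a::field list) \<noteq> []" shows "Poly (rev q) \<noteq> 0"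
proof -
	have "hd q \<noteq> 0" using assms unfolding univ_poly_carrier[symmetric] polynomial_def by auto
	moreover have "pcoeff (Poly (rev q)) (length q-1) = hd q"
		using assms(2) by (simp add: nth_default_def rev_nth hd_conv_nth)
	ultimately show ?thesis by (metis Polynomial.coeff_0)
qed

lemma poly_list:
	assumes "over_field (E :: 'a::field set) P" "P \<noteq> 0"
	shows "rev (coeffs P) \<in> carrier (univ_poly Omega E)" "ring.eval Omega (rev (coeffs P)) x = poly P x"
proof -
	have "set (coeffs P) \<subseteq> E" using assms(1) by (auto simp: coeffs_def over_field_def)
	moreover have "hd (rev (coeffs P)) \<noteq> 0" using assms(2) last_coeffs_eq_coeff_degree[of P] by (simp add: hd_rev)
	ultimately show "rev (coeffs P) \<in> carrier (univ_poly Omega E)"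
		unfolding univ_poly_carrier[symmetric] polynomial_def by simp
	show "ring.eval Omega (rev (coeffs P)) x = poly P x" by (simp add: eval_Poly)
qed

text \<open>An irreducible \<open>q\<close> vanishing at \<open>x\<close> is associated to the
  minimal polynomial of \<open>x\<close>, hence divides every polynomial over \<open>E\<close> that
  vanishes there.\<close>

lemma irr_dvd_root:
	assumes E: "sfield (E :: 'a::field set)" and alg: "\<not> ring.transcendental Omega E x"
		and q: "q \<in> carrier (univ_poly Omega E)" "ring_irreducible\<^bsub>univ_poly Omega E\<^esub> q" "ring.eval Omega q x = 0"
		and P: "over_field E P" "poly P x = 0" and y: "ring.eval Omega q y = 0"
	shows "poly P y = 0"
proof (cases "P = 0")
	case False
	have alg': "(ring.algebraic Omega over E) x" using alg by (simp add: over_def)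
	have xc: "x \<in> carrier Omega" by simp
	note I = Om.IrrE[OF E xc alg']
	have "q \<in> PIdl\<^bsub>univ_poly Omega E\<^esub> (Om.Irr E x)"
		unfolding Om.Irr_generates_ker[OF E xc alg', symmetric] a_kernel_def' using q by simp
	from Om.cgenideal_pirreducible[OF E I(1,2) q(2) this]
	have "Om.Irr E x \<sim>\<^bsub>univ_poly Omega E\<^esub> q" .
	hence d: "q divides\<^bsub>univ_poly Omega E\<^esub> Om.Irr E x" by (simp add: associated_def)
	have "q pdivides\<^bsub>Omega\<^esub> Om.Irr E x" using Om.pdivides_iff_shell[OF E q(1) I(1)] d by blast
	moreover have "Om.Irr E x pdivides\<^bsub>Omega\<^esub> rev (coeffs P)"
		by (rule Om.Irr_minimal[OF E xc alg' poly_list(1)[OF P(1) False]]) (simp add: poly_list(2)[OF P(1) False] P(2))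
	ultimately have "q divides\<^bsub>univ_poly Omega E\<^esub> rev (coeffs P)"
		using Om.pdivides_iff_shell[OF E I(1) poly_list(1)[OF P(1) False]] d monoid.divides_trans[OF comm_monoid.axioms(1)[OF cring.axioms(2)[OF Om.univ_poly_is_cring[OF subfieldE(1)[OF E]]]]] q(1)
		by blast
	then obtain r where r: "r \<in> carrier (univ_poly Omega E)" "rev (coeffs P) = q \<otimes>\<^bsub>univ_poly Omega E\<^esub> r"
		by auto
	interpret h: ring_hom_ring "univ_poly Omega E" Omega "\<lambda>p. ring.eval Omega p y"
		by (rule Om.eval_ring_hom[OF subfieldE(1)[OF E]]) simp
	have "poly P y = ring.eval Omega q y*ring.eval Omega r y"
		unfolding poly_list(2)[OF P(1) False, symmetric] r(2) using h.hom_mult[OF q(1) r(1)] by simp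
	thus ?thesis using y by simp
qed simp

lemma finite_alg: "sfield (K :: 'a::field set) ==> sfield E ==> ring.finite_dimension Omega K E ==> x \<in> E ==> \<not> ring.transcendental Omega K x"
	using Om.finite_dimension_imp_algebraic[OF _ subfieldE(1), of K E x] by (simp add: over_def)

text \<open>The minimal polynomial qualifies: the powers of \<open>x\<close> below its degree are
  independent, so their number is at most \<open>n\<close>.\<close>

lemma small_degree_poly:
	assumes K: "sfield (K :: 'a::field set)" and E: "sfield E" and d: "ring.dimension Omega n K E" and x: "x \<in> E"
	obtains P where "over_field K P" "P \<noteq> 0" "pdeg P \<le> n" "poly P x = 0"
proof -
	have xc: "x \<in> carrier Omega" by simp
	have alg: "(ring.algebraic Omega over K) x"
		using Om.finite_dimension_imp_algebraic[OF K subfieldE(1)[OF E] Om.finite_dimensionI[OF d] x] .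
	define q where "q = Om.Irr K x"
	note I = Om.IrrE[OF K xc alg, folded q_def]
	have "length (Om.exp_base x (length q-1)) \<le> n"
	proof (rule Om.independent_length_le_dimension[OF K d])
		show "ring.independent Omega K (Om.exp_base x (length q-1))" unfolding q_def by (rule Om.exp_base_independent[OF K xc alg])
		show "set (Om.exp_base x (length q-1)) \<subseteq> E" using sf_power[OF E x] by (auto simp: Om.exp_base_def)
	qed
	hence ln: "length q-1 \<le> n" by (simp add: Om.exp_base_def)
	have q0: "q \<noteq> []"
		using Om.pirreducible_degree[OF K I(1,2)] by auto
	show thesis
	proof (rule that[of "Poly (rev q)"])
		show "over_field K (Poly (rev q))" by (rule over_Poly[OF K I(1)])
		show "poly (Poly (rev q)) x = 0" using I(4) by (simp add: eval_Poly)
		show "Poly (rev q) \<noteq> 0" by (rule Poly_rev_nonzero[OF I(1) q0])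
		have "pdeg (Poly (rev q)) \<le> length q-1"
			by (rule degree_le) (auto simp: nth_default_def)
		thus "pdeg (Poly (rev q)) \<le> n" using ln by simp
	qed
qed

subsection \<open>Galois groups\<close>

lemma Gal_iff:
	assumes "sfield E"
	shows "(g \<in> carrier (Gal E F)) = (g \<in> extensional E \<and> g ` E = E \<and> emb E g \<and> (\<forall>x\<in>F. g x = x))"
proof -
	have "(g \<in> ring_hom (Omega\<lparr>carrier := E\<rparr>) (Omega\<lparr>carrier := E\<rparr>)) = (g \<in> E \<rightarrow> E \<and> emb E g)"
		by (auto simp: ring_hom_def emb_def)
	moreover have "emb E g ==> inj_on g E" by (rule emb_inj[OF assms])
	ultimately show ?thesis by (auto simp: Gal_def Bij_def bij_betw_def)
qed

lemma Gal_mult: "g \<in> carrier (Gal E F) ==> h \<in> carrier (Gal E F) ==> g \<otimes>\<^bsub>Gal E F\<^esub> h = compose E g h"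
	by (simp add: Gal_def BijGroup_def)

lemma Gal_one: "\<one>\<^bsub>Gal E F\<^esub> = (\<lambda>x\<in>E. x)"
	by (simp add: Gal_def BijGroup_def)

lemma Gal_subgroup: assumes E: "sfield E" "F \<subseteq> E" shows "subgroup (carrier (Gal E F)) (BijGroup E)"
proof (rule group.subgroupI[OF group_BijGroup])
	show "carrier (Gal E F) \<subseteq> carrier (BijGroup E)" by (auto simp: Gal_def BijGroup_def)
	have "(\<lambda>x\<in>E. x) \<in> carrier (Gal E F)"
		using E(2) by (auto simp: Gal_iff[OF E(1)] emb_def sf_add[OF E(1)] sf_mul[OF E(1)] sf_1[OF E(1)])
	thus "carrier (Gal E F) \<noteq> {}" by blast
next
	fix g assume g: "g \<in> carrier (Gal E F)"
	hence g': "g ` E = E" "emb E g" "\<And>x. x \<in> F ==> g x = x" by (auto simp: Gal_iff[OF E(1)])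
	have gB: "g \<in> Bij E" using g by (simp add: Gal_def)
	define h where "h = (\<lambda>x\<in>E. inv_into E g x)"
	have hE: "h x \<in> E" "g (h x) = x" if "x \<in> E" for x
		using that g'(1) by (simp_all add: h_def inv_into_into f_inv_into_f)
	have hg: "h (g x) = x" if "x \<in> E" for x
	proof -
		have "g x \<in> E" using that g'(1) by blast
		thus ?thesis using that emb_inj[OF E(1) g'(2)] by (simp add: h_def)
	qed
	have *: "h y = x" if "x \<in> E" "g x = y" for x y using hg[OF that(1)] that(2) by simp
	have "h (x+y) = h x+h y" "h (x*y) = h x*h y" if "x \<in> E" "y \<in> E" for x y
		by (rule *, use hE[OF that(1)] hE[OF that(2)] in \<open>simp_all add: sf_add[OF E(1)] sf_mul[OF E(1)] emb_add[OF E(1) g'(2)] emb_mul[OF E(1) g'(2)]\<close>)+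
	moreover have "h 1 = 1" by (rule *) (use emb_1[OF E(1) g'(2)] sf_1[OF E(1)] in auto)
	ultimately have "emb E h" by (simp add: emb_def)
	moreover have "h x = x" if "x \<in> F" for x by (rule *) (use that g'(3) E(2) in auto)
	moreover have "h ` E = E"
	proof
		show "E \<subseteq> h ` E"
		proof
			fix x assume x: "x \<in> E"
			hence "g x \<in> E" using g'(1) by blast
			thus "x \<in> h ` E" using hg[OF x] by (metis imageI)
		qed
	qed (use hE(1) in blast)
	ultimately show "m_inv (BijGroup E) g \<in> carrier (Gal E F)"
		using inv_BijGroup[OF gB] by (simp add: Gal_iff[OF E(1)] h_def)
next
	fix g h assume gh: "g \<in> carrier (Gal E F)" "h \<in> carrier (Gal E F)"
	hence g': "g ` E = E" "emb E g" "\<And>x. x \<in> F ==> g x = x" and h': "h ` E = E" "emb E h" "\<And>x. x \<in> F ==> h x = x"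
		by (auto simp: Gal_iff[OF E(1)])
	have hE: "h x \<in> E" if "x \<in> E" for x using that h'(1) by blast
	have "emb E (compose E g h)"
		by (simp add: emb_def compose_def sf_add[OF E(1)] sf_mul[OF E(1)] sf_1[OF E(1)] hE
				emb_add[OF E(1) g'(2)] emb_mul[OF E(1) g'(2)] emb_1[OF E(1) g'(2)] emb_add[OF E(1) h'(2)] emb_mul[OF E(1) h'(2)] emb_1[OF E(1) h'(2)])
	moreover have "compose E g h ` E = E"
	proof -
		have "compose E g h ` E = g ` (h ` E)" unfolding image_image by (rule image_cong) (simp_all add: compose_def)
		thus ?thesis using g'(1) h'(1) by simp
	qed
	moreover have "\<forall>x\<in>F. compose E g h x = x" using g'(3) h'(3) E(2) by (auto simp: compose_def)
	ultimately have "compose E g h \<in> carrier (Gal E F)" by (simp add: Gal_iff[OF E(1)])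
	thus "g \<otimes>\<^bsub>BijGroup E\<^esub> h \<in> carrier (Gal E F)" using Gal_mult[OF gh] by (simp add: Gal_def)
qed

lemma Gal_group: assumes "sfield E" "F \<subseteq> E" shows "group (Gal E F)"
proof -
	show ?thesis using subgroup.subgroup_is_group[OF Gal_subgroup[OF assms] group_BijGroup] by (simp add: Gal_def)
qed

lemma sf_Int: "sfield (A :: 'a::field set) ==> sfield B ==> sfield (A \<inter> B)"
	by (rule sfieldI) (simp_all add: sf_1 sf_diff sf_mul sf_inverse)

text \<open>With \<open>x = poly P z\<close> and \<open>P\<close> of degree below \<open>n\<close>,
  the polynomial \<open>P - x\<close> has the \<open>n\<close> distinct roots \<open>h c z\<close>;
  so it vanishes and \<open>P\<close> is the constant \<open>x\<close>.\<close>

lemma fixed_lin_span: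
	assumes E: "sfield (E :: 'a::field set)" "sfield E'" "E \<subseteq> E'" "z \<in> E'" and n: "0 < n"
		and x: "x \<in> lin_span E z n" and h: "\<And>c. c < n ==> emb E' (h c)" "\<And>c y. c < n ==> y \<in> E ==> h c y = y"
		"inj_on (\<lambda>c. h c z) {..<n}" "\<And>c. c < n ==> h c x = x"
	shows "x \<in> E"
proof -
	obtain P where P: "x = poly P z" "over_field E P" "\<forall>i\<ge>n. pcoeff P i = 0" using x by (auto simp: lin_span_poly[OF E(1)])
	have dP: "pdeg P < n" using P(3) n by (metis leading_coeff_0_iff degree_0 linorder_not_less)
	have PE: "over_field E' P" by (rule over_mono[OF P(2) E(3)])
	define Q where "Q = P - [:x:]"
	have r: "poly Q (h c z) = 0" if "c < n" for c
	proof -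
		have "map_poly (h c) P = P"
			by (rule poly_eqI) (use P(2) h(2)[OF that] in \<open>simp add: coeff_map_emb[OF E(2) h(1)[OF that]] over_field_def\<close>)
		hence "h c x = poly P (h c z)" unfolding P(1) using emb_poly[OF E(2) h(1)[OF that] PE E(4)] by simp
		thus ?thesis using h(4)[OF that] by (simp add: Q_def)
	qed
	have "Q = 0"
	proof (rule ccontr)
		assume Q: "Q \<noteq> 0"
		have "n = card ((\<lambda>c. h c z) ` {..<n})" using card_image[OF h(3)] by simp
		also have "\<dots> \<le> card {y. poly Q y = 0}" by (rule card_mono[OF poly_roots_finite[OF Q]]) (use r in auto)
		also have "\<dots> \<le> pdeg Q" by (rule card_poly_roots_bound[OF Q])
		also have "\<dots> < n" unfolding Q_def using degree_diff_le_max[of P "[:x:]"] dP by simp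
		finally show False by simp
	qed
	hence "P = [:x:]" by (simp add: Q_def)
	thus ?thesis using P(2) by simp
qed

section \<open>Fixed fields, the normal closure and the uniqueness of the subfield\<close>

context eis
begin

lemma embK_cong: "embK E g ==> sfield E ==> K \<subseteq> E ==> (\<And>x. x \<in> E ==> h x = g x) ==> embK E h"
	using emb_cong[of E g h] by (auto simp: embK_def)

lemma embK_comp': "embK E g ==> embK E h ==> h ` E \<subseteq> E ==> embK E (g \<circ> h)"
	unfolding embK_def emb_def by (simp add: image_subset_iff)

lemma emb_F_image: "embK F g ==> g ` F = F"
	by (rule emb_surj[OF K_sf F_sf KF _ embK_emb _ F_dim]) (use F_emb_mem in \<open>auto simp: embK_def\<close>)

lemma K_fin_dim: assumes "sfield E" "K \<subseteq> E" "E \<subseteq> TT" shows "ring.finite_dimension Omega K E"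
proof -
	obtain n where n: "ring.dimension Omega n K TT" using T_dim_K[of "Suc l"] by blast
	have "subalgebra K E Omega"
	proof (rule subalgebra.intro)
		show "subgroup E (add_monoid Omega)"
			by (rule Om.add.subgroupI) (use sf_0[OF assms(1)] sf_minus[OF assms(1)] sf_add[OF assms(1)] in \<open>auto simp: a_inv_def[symmetric]\<close>)
		show "subalgebra_axioms K E Omega"
			using sf_mul[OF assms(1)] assms(2) by (auto simp: subalgebra_axioms_def)
	qed
	thus ?thesis using Om.subalbegra_incl_imp_finite_dimension[OF K_sf Om.finite_dimensionI[OF n] _ assms(3)] by blast
qed

lemma K_complete_sub: assumes "sfield E" "K \<subseteq> E" "E \<subseteq> TT" shows "vcomplete E"
proof -
	obtain n where "ring.dimension Omega n K E" using K_fin_dim[OF assms] by blast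
	thus ?thesis by (rule dimension_complete[OF K_sf lf_complete[OF K]])
qed

text \<open>The orbit polynomial of \<open>x\<close> has coefficients fixed by all embeddings, hence
  in \<open>K\<close>. The irreducible polynomial with root \<open>x\<close> divides it, so all of
  its roots lie in the orbit and thus in \<open>E\<close>.\<close>

lemma normal_of_fixed:
	assumes E: "sfield E" "K \<subseteq> E" "E \<subseteq> TT" and mem: "\<And>g. embK E g ==> g ` E = E"
		and fx: "\<And>x. x \<in> E ==> (\<And>g. embK E g ==> g x = x) ==> x \<in> K"
	shows "normal_ext K E"
	unfolding normal_ext_def
proof (intro conjI ballI impI allI)
	show "field_ext K E" using K_sf E by (simp add: field_ext_def)
	show alg: "\<not> ring.transcendental Omega K x" if "x \<in> E" for x by (rule finite_alg[OF K_sf E(1) K_fin_dim[OF E] that])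
	fix q y
	assume q: "q \<in> carrier (univ_poly Omega K)" "ring_irreducible\<^bsub>univ_poly Omega K\<^esub> q"
		and "\<exists>x\<in>E. ring.eval Omega q x = 0" and y: "ring.eval Omega q y = 0"
	then obtain x where x: "x \<in> E" "ring.eval Omega q x = 0" by blast
	define Q where "Q = Poly (rev q)"
	have Q: "over_field K Q" "poly Q x = 0" using over_Poly[OF K_sf q(1)] x(2) by (simp_all add: Q_def eval_Poly)
	define S where "S = {g x | g. embK E g}"
	have S_E: "S \<subseteq> E" unfolding S_def using mem x(1) by blast
	have id: "embK E (\<lambda>x. x)" by (simp add: embK_def emb_def)
	have xS: "x \<in> S" unfolding S_def using id by force
	have "Q \<noteq> 0"
		unfolding Q_def using Om.pirreducible_degree[OF K_sf q] by (intro Poly_rev_nonzero[OF q(1)]) auto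
	hence "finite {z. poly Q z = 0}" by (rule poly_roots_finite)
	moreover have "S \<subseteq> {z. poly Q z = 0}" unfolding S_def using embK_root[OF E(1,2) _ Q(1) x(1) Q(2)] by blast
	ultimately have fin: "finite S" by (rule finite_subset[rotated])
	have gS: "g ` S = S" if g: "embK E g" for g
	proof (rule endo_inj_surj[OF fin])
		show "g ` S \<subseteq> S"
		proof
			fix w assume "w \<in> g ` S"
			then obtain h where h: "embK E h" "w = g (h x)" by (auto simp: S_def)
			have "embK E (g \<circ> h)" by (rule embK_comp'[OF g h(1)]) (use mem[OF h(1)] in simp)
			moreover have "w = (g \<circ> h) x" by (simp add: h(2))
			ultimately show "w \<in> S" unfolding S_def by blast
		qed
		show "inj_on g S" by (rule inj_on_subset[OF emb_inj[OF E(1) embK_emb[OF g]] S_E])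
	qed
	define P where "P = (\<Prod>z\<in>S. [:-z, 1:])"
	have *: "over_field E (\<Prod>z\<in>A. [:-z, 1:]) \<and> (\<forall>g. embK E g --> map_poly g (\<Prod>z\<in>A. [:-z, 1:]) = (\<Prod>z\<in>A. [:- g z, 1:]))"
		if "finite A" "A \<subseteq> E" for A
		using that
	proof (induction A rule: finite_induct)
		case empty
		have "map_poly g 1 = 1" if "embK E g" for g
			by (rule poly_eqI) (use emb_0[OF E(1) embK_emb[OF that]] emb_1[OF E(1) embK_emb[OF that]] in \<open>simp add: coeff_map_poly\<close>)
		thus ?case by (simp add: over_field_def sf_0[OF E(1)] sf_1[OF E(1)])
	next
		case (insert a A)
		have a: "over_field E [:-a, 1:]" using insert.prems sf_minus[OF E(1)] sf_1[OF E(1)] over_0[OF E(1)] by simp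
		have A: "over_field E (\<Prod>z\<in>A. [:-z, 1:])" using insert by blast
		have "map_poly g (\<Prod>z\<in>insert a A. [:-z, 1:]) = (\<Prod>z\<in>insert a A. [:- g z, 1:])" if g: "embK E g" for g
		proof -
			note ge = embK_emb[OF g]
			have "map_poly g [:-a, 1:] = [:- g a, 1:]"
				using insert.prems by (simp add: map_poly_pCons emb_0[OF E(1) ge] emb_1[OF E(1) ge] emb_minus[OF E(1) ge])
			moreover have "map_poly g (\<Prod>z\<in>A. [:-z, 1:]) = (\<Prod>z\<in>A. [:- g z, 1:])" using insert g by blast
			ultimately show ?thesis using insert(1,2) map_emb_mult[OF E(1) ge a A] by simp
		qed
		thus ?case using insert(1,2) over_mult[OF E(1) a A] by simp
	qed
	have "over_field K P"
		unfolding over_field_def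
	proof
		fix i
		have "pcoeff P i \<in> E" using *[OF fin S_E] by (simp add: P_def over_field_def)
		moreover have "g (pcoeff P i) = pcoeff P i" if g: "embK E g" for g
		proof -
			have "map_poly g P = (\<Prod>z\<in>S. [:- g z, 1:])" using *[OF fin S_E] g by (simp add: P_def)
			also have "\<dots> = (\<Prod>z\<in>g ` S. [:-z, 1:])"
				using prod.reindex[OF inj_on_subset[OF emb_inj[OF E(1) embK_emb[OF g]] S_E], of "\<lambda>z. [:-z, 1:]"] by simp
			also have "\<dots> = P" by (simp only: gS[OF g] P_def)
			finally show ?thesis by (metis coeff_map_emb[OF E(1) embK_emb[OF g]])
		qed
		ultimately show "pcoeff P i \<in> K" by (rule fx)
	qed
	moreover have "poly P x = 0" unfolding P_def poly_prod using fin xS by (intro prod_zero) auto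
	ultimately have "poly P y = 0" using irr_dvd_root[OF K_sf alg[OF x(1)] q x(2) _ _ y] by blast
	hence "y \<in> S" using fin by (auto simp: P_def poly_prod)
	thus "y \<in> E" using S_E by blast
qed

lemma conj_in_normal:
	assumes N: "normal_ext K N" and E: "sfield E" "K \<subseteq> E" and g: "embK E g" and y: "y \<in> E" "y \<in> N"
	shows "g y \<in> N"
proof -
	have yc: "y \<in> carrier Omega" by simp
	have alg: "(ring.algebraic Omega over K) y" using N y(2) by (simp add: normal_ext_def over_def)
	note I = Om.IrrE[OF K_sf yc alg]
	define Q where "Q = Poly (rev (Om.Irr K y))"
	have "over_field K Q" "poly Q y = 0" using over_Poly[OF K_sf I(1)] I(4) by (simp_all add: Q_def eval_Poly)
	hence "poly Q (g y) = 0" using embK_root[OF E g _ y(1)] by blast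
	hence "ring.eval Omega (Om.Irr K y) (g y) = 0" by (simp add: Q_def eval_Poly)
	thus ?thesis using N I(1,2,4) y(2) unfolding normal_ext_def by auto
qed

lemma fixed_F: assumes "x \<in> F" "\<sigma> x = x" shows "x \<in> K"
proof (rule fixed_lin_span[OF K_sf F_sf KF thetaF p_gt_0])
	show "x \<in> lin_span K \<theta> p" using assms(1) F_span by simp
	show "emb F (\<sigma> ^^ c)" for c using sigma_pow embK_emb by blast
	show "(\<sigma> ^^ c) y = y" if "y \<in> K" for c y using sigma_pow embK_K that by blast
	show "inj_on (\<lambda>c. (\<sigma> ^^ c) \<theta>) {..<p}" using th_inj by (simp add: inj_on_def sigma_pow_th)
	show "(\<sigma> ^^ c) x = x" for c by (induction c) (simp_all add: assms(2))
qed

lemma cc_exists': assumes "splits ==> p dvd c 0" shows "\<exists>g. embF g \<and> (\<forall>k\<le>l. [cc g k = c k] (mod p))"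
proof (rule cc_exists[of c, OF assms])
	fix g assume "embF g" "\<And>k. k \<le> l ==> [cc g k = c k] (mod p)"
	thus ?thesis by (intro exI[of _ g] conjI allI impI)
qed

text \<open>The automorphisms whose pairing value is \<open>c\<close> at \<open>j\<close> and 0
  elsewhere fix \<open>T j\<close> and send \<open>Y j\<close> to \<open>p\<close> different
  elements, as \<open>fixed_lin_span\<close> requires.\<close>

lemma fixed_T: assumes j: "j \<le> l" and x: "x \<in> T (Suc j)" "\<And>g. embF g ==> g x = x" shows "x \<in> T j"
proof (cases "j = 0 \<and> splits")
	case True
	thus ?thesis using x(1) T1_splits by simp
next
	case False
	have "\<exists>g. embF g \<and> (\<forall>k\<le>l. [cc g k = (if k = j then c else 0)] (mod p))" for c
	proof -
		have *: "splits ==> p dvd (if 0 = j then c else 0)" using False by auto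
		show ?thesis by (rule cc_exists'[of "\<lambda>k. if k = j then c else 0", OF *])
	qed
	hence "\<forall>c. \<exists>g. embF g \<and> (\<forall>k\<le>l. [cc g k = (if k = j then c else 0)] (mod p))" by blast
	from choice[OF this] obtain h where h: "\<And>c. embF (h c)" "\<And>c k. k \<le> l ==> [cc (h c) k = (if k = j then c else 0)] (mod p)" by blast
	have Ts: "sfield (T j)" "sfield (T (Suc j))" using T_sf j by auto
	show ?thesis
	proof (rule fixed_lin_span[OF Ts T_Suc[OF j] Y_T[OF j] p_gt_0])
		show "x \<in> lin_span (T j) (Y j) p"
			using x(1) ext_lin_span[OF Ts(1) ASpoly_T[OF j] ASpoly_monic(2,1) p_gt_0, of "Y j"] by (simp add: T.simps poly_ASpoly wp_Y)
		show "emb (T (Suc j)) (h c)" for c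
			using emb_subset[OF embK_emb[OF embF_K[OF h(1)]] T_sub_TT] j by simp
		show "h c y = y" if "y \<in> T j" for c y
		proof (rule cc_fix[OF h(1) _ _ that])
			show "j \<le> Suc l" using j by simp
			show "cc (h c) k = 0" if "k < j" for k
				using h(2)[of k c] cc(1)[OF h(1), of k c] that j by (simp add: cong_def)
		qed
		show "inj_on (\<lambda>c. h c (Y j)) {..<p}"
		proof (rule inj_onI)
			fix c d assume cd: "c \<in> {..<p}" "d \<in> {..<p}" "h c (Y j) = h d (Y j)"
			hence "cc (h c) j = cc (h d) j" by (simp add: cc_def)
			thus "c = d" using h(2)[OF j, of c] h(2)[OF j, of d] cd by (simp add: cong_def)
		qed
		show "h c x = x" for c by (rule x(2)[OF h(1)])
	qed
qed

lemma fixed_embF: assumes "x \<in> TT" "\<And>g. embF g ==> g x = x" shows "x \<in> F"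
proof -
	have "x \<in> T (Suc l-i)" if "i \<le> Suc l" for i
		using that
	proof (induction i)
		case (Suc i)
		hence "x \<in> T (Suc (Suc l-Suc i))" by (simp add: Suc_diff_le)
		thus ?case by (rule fixed_T[rotated]) (use assms(2) in auto)
	qed (use assms(1) in simp)
	from this[of "Suc l"] show ?thesis by simp
qed

lemma fixed_embK: assumes "x \<in> TT" "\<And>g. embK TT g ==> g x = x" shows "x \<in> K"
proof (rule fixed_F)
	show xF: "x \<in> F" by (rule fixed_embF[OF assms(1)]) (use assms(2) embF_K in blast)
	obtain g where g: "lifts g" using lift_ex by blast
	hence "embK TT g" "g x = \<sigma> x" using xF by (simp_all add: lifts_def)
	thus "\<sigma> x = x" using assms(2) by metis
qed

lemma TT_normal: "normal_ext K TT"
	by (rule normal_of_fixed[OF TT_sf K_sub_T order_refl emb_TT_image fixed_embK])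

lemma F_normal: "normal_ext K F"
	by (rule normal_of_fixed[OF F_sf KF F_sub_T emb_F_image fixed_F]) (use sigma(1) in blast)+

text \<open>A normal field containing \<open>L\<close> contains \<open>Y l\<close>, and with
  \<open>Y (k+1)\<close> also its image under a lift of \<sigma>. The difference of the two is
  congruent to \<open>Y k\<close>, which is therefore in the field by \<open>AS_root_in\<close>;
  intersecting with \<open>TT\<close> provides the completeness used there.\<close>

lemma normal_closure_L: "normal_closure K L = TT"
proof
	show "normal_closure K L \<subseteq> TT" unfolding normal_closure_def using TT_normal L_sub_T by blast
	have "TT \<subseteq> N" if N: "normal_ext K N" "L \<subseteq> N" for N
	proof -
		define E where "E = N \<inter> TT"
		have sfE: "sfield E" unfolding E_def using N(1) TT_sf by (intro sf_Int) (auto simp: normal_ext_def field_ext_def)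
		have FE: "F \<subseteq> E" unfolding E_def using FL N(2) F_sub_T by blast
		have cE: "vcomplete E" by (rule K_complete_sub[OF sfE]) (use KF FE E_def in auto)
		obtain g where g: "lifts g" using lift_ex by blast
		hence gK: "embK TT g" by (simp add: lifts_def)
		have YE: "Y (l-i) \<in> E" if "i \<le> l" for i
			using that
		proof (induction i)
			case 0 thus ?case using Y_l N(2) Y_TT[of l] by (auto simp: E_def)
		next
			case (Suc i)
			define k where "k = l-Suc i"
			have k: "Suc k = l-i" "Suc k \<le> l" using Suc.prems by (auto simp: k_def)
			have kl: "k \<le> l" using k by simp
			have yE: "Y (Suc k) \<in> E" using Suc k by simp
			hence gE: "g (Y (Suc k)) \<in> E"
				using conj_in_normal[OF N(1) TT_sf K_sub_T gK] emb_TT_mem[OF gK] by (simp add: E_def)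
			show ?case
				unfolding k_def[symmetric]
			proof (rule AS_root_in[OF sfE cE, of "g (Y (Suc k))-Y (Suc k)"])
				show "g (Y (Suc k))-Y (Suc k) \<in> E" by (rule sf_diff[OF sfE gE yE])
				have "vgt (-1/p) (g (Y (Suc k)))" using embK_vgt[OF gK Y_TT[OF k(2)]] Y_small[OF k(2)] by simp
				thus "vgt (-1/p) (g (Y (Suc k))-Y (Suc k))" using Y_small[OF k(2)] by (rule vgt_diff)
				show "wp (Y k) \<in> E" unfolding wp_Y using alpha_F[OF kl] FE by blast
				have "vgt 0 (g (Y (Suc k))-Y (Suc k)-Yp (Suc k))" using g k(2) unfolding lifts_def by blast
				thus "vgt 0 (Y k-(g (Y (Suc k))-Y (Suc k)))" by (simp add: Yp_def vgt_minus_commute)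
			qed
		qed
		have "T j \<subseteq> E" if "j \<le> Suc l" for j
			using that
		proof (induction j)
			case 0 thus ?case using FE by simp
		next
			case (Suc j)
			have "Y j \<in> E" using YE[of "l-j"] Suc.prems by simp
			thus ?case unfolding T.simps using ext_least[OF T_sf sfE] Suc by simp
		qed
		thus ?thesis unfolding E_def by blast
	qed
	thus "TT \<subseteq> normal_closure K L" unfolding normal_closure_def by blast
qed

lemma GalTK: "(g \<in> carrier (Gal TT K)) = (g \<in> extensional TT \<and> embK TT g)"
	unfolding Gal_iff[OF TT_sf] using emb_TT_image[of g] by (auto simp: embK_def)

lemma GalTF: "(g \<in> carrier (Gal TT F)) = (g \<in> extensional TT \<and> embF g)"
	unfolding Gal_iff[OF TT_sf] embF_def using emb_TT_image[of g] KF by (auto simp: embK_def)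

lemma GalFK: "(g \<in> carrier (Gal F K)) = (g \<in> extensional F \<and> embK F g)"
	unfolding Gal_iff[OF F_sf] using emb_F_image[of g] by (auto simp: embK_def)

lemma embK_restrict: "embK TT (restrict g TT) = embK TT g" and embF_restrict: "embF (restrict g TT) = embF g"
proof -
	show 1: "embK TT (restrict g TT) = embK TT g"
		using embK_cong[OF _ TT_sf K_sub_T, of g "restrict g TT"] embK_cong[OF _ TT_sf K_sub_T, of "restrict g TT" g] by auto
	thus "embF (restrict g TT) = embF g" unfolding embF_def using F_sub_T[of "Suc l"] by auto
qed

lemma cc_restrict: "k \<le> l ==> cc (restrict g TT) k = cc g k"
	using Y_TT by (simp add: cc_def)

lemma cc_inj: assumes g: "embF g" and h: "embF h" and c: "\<And>k. k \<le> l ==> cc g k = cc h k" and x: "x \<in> TT" shows "g x = h x"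
proof (rule emb_T_eq[OF order_refl _ _ _ _ x])
	show "emb TT g" "emb TT h" using embK_emb embF_K g h by blast+
	show "g x = h x" if "x \<in> F" for x using embF_F[OF g that] embF_F[OF h that] by simp
	fix k assume "k < Suc l"
	hence k: "k \<le> l" by simp
	show "g (Y k) = h (Y k)"
	proof (rule wp_unique)
		show "wp (g (Y k)) = wp (h (Y k))"
			using emb_Y_small(2)[OF embF_K[OF g] order_refl, of k] emb_Y_small(2)[OF embF_K[OF h] order_refl, of k]
				embF_F[OF g alpha_F[OF k]] embF_F[OF h alpha_F[OF k]] k by simp
		show "vgt (-1/p) (h (Y k))" using emb_Y_small(1)[OF embF_K[OF h] order_refl, of k] k by simp
		show "vgt 0 (g (Y k)-h (Y k))"
			using vgt_diff[OF cc(2)[OF g k] cc(2)[OF h k]] c[OF k] by simp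
	qed
qed

lemma embF_commute: assumes "embF g" "embF h" "x \<in> TT" shows "g (h x) = h (g x)"
proof -
	have "(g \<circ> h) x = (h \<circ> g) x"
	proof (rule cc_inj[OF embF_comp[OF assms(1,2)] embF_comp[OF assms(2,1)] _ assms(3)])
		fix k assume k: "k \<le> l"
		show "cc (g \<circ> h) k = cc (h \<circ> g) k"
			using cc_comp[OF assms(1,2) k] cc_comp[OF assms(2,1) k] cc(1)[OF embF_comp[OF assms(1,2)] k] cc(1)[OF embF_comp[OF assms(2,1)] k] by (simp add: cong_def add.commute)
	qed
	thus ?thesis by simp
qed

lemma embF_id: "embF (\<lambda>x. x)"
	using embK_id by (simp add: embF_def)

lemma cc_id: "k \<le> l ==> cc (\<lambda>x. x) k = 0"
	by (rule cc_of_fix[OF embF_id]) auto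

lemma embF_funpow: "embF g ==> embF (g ^^ n)"
	by (induction n) (simp_all add: embF_comp embF_id id_def)

lemma cc_funpow: assumes "embF g" "k \<le> l" shows "[cc (g ^^ n) k = n * cc g k] (mod p)"
proof (induction n)
	case 0
	thus ?case using cc_id[OF assms(2)] by simp
next
	case (Suc n)
	have "[cc (g \<circ> g ^^ n) k = cc g k + cc (g ^^ n) k] (mod p)" by (rule cc_comp[OF assms(1) embF_funpow[OF assms(1)] assms(2)])
	also have "[cc g k + cc (g ^^ n) k = cc g k+n * cc g k] (mod p)" by (rule cong_add[OF cong_refl Suc])
	finally show ?case by (simp only: funpow.simps mult_Suc)
qed

lemma embF_pow_p: assumes "embF g" "x \<in> TT" shows "(g ^^ p) x = x"
proof -
	have "(g ^^ p) x = (\<lambda>x. x) x"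
	proof (rule cc_inj[OF embF_funpow[OF assms(1)] embF_id _ assms(2)])
		fix k assume k: "k \<le> l"
		show "cc (g ^^ p) k = cc (\<lambda>x. x) k"
			using cc_funpow[OF assms(1) k, of p] cc(1)[OF embF_funpow[OF assms(1)] k, of p] cc_id[OF k] by (simp add: cong_def)
	qed
	thus ?thesis .
qed

lemma cc_l_fix: assumes "embF g" "cc g l = 0" "x \<in> L" shows "g x = x"
proof -
	have e: "emb L g" using emb_subset[OF embK_emb[OF embF_K[OF assms(1)]] L_sub_T] .
	have gY: "g (Y l) = Y l"
	proof (rule wp_unique)
		show "wp (g (Y l)) = wp (Y l)"
			using emb_Y_small(2)[OF embF_K[OF assms(1)] order_refl, of l] embF_F[OF assms(1) alpha_F[of l]] by (simp add: wp_Y)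
		show "vgt (-1/p) (Y l)" by (rule Y_small) simp
		show "vgt 0 (g (Y l)-Y l)" using cc(2)[OF assms(1), of l] assms(2) by simp
	qed
	obtain P where P: "x = poly P (Y l)" "over_field F P" using assms(3) ext_poly[OF F_sf] by (auto simp: L_eq)
	have "map_poly g P = P"
		by (rule poly_eqI) (use P(2) embF_F[OF assms(1)] in \<open>simp add: coeff_map_emb[OF L_sf e] over_field_def\<close>)
	thus ?thesis unfolding P(1) emb_poly[OF L_sf e over_mono[OF P(2) FL] Y_l] by (simp add: gY)
qed

lemma cc_l_moves: assumes g: "embF g" "cc g l \<noteq> 0" and x: "x \<in> L" "g x = x" shows "x \<in> F"
proof (rule fixed_lin_span[OF F_sf L_sf FL Y_l p_gt_0])
	show "x \<in> lin_span F (Y l) p" using x(1) ext_lin_span[OF F_sf Yl_q] by (simp add: L_eq)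
	show "emb L (g ^^ c)" for c using emb_subset[OF embK_emb[OF embF_K[OF embF_funpow[OF g(1)]]] L_sub_T] .
	show "(g ^^ c) y = y" if "y \<in> F" for c y by (rule embF_F[OF embF_funpow[OF g(1)] that])
	show "(g ^^ c) x = x" for c by (induction c) (simp_all add: x(2))
	show "inj_on (\<lambda>c. (g ^^ c) (Y l)) {..<p}"
	proof (rule inj_onI)
		fix c d assume cd: "c \<in> {..<p}" "d \<in> {..<p}" "(g ^^ c) (Y l) = (g ^^ d) (Y l)"
		hence "cc (g ^^ c) l = cc (g ^^ d) l" by (simp add: cc_def)
		hence "[c * cc g l = d * cc g l] (mod p)"
			using cc_funpow[OF g(1), of l c] cc_funpow[OF g(1), of l d] by (simp add: cong_def)
		moreover have "Rings.coprime (cc g l) p"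
			using cc(1)[OF g(1), of l] g(2) prime_p by (metis coprime_commute dvd_imp_le gr0I leD order_refl prime_imp_coprime)
		ultimately have "[c = d] (mod p)" by (simp add: cong_mult_rcancel_nat)
		thus "c = d" using cd by (simp add: cong_def)
	qed
qed

text \<open>An element \<open>x\<close> of another such subfield, outside \<open>F\<close>, would
  have as conjugates exactly its \<open>p\<close> images under the powers of \<open>t0\<close>, an
  automorphism over \<open>F\<close> moving \<open>Y l\<close>. The automorphism \<open>t1\<close>
  pairs nontrivially with \<open>\<alpha> (l-1)\<close> alone, so it fixes \<open>L\<close>, and
  with it the image of \<open>x\<close> under a lift \<open>g\<close> of \<sigma>. Hence the
  conjugate \<open>h\<close> of \<open>t1\<close> by \<open>g\<close> fixes \<open>x\<close>; but
  \<open>h\<close> moves \<open>Y l\<close>, which forces \<open>x\<close> into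
  \<open>F\<close>.\<close>

lemma F_unique: assumes F': "ext_of_degree p K F'" "F' \<subseteq> L" shows "F' = F"
proof (rule dimension_subset_eq[OF K_sf])
	show d: "ring.dimension Omega p K F'" "ring.dimension Omega p K F" using F'(1) F_dim by (simp_all add: ext_of_degree_def)
	have sF': "sfield F'" using F'(1) by (simp add: ext_of_degree_def field_ext_def)
	show "F' \<subseteq> F"
	proof (rule ccontr)
		assume "\<not> F' \<subseteq> F"
		then obtain x where x: "x \<in> F'" "x \<notin> F" by blast
		have xL: "x \<in> L" using x(1) F'(2) by blast
		have xT: "x \<in> TT" using xL L_sub_T by blast
		obtain P where P: "over_field K P" "P \<noteq> 0" "pdeg P \<le> p" "poly P x = 0" using small_degree_poly[OF K_sf sF' d(1) x(1)] .
		obtain t0 where t0: "embF t0" "\<And>k. k \<le> l ==> [cc t0 k = (if k = l then 1 else 0)] (mod p)"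
			using cc_exists[of "\<lambda>k. if k = l then 1 else 0"] l by auto
		\<comment> \<open>Here \<open>l \<ge> 2\<close> enters: \<open>l-1\<close> is positive, so the
		  value 1 is available there even in the split case.\<close>
		obtain t1 where t1: "embF t1" "\<And>k. k \<le> l ==> [cc t1 k = (if k = l-1 then 1 else 0)] (mod p)"
			using cc_exists[of "\<lambda>k. if k = l-1 then 1 else 0"] l by auto
		have inj: "inj_on (\<lambda>c. (t0 ^^ c) x) {..<p}"
		proof (rule linorder_inj_onI')
			fix c d assume cd: "c \<in> {..<p}" "d \<in> {..<p}" "c < d"
			show "(t0 ^^ c) x \<noteq> (t0 ^^ d) x"
			proof
				assume eq: "(t0 ^^ c) x = (t0 ^^ d) x"
				have "(t0 ^^ c) x = (t0 ^^ c) ((t0 ^^ (d - c)) x)" using cd(3) eq by (metis comp_apply funpow_add le_add_diff_inverse less_imp_le)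
				hence "x = (t0 ^^ (d - c)) x"
					by (rule inj_onD[OF emb_inj[OF TT_sf embK_emb[OF embF_K[OF embF_funpow[OF t0(1)]]]] _ xT
								emb_TT_mem[OF embF_K[OF embF_funpow[OF t0(1)]] xT]])
				hence "(t0 ^^ (d - c)) x = x" by (rule sym)
				moreover have "cc (t0 ^^ (d - c)) l \<noteq> 0"
				proof
					assume "cc (t0 ^^ (d - c)) l = 0"
					hence "[(d - c) * cc t0 l = 0] (mod p)" using cc_funpow[OF t0(1), of l "d - c"] by (simp add: cong_sym)
					moreover have "[(d - c) * cc t0 l = (d - c)*1] (mod p)" using cong_mult[OF cong_refl t0(2)[of l]] by simp
					ultimately have "p dvd d - c" by (simp add: cong_def mod_eq_0_iff_dvd)
					thus False using cd by (auto dest: dvd_imp_le)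
				qed
				ultimately show False using cc_l_moves[OF embF_funpow[OF t0(1)] _ xL] x(2) by blast
			qed
		qed
		define C where "C = (\<lambda>c. (t0 ^^ c) x) ` {..<p}"
		have root: "poly P (g x) = 0" if "embK TT g" for g by (rule embK_root[OF TT_sf K_sub_T that P(1) xT P(4)])
		have C: "C = {z. poly P z = 0}"
		proof (rule card_seteq[OF poly_roots_finite[OF P(2)]])
			show "C \<subseteq> {z. poly P z = 0}" unfolding C_def using root embF_K[OF embF_funpow[OF t0(1)]] by auto
			have "card {z. poly P z = 0} \<le> p" using card_poly_roots_bound[OF P(2)] P(3) by simp
			thus "card {z. poly P z = 0} \<le> card C" unfolding C_def using card_image[OF inj] by simp
		qed
		obtain g where g: "lifts g" using lift_ex by blast
		hence gK: "embK TT g" by (simp add: lifts_def)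
		obtain c where c: "g x = (t0 ^^ c) x" using root[OF gK] C by (auto simp: C_def)
		define h where "h = inv_into TT g \<circ> t1 \<circ> g"
		have "vgt 0 (g (Y l)-Y l-Yp l - of_nat 0)" using g by (simp add: lifts_def)
		note h = cc_conj[OF gK t1(1) order_refl this, folded h_def]
		have "t1 x = x"
		proof (rule cc_l_fix[OF t1(1) _ xL])
			show "cc t1 l = 0" using l t1(2)[of l] cc(1)[OF t1(1), of l] by (auto simp: cong_def)
		qed
		hence "t1 (g x) = g x"
			unfolding c using embF_commute[OF t1(1) embF_funpow[OF t0(1)] xT] by simp
		hence "h x = x" unfolding h_def using inv_into_f_f[OF emb_inj[OF TT_sf embK_emb[OF gK]] xT] by simp
		moreover have "cc h l \<noteq> 0"
		proof
			assume 0: "cc h l = 0"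
			obtain i where i: "l = Suc i" using l by (cases l) auto
			have "[0 = cc t1 (Suc i) + cc t1 i] (mod p)" using h(2) 0 i by simp
			moreover have "[cc t1 (Suc i) + cc t1 i = 0+1] (mod p)" using cong_add[OF t1(2)[of "Suc i"] t1(2)[of i]] i by simp
			ultimately show False using p_gt_1 by (simp add: cong_def)
		qed
		ultimately show False using cc_l_moves[OF h(1) _ xL] x(2) by blast
	qed
qed

end

subsection \<open>Modules over the group algebra of a finite abelian group\<close>

text \<open>The abstract setting for modules over the group algebra of \<open>Q\<close> over the
  prime field. Since the exponent of the module is \<open>p\<close>, powers depend only on exponents
  modulo \<open>p\<close>, which matches coefficients represented in \<open>0..p-1\<close>.\<close>

locale fp_action = M: comm_group M + Q: comm_group Q
	for M :: "('m, 'x) monoid_scheme" (structure) and Q :: "('g, 'y) monoid_scheme" +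
	fixes p :: nat and act :: "'g => 'm => 'm"
	assumes p1: "1 < p" and fin: "finite (carrier Q)"
		and expo: "x \<in> carrier M ==> x [^] p = \<one>"
		and act_closed: "g \<in> carrier Q ==> x \<in> carrier M ==> act g x \<in> carrier M"
		and act_mult: "g \<in> carrier Q ==> x \<in> carrier M ==> y \<in> carrier M ==> act g (x \<otimes> y) = act g x \<otimes> act g y"
		and act_one: "x \<in> carrier M ==> act \<one>\<^bsub>Q\<^esub> x = x"
		and act_assoc: "g \<in> carrier Q ==> h \<in> carrier Q ==> x \<in> carrier M ==> act (g \<otimes>\<^bsub>Q\<^esub> h) x = act g (act h x)"
begin

abbreviation "A \<equiv> group_algebra (residue_ring (int p)) Q"

abbreviation (input) qmult (infixl "\<cdot>" 70) where "g \<cdot> h \<equiv> g \<otimes>\<^bsub>Q\<^esub> h"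
abbreviation (input) "qinv g \<equiv> inv\<^bsub>Q\<^esub> g"
abbreviation (input) amult (infixl "\<star>" 70) where "a \<star> b \<equiv> a \<otimes>\<^bsub>A\<^esub> b"
abbreviation (input) aadd (infixl "\<boxplus>" 65) where "a \<boxplus> b \<equiv> a \<oplus>\<^bsub>A\<^esub> b"

text \<open>Convolution over the integers: associativity and commutativity are exact here and pass
  to the group algebra modulo \<open>p\<close> by \<open>A_cong_mult\<close>.\<close>

definition conv :: "('g => int) => ('g => int) => 'g => int" where
	"conv a b g = (\<Sum>h\<in>carrier Q. a h*b (qinv h \<cdot> g))"

definition delta :: "'g => 'g => int" where
	"delta h = (\<lambda>g\<in>carrier Q. if g = h then 1 else 0)"

lemma res: "cring (residue_ring (int p))"
	by (rule residues.cring) (use p1 in \<open>simp add: residues_def\<close>)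

lemma carrier_A: "carrier A = carrier Q \<rightarrow>\<^sub>E {0..int p-1}"
	by (simp add: group_algebra_def residue_ring_def)

lemma A_range: "a \<in> carrier A ==> g \<in> carrier Q ==> 0 \<le> a g \<and> a g < int p"
	unfolding carrier_A by auto

lemma A_mod: "a \<in> carrier A ==> g \<in> carrier Q ==> a g mod int p = a g"
	using A_range[of a g] by simp

lemma A_I: "(\<And>g. g \<in> carrier Q ==> 0 \<le> a g \<and> a g < int p) ==> a \<in> extensional (carrier Q) ==> a \<in> carrier A"
	unfolding carrier_A by (auto simp: PiE_def)

lemma A_ext: "a \<in> carrier A ==> b \<in> carrier A ==> (\<And>g. g \<in> carrier Q ==> [a g = b g] (mod int p)) ==> a = b"
	unfolding carrier_A
	by (rule PiE_ext) (use A_mod[unfolded carrier_A] in \<open>force simp: cong_def\<close>)+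

lemma finsum_res:
	assumes "finite B" "\<And>i. i \<in> B ==> f i \<in> {0..int p-1}"
	shows "finsum (residue_ring (int p)) f B = (\<Sum>i\<in>B. f i) mod int p"
proof -
	interpret R: cring "residue_ring (int p)" by (rule res)
	show ?thesis
		using assms
	proof (induction B rule: finite_induct)
		case (insert i B)
		have "finsum (residue_ring (int p)) f (insert i B) = f i \<oplus>\<^bsub>residue_ring (int p)\<^esub> finsum (residue_ring (int p)) f B"
			using insert by (intro R.finsum_insert) (auto simp: residue_ring_def)
		also have "\<dots> = (f i+(\<Sum>i\<in>B. f i) mod int p) mod int p" using insert by (simp add: residue_ring_def)
		finally show ?case using insert by (simp add: mod_add_right_eq)
	next
		case empty
		show ?case unfolding R.finsum_empty by (simp add: residue_ring_def)
	qed
qed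

lemma A_mult: assumes "a \<in> carrier A" "b \<in> carrier A" shows "a \<star> b = (\<lambda>g\<in>carrier Q. conv a b g mod int p)"
proof
	fix g
	show "(a \<star> b) g = (\<lambda>g\<in>carrier Q. conv a b g mod int p) g"
	proof (cases "g \<in> carrier Q")
		case True
		have "(a \<star> b) g = (\<Oplus>\<^bsub>residue_ring (int p)\<^esub>h\<in>carrier Q. (a h*b (qinv h \<cdot> g)) mod int p)"
			using True by (simp add: group_algebra_def residue_ring_def)
		also have "\<dots> = (\<Sum>h\<in>carrier Q. (a h*b (qinv h \<cdot> g)) mod int p) mod int p"
			by (rule finsum_res[OF fin]) (use p1 in auto)
		also have "\<dots> = conv a b g mod int p" by (simp add: conv_def mod_sum_eq)
		finally show ?thesis using True by simp
	qed (simp add: group_algebra_def)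
qed

lemma A_add: "a \<boxplus> b = (\<lambda>g\<in>carrier Q. (a g+b g) mod int p)"
	and A_zero: "\<zero>\<^bsub>A\<^esub> = (\<lambda>g\<in>carrier Q. 0)" and A_one: "\<one>\<^bsub>A\<^esub> = delta \<one>\<^bsub>Q\<^esub>"
	by (simp_all add: group_algebra_def residue_ring_def delta_def cong: if_cong)

lemma A_mult_closed: "a \<in> carrier A ==> b \<in> carrier A ==> a \<star> b \<in> carrier A"
	unfolding A_mult using p1 by (intro A_I) auto

lemma A_add_closed: "a \<boxplus> b \<in> carrier A" and A_zero_closed: "\<zero>\<^bsub>A\<^esub> \<in> carrier A"
	and delta_closed: "delta g \<in> carrier A"
proof -
	show "a \<boxplus> b \<in> carrier A" unfolding A_add by (rule A_I) (use p1 in simp_all)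
	show "\<zero>\<^bsub>A\<^esub> \<in> carrier A" unfolding A_zero by (rule A_I) (use p1 in simp_all)
	show "delta g \<in> carrier A" unfolding delta_def by (rule A_I) (use p1 in simp_all)
qed

lemma conv_cong: "(\<And>g. g \<in> carrier Q ==> [a g = a' g] (mod int p)) ==> (\<And>g. g \<in> carrier Q ==> [b g = b' g] (mod int p))
		==> g \<in> carrier Q ==> [conv a b g = conv a' b' g] (mod int p)"
	unfolding conv_def by (intro cong_sum cong_mult) auto

lemma conv_comm: assumes "g \<in> carrier Q" shows "conv a b g = conv b a g"
	unfolding conv_def
	by (rule sum.reindex_bij_witness[of _ "\<lambda>h. qinv h \<cdot> g" "\<lambda>h. qinv h \<cdot> g"])
		(use assms in \<open>simp_all add: Q.inv_mult Q.m_ac mult.commute Q.m_assoc[symmetric]\<close>)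

lemma conv_shift: assumes "k \<in> carrier Q" "g \<in> carrier Q"
	shows "(\<Sum>h\<in>carrier Q. b (qinv k \<cdot> h) * c (qinv h \<cdot> g)) = conv b c (qinv k \<cdot> g)"
proof -
	have c: "k \<cdot> (qinv k \<cdot> x) = x" "qinv k \<cdot> (k \<cdot> x) = x" if "x \<in> carrier Q" for x
		using that assms(1) by (simp_all add: Q.m_assoc[symmetric])
	have i: "qinv (qinv k \<cdot> h) \<cdot> (qinv k \<cdot> g) = qinv h \<cdot> g" if "h \<in> carrier Q" for h
		using that assms by (simp add: Q.inv_mult_group Q.m_assoc c)
	show ?thesis
		unfolding conv_def
		by (rule sum.reindex_bij_witness[of _ "\<lambda>h. k \<cdot> h" "\<lambda>h. qinv k \<cdot> h"])
			(use assms in \<open>simp_all add: c i\<close>)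
qed

lemma conv_assoc: assumes "g \<in> carrier Q" shows "conv (conv a b) c g = conv a (conv b c) g"
proof -
	have "conv (conv a b) c g = (\<Sum>h\<in>carrier Q. \<Sum>k\<in>carrier Q. a k*(b (qinv k \<cdot> h) * c (qinv h \<cdot> g)))"
		by (simp add: conv_def sum_distrib_right mult.assoc)
	also have "\<dots> = (\<Sum>k\<in>carrier Q. a k*(\<Sum>h\<in>carrier Q. b (qinv k \<cdot> h) * c (qinv h \<cdot> g)))"
		by (subst sum.swap) (simp add: sum_distrib_left)
	also have "\<dots> = conv a (conv b c) g" unfolding conv_def[of a] by (rule sum.cong) (simp_all add: conv_shift assms)
	finally show ?thesis .
qed

lemma conv_delta: assumes "h \<in> carrier Q" "g \<in> carrier Q" shows "conv (delta h) b g = b (qinv h \<cdot> g)"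
proof -
	have "conv (delta h) b g = (\<Sum>k\<in>carrier Q. if k = h then b (qinv h \<cdot> g) else 0)"
		unfolding conv_def by (rule sum.cong) (auto simp: delta_def)
	thus ?thesis using fin assms(1) by simp
qed

lemma A_cong_mult: "a \<in> carrier A ==> b \<in> carrier A ==> g \<in> carrier Q ==> [(a \<star> b) g = conv a b g] (mod int p)"
	by (simp add: A_mult)

lemma A_cring: "cring A"
proof (rule cringI)
	show "abelian_group A"
	proof (rule abelian_groupI)
		show "\<exists>y\<in>carrier A. y \<boxplus> x = \<zero>\<^bsub>A\<^esub>" if x: "x \<in> carrier A" for x
		proof (rule bexI)
			show y: "(\<lambda>g\<in>carrier Q. (- x g) mod int p) \<in> carrier A" using p1 by (intro A_I) auto
			show "(\<lambda>g\<in>carrier Q. (- x g) mod int p) \<boxplus> x = \<zero>\<^bsub>A\<^esub>"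
				by (rule A_ext[OF A_add_closed A_zero_closed]) (simp add: A_add A_zero cong_def mod_add_left_eq)
		qed
		show "\<zero>\<^bsub>A\<^esub> \<boxplus> x = x" if x: "x \<in> carrier A" for x
			by (rule A_ext[OF A_add_closed x]) (simp add: A_add A_zero cong_def)
		show "x \<boxplus> y \<boxplus> z = x \<boxplus> (y \<boxplus> z)" for x y z
			by (rule A_ext[OF A_add_closed A_add_closed]) (simp add: A_add cong_def mod_add_left_eq mod_add_right_eq add.assoc)
		show "x \<boxplus> y = y \<boxplus> x" for x y by (simp add: A_add add.commute)
	qed (rule A_add_closed A_zero_closed)+
	show "comm_monoid A"
	proof (rule comm_monoidI)
		fix x y z assume xyz: "x \<in> carrier A" "y \<in> carrier A" "z \<in> carrier A"
		note c = A_mult_closed[OF xyz(1,2)] A_mult_closed[OF xyz(2,3)]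
		show "x \<star> y \<star> z = x \<star> (y \<star> z)"
		proof (rule A_ext[OF A_mult_closed[OF c(1) xyz(3)] A_mult_closed[OF xyz(1) c(2)]])
			fix g assume g: "g \<in> carrier Q"
			have "[(x \<star> y \<star> z) g = conv (x \<star> y) z g] (mod int p)" by (rule A_cong_mult[OF c(1) xyz(3) g])
			also have "[conv (x \<star> y) z g = conv (conv x y) z g] (mod int p)"
				by (rule conv_cong[OF A_cong_mult[OF xyz(1,2)] cong_refl g])
			also have "conv (conv x y) z g = conv x (conv y z) g" by (rule conv_assoc[OF g])
			also have "[conv x (conv y z) g = conv x (y \<star> z) g] (mod int p)"
				by (rule conv_cong[OF cong_refl cong_sym[OF A_cong_mult[OF xyz(2,3)]] g])
			also have "[conv x (y \<star> z) g = (x \<star> (y \<star> z)) g] (mod int p)"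
				by (rule cong_sym[OF A_cong_mult[OF xyz(1) c(2) g]])
			finally show "[(x \<star> y \<star> z) g = (x \<star> (y \<star> z)) g] (mod int p)" .
		qed
	next
		fix x y assume xy: "x \<in> carrier A" "y \<in> carrier A"
		show "x \<star> y = y \<star> x"
			unfolding A_mult[OF xy] A_mult[OF xy(2,1)] by (rule restrict_ext) (simp add: conv_comm)
	next
		fix x assume x: "x \<in> carrier A"
		have o: "\<one>\<^bsub>A\<^esub> \<in> carrier A" unfolding A_one by (rule delta_closed)
		show "\<one>\<^bsub>A\<^esub> \<star> x = x"
			by (rule A_ext[OF A_mult_closed[OF o x] x]) (simp add: A_mult[OF o x], simp add: A_one conv_delta)
	qed (use A_mult_closed delta_closed A_one in auto)
	fix x y z assume xyz: "x \<in> carrier A" "y \<in> carrier A" "z \<in> carrier A"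
	show "(x \<boxplus> y) \<star> z = x \<star> z \<boxplus> y \<star> z"
	proof (rule A_ext[OF A_mult_closed[OF A_add_closed xyz(3)] A_add_closed])
		fix g assume g: "g \<in> carrier Q"
		have "[((x \<boxplus> y) \<star> z) g = conv (x \<boxplus> y) z g] (mod int p)" by (rule A_cong_mult[OF A_add_closed xyz(3) g])
		also have "[conv (x \<boxplus> y) z g = conv (\<lambda>g. x g+y g) z g] (mod int p)"
			by (rule conv_cong[OF _ cong_refl g]) (simp add: A_add cong_def)
		also have "conv (\<lambda>g. x g+y g) z g = conv x z g + conv y z g" by (simp add: conv_def distrib_right)
		also have "[conv x z g + conv y z g = (x \<star> z \<boxplus> y \<star> z) g] (mod int p)"
			using g by (simp add: A_add A_mult xyz mod_add_eq)
		finally show "[((x \<boxplus> y) \<star> z) g = (x \<star> z \<boxplus> y \<star> z) g] (mod int p)" .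
	qed
qed

definition sm :: "('g => int) => 'm => 'm" where
	"sm a x = (\<Otimes>g\<in>carrier Q. act g x [^] a g)"

text \<open>The two parameters allow the record to be instantiated so as to equal
  \<open>galois_module\<close>, see \<open>galois_module_Md\<close>.\<close>

definition Md :: "('m => 'm => 'm) => 'm => ('g => int, 'm) module" where
	"Md mu on = \<lparr>carrier = carrier M, monoid.mult = mu, one = on, ring.zero = \<one>, ring.add = (\<otimes>), smult = sm\<rparr>"

lemma pow_cong: assumes x: "x \<in> carrier M" and "[a = b] (mod int p)" shows "x [^] a = x [^] b"
proof -
	obtain k where k: "a = b+int p * k" using assms(2) by (metis cong_iff_lin cong_sym)
	show ?thesis using M.int_pow_pow[OF x, of "int p" k] expo[OF x] M.int_pow_mult[OF x, of b "int p * k"] x by (simp add: int_pow_int k)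
qed

lemma pow_sum: assumes "x \<in> carrier M" "finite B" shows "x [^] (\<Sum>i\<in>B. f i :: int) = (\<Otimes>i\<in>B. x [^] f i)"
	using assms(2)
proof (induction B rule: finite_induct)
	case (insert i B)
	have "x [^] (\<Sum>i\<in>insert i B. f i :: int) = x [^] f i \<otimes> x [^] (\<Sum>i\<in>B. f i)"
		using M.int_pow_mult[OF assms(1), of "f i" "\<Sum>i\<in>B. f i"] insert(1,2) by simp
	moreover have "(\<Otimes>i\<in>insert i B. x [^] f i) = x [^] f i \<otimes> (\<Otimes>i\<in>B. x [^] f i)"
		by (rule M.finprod_insert[OF insert(1,2)]) (use assms(1) in auto)
	ultimately show ?case using insert(3) by simp
qed simp

lemma hom_finprod: assumes k: "group_hom M M k" and "finite B" "\<And>i. i \<in> B ==> f i \<in> carrier M"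
	shows "k (\<Otimes>i\<in>B. f i) = (\<Otimes>i\<in>B. k (f i))"
	using assms(2,3)
proof (induction B rule: finite_induct)
	case (insert i B)
	have fB: "f \<in> B \<rightarrow> carrier M" "f i \<in> carrier M" using insert by auto
	have "k (\<Otimes>i\<in>insert i B. f i) = k (f i) \<otimes> (\<Otimes>i\<in>B. k (f i))"
		using M.finprod_insert[OF insert(1,2) fB] insert group_hom.hom_mult[OF k fB(2) M.finprod_closed[OF fB(1)]] by simp
	also have "\<dots> = (\<Otimes>i\<in>insert i B. k (f i))"
		by (rule M.finprod_insert[OF insert(1,2), symmetric]) (use fB group_hom.hom_closed[OF k] in auto)
	finally show ?case .
qed (simp add: group_hom.hom_one[OF k])

lemma pow_hom: "group_hom M M (\<lambda>x. x [^] (n::int))"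
	by (unfold_locales) (auto simp: hom_def M.int_pow_distrib)

lemma finprod_swap:
	assumes "finite B" "finite C" "\<And>i j. i \<in> B ==> j \<in> C ==> f i j \<in> carrier M"
	shows "(\<Otimes>i\<in>B. \<Otimes>j\<in>C. f i j) = (\<Otimes>j\<in>C. \<Otimes>i\<in>B. f i j)"
	using assms(1,3)
proof (induction B rule: finite_induct)
	case (insert i B)
	have c: "(\<lambda>i. \<Otimes>j\<in>C. f i j) \<in> B \<rightarrow> carrier M" "(\<Otimes>j\<in>C. f i j) \<in> carrier M"
		using insert by auto
	have "(\<Otimes>i\<in>insert i B. \<Otimes>j\<in>C. f i j) = (\<Otimes>j\<in>C. f i j) \<otimes> (\<Otimes>i\<in>B. \<Otimes>j\<in>C. f i j)" by (rule M.finprod_insert[OF insert(1,2) c])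
	also have "\<dots> = (\<Otimes>j\<in>C. f i j) \<otimes> (\<Otimes>j\<in>C. \<Otimes>i\<in>B. f i j)" using insert by simp
	also have "\<dots> = (\<Otimes>j\<in>C. f i j \<otimes> (\<Otimes>i\<in>B. f i j))"
		by (rule M.finprod_multf[symmetric]) (use insert in \<open>auto intro!: M.finprod_closed\<close>)
	also have "\<dots> = (\<Otimes>j\<in>C. \<Otimes>i\<in>insert i B. f i j)"
		by (rule M.finprod_cong'[OF refl]) (use insert in \<open>auto intro!: M.finprod_closed M.finprod_insert[symmetric]\<close>)
	finally show ?case .
qed simp

lemma act_hom: "g \<in> carrier Q ==> group_hom M M (act g)"
	by (unfold_locales) (auto simp: hom_def act_closed act_mult)

lemma act_pow: "g \<in> carrier Q ==> x \<in> carrier M ==> act g (x [^] (n::int)) = act g x [^] n"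
	using group_hom.hom_int_pow[OF act_hom] by blast

lemma sm_closed: "x \<in> carrier M ==> sm a x \<in> carrier M"
	unfolding sm_def by (intro M.finprod_closed) (auto intro: act_closed)

text \<open>The double product over \<open>g\<close> and \<open>h\<close> is exchanged, and the
  substitution of \<open>h \<cdot> g\<close> for \<open>g\<close> turns the convolution into two
  successive actions.\<close>

lemma sm_mult: assumes a: "a \<in> carrier A" and b: "b \<in> carrier A" and x: "x \<in> carrier M"
	shows "sm (a \<star> b) x = sm a (sm b x)"
proof -
	have ac: "act g x \<in> carrier M" if "g \<in> carrier Q" for g using act_closed that x by blast
	have "sm (a \<star> b) x = (\<Otimes>g\<in>carrier Q. \<Otimes>h\<in>carrier Q. act g x [^] (a h*b (qinv h \<cdot> g)))"
		unfolding sm_def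
	proof (rule M.finprod_cong'[OF refl])
		fix g assume g: "g \<in> carrier Q"
		have "act g x [^] (a \<star> b) g = act g x [^] conv a b g" by (rule pow_cong[OF ac[OF g] A_cong_mult[OF a b g]])
		also have "\<dots> = (\<Otimes>h\<in>carrier Q. act g x [^] (a h*b (qinv h \<cdot> g)))"
			unfolding conv_def by (rule pow_sum[OF ac[OF g] fin])
		finally show "act g x [^] (a \<star> b) g = (\<Otimes>h\<in>carrier Q. act g x [^] (a h*b (qinv h \<cdot> g)))" .
	qed (use ac in \<open>auto intro!: M.finprod_closed\<close>)
	also have "\<dots> = (\<Otimes>h\<in>carrier Q. \<Otimes>g\<in>carrier Q. act g x [^] (a h*b (qinv h \<cdot> g)))"
		by (rule finprod_swap[OF fin fin]) (use ac in auto)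
	also have "\<dots> = (\<Otimes>h\<in>carrier Q. act h (sm b x) [^] a h)"
	proof (rule M.finprod_cong'[OF refl])
		fix h assume h: "h \<in> carrier Q"
		have im: "(\<lambda>g. h \<cdot> g) ` carrier Q = carrier Q" by (rule Q.surj_const_mult[OF h])
		have inj: "inj_on (\<lambda>g. h \<cdot> g) (carrier Q)" by (rule Q.inj_on_cmult[OF h])
		have "(\<Otimes>g\<in>carrier Q. act g x [^] (a h*b (qinv h \<cdot> g)))
				= (\<Otimes>g\<in>(\<lambda>g. h \<cdot> g) ` carrier Q. act g x [^] (a h*b (qinv h \<cdot> g)))" by (simp only: im)
		also have "\<dots> = (\<Otimes>g\<in>carrier Q. act (h \<cdot> g) x [^] (a h*b (qinv h \<cdot> (h \<cdot> g))))"
			by (rule M.finprod_reindex[OF _ inj]) (use ac h in auto)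
		also have "\<dots> = (\<Otimes>g\<in>carrier Q. (act h (act g x [^] b g)) [^] a h)"
		proof (rule M.finprod_cong'[OF refl])
			fix g assume g: "g \<in> carrier Q"
			show "act (h \<cdot> g) x [^] (a h*b (qinv h \<cdot> (h \<cdot> g))) = (act h (act g x [^] b g)) [^] a h"
				using g h act_closed M.int_pow_pow[of "act h (act g x)" "b g" "a h"] by (simp add: Q.m_assoc[symmetric] act_assoc x act_pow mult.commute)
		qed (use ac act_closed h in auto)
		also have "\<dots> = act h (sm b x) [^] a h"
			unfolding sm_def using hom_finprod[OF pow_hom fin, of "\<lambda>g. act h (act g x [^] b g)" "a h"] hom_finprod[OF act_hom[OF h] fin, of "\<lambda>g. act g x [^] b g"]
				ac act_closed h fin by simp
		finally show "(\<Otimes>g\<in>carrier Q. act g x [^] (a h*b (qinv h \<cdot> g))) = act h (sm b x) [^] a h" .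
	qed (use act_closed sm_closed x in auto)
	finally show ?thesis by (simp add: sm_def)
qed

lemma sm_delta: assumes h: "h \<in> carrier Q" and x: "x \<in> carrier M" shows "sm (delta h) x = act h x"
proof -
	have "sm (delta h) x = (\<Otimes>g\<in>carrier Q. if h = g then act g x else \<one>)"
		unfolding sm_def by (rule M.finprod_cong'[OF refl]) (use act_closed x in \<open>auto simp: delta_def M.int_pow_1\<close>)
	also have "\<dots> = act h x" by (rule M.finprod_singleton[OF h fin]) (use act_closed x in auto)
	finally show ?thesis .
qed

lemma Md_module: "Module.module A (Md mu on)"
proof (rule moduleI)
	show "abelian_group (Md mu on)"
		by (rule abelian_groupI) (auto simp: Md_def M.m_ac intro: M.l_inv_ex)
	fix a b x y assume a: "a \<in> carrier A" and x: "x \<in> carrier (Md mu on)"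
	have x: "x \<in> carrier M" using x by (simp add: Md_def)
	show "a \<odot>\<^bsub>Md mu on\<^esub> x \<in> carrier (Md mu on)" using sm_closed[OF x] by (simp add: Md_def)
	{ assume b: "b \<in> carrier A"
		show "(a \<star> b) \<odot>\<^bsub>Md mu on\<^esub> x = a \<odot>\<^bsub>Md mu on\<^esub> (b \<odot>\<^bsub>Md mu on\<^esub> x)" using sm_mult[OF a b x] by (simp add: Md_def)
		have "sm (a \<boxplus> b) x = (\<Otimes>g\<in>carrier Q. act g x [^] a g \<otimes> act g x [^] b g)"
			unfolding sm_def
		proof (rule M.finprod_cong'[OF refl])
			fix g assume g: "g \<in> carrier Q"
			have "[(a \<boxplus> b) g = a g+b g] (mod int p)" using g by (simp add: A_add)
			thus "act g x [^] (a \<boxplus> b) g = act g x [^] a g \<otimes> act g x [^] b g"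
				using pow_cong[OF act_closed[OF g x]] M.int_pow_mult[OF act_closed[OF g x]] by simp
		qed (use act_closed x in auto)
		also have "\<dots> = sm a x \<otimes> sm b x" unfolding sm_def by (rule M.finprod_multf) (use act_closed x in auto)
		finally show "(a \<boxplus> b) \<odot>\<^bsub>Md mu on\<^esub> x = a \<odot>\<^bsub>Md mu on\<^esub> x \<oplus>\<^bsub>Md mu on\<^esub> b \<odot>\<^bsub>Md mu on\<^esub> x" by (simp add: Md_def) }
	{ assume "y \<in> carrier (Md mu on)"
		hence y: "y \<in> carrier M" by (simp add: Md_def)
		have "sm a (x \<otimes> y) = (\<Otimes>g\<in>carrier Q. act g x [^] a g \<otimes> act g y [^] a g)"
			unfolding sm_def
			by (rule M.finprod_cong'[OF refl]) (use act_closed x y M.int_pow_distrib in \<open>auto simp: act_mult\<close>)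
		also have "\<dots> = sm a x \<otimes> sm a y" unfolding sm_def by (rule M.finprod_multf) (use act_closed x y in auto)
		finally show "a \<odot>\<^bsub>Md mu on\<^esub> (x \<oplus>\<^bsub>Md mu on\<^esub> y) = a \<odot>\<^bsub>Md mu on\<^esub> x \<oplus>\<^bsub>Md mu on\<^esub> a \<odot>\<^bsub>Md mu on\<^esub> y" by (simp add: Md_def) }
next
	fix x assume "x \<in> carrier (Md mu on)"
	hence x: "x \<in> carrier M" by (simp add: Md_def)
	show "\<one>\<^bsub>A\<^esub> \<odot>\<^bsub>Md mu on\<^esub> x = x" using sm_delta[OF Q.one_closed x] act_one[OF x] by (simp add: Md_def A_one)
qed (rule A_cring)

lemma Md_add_group: "subgroup S (add_monoid (Md mu on)) = subgroup S M"
proof -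
	interpret N: abelian_group "Md mu on" using Md_module by (rule module.axioms)
	have i: "inv\<^bsub>add_monoid (Md mu on)\<^esub> x = inv x" if "x \<in> carrier M" for x
		by (rule group.inv_equality[OF N.a_group]) (use that in \<open>auto simp: Md_def\<close>)
	show ?thesis
	proof
		assume "subgroup S (add_monoid (Md mu on))"
		then interpret S: subgroup S "add_monoid (Md mu on)" .
		have sub: "S \<subseteq> carrier M" using S.subset by (simp add: Md_def)
		show "subgroup S M"
		proof (rule subgroup.intro[OF sub])
			show "x \<otimes> y \<in> S" if "x \<in> S" "y \<in> S" for x y using S.m_closed[OF that] by (simp add: Md_def)
			show "\<one> \<in> S" using S.one_closed by (simp add: Md_def)
			show "inv x \<in> S" if "x \<in> S" for x using S.m_inv_closed[OF that] i[OF subsetD[OF sub that]] by simp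
		qed
	next
		assume "subgroup S M"
		then interpret S: subgroup S M .
		show "subgroup S (add_monoid (Md mu on))"
		proof (rule subgroup.intro)
			show "S \<subseteq> carrier (add_monoid (Md mu on))" using S.subset by (simp add: Md_def)
			show "x \<otimes>\<^bsub>add_monoid (Md mu on)\<^esub> y \<in> S" if "x \<in> S" "y \<in> S" for x y using S.m_closed[OF that] by (simp add: Md_def)
			show "\<one>\<^bsub>add_monoid (Md mu on)\<^esub> \<in> S" by (simp add: Md_def)
			show "inv\<^bsub>add_monoid (Md mu on)\<^esub> x \<in> S" if "x \<in> S" for x
				using S.m_inv_closed[OF that] i[OF S.mem_carrier[OF that]] by simp
		qed
	qed
qed

text \<open>The basis elements \<open>delta g\<close> act as the group does, and a general scalar
  acts by a product of powers of such actions.\<close>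

lemma submodule_iff: "submodule S A (Md mu on) = (subgroup S M \<and> (\<forall>g\<in>carrier Q. \<forall>x\<in>S. act g x \<in> S))"
proof
	assume S: "submodule S A (Md mu on)"
	hence sg: "subgroup S M" using Md_add_group submodule.axioms(1) by blast
	have "act g x \<in> S" if "g \<in> carrier Q" "x \<in> S" for g x
	proof -
		have "delta g \<odot>\<^bsub>Md mu on\<^esub> x \<in> S" by (rule submodule.smult_closed[OF S delta_closed that(2)])
		thus ?thesis using sm_delta[OF that(1) subgroup.mem_carrier[OF sg that(2)]] by (simp add: Md_def)
	qed
	thus "subgroup S M \<and> (\<forall>g\<in>carrier Q. \<forall>x\<in>S. act g x \<in> S)" using sg by blast
next
	assume S: "subgroup S M \<and> (\<forall>g\<in>carrier Q. \<forall>x\<in>S. act g x \<in> S)"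
	then interpret S: subgroup S M by blast
	have fp: "(\<Otimes>i\<in>B. f i) \<in> S" if "finite B" "\<And>i. i \<in> B ==> f i \<in> S" for B and f :: "'g => 'm"
		using that
	proof (induction B rule: finite_induct)
		case (insert i B)
		hence "(\<Otimes>i\<in>insert i B. f i) = f i \<otimes> (\<Otimes>i\<in>B. f i)" by (intro M.finprod_insert) auto
		thus ?case using insert by simp
	qed simp
	have pw: "x [^] (n::int) \<in> S" if "x \<in> S" for x n by (rule M.subgroup_int_pow_closed) (use that S in auto)
	show "submodule S A (Md mu on)"
	proof (rule submodule.intro)
		show "subgroup S (add_monoid (Md mu on))" using Md_add_group S by blast
		show "submodule_axioms S A (Md mu on)"
		proof
			fix a x assume "a \<in> carrier A" "x \<in> S"
			hence "sm a x \<in> S" unfolding sm_def by (intro fp[OF fin] pw) (use S in blast)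
			thus "a \<odot>\<^bsub>Md mu on\<^esub> x \<in> S" by (simp add: Md_def)
		qed
	qed
qed

end

context eis
begin

abbreviation "GF \<equiv> Gal TT F"
abbreviation "GK \<equiv> Gal TT K"
abbreviation "GQ \<equiv> Gal F K"
abbreviation "cact \<equiv> conj_action K F TT"
abbreviation "GMod \<equiv> galois_module K F TT"

subsection \<open>The splitting\<close>

lemma Gal_TK_group: "group GK" and Gal_TF_group: "group GF" and Gal_FK_group: "group GQ"
	using Gal_group[OF TT_sf K_sub_T] Gal_group[OF TT_sf F_sub_T] Gal_group[OF F_sf KF] by simp_all

lemma embK_TF: "embK TT g ==> embK F g"
	by (rule embK_T_F)

lemma Gal_res: "g \<in> carrier GK ==> restrict g F \<in> carrier GQ"
	unfolding GalTK GalFK using embK_cong[OF embK_TF F_sf KF, of g "restrict g F"] by auto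

lemma F_emb_pow: "embK F h ==> \<exists>c<p. \<forall>x\<in>F. h x = (\<sigma> ^^ c) x"
proof (rule F_emb_sigma_pow[of h])
	fix c assume "c < p" "\<And>x. x \<in> F ==> h x = (\<sigma> ^^ c) x"
	thus ?thesis by (intro exI[of _ c] conjI ballI)
qed

lemma GalFK_pow: "q \<in> carrier GQ ==> \<exists>c<p. \<forall>x\<in>F. q x = (\<sigma> ^^ c) x"
	using F_emb_pow by (simp add: GalFK)

lemma sigma_pow_cong: assumes "\<And>x. x \<in> F ==> (\<sigma> ^^ m') x = (\<sigma> ^^ n) x" shows "[m' = n] (mod p)"
proof -
	show ?thesis using assms[OF thetaF] inj_onD[OF th_inj, of "m' mod p" "n mod p"] p_gt_0 by (simp add: sigma_pow_th cong_def)
qed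

definition "lft = (SOME g. lifts g)"

lemma lft: "lifts lft"
	unfolding lft_def by (rule someI_ex[OF lift_ex])

lemma lft_K: "embK TT lft" and lft_F: "x \<in> F ==> lft x = \<sigma> x"
	using lft by (simp_all add: lifts_def)

lemma lft_pow_F: "x \<in> F ==> (lft ^^ n) x = (\<sigma> ^^ n) x"
proof (induction n)
	case (Suc n)
	thus ?case using lft_F[OF F_emb_mem[OF conjunct1[OF sigma_pow] Suc.prems]] by simp
qed simp

lemma lft_pow_mod: assumes "x \<in> TT" shows "(lft ^^ n) x = (lft ^^ (n mod p)) x"
proof -
	have "(lft ^^ (p * k)) y = y" if "y \<in> TT" for k y
	proof (induction k)
		case (Suc k)
		have "(lft ^^ (p*Suc k)) y = (lft ^^ p) ((lft ^^ (p * k)) y)" by (simp add: funpow_add)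
		thus ?case using Suc lift_pow_p[OF lft that] by simp
	qed simp
	from this[OF emb_TT_mem[OF embK_funpow[OF lft_K] assms], of "n div p" "n mod p"]
	have "(lft ^^ (p*(n div p)+n mod p)) x = (lft ^^ (n mod p)) x" by (simp only: funpow_add comp_apply)
	thus ?thesis by simp
qed

lemma lft_pow_cong: "[m' = n] (mod p) ==> x \<in> TT ==> (lft ^^ m') x = (lft ^^ n) x"
	using lft_pow_mod[of x m'] lft_pow_mod[of x n] by (simp add: cong_def)

definition "ex q = (SOME n. \<forall>x\<in>F. q x = (\<sigma> ^^ n) x)"

lemma ex: "q \<in> carrier GQ ==> x \<in> F ==> q x = (\<sigma> ^^ ex q) x"
	using someI_ex[of "\<lambda>n. \<forall>x\<in>F. q x = (\<sigma> ^^ n) x"] GalFK_pow[of q] unfolding ex_def by blast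

text \<open>A power of the normalized lift; by \<open>lift_pow_p\<close> it depends only on the
  exponent modulo \<open>p\<close>, so the section is a homomorphism.\<close>

definition "sec q = restrict (lft ^^ ex q) TT"

lemma sec: "sec q \<in> carrier GK"
	using embK_funpow[OF lft_K] by (simp add: GalTK sec_def embK_restrict)

lemma sec_F: "q \<in> carrier GQ ==> x \<in> F ==> sec q x = q x"
	using F_sub_T[of "Suc l"] by (auto simp: sec_def lft_pow_F ex)

lemma sec_res: assumes "q \<in> carrier GQ" shows "restrict (sec q) F = q"
proof
	fix x show "restrict (sec q) F x = q x"
		using sec_F[OF assms, of x] assms by (cases "x \<in> F") (auto simp: GalFK extensional_def)
qed

lemma sec_hom: "sec \<in> hom GQ GK"
proof (rule homI[OF sec])
	fix q r assume qr: "q \<in> carrier GQ" "r \<in> carrier GQ"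
	have m: "q \<otimes>\<^bsub>GQ\<^esub> r \<in> carrier GQ" by (rule monoid.m_closed[OF group.is_monoid[OF Gal_FK_group] qr])
	have c: "[ex (q \<otimes>\<^bsub>GQ\<^esub> r) = ex q+ex r] (mod p)"
	proof (rule sigma_pow_cong)
		fix x assume x: "x \<in> F"
		have "r x \<in> F" using qr(2) x F_emb_mem unfolding GalFK by blast
		thus "(\<sigma> ^^ ex (q \<otimes>\<^bsub>GQ\<^esub> r)) x = (\<sigma> ^^ (ex q+ex r)) x"
			using ex[OF m x] x ex[OF qr(2) x] ex[OF qr(1), of "r x"] by (simp add: Gal_mult[OF qr] compose_def funpow_add)
	qed
	have "compose TT (sec q) (sec r) = sec (q \<otimes>\<^bsub>GQ\<^esub> r)"
	proof
		fix x
		show "compose TT (sec q) (sec r) x = sec (q \<otimes>\<^bsub>GQ\<^esub> r) x"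
		proof (cases "x \<in> TT")
			case True
			thus ?thesis using emb_TT_mem[OF embK_funpow[OF lft_K] True, of "ex r"] lft_pow_cong[OF c True]
				by (simp add: sec_def compose_def funpow_add)
		qed (simp add: compose_def sec_def)
	qed
	thus "sec (q \<otimes>\<^bsub>GQ\<^esub> r) = sec q \<otimes>\<^bsub>GK\<^esub> sec r" using Gal_mult[OF sec sec] by simp
qed

lemma embF_in_K: "carrier GF \<subseteq> carrier GK"
	by (auto simp: GalTK GalTF embF_def)

lemma res_hom: "(\<lambda>g. restrict g F) \<in> hom GK GQ"
proof (rule homI[OF Gal_res])
	fix g h assume gh: "g \<in> carrier GK" "h \<in> carrier GK"
	have "h x \<in> F" if "x \<in> F" for x using gh(2) that F_emb_mem[OF embK_TF] unfolding GalTK by blast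
	hence "restrict (compose TT g h) F = compose F (restrict g F) (restrict h F)"
		using F_sub_T[of "Suc l"] by (auto simp: compose_def fun_eq_iff)
	thus "restrict (g \<otimes>\<^bsub>GK\<^esub> h) F = restrict g F \<otimes>\<^bsub>GQ\<^esub> restrict h F"
		using Gal_mult[OF gh] Gal_mult[OF Gal_res[OF gh(1)] Gal_res[OF gh(2)]] by simp
qed

lemma split: "split_extension GK GF GQ (\<lambda>\<sigma>. restrict \<sigma> F)"
	unfolding split_extension_def
proof (intro conjI)
	show "(\<lambda>x. x) \<in> hom GF GK"
		using embF_in_K by (intro homI) (auto simp: Gal_mult subset_iff)
	show "(\<lambda>\<sigma>. restrict \<sigma> F) ` carrier GK = carrier GQ"
	proof
		show "carrier GQ \<subseteq> (\<lambda>\<sigma>. restrict \<sigma> F) ` carrier GK"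
		proof
			fix q assume "q \<in> carrier GQ"
			hence "(\<lambda>\<sigma>. restrict \<sigma> F) (sec q) = q" by (rule sec_res)
			from this[symmetric] sec show "q \<in> (\<lambda>\<sigma>. restrict \<sigma> F) ` carrier GK" by (rule image_eqI)
		qed
	qed (use Gal_res in blast)
	show "kernel GK GQ (\<lambda>\<sigma>. restrict \<sigma> F) = carrier GF"
	proof -
		have "(restrict g F = (\<lambda>x\<in>F. x)) = (\<forall>x\<in>F. g x = x)" for g :: "'a => 'a" by (auto simp: fun_eq_iff)
		thus ?thesis by (auto simp: kernel_def Gal_one GalTK GalTF embF_def)
	qed
	show "\<exists>s\<in>hom GQ GK. \<forall>x\<in>carrier GQ. restrict (s x) F = x" using sec_hom sec_res by blast
qed (rule Gal_TK_group Gal_TF_group Gal_FK_group res_hom)+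

lemma GalTF_eqI: "g \<in> carrier GF ==> h \<in> carrier GF ==> (\<And>x. x \<in> TT ==> g x = h x) ==> g = h"
	unfolding GalTF by (rule extensionalityI[of g TT h]) auto

lemma TF_comm: "comm_group GF"
proof (rule group.group_comm_groupI[OF Gal_TF_group])
	fix g h assume gh: "g \<in> carrier GF" "h \<in> carrier GF"
	have "compose TT g h = compose TT h g"
		using embF_commute[of g h] gh by (auto simp: compose_def GalTF)
	thus "g \<otimes>\<^bsub>GF\<^esub> h = h \<otimes>\<^bsub>GF\<^esub> g" using Gal_mult gh by metis
qed

lemma GalTF_pow: assumes g: "g \<in> carrier GF" shows "g [^]\<^bsub>GF\<^esub> (n::nat) = restrict (g ^^ n) TT"
proof (induction n)
	case 0 thus ?case by (simp add: nat_pow_def Gal_one)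
next
	case (Suc n)
	have gF: "embF g" using g by (simp add: GalTF)
	have gn: "restrict (g ^^ n) TT \<in> carrier GF" using embF_funpow[OF gF] by (simp add: GalTF embF_restrict)
	have "g [^]\<^bsub>GF\<^esub> Suc n = compose TT (restrict (g ^^ n) TT) g"
		unfolding monoid.nat_pow_Suc[OF group.is_monoid[OF Gal_TF_group]] Suc by (rule Gal_mult[OF gn g])
	also have "\<dots> = restrict (g ^^ Suc n) TT"
		using emb_TT_mem[OF embF_K[OF gF]] by (auto simp: compose_def funpow_swap1)
	finally show ?case .
qed

lemma TF_expo: assumes "g \<in> carrier GF" shows "g [^]\<^bsub>GF\<^esub> p = \<one>\<^bsub>GF\<^esub>"
	unfolding GalTF_pow[OF assms] Gal_one
	by (rule restrict_ext) (use embF_pow_p assms in \<open>simp add: GalTF\<close>)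

lemma TF_elementary: "elementary_abelian p GF"
	using TF_comm TF_expo by (simp add: elementary_abelian_def)

subsection \<open>The Galois module\<close>

lemma FK_comm: "comm_group GQ"
proof (rule group.group_comm_groupI[OF Gal_FK_group])
	fix g h assume gh: "g \<in> carrier GQ" "h \<in> carrier GQ"
	have "compose F g h = compose F h g"
	proof
		fix x show "compose F g h x = compose F h g x"
		proof (cases "x \<in> F")
			case True
			have "h x \<in> F" "g x \<in> F" using gh True F_emb_mem unfolding GalFK by blast+
			hence "g (h x) = (\<sigma> ^^ (ex g+ex h)) x" "h (g x) = (\<sigma> ^^ (ex h+ex g)) x"
				using True by (simp_all add: funpow_add ex[OF gh(1)] ex[OF gh(2)])
			thus ?thesis by (simp add: compose_def add.commute)
		qed (simp add: compose_def)
	qed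
	thus "g \<otimes>\<^bsub>GQ\<^esub> h = h \<otimes>\<^bsub>GQ\<^esub> g" using Gal_mult gh by metis
qed

lemma FK_finite: "finite (carrier GQ)"
proof (rule finite_surj)
	show "finite {..<p}" by simp
	show "carrier GQ \<subseteq> (\<lambda>n. restrict (\<sigma> ^^ n) F) ` {..<p}"
	proof
		fix q assume q: "q \<in> carrier GQ"
		then obtain n where n: "n < p" "\<And>x. x \<in> F ==> q x = (\<sigma> ^^ n) x" using GalFK_pow[OF q] by auto
		have "q = restrict (\<sigma> ^^ n) F"
			by (rule extensionalityI[of _ F]) (use q n(2) in \<open>auto simp: GalFK\<close>)
		thus "q \<in> (\<lambda>n. restrict (\<sigma> ^^ n) F) ` {..<p}" using n(1) by blast
	qed
qed

text \<open>Any two lifts of an element of \<open>Gal F K\<close> differ by an element commuting with \<open>m\<close>.\<close>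

lemma conj_action:
	assumes q: "q \<in> carrier GQ" and m: "t \<in> carrier GF"
	shows "cact q t \<in> carrier GF"
		"embK TT g ==> (\<And>x. x \<in> F ==> g x = q x) ==> y \<in> TT ==> cact q t (g y) = g (t y)"
proof -
	define h where "h = (SOME h. h \<in> carrier GK \<and> restrict h F = q)"
	have "\<exists>h. h \<in> carrier GK \<and> restrict h F = q" using sec sec_res[OF q] by blast
	from someI_ex[OF this] have "h \<in> carrier GK \<and> restrict h F = q" unfolding h_def[symmetric] .
	hence h: "h \<in> carrier GK" "restrict h F = q" by auto
	have hK: "embK TT h" using h(1) by (simp add: GalTK)
	have hF: "h x = q x" if "x \<in> F" for x using arg_cong[OF h(2), of "\<lambda>a. a x"] that by simp
	have tF: "embF t" using m by (simp add: GalTF)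
	have tT: "t \<in> carrier GK" using m embF_in_K by blast
	interpret G: group GK by (rule Gal_TK_group)
	define c where "c = cact q t"
	have c_eq: "c = h \<otimes>\<^bsub>GK\<^esub> t \<otimes>\<^bsub>GK\<^esub> m_inv GK h"
		by (simp add: c_def conj_action_def h_def Let_def)
	have cT: "c \<in> carrier GK" unfolding c_eq using h(1) tT by simp
	have "c \<otimes>\<^bsub>GK\<^esub> h = h \<otimes>\<^bsub>GK\<^esub> t" unfolding c_eq using h(1) tT by (simp add: G.m_assoc)
	hence eq: "compose TT c h = compose TT h t" using Gal_mult[OF cT h(1)] Gal_mult[OF h(1) tT] by simp
	have ch: "c (h y) = h (t y)" if "y \<in> TT" for y
	proof -
		have "compose TT c h y = compose TT h t y" unfolding eq ..
		thus ?thesis using that by (simp add: compose_def)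
	qed
	have "c x = x" if x: "x \<in> F" for x
	proof -
		obtain y where y: "y \<in> F" "h y = x" using emb_F_image[OF embK_TF[OF hK]] x by force
		show ?thesis using y(1) F_sub_T ch[of y] embF_F[OF tF y(1)] y(2) by auto
	qed
	thus "cact q t \<in> carrier GF" using cT by (simp add: GalTK GalTF embF_def c_def)
	assume g: "embK TT g" and gq: "\<And>x. x \<in> F ==> g x = q x" and y: "y \<in> TT"
	define k where "k = inv_into TT h"
	have kK: "embK TT k" unfolding k_def by (rule embK_inv[OF hK])
	have kh: "k (h x) = x" if "x \<in> TT" for x unfolding k_def by (rule inv_into_f_f[OF emb_inj[OF TT_sf embK_emb[OF hK]] that])
	have hk: "h (k x) = x" if "x \<in> TT" for x unfolding k_def by (rule f_inv_into_f) (use emb_TT_image[OF hK] that in simp)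
	have eF: "embF (k \<circ> g)"
		unfolding embF_def
	proof (intro conjI ballI)
		show "embK TT (k \<circ> g)" by (rule embK_comp[OF kK g])
		show "(k \<circ> g) x = x" if x: "x \<in> F" for x
		proof -
			show ?thesis using x F_sub_T gq[OF x] hF[OF x] kh[of x] by auto
		qed
	qed
	have gT: "g y \<in> TT" "t y \<in> TT" "g (t y) \<in> TT" using emb_TT_mem[OF g] emb_TT_mem[OF embF_K[OF tF]] y by auto
	have kg: "k (g y) \<in> TT" by (rule emb_TT_mem[OF kK gT(1)])
	have "c (g y) = h (t (k (g y)))" using ch[OF kg] hk[OF gT(1)] by simp
	also have "t (k (g y)) = k (g (t y))" using embF_commute[OF tF eF y] by simp
	finally show "cact q t (g y) = g (t y)" using hk[OF gT(3)] by (simp add: c_def)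
qed

lemma conj_action_eqI:
	assumes "q \<in> carrier GQ" "t \<in> carrier GF" "embK TT g" "\<And>x. x \<in> F ==> g x = q x"
		and "s' \<in> carrier GF" "\<And>y. y \<in> TT ==> s' (g y) = g (t y)"
	shows "cact q t = s'"
proof (rule GalTF_eqI[OF conj_action(1)[OF assms(1,2)] assms(5)])
	fix x assume "x \<in> TT"
	then obtain y where y: "y \<in> TT" "x = g y" using emb_TT_image[OF assms(3)] by blast
	thus "cact q t x = s' x" using conj_action(2)[OF assms(1-4) y(1)] assms(6)[OF y(1)] by simp
qed

lemma lift_FK: "q \<in> carrier GQ ==> \<exists>g. embK TT g \<and> (\<forall>x\<in>F. g x = q x)"
	using sec[of q] sec_F[of q] unfolding GalTK by (intro exI[of _ "sec q"]) simp

lemma fp_act: "fp_action GF GQ p (cact)"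
proof (intro fp_action.intro fp_action_axioms.intro)
	interpret M: comm_group GF by (rule TF_comm)
	interpret Q: comm_group GQ by (rule FK_comm)
	fix q r t t' assume q: "q \<in> carrier GQ" and t: "t \<in> carrier GF"
	show "cact q t \<in> carrier GF" by (rule conj_action(1)[OF q t])
	obtain g where g: "embK TT g" "\<And>x. x \<in> F ==> g x = q x" using lift_FK[OF q] by auto
	note ga = emb_TT_mem[OF g(1)]
	have tT: "t y \<in> TT" if "y \<in> TT" for y using emb_TT_mem[OF embF_K] t that unfolding GalTF by blast
	{
		assume t': "t' \<in> carrier GF"
		have t'T: "t' y \<in> TT" if "y \<in> TT" for y using emb_TT_mem[OF embF_K] t' that unfolding GalTF by blast
		note c = conj_action(1)[OF q t] conj_action(1)[OF q t']
		show "cact q (t \<otimes>\<^bsub>GF\<^esub> t') = cact q t \<otimes>\<^bsub>GF\<^esub> cact q t'"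
		proof (rule conj_action_eqI[OF q _ g])
			show "t \<otimes>\<^bsub>GF\<^esub> t' \<in> carrier GF" using t t' by simp
			show "cact q t \<otimes>\<^bsub>GF\<^esub> cact q t' \<in> carrier GF" using c by simp
			fix y assume y: "y \<in> TT"
			show "(cact q t \<otimes>\<^bsub>GF\<^esub> cact q t') (g y) = g ((t \<otimes>\<^bsub>GF\<^esub> t') y)"
				unfolding Gal_mult[OF c] Gal_mult[OF t t'] using y ga[OF y] conj_action(2)[OF q t' g y] conj_action(2)[OF q t g t'T[OF y]]
				by (simp add: compose_def)
		qed
	}
	{
		assume r: "r \<in> carrier GQ"
		obtain h where h: "embK TT h" "\<And>x. x \<in> F ==> h x = r x" using lift_FK[OF r] by auto
		note c = conj_action(1)[OF r t]
		show "cact (q \<otimes>\<^bsub>GQ\<^esub> r) t = cact q (cact r t)"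
		proof (rule conj_action_eqI[OF _ t embK_comp[OF g(1) h(1)] _ conj_action(1)[OF q c]])
			show "q \<otimes>\<^bsub>GQ\<^esub> r \<in> carrier GQ" using q r by simp
			show "(g \<circ> h) x = (q \<otimes>\<^bsub>GQ\<^esub> r) x" if x: "x \<in> F" for x
			proof -
				have "r x \<in> F" using r x F_emb_mem unfolding GalFK by blast
				thus ?thesis using x g(2) h(2) by (simp add: Gal_mult[OF q r] compose_def)
			qed
			show "cact q (cact r t) ((g \<circ> h) y) = (g \<circ> h) (t y)" if y: "y \<in> TT" for y
				using conj_action(2)[OF q c g emb_TT_mem[OF h(1) y]] conj_action(2)[OF r t h y] by simp
		qed
	}
next
	interpret M: comm_group GF by (rule TF_comm)
	interpret Q: comm_group GQ by (rule FK_comm)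
	fix t assume t: "t \<in> carrier GF"
	show "cact \<one>\<^bsub>GQ\<^esub> t = t"
		by (rule conj_action_eqI[OF Q.one_closed t embK_id _ t]) (simp_all add: Gal_one)
	show "t [^]\<^bsub>GF\<^esub> p = \<one>\<^bsub>GF\<^esub>" by (rule TF_expo[OF t])
qed (use p_gt_1 FK_finite TF_comm FK_comm in auto)

sublocale GM: fp_action GF GQ p "cact"
	by (rule fp_act)

lemma galois_module_Md: "GMod = GM.Md (\<lambda>_ _. undefined) undefined"
	by (simp add: galois_module_def GM.Md_def GM.sm_def fun_eq_iff)

section \<open>The chain of submodules\<close>

definition "sg = restrict \<sigma> F"

lemma sg: "sg \<in> carrier GQ"
	unfolding sg_def GalFK using embK_cong[OF sigma(1) F_sf KF, of "restrict \<sigma> F"] by simp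

lemma GalFK_sg: assumes "q \<in> carrier GQ" obtains n :: nat where "q = sg [^]\<^bsub>GQ\<^esub> n"
proof -
	obtain n where n: "\<forall>x\<in>F. q x = (\<sigma> ^^ n) x" using GalFK_pow[OF assms] by blast
	have "sg [^]\<^bsub>GQ\<^esub> n = restrict (\<sigma> ^^ n) F" for n :: nat
	proof (induction n)
		case 0 thus ?case by (simp add: Gal_one)
	next
		case (Suc n)
		have c: "restrict (\<sigma> ^^ n) F \<in> carrier GQ"
			unfolding GalFK using embK_cong[OF conjunct1[OF sigma_pow] F_sf KF, of "restrict (\<sigma> ^^ n) F" n] by simp
		have "sg [^]\<^bsub>GQ\<^esub> Suc n = compose F (restrict (\<sigma> ^^ n) F) sg"
			unfolding GM.Q.nat_pow_Suc Suc by (rule Gal_mult[OF c sg])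
		also have "\<dots> = restrict (\<sigma> ^^ Suc n) F"
			using F_emb_mem[OF sigma(1)] by (auto simp: compose_def funpow_swap1 sg_def)
		finally show ?case .
	qed
	moreover have "q = restrict (\<sigma> ^^ n) F"
		by (rule extensionalityI[of _ F]) (use assms n in \<open>auto simp: GalFK\<close>)
	ultimately show thesis using that by metis
qed

lemma submodule_iff':
	"submodule S GM.A (GMod) = (subgroup S GF \<and> (\<forall>t\<in>S. cact sg t \<in> S))"
	unfolding galois_module_Md GM.submodule_iff
proof safe
	fix q t assume S: "subgroup S GF" "\<forall>t\<in>S. cact sg t \<in> S" and q: "q \<in> carrier GQ" and t: "t \<in> S"
	have tM: "t \<in> carrier GF" by (rule subgroup.mem_carrier[OF S(1) t])
	obtain n :: nat where n: "q = sg [^]\<^bsub>GQ\<^esub> n" using GalFK_sg[OF q] .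
	have "cact (sg [^]\<^bsub>GQ\<^esub> n) t \<in> S" for n :: nat
	proof (induction n)
		case 0 thus ?case using t GM.act_one[OF tM] by simp
	next
		case (Suc n)
		have "sg [^]\<^bsub>GQ\<^esub> Suc n = sg \<otimes>\<^bsub>GQ\<^esub> sg [^]\<^bsub>GQ\<^esub> n" using GM.Q.nat_pow_Suc2[OF sg] by simp
		thus ?case using GM.act_assoc[OF sg GM.Q.nat_pow_closed[OF sg] tM, of n] Suc S(2) by simp
	qed
	thus "cact q t \<in> S" unfolding n .
qed (use sg in blast)

text \<open>The automorphisms over \<open>F\<close> that fix \<open>T j\<close>, for
  \<open>j\<close> up to \<open>l+1\<close>. The guard \<open>k \<le> l\<close> is there because the
  pairing is meaningful only for those indices.\<close>

definition "Dk j = {t \<in> carrier GF. \<forall>k<j. k \<le> l --> cc t k = 0}"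

lemma cc_mult: assumes "t \<in> carrier GF" "t' \<in> carrier GF" "k \<le> l"
	shows "[cc (t \<otimes>\<^bsub>GF\<^esub> t') k = cc t k + cc t' k] (mod p)"
proof -
	have "t \<otimes>\<^bsub>GF\<^esub> t' = restrict (t \<circ> t') TT" unfolding Gal_mult[OF assms(1,2)] by (simp add: compose_def o_def)
	thus ?thesis using cc_comp[of t t' k] cc_restrict[OF assms(3), of "t \<circ> t'"] assms unfolding GalTF by simp
qed

lemma cc_lt: "t \<in> carrier GF ==> k \<le> l ==> cc t k < p"
	using cc(1) unfolding GalTF by blast

lemma cc_0: "t \<in> carrier GF ==> k \<le> l ==> [cc t k = 0] (mod p) ==> cc t k = 0"
	using cc_lt by (simp add: cong_def)

lemma cc_one: "k \<le> l ==> cc \<one>\<^bsub>GF\<^esub> k = 0"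
	using cc_restrict[of k "\<lambda>x. x"] cc_id by (simp add: Gal_one)

lemma cc_inv: assumes "t \<in> carrier GF" "k \<le> l" shows "[cc t k + cc (inv\<^bsub>GF\<^esub> t) k = 0] (mod p)"
proof -
	have "[cc (t \<otimes>\<^bsub>GF\<^esub> inv\<^bsub>GF\<^esub> t) k = cc t k + cc (inv\<^bsub>GF\<^esub> t) k] (mod p)"
		by (rule cc_mult[OF assms(1) GM.M.inv_closed[OF assms(1)] assms(2)])
	thus ?thesis using assms cc_one[OF assms(2)] by (simp add: cong_sym)
qed

lemma cc_pow: "t \<in> carrier GF ==> k \<le> l ==> [cc (t [^]\<^bsub>GF\<^esub> (n::nat)) k = n * cc t k] (mod p)"
	using cc_funpow[of t k n] cc_restrict[of k "t ^^ n"] by (simp add: GalTF_pow) (simp add: GalTF)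

text \<open>Dual to \<open>\<sigma> (\<alpha> k) = \<alpha> k + \<alpha> (k-1)\<close>: on families
  of pairing values \<open>\<sigma> - 1\<close> acts as a single nilpotent Jordan block, which is
  the reason for indecomposability.\<close>

lemma cc_act: assumes t: "t \<in> carrier GF" and k: "k \<le> l"
	shows "[cc t k = cc (cact sg t) k+(case k of 0 => 0 | Suc i => cc (cact sg t) i)] (mod p)"
proof -
	define t' where "t' = cact sg t"
	have t': "embF t'" using conj_action(1)[OF sg t] by (simp add: t'_def GalTF)
	have "vgt 0 (lft (Y k)-Y k-Yp k - of_nat 0)" using lft k by (simp add: lifts_def)
	note c = cc_conj(2)[OF lft_K t' k this]
	have "inv_into TT lft (t' (lft y)) = t y" if y: "y \<in> TT" for y
	proof -
		have "t' (lft y) = lft (t y)" unfolding t'_def by (rule conj_action(2)[OF sg t lft_K _ y]) (simp add: lft_F sg_def)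
		moreover have "t y \<in> TT" using emb_TT_mem[OF embF_K] t y unfolding GalTF by blast
		ultimately show ?thesis using inv_into_f_f[OF emb_inj[OF TT_sf embK_emb[OF lft_K]]] by simp
	qed
	hence "cc (inv_into TT lft \<circ> t' \<circ> lft) k = cc t k" using Y_TT[OF k] by (simp add: cc_def)
	thus ?thesis using c unfolding t'_def by simp
qed

lemma Dk_subgroup: "subgroup (Dk j) GF"
proof (rule GM.M.subgroupI)
	show "Dk j \<subseteq> carrier GF" by (auto simp: Dk_def)
	show "Dk j \<noteq> {}" using cc_one by (auto simp: Dk_def)
	fix a assume a: "a \<in> Dk j"
	hence aM: "a \<in> carrier GF" by (simp add: Dk_def)
	have "cc (inv\<^bsub>GF\<^esub> a) k = 0" if "k < j" "k \<le> l" for k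
		using cc_inv[OF aM that(2)] a that cc_0[OF GM.M.inv_closed[OF aM] that(2)] by (simp add: Dk_def)
	thus "inv\<^bsub>GF\<^esub> a \<in> Dk j" using aM by (simp add: Dk_def)
	fix b assume b: "b \<in> Dk j"
	hence bM: "b \<in> carrier GF" by (simp add: Dk_def)
	have "cc (a \<otimes>\<^bsub>GF\<^esub> b) k = 0" if "k < j" "k \<le> l" for k
		using cc_mult[OF aM bM that(2)] a b that cc_0[OF GM.M.m_closed[OF aM bM] that(2)] by (simp add: Dk_def)
	thus "a \<otimes>\<^bsub>GF\<^esub> b \<in> Dk j" using aM bM by (simp add: Dk_def)
qed

lemma Dk_submodule: "submodule (Dk j) GM.A (GMod)"
	unfolding submodule_iff'
proof (intro conjI ballI)
	fix t assume t: "t \<in> Dk j"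
	hence tM: "t \<in> carrier GF" by (simp add: Dk_def)
	note t'M = conj_action(1)[OF sg tM]
	have "k < j ==> k \<le> l ==> cc (cact sg t) k = 0" for k
	proof (induction k)
		case 0
		thus ?case using cc_act[OF tM, of 0] t cc_0[OF t'M] by (simp add: Dk_def cong_sym_eq)
	next
		case (Suc k)
		thus ?case using cc_act[OF tM, of "Suc k"] t cc_0[OF t'M] by (simp add: Dk_def cong_sym_eq)
	qed
	thus "cact sg t \<in> Dk j" using t'M by (simp add: Dk_def)
qed (rule Dk_subgroup)

lemma GalTF_cc_eqI: assumes "t \<in> carrier GF" "t' \<in> carrier GF" "\<And>k. k \<le> l ==> cc t k = cc t' k" shows "t = t'"
	by (rule GalTF_eqI[OF assms(1,2)]) (rule cc_inj, use assms in \<open>auto simp: GalTF\<close>)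

lemma Dk_last: "Dk (Suc l) = {\<one>\<^bsub>GF\<^esub>}"
	using GalTF_cc_eqI[OF _ GM.M.one_closed] cc_one by (auto simp: Dk_def)

lemma GalTF_ex: assumes "splits ==> p dvd c 0" "\<And>k. k \<le> l ==> c k < p"
	shows "\<exists>t\<in>carrier GF. \<forall>k\<le>l. cc t k = c k"
proof -
	obtain g where g: "embF g" "\<forall>k\<le>l. [cc g k = c k] (mod p)" using cc_exists'[of c, OF assms(1)] by blast
	have "cc (restrict g TT) k = c k" if "k \<le> l" for k
	proof -
		have "[cc g k = c k] (mod p)" using g(2) that by blast
		thus ?thesis using assms(2)[OF that] cc(1)[OF g(1) that] cc_restrict[OF that, of g] by (simp add: cong_def)
	qed
	moreover have "restrict g TT \<in> carrier GF" using g(1) by (simp add: GalTF embF_restrict)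
	ultimately show ?thesis by blast
qed

text \<open>The value at \<open>j\<close> embeds the quotient of \<open>Dk j\<close> by
  \<open>Dk (Suc j)\<close> into a group of prime order, so nothing lies strictly between
  them.\<close>

lemma Dk_step:
	assumes j: "j \<le> l" and S: "subgroup S GF" "Dk (Suc j) \<subseteq> S" "S \<subseteq> Dk j"
	shows "S = Dk (Suc j) \<or> S = Dk j"
proof (rule ccontr)
	assume n: "\<not> ?thesis"
	then obtain t where t: "t \<in> S" "t \<notin> Dk (Suc j)" using S(2) by blast
	have tM: "t \<in> carrier GF" by (rule subgroup.mem_carrier[OF S(1) t(1)])
	have tj: "t \<in> Dk j" using t S(3) by blast
	have c: "cc t j \<noteq> 0" using t(2) tj by (auto simp: Dk_def less_Suc_eq)
	hence cop: "Rings.coprime (cc t j) p"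
		using cc_lt[OF tM j] prime_p by (metis coprime_commute dvd_imp_le gr0I leD prime_imp_coprime)
	have "Dk j \<subseteq> S"
	proof
		fix x assume x: "x \<in> Dk j"
		hence xM: "x \<in> carrier GF" by (simp add: Dk_def)
		obtain e where e: "[cc t j*e = 1] (mod p)" using cong_solve_coprime_nat[OF cop] by auto
		\<comment> \<open>With this exponent \<open>t^n\<close> cancels the value of \<open>x\<close> at
		  \<open>j\<close>, and the product lies in \<open>Dk (Suc j)\<close>.\<close>
		define n where "n = e*(p - cc x j)"
		have nc: "[n * cc t j = p - cc x j] (mod p)"
		proof -
			have "[cc t j*e*(p - cc x j) = 1*(p - cc x j)] (mod p)" by (rule cong_mult[OF e cong_refl])
			thus ?thesis by (simp add: n_def mult_ac)
		qed
		define y where "y = x \<otimes>\<^bsub>GF\<^esub> t [^]\<^bsub>GF\<^esub> n"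
		have tn: "t [^]\<^bsub>GF\<^esub> n \<in> S" using S(1) t(1) by (induction n) (simp_all add: subgroup.one_closed subgroup.m_closed)
		have tnM: "t [^]\<^bsub>GF\<^esub> n \<in> carrier GF" by (rule subgroup.mem_carrier[OF S(1) tn])
		have yM: "y \<in> carrier GF" unfolding y_def using xM tnM by simp
		have "cc y k = 0" if k: "k < Suc j" "k \<le> l" for k
		proof (rule cc_0[OF yM k(2)])
			have "[cc y k = cc x k + cc (t [^]\<^bsub>GF\<^esub> n) k] (mod p)" unfolding y_def by (rule cc_mult[OF xM tnM k(2)])
			also have "[cc x k + cc (t [^]\<^bsub>GF\<^esub> n) k = cc x k+n * cc t k] (mod p)" by (rule cong_add[OF cong_refl cc_pow[OF tM k(2)]])
			also have "[cc x k+n * cc t k = 0] (mod p)"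
			proof (cases "k = j")
				case True
				have "[cc x j+n * cc t j = cc x j+(p - cc x j)] (mod p)" by (rule cong_add[OF cong_refl nc])
				also have "cc x j+(p - cc x j) = p" using cc_lt[OF xM j] by simp
				finally show ?thesis using True by (simp add: cong_def)
			next
				case False
				hence "k < j" using k by simp
				thus ?thesis using x tj k by (simp add: Dk_def)
			qed
			finally show "[cc y k = 0] (mod p)" .
		qed
		hence yS: "y \<in> S" using yM S(2) by (auto simp: Dk_def)
		have "x = y \<otimes>\<^bsub>GF\<^esub> inv\<^bsub>GF\<^esub> (t [^]\<^bsub>GF\<^esub> n)" unfolding y_def using xM tnM by (simp add: GM.M.m_assoc)
		thus "x \<in> S" using yS tn S(1) by (simp add: subgroup.m_closed subgroup.m_inv_closed)
	qed
	thus False using n S(3) by blast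
qed

lemma Dk_strict: assumes "j \<le> l" "0 < j \<or> \<not> splits" shows "Dk (Suc j) \<subset> Dk j"
proof -
	have "\<exists>t\<in>carrier GF. \<forall>k\<le>l. cc t k = (if k = j then 1 else 0)"
		by (rule GalTF_ex) (use assms(2) p_gt_1 in auto)
	then obtain t where t: "t \<in> carrier GF" "\<forall>k\<le>l. cc t k = (if k = j then 1 else 0)" by blast
	have "t \<in> Dk j" "t \<notin> Dk (Suc j)" using t assms(1) by (auto simp: Dk_def)
	moreover have "Dk (Suc j) \<subseteq> Dk j" by (auto simp: Dk_def)
	ultimately show ?thesis by blast
qed

lemma Dk_0: "Dk 0 = carrier GF" and Dk_1: "splits ==> Dk 1 = carrier GF"
	using cc_splits by (auto simp: Dk_def GalTF)

lemma galois_carrier: "carrier (GMod) = carrier GF" "\<zero>\<^bsub>GMod\<^esub> = \<one>\<^bsub>GF\<^esub>"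
	by (simp_all add: galois_module_def)

text \<open>The chain ascends from \<open>Dk (l+1)\<close>, which is trivial. In the split case
  \<open>Dk 1\<close> is already the whole group, so there is one step less.\<close>

lemma comp_length: "has_composition_length GM.A (GMod) (if splits then l else l+1)"
proof -
	define n where "n = (if splits then l else l+1)"
	have nl: "n \<le> Suc l" by (simp add: n_def)
	show ?thesis
		unfolding has_composition_length_def n_def[symmetric]
	proof (intro exI[of _ "\<lambda>i. Dk (Suc l-i)"] conjI allI impI)
		show "Dk (Suc l-0) = {\<zero>\<^bsub>GMod\<^esub>}" using Dk_last by (simp add: galois_carrier)
		show "Dk (Suc l-n) = carrier (GMod)" using Dk_0 Dk_1 by (simp add: galois_carrier n_def)
		show "submodule (Dk (Suc l-i)) GM.A (GMod)" for i by (rule Dk_submodule)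
		fix i assume i: "i < n"
		define j where "j = Suc l-Suc i"
		have j: "Suc l-i = Suc j" "j \<le> l" "0 < j \<or> \<not> splits" using i by (auto simp: j_def n_def split: if_splits)
		show "Dk (Suc l-i) \<subset> Dk (Suc l-Suc i)" using Dk_strict[OF j(2,3)] j(1) by (simp add: j_def)
		fix S assume "submodule S GM.A (GMod) \<and> Dk (Suc l-i) \<subseteq> S \<and> S \<subseteq> Dk (Suc l-Suc i)"
		thus "S = Dk (Suc l-i) \<or> S = Dk (Suc l-Suc i)"
			using Dk_step[OF j(2), of S] unfolding submodule_iff' j(1) j_def[symmetric] by blast
	qed
qed

text \<open>Applying \<open>1 - \<sigma>\<close> moves the first nonzero pairing value from index
  \<open>j\<close> to \<open>j+1\<close>; repeated application reaches an element of
  \<open>Dk l\<close> with nonzero value at \<open>l\<close>, and it generates \<open>Dk l\<close>.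
  So \<open>Dk l\<close> is the socle, and it is simple.\<close>

lemma submodule_contains_last:
	assumes S: "submodule S GM.A (GMod)" "S \<noteq> {\<one>\<^bsub>GF\<^esub>}"
	shows "Dk l \<subseteq> S"
proof -
	have sS: "subgroup S GF" and aS: "\<And>t. t \<in> S ==> cact sg t \<in> S" using S(1) unfolding submodule_iff' by auto
	have step: "\<exists>t\<in>S. t \<in> Dk (j+i) \<and> cc t (j+i) \<noteq> 0" if t: "t \<in> S" "t \<in> Dk j" "cc t j \<noteq> 0" and "j+i \<le> l" for t i j
		using that(4)
	proof (induction i)
		case 0 thus ?case using t by auto
	next
		case (Suc i)
		then obtain t where t: "t \<in> S" "t \<in> Dk (j+i)" "cc t (j+i) \<noteq> 0" by auto
		define n where "n = j+i"
		have nl: "Suc n \<le> l" using Suc.prems by (simp add: n_def)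
		have tM: "t \<in> carrier GF" by (rule subgroup.mem_carrier[OF sS t(1)])
		define t' where "t' = cact sg t"
		have t'S: "t' \<in> S" unfolding t'_def by (rule aS[OF t(1)])
		have t'M: "t' \<in> carrier GF" by (rule subgroup.mem_carrier[OF sS t'S])
		have t'D: "t' \<in> Dk n" unfolding t'_def n_def using Dk_submodule t(2) unfolding submodule_iff' by blast
		\<comment> \<open>In additive notation this is \<open>(1 - \<sigma>) t\<close>; its value at
		  \<open>k\<close> is that of \<open>t'\<close> at \<open>k-1\<close>.\<close>
		define w where "w = t \<otimes>\<^bsub>GF\<^esub> inv\<^bsub>GF\<^esub> t'"
		have wS: "w \<in> S" unfolding w_def by (rule subgroup.m_closed[OF sS t(1) subgroup.m_inv_closed[OF sS t'S]])
		have wM: "w \<in> carrier GF" by (rule subgroup.mem_carrier[OF sS wS])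
		have w: "[cc w k = (case k of 0 => 0 | Suc i => cc t' i)] (mod p)" if "k \<le> l" for k
		proof -
			define c where "c = (case k of 0 => 0 | Suc i => cc t' i)"
			have "[cc w k = cc t k + cc (inv\<^bsub>GF\<^esub> t') k] (mod p)" unfolding w_def by (rule cc_mult[OF tM GM.M.inv_closed[OF t'M] that])
			also have "[cc t k + cc (inv\<^bsub>GF\<^esub> t') k = (cc t' k + c) + cc (inv\<^bsub>GF\<^esub> t') k] (mod p)"
				unfolding c_def t'_def by (rule cong_add[OF cc_act[OF tM that] cong_refl])
			also have "(cc t' k + c) + cc (inv\<^bsub>GF\<^esub> t') k = (cc t' k + cc (inv\<^bsub>GF\<^esub> t') k) + c" by simp
			also have "[(cc t' k + cc (inv\<^bsub>GF\<^esub> t') k) + c = 0 + c] (mod p)" by (rule cong_add[OF cc_inv[OF t'M that] cong_refl])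
			finally show ?thesis by (simp add: c_def)
		qed
		have "cc w k = 0" if k: "k < Suc n" "k \<le> l" for k
		proof (rule cc_0[OF wM k(2)])
			show "[cc w k = 0] (mod p)" using t'D k w[OF k(2)] by (auto simp: Dk_def split: nat.splits)
		qed
		hence wD: "w \<in> Dk (Suc n)" using wM by (simp add: Dk_def)
		have nl': "n \<le> l" using nl by simp
		have "cc t' n \<noteq> 0"
		proof
			assume 0: "cc t' n = 0"
			have "[cc t n = 0] (mod p)" using t'D nl' cc_act[OF tM nl', folded t'_def] 0 by (auto simp: Dk_def split: nat.splits)
			thus False using cc_0[OF tM nl'] t(3) by (simp add: n_def)
		qed
		moreover have "cc t' n = 0" if "cc w (Suc n) = 0"
			by (rule cc_0[OF t'M nl' cong_sym]) (use w[OF nl] that in simp)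
		ultimately have "cc w (Suc n) \<noteq> 0" by metis
		thus ?case using wS wD by (auto simp: n_def)
	qed
	obtain t where t: "t \<in> S" "t \<noteq> \<one>\<^bsub>GF\<^esub>" using S(2) subgroup.one_closed[OF sS] by blast
	have tM: "t \<in> carrier GF" by (rule subgroup.mem_carrier[OF sS t(1)])
	have nz: "\<exists>k. k \<le> l \<and> cc t k \<noteq> 0"
	proof (rule ccontr)
		assume "\<not> ?thesis"
		hence "cc t k = cc \<one>\<^bsub>GF\<^esub> k" if "k \<le> l" for k using that by (simp add: cc_one)
		thus False using t(2) GalTF_cc_eqI[OF tM GM.M.one_closed] by simp
	qed
	define j where "j = (LEAST k. k \<le> l \<and> cc t k \<noteq> 0)"
	have j: "j \<le> l" "cc t j \<noteq> 0" using LeastI_ex[OF nz] by (simp_all add: j_def)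
	have "cc t k = 0" if "k < j" "k \<le> l" for k
		using not_less_Least[of k "\<lambda>k. k \<le> l \<and> cc t k \<noteq> 0"] that by (simp add: j_def)
	hence "t \<in> Dk j" using tM by (simp add: Dk_def)
	then obtain w where w: "w \<in> S" "w \<in> Dk l" "cc w l \<noteq> 0" using step[OF t(1) _ j(2), of "l-j"] j(1) by auto
	have "S \<inter> Dk l = Dk (Suc l) \<or> S \<inter> Dk l = Dk l"
	proof (rule Dk_step[OF order_refl])
		show "subgroup (S \<inter> Dk l) GF" by (rule GM.M.subgroups_Inter_pair[OF sS Dk_subgroup])
		show "Dk (Suc l) \<subseteq> S \<inter> Dk l" unfolding Dk_last using subgroup.one_closed[OF sS] subgroup.one_closed[OF Dk_subgroup] by blast
	qed simp
	moreover have "w \<notin> Dk (Suc l)" using w(3) by (auto simp: Dk_def)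
	ultimately show ?thesis using w by blast
qed

text \<open>Two nonzero submodules both contain the socle, so they are never complementary.\<close>

lemma indecomposable: "indecomposable_module GM.A (GMod)"
	unfolding indecomposable_module_def galois_carrier
proof (intro conjI allI impI)
	show "Module.module GM.A (GMod)" unfolding galois_module_Md by (rule GM.Md_module)
	have s: "Dk (Suc l) \<subset> Dk l" by (rule Dk_strict) (use l in auto)
	moreover have "Dk l \<subseteq> carrier GF" by (auto simp: Dk_def)
	ultimately show "carrier GF \<noteq> {\<one>\<^bsub>GF\<^esub>}" unfolding Dk_last by blast
	fix A B assume AB: "submodule A GM.A (GMod) \<and> submodule B GM.A (GMod) \<and>
				A \<inter> B = {\<one>\<^bsub>GF\<^esub>} \<and> A <+>\<^bsub>GMod\<^esub> B = carrier GF"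
	show "A = {\<one>\<^bsub>GF\<^esub>} \<or> B = {\<one>\<^bsub>GF\<^esub>}"
	proof (rule ccontr)
		assume "\<not> ?thesis"
		hence "Dk l \<subseteq> A \<inter> B" using submodule_contains_last AB by blast
		thus False using s AB unfolding Dk_last by blast
	qed
qed

end

subsection \<open>Ramification indices\<close>

context padic_valuation
begin

lemma value_group_lf: assumes "lf E e" shows "value_group v E = range (\<lambda>n. of_int n/real e)"
proof
	show "value_group v E \<subseteq> range (\<lambda>n. of_int n/real e)"
	proof
		fix r assume "r \<in> value_group v E"
		then obtain x where x: "x \<in> E" "x \<noteq> 0" "r = real_of_ereal (v x)" by (auto simp: value_group_def)
		obtain n :: int where "val (of_int n/real e) x" using lf_val[OF assms x(1,2)] .
		thus "r \<in> range (\<lambda>n. of_int n/real e)" using x(3) by (auto simp: val_def)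
	qed
	show "range (\<lambda>n. of_int n/real e) \<subseteq> value_group v E"
	proof
		fix r assume "r \<in> range (\<lambda>n. of_int n/real e)"
		then obtain n where n: "r = of_int n/real e" by blast
		obtain x where x: "x \<in> E" "val r x" using lf_elem[OF assms, of n] n by blast
		have "x \<noteq> 0" by (rule val_nonzero[OF x(2)])
		moreover have "r = real_of_ereal (v x)" using x(2) by (simp add: val_def)
		ultimately show "r \<in> value_group v E" using x(1) by (auto simp: value_group_def)
	qed
qed

lemma value_group_Qp: "value_group v (Qp v) = range (\<lambda>n. of_int n/real 1)"
proof
	show "value_group v (Qp v) \<subseteq> range (\<lambda>n. of_int n/real 1)"
	proof
		fix r assume "r \<in> value_group v (Qp v)"
		then obtain x where x: "x \<in> Qp v" "x \<noteq> 0" "r = real_of_ereal (v x)" by (auto simp: value_group_def)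
		obtain n :: int where "val (of_int n) x" using val_Qp_ex[OF x(1,2)] by blast
		thus "r \<in> range (\<lambda>n. of_int n/real 1)" using x(3) by (auto simp: val_def)
	qed
	show "range (\<lambda>n. of_int n/real 1) \<subseteq> value_group v (Qp v)"
	proof
		fix r assume "r \<in> range (\<lambda>n. of_int n/real 1)"
		then obtain n where n: "r = of_int n" by auto
		define q :: rat where "q = of_nat p powi n"
		have q: "of_rat q = (of_nat p :: 'a) powi n" by (simp add: q_def power_int_def of_rat_power of_rat_inverse)
		have x: "val r (of_rat q)" using val_powi[OF val_p', of n] by (simp add: n q)
		have "rat_limit v (\<lambda>_. q) (of_rat q)" by (simp add: rat_limit_def)
		hence "of_rat q \<in> Qp v" by (auto simp: Qp_def)
		moreover have "of_rat q \<noteq> (0 :: 'a)" by (rule val_nonzero[OF x])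
		moreover have "r = real_of_ereal (v (of_rat q))" using x by (simp add: val_def)
		ultimately show "r \<in> value_group v (Qp v)" by (auto simp: value_group_def)
	qed
qed

lemma ram_index_eq:
	assumes F: "value_group v F = range (\<lambda>n. of_int n/real e)" and E: "value_group v E = range (\<lambda>n. of_int n/real (e*d))"
		and e: "e > 0" "d > 0"
	shows "ram_index v F E = d"
proof -
	define V where "V = range (\<lambda>n. of_int n/real e)"
	define C where "C n = (+) (of_int n/real (e*d)) ` V" for n :: int
	have C_eq: "(C i = C j) = (int d dvd i-j)" for i j
	proof
		assume "C i = C j"
		moreover have "of_int i/real (e*d) \<in> C i" unfolding C_def V_def by (rule image_eqI[of _ _ 0]) (auto intro: range_eqI[of _ _ 0])
		ultimately obtain n where "of_int i/real (e*d) = of_int j/real (e*d) + of_int n/real e"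
			by (auto simp: C_def V_def)
		hence "real_of_int i = of_int (j+n*int d)" using e by (simp add: field_simps)
		hence "i = j+n*int d" by (simp only: of_int_eq_iff)
		thus "int d dvd i-j" by simp
	next
		assume "int d dvd i-j"
		then obtain k where k: "i = j+int d * k" by (metis dvdE add.commute diff_add_cancel)
		have sub: "C (j+int d * k) \<subseteq> C j" for j k
		proof
			fix x assume "x \<in> C (j+int d * k)"
			then obtain n where "x = of_int (j+int d * k)/real (e*d) + of_int n/real e" by (auto simp: C_def V_def)
			moreover have "of_int (j+int d * k)/real (e*d) = of_int j/real (e*d) + of_int k/real e"
				using e by (simp add: add_divide_distrib)
			ultimately have "x = of_int j/real (e*d) + of_int (n + k)/real e" by (simp add: add_divide_distrib)
			thus "x \<in> C j" unfolding C_def V_def by (rule image_eqI[OF _ rangeI])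
		qed
		have "C i \<subseteq> C j" using sub[of j k] k by simp
		moreover have "C j \<subseteq> C i" using sub[of i "-k"] k by simp
		ultimately show "C i = C j" by blast
	qed
	have "(\<lambda>c. (+) c ` value_group v F) ` value_group v E = range C"
		unfolding E F image_image C_def V_def[symmetric] ..
	also have "\<dots> = (\<lambda>i. C (int i)) ` {..<d}"
	proof
		show "range C \<subseteq> (\<lambda>i. C (int i)) ` {..<d}"
		proof
			fix x assume "x \<in> range C"
			then obtain n where n: "x = C n" by blast
			have "C n = C (int (nat (n mod int d)))" unfolding C_eq using e by simp
			moreover have "nat (n mod int d) < d" using e by (simp add: nat_less_iff)
			ultimately show "x \<in> (\<lambda>i. C (int i)) ` {..<d}" using n by blast
		qed
	qed blast
	finally have "ram_index v F E = card ((\<lambda>i. C (int i)) ` {..<d})" by (simp add: ram_index_def)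
	also have "\<dots> = card {..<d}"
	proof (rule card_image, rule inj_onI)
		fix i j assume ij: "i \<in> {..<d}" "j \<in> {..<d}" "C (int i) = C (int j)"
		hence "int i mod int d = int j mod int d" unfolding C_eq mod_eq_dvd_iff by blast
		thus "i = j" using ij(1,2) by simp
	qed
	finally show ?thesis by simp
qed

end

context eis
begin

declare One_nat_def [simp del]

abbreviation "lram \<equiv> lower_ram v TT (T 1)"
abbreviation "herb \<equiv> herbrand v TT (T 1)"

lemma T_Suc_0 [simp]: "T (Suc 0) = T 1"
	by (simp add: One_nat_def)

lemma T1_TT: "T 1 \<subseteq> TT" by (rule T_sub_TT) simp
lemma F_T1: "F \<subseteq> T 1" by (rule F_sub_T)
lemma T1_sf: "sfield (T 1)" by (rule T_sf) simp

lemma TT_lf: "lf TT (p^Suc l)"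
	by (rule T_lf) auto

lemma ram_F_T1: "ram_index v F (T 1) = 1"
	by (rule ram_index_eq[OF value_group_lf[OF F_lf]]) (use value_group_lf[OF T1_lf] p_gt_0 in auto)

lemma ram_T1_TT: "ram_index v (T 1) TT = p^l"
	by (rule ram_index_eq[OF value_group_lf[OF T1_lf]]) (use value_group_lf[OF TT_lf] p_gt_0 in auto)

lemma ram_Qp_TT: "ram_index v (Qp v) TT = p^Suc l"
	by (rule ram_index_eq[OF value_group_Qp]) (use value_group_lf[OF TT_lf] p_gt_0 in auto)

lemma T1_T_dim: "j \<le> l ==> ring.dimension Omega (p^j) (T 1) (T (Suc j))"
proof (induction j)
	case 0 show ?case using Om.dimension_one[OF T1_sf] by simp
next
	case (Suc j)
	have "ring.dimension Omega (p^j*p) (T 1) (T (Suc (Suc j)))"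
		by (rule Om.telescopic_base[OF T1_sf T_sf[of "Suc j"] _ T_dim[of "Suc j"]]) (use Suc in auto)
	thus ?case by (simp add: mult.commute)
qed

lemma TT_totally_ramified: "totally_ramified_ext v (T 1) TT"
	using T1_T_dim[OF order_refl] T1_sf TT_sf T1_TT
	by (simp add: totally_ramified_ext_def ram_T1_TT ext_of_degree_def field_ext_def)

lemma T1_unramified: "\<not> splits ==> unramified_ext v F (T 1)"
	using T_dim[of 0] F_sf T1_sf F_T1 ram_F_T1
	by (auto simp: unramified_ext_def finite_ext_def field_ext_def Om.finite_dimension_def)

lemma F_psub_T1: assumes "\<not> splits" shows "F \<subset> T 1"
proof -
	have "F \<noteq> T 1"
	proof
		assume e: "F = T 1"
		have "ring.dimension Omega p F F" using T_dim[of 0] assms e by simp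
		moreover have "ring.dimension Omega 1 F F" by (rule Om.dimension_one[OF F_sf])
		ultimately have "p = 1" using Om.dimension_is_inj[OF F_sf] by blast
		thus False using p_gt_1 by simp
	qed
	thus ?thesis using F_T1 by blast
qed

subsection \<open>The ramification filtration\<close>

lemma TT_residue: "j \<le> l ==> x \<in> T (Suc j) ==> vge 0 x ==> \<exists>c\<in>T 1. vgt 0 (x - c)"
proof (induction j arbitrary: x)
	case 0 thus ?case by (intro bexI[of _ x]) auto
next
	case (Suc j)
	define n where "n = Suc j"
	have n: "0 < n" "n \<le> l" using Suc.prems by (auto simp: n_def)
	have "x \<in> lin_span (T n) (G n) p" using G(4)[OF n] Suc.prems(2) by (simp add: n_def)
	from ram_residue[OF T_lf[OF n(1)] G_ram(1)[OF n] G_ram(3)[OF n] p_gt_0 this Suc.prems(3)] n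
	obtain y where y: "y \<in> T n" "vge 0 y" "vgt 0 (x-y)" by auto
	obtain c where c: "c \<in> T 1" "vgt 0 (y - c)" using Suc.IH[of y] y n by (auto simp: n_def)
	thus ?case using vgt_add[OF y(3) c(2)] by (intro bexI[of _ c]) auto
qed

lemma Gal_T1: "(t \<in> carrier (Gal TT (T 1))) = (t \<in> Dk 1)"
proof -
	have "(t \<in> carrier (Gal TT (T 1))) = (t \<in> carrier GF \<and> (\<forall>x\<in>T 1. t x = x))"
		using Gal_iff[OF TT_sf] F_T1 by blast
	also have "\<dots> = (t \<in> carrier GF \<and> cc t 0 = 0)"
	proof -
		{ assume t: "t \<in> carrier GF"
			hence e: "embF t" by (simp add: GalTF)
			have "cc t 0 = 0" if "\<forall>x\<in>T 1. t x = x"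
				by (rule cc_of_fix[OF e]) (use that Y_T[of 0] in auto)
			moreover have "t x = x" if "cc t 0 = 0" "x \<in> T 1" for x
				by (rule cc_fix[OF e _ _ that(2)]) (use that(1) in auto)
			ultimately have "(\<forall>x\<in>T 1. t x = x) = (cc t 0 = 0)" by blast }
		thus ?thesis by blast
	qed
	also have "\<dots> = (t \<in> Dk 1)" by (auto simp: Dk_def)
	finally show ?thesis .
qed

lemma bb_mono: "i < j ==> bb i < bb j"
proof (induction j rule: less_Suc_induct)
	case (1 i) thus ?case using p_gt_0 by (simp add: bb_Suc)
qed auto

lemma norm_ge: "(ereal (of_int \<lceil>w\<rceil>+1) \<le> normalized_val v TT x) = vge ((of_int \<lceil>w\<rceil>+1)/real (p^Suc l)) x"
proof (cases "x = 0")
	case False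
	then obtain a where a: "val a x" using val_ex by blast
	thus ?thesis
		using p_gt_0 by (simp add: normalized_val_def ram_Qp_TT vge_def val_def[of a x] divide_le_eq mult.commute del: power_Suc)
next
	case True
	show ?thesis using p_gt_0 True by (simp add: normalized_val_def ram_Qp_TT del: power_Suc)
qed

text \<open>A uniformizer, with valuation prime to \<open>p\<close>, is moved by exactly
  \<open>bb i\<close> steps, which gives the upper bound. Conversely an integral \<open>x\<close> is
  changed by an element of \<open>T 1\<close> with the same residue, which \<open>t\<close> fixes;
  the difference has valuation at least one step, and this supplies the \<open>+ 1\<close> of the
  lower numbering.\<close>

lemma break_lower:
	assumes t: "t \<in> Dk i" and i: "0 < i" "i \<le> l" and c: "cc t i \<noteq> 0"
	shows "(t \<in> lram w) = (w \<le> real (bb i))"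
proof -
	define N where "N = p^Suc l"
	have e: "embF t" using t by (simp add: Dk_def GalTF)
	have br: "has_break TT N t (real (bb i))"
		unfolding N_def by (rule emb_break[OF e i _ c i(2) order_refl]) (use t i in \<open>auto simp: Dk_def\<close>)
	have t1: "t \<in> Dk 1" using t i by (auto simp: Dk_def)
	have iff: "(t \<in> lram w) = (\<forall>x\<in>TT. vge 0 x --> vge ((of_int \<lceil>w\<rceil>+1)/real N) (t x-x))"
		unfolding lower_ram_def int_ring_def mem_Collect_eq Gal_T1 norm_ge N_def[symmetric] using t1 by (auto simp: vge_def zero_ereal_def)
	have mono: "(\<lceil>w\<rceil> \<le> int (bb i)) = (w \<le> real (bb i))" by (simp add: ceiling_le_iff)
	show ?thesis
	proof
		assume L: "t \<in> lram w"
		obtain z where z: "z \<in> TT" "val (of_int 1/real N) z" using lf_elem[OF TT_lf, of 1] unfolding N_def by blast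
		have "vge 0 z" using z(2) by (simp add: val_vge)
		hence ge: "vge ((of_int \<lceil>w\<rceil>+1)/real N) (t z-z)" using L z(1) unfolding iff by blast
		have "\<not> int p dvd 1" using p_gt_1 by simp
		from has_breakD(2)[OF br z this] have "val ((of_int 1+real (bb i))/real N) (t z-z)" .
		hence "(of_int \<lceil>w\<rceil>+1)/real N \<le> (of_int 1+real (bb i))/real N" using ge by (simp add: val_vge)
		hence "of_int \<lceil>w\<rceil> \<le> real (bb i)" using p_gt_0 by (simp add: N_def divide_le_cancel)
		hence "\<lceil>w\<rceil> \<le> int (bb i)" by linarith
		thus "w \<le> real (bb i)" using mono by blast
	next
		assume "w \<le> real (bb i)"
		hence w: "\<lceil>w\<rceil> \<le> int (bb i)" using mono by blast
		show "t \<in> lram w"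
			unfolding iff
		proof (intro ballI impI)
			fix x assume x: "x \<in> TT" "vge 0 x"
			obtain a where a: "a \<in> T 1" "vgt 0 (x-a)" using TT_residue[OF order_refl x] by blast
			have aT: "a \<in> TT" using a(1) T1_TT by blast
			define y where "y = x-a"
			have yT: "y \<in> TT" unfolding y_def by (rule sf_diff[OF TT_sf x(1) aT])
			have "t a = a" by (rule cc_fix[OF e _ _ a(1)]) (use t1 in \<open>auto simp: Dk_def\<close>)
			hence ty: "t x-x = t y-y" unfolding y_def emb_diff[OF TT_sf embK_emb[OF embF_K[OF e]] x(1) aT] by simp
			show "vge ((of_int \<lceil>w\<rceil>+1)/real N) (t x-x)"
			proof (cases "y = 0")
				case True
				thus ?thesis using ty emb_0[OF TT_sf embK_emb[OF embF_K[OF e]]] by simp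
			next
				case False
				obtain n :: int where n: "val (of_int n/real N) y" using lf_val[OF TT_lf yT False] unfolding N_def .
				have "of_int \<lceil>w\<rceil>+1 \<le> of_int n+real (bb i)" using n a(2) w by (simp add: y_def val_vgt zero_less_divide_iff)
				hence "(of_int \<lceil>w\<rceil>+1)/real N \<le> (of_int n+real (bb i))/real N" by (simp add: divide_le_cancel)
				with has_breakD(1)[OF br yT n] show ?thesis unfolding ty by (rule vge_mono)
			qed
		qed
	qed
qed

lemma one_lower: "\<one>\<^bsub>GF\<^esub> \<in> lram w"
proof -
	have "\<one>\<^bsub>GF\<^esub> \<in> Dk 1" using subgroup.one_closed[OF Dk_subgroup] .
	thus ?thesis unfolding lower_ram_def by (auto simp: Gal_T1 Gal_one int_ring_def norm_ge)
qed

text \<open>The intervals on which the lower filtration is constant. They are open on the left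
  because a group persists up to and including its break; the first and the last are
  unbounded.\<close>

definition "lev a w = (a \<le> l \<and> (a = 0 \<or> real (bb a) < w) \<and> (a = l \<or> w \<le> real (bb (Suc a))))"

text \<open>A nontrivial element fixing \<open>T 1\<close> lies in \<open>Dk (Suc a)\<close> iff its
  first nonzero pairing value occurs at some \<open>i > a\<close>; by \<open>break_lower\<close>
  this is a comparison of \<open>w\<close> with \<open>bb i\<close>.\<close>

lemma lower_Dk: assumes "lev a w" shows "lram w = Dk (Suc a)"
proof (rule Set.set_eqI)
	fix t
	show "(t \<in> lram w) = (t \<in> Dk (Suc a))"
	proof (cases "t \<in> Dk 1")
		case False
		have "t \<notin> lram w" using False by (simp add: lower_ram_def Gal_T1)
		moreover have "t \<notin> Dk (Suc a)" using False by (auto simp: Dk_def)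
		ultimately show ?thesis by blast
	next
		case t1: True
		hence tM: "t \<in> carrier GF" by (simp add: Dk_def)
		show ?thesis
		proof (cases "\<exists>k. k \<le> l \<and> cc t k \<noteq> 0")
			case False
			hence "t = \<one>\<^bsub>GF\<^esub>" using GalTF_cc_eqI[OF tM GM.M.one_closed] by (simp add: cc_one)
			thus ?thesis using one_lower subgroup.one_closed[OF Dk_subgroup] by simp
		next
			case nz: True
			define i where "i = (LEAST k. k \<le> l \<and> cc t k \<noteq> 0)"
			have i: "i \<le> l" "cc t i \<noteq> 0" using LeastI_ex[OF nz] by (simp_all add: i_def)
			have z: "cc t k = 0" if "k < i" "k \<le> l" for k
				using not_less_Least[of k "\<lambda>k. k \<le> l \<and> cc t k \<noteq> 0"] that by (simp add: i_def)
			have tD: "t \<in> Dk i" using z tM by (simp add: Dk_def)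
			have i0: "0 < i" using i(2) t1 by (cases i) (auto simp: Dk_def)
			have "(t \<in> Dk (Suc a)) = (a < i)"
			proof
				assume "t \<in> Dk (Suc a)"
				thus "a < i" using i by (auto simp: Dk_def intro: ccontr)
			next
				assume "a < i" thus "t \<in> Dk (Suc a)" using z tM by (simp add: Dk_def)
			qed
			also have "\<dots> = (w \<le> real (bb i))"
			proof
				assume "a < i"
				hence "a \<noteq> l" using i by simp
				hence "w \<le> real (bb (Suc a))" using assms by (simp add: lev_def)
				also have "bb (Suc a) \<le> bb i" using \<open>a < i\<close> bb_mono[of "Suc a" i] by (cases "Suc a = i") auto
				finally show "w \<le> real (bb i)" by simp
			next
				assume wi: "w \<le> real (bb i)"
				show "a < i"
				proof (rule ccontr)
					assume "\<not> a < i"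
					hence ia: "i \<le> a" by simp
					hence "real (bb a) < w" using assms i0 by (auto simp: lev_def)
					moreover have "bb i \<le> bb a" using ia bb_mono[of i a] by (cases "i = a") auto
					ultimately show False using wi by simp
				qed
			qed
			also have "\<dots> = (t \<in> lram w)" using break_lower[OF tD i0 i] by blast
			finally show ?thesis by blast
		qed
	qed
qed

lemma lev_ex: "\<exists>a. lev a w"
proof -
	define S where "S = {a. a \<le> l \<and> (a = 0 \<or> real (bb a) < w)}"
	have fin: "finite S" by (rule finite_subset[of _ "{..l}"]) (auto simp: S_def)
	have ne: "0 \<in> S" by (simp add: S_def)
	define a where "a = Max S"
	have a: "a \<in> S" unfolding a_def using fin ne by (intro Max_in) auto
	have "a = l \<or> w \<le> real (bb (Suc a))"
	proof (rule ccontr)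
		assume "\<not> ?thesis"
		hence "Suc a \<in> S" using a by (auto simp: S_def)
		hence "Suc a \<le> a" unfolding a_def using fin Max_ge by blast
		thus False by simp
	qed
	thus ?thesis using a by (auto simp: lev_def S_def)
qed

text \<open>An element of \<open>Dk (Suc j)\<close> is determined by its pairing values at
  \<open>j+1, ..., l\<close>, and these are arbitrary.\<close>

lemma card_Dk: assumes "j \<le> l" shows "card (Dk (Suc j)) = p^(l-j)"
proof -
	define B where "B = ({Suc j..l} \<rightarrow>\<^sub>E {..<p})"
	have "bij_betw (\<lambda>t. \<lambda>k\<in>{Suc j..l}. cc t k) (Dk (Suc j)) B"
	proof (rule bij_betwI')
		fix t t' assume t: "t \<in> Dk (Suc j)" "t' \<in> Dk (Suc j)"
		hence M: "t \<in> carrier GF" "t' \<in> carrier GF" by (auto simp: Dk_def)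
		show "((\<lambda>k\<in>{Suc j..l}. cc t k) = (\<lambda>k\<in>{Suc j..l}. cc t' k)) = (t = t')"
		proof
			assume eq: "(\<lambda>k\<in>{Suc j..l}. cc t k) = (\<lambda>k\<in>{Suc j..l}. cc t' k)"
			show "t = t'"
			proof (rule GalTF_cc_eqI[OF M])
				fix k assume k: "k \<le> l"
				show "cc t k = cc t' k"
				proof (cases "k < Suc j")
					case True thus ?thesis using t k by (simp add: Dk_def)
				next
					case False
					have "(\<lambda>k\<in>{Suc j..l}. cc t k) k = (\<lambda>k\<in>{Suc j..l}. cc t' k) k" unfolding eq ..
					thus ?thesis using False k by simp
				qed
			qed
		qed simp
	next
		fix t assume "t \<in> Dk (Suc j)"
		hence "t \<in> carrier GF" by (simp add: Dk_def)
		thus "(\<lambda>k\<in>{Suc j..l}. cc t k) \<in> B" unfolding B_def using cc_lt by auto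
	next
		fix c assume c: "c \<in> B"
		have cp: "c k < p" if "Suc j \<le> k" "k \<le> l" for k using PiE_mem[OF c[unfolded B_def], of k] that by simp
		have "\<exists>t\<in>carrier GF. \<forall>k\<le>l. cc t k = (if k < Suc j then 0 else c k)"
			by (rule GalTF_ex) (use cp p_gt_0 in auto)
		then obtain t where t: "t \<in> carrier GF" "\<And>k. k \<le> l ==> cc t k = (if k < Suc j then 0 else c k)" by blast
		have "t \<in> Dk (Suc j)" using t by (simp add: Dk_def)
		moreover have "c = (\<lambda>k\<in>{Suc j..l}. cc t k)"
		proof
			fix k show "c k = (\<lambda>k\<in>{Suc j..l}. cc t k) k"
				using t(2)[of k] PiE_arb[OF c[unfolded B_def], of k] by (cases "k \<in> {Suc j..l}") auto
		qed
		ultimately show "\<exists>t\<in>Dk (Suc j). c = (\<lambda>k\<in>{Suc j..l}. cc t k)" by blast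
	qed
	hence "card (Dk (Suc j)) = card B" by (rule bij_betw_same_card)
	also have "\<dots> = p^(l-j)" by (simp add: B_def card_PiE)
	finally show ?thesis .
qed

section \<open>The Herbrand function and the upper numbering\<close>

lemma lev_0: "w \<le> 0 ==> lev 0 w"
	by (simp add: lev_def)

lemma ratio: "lev a w ==> real (card (lram w))/real (card (lram 0)) = 1/real (p^a)"
proof -
	assume a: "lev a w"
	hence al: "a \<le> l" by (simp add: lev_def)
	have "real (p^l) = real (p^(l-a))*real (p^a)" using al by (simp flip: power_add)
	thus ?thesis using p_gt_0
		by (simp add: lower_Dk[OF a] lower_Dk[OF lev_0[of 0]] card_Dk al)
qed

abbreviation "rr w \<equiv> real (card (lram w))/real (card (lram 0))"

lemma rr_interval:
	assumes "a \<le> l" "real (bb a) \<le> w" "a = l \<or> w \<le> real (bb (Suc a))"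
	shows "(rr has_integral ((w-real (bb a))/real (p^a))) {real (bb a)..w}"
\<comment> \<open>The left endpoint belongs to the preceding interval of constancy; one point does
  not change the integral.\<close>
proof (rule has_integral_spike_finite[of "{real (bb a)}"])
	show "((\<lambda>_. 1/real (p^a)) has_integral ((w-real (bb a))/real (p^a))) {real (bb a)..w}"
		using has_integral_const_real[of "1/real (p^a)" "real (bb a)" w] assms(2) by simp
	fix x assume x: "x \<in> {real (bb a)..w} - {real (bb a)}"
	hence "lev a x" using assms by (auto simp: lev_def)
	thus "rr x = 1/real (p^a)" by (rule ratio)
qed simp

text \<open>The interval from \<open>bb a\<close> to \<open>bb (Suc a)\<close> has length
  \<open>p^a\<close>, and the integrand is \<open>1/p^a\<close> there, so each interval contributes
  1. Thus the lower number \<open>bb a\<close> becomes the upper number \<open>a\<close>.\<close>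

lemma rr_bb: "a \<le> l ==> (rr has_integral (real a)) {0..real (bb a)}"
proof (induction a)
	case 0 show ?case by (simp add: has_integral_refl)
next
	case (Suc a)
	have d: "real (bb (Suc a))-real (bb a) = real (p^a)" by (simp add: bb_Suc)
	have "(rr has_integral (real (bb (Suc a))-real (bb a))/real (p^a)) {real (bb a)..real (bb (Suc a))}"
		by (rule rr_interval) (use Suc bb_mono[of a "Suc a"] in auto)
	moreover have "real (p^a)/real (p^a) = 1" using p_gt_0 by simp
	ultimately have "(rr has_integral 1) {real (bb a)..real (bb (Suc a))}" unfolding d by (simp only:)
	from has_integral_combine[OF _ _ Suc.IH this] bb_mono[of a "Suc a"] Suc.prems
	show ?case by (simp add: add.commute)
qed

lemma herbrand_eq: assumes "lev a w" "0 < w" shows "herb w = real a+(w-real (bb a))/real (p^a)"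
proof -
	have a: "a \<le> l" "real (bb a) \<le> w" "a = l \<or> w \<le> real (bb (Suc a))" using assms by (auto simp: lev_def)
	have "(rr has_integral (real a+(w-real (bb a))/real (p^a))) {0..w}"
		by (rule has_integral_combine[OF _ a(2) rr_bb[OF a(1)] rr_interval[OF a]]) simp
	moreover have "\<not> w \<le> 0" using assms(2) by simp
	ultimately show ?thesis unfolding herbrand_def by (simp only: if_False integral_unique)
qed

lemma herbrand_bounds: assumes "lev a w" "0 < w"
	shows "real a < herb w" "a = l \<or> herb w \<le> real (Suc a)"
proof -
	have a: "real (bb a) < w" using assms by (auto simp: lev_def)
	have P: "0 < real (p^a)" using p_gt_0 by simp
	show "real a < herb w" unfolding herbrand_eq[OF assms] using a P by simp
	show "a = l \<or> herb w \<le> real (Suc a)"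
	proof (cases "a = l")
		case False
		hence "w \<le> real (bb (Suc a))" using assms by (simp add: lev_def)
		hence "w-real (bb a) \<le> real (p^a)" by (simp add: bb_Suc)
		hence "(w-real (bb a))/real (p^a) \<le> 1" using P by simp
		thus ?thesis unfolding herbrand_eq[OF assms] by simp
	qed simp
qed

lemma herbrand_inj: "inj_on (herb) {-1..}"
proof (rule inj_onI)
	fix x y assume xy: "x \<in> {-1..}" "y \<in> {-1..}" "herb x = herb y"
	have np: "herb z = z" if "z \<le> 0" for z using that by (simp add: herbrand_def)
	have pos: "0 < herb z" if "0 < z" for z
	proof -
		obtain a where "lev a z" using lev_ex by blast
		from herbrand_bounds(1)[OF this that] show ?thesis by simp
	qed
	show "x = y"
	proof (cases "x \<le> 0")
		case True
		hence "\<not> 0 < y" using pos[of y] np[of x] xy(3) by auto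
		hence "herb y = y" by (intro np) simp
		thus ?thesis using np[OF True] xy(3) by (metis)
	next
		case False
		hence x0: "0 < x" by simp
		have y0: "0 < y" using pos[OF x0] np[of y] xy(3) by (cases "y \<le> 0") auto
		obtain a where a: "lev a x" using lev_ex by blast
		obtain b where b: "lev b y" using lev_ex by blast
		have "a \<le> l" "b \<le> l" using a b by (auto simp: lev_def)
		hence "a = b" using herbrand_bounds[OF a x0] herbrand_bounds[OF b y0] xy(3) by linarith
		hence b': "lev a y" using b by simp
		have "real a+(x-real (bb a))/real (p^a) = real a+(y-real (bb a))/real (p^a)"
			unfolding herbrand_eq[OF a x0, symmetric] herbrand_eq[OF b' y0, symmetric] by (rule xy(3))
		thus ?thesis using p_gt_0 by simp
	qed
qed

definition "ulev a w = (a \<le> l \<and> (a = 0 \<or> real a < w) \<and> (a = l \<or> w \<le> real (Suc a)) \<and> -1 \<le> w)"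

lemma upper_Dk: assumes "ulev a w" shows "upper_ram v TT (T 1) w = Dk (Suc a)"
proof (cases "w \<le> 0")
	case True
	have "the_inv_into {-1..} (herb) w = w"
		by (rule the_inv_into_f_eq[OF herbrand_inj]) (use True assms in \<open>auto simp: herbrand_def ulev_def\<close>)
	moreover have "a = 0" using assms True by (auto simp: ulev_def)
	ultimately show ?thesis using lower_Dk[OF lev_0[OF True]] by (simp add: upper_ram_def)
next
	case False
	\<comment> \<open>The inverse of the linear piece of the Herbrand function computed in
	  \<open>herbrand_eq\<close>.\<close>
	define x where "x = real (bb a)+(w-real a)*real (p^a)"
	have P: "0 < real (p^a)" using p_gt_0 by simp
	have x: "real (bb a) < x" using P assms False by (auto simp: ulev_def x_def)
	have "a = l \<or> x \<le> real (bb (Suc a))"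
	proof (cases "a = l")
		case al: False
		hence "(w-real a)*real (p^a) \<le> 1*real (p^a)" using assms P by (intro mult_right_mono) (auto simp: ulev_def)
		thus ?thesis by (simp add: x_def bb_Suc)
	qed simp
	hence lx: "lev a x" using x assms by (auto simp: lev_def ulev_def)
	have x0: "0 < x" using x by simp
	have "herb x = w" unfolding herbrand_eq[OF lx x0] using P by (simp add: x_def)
	hence "the_inv_into {-1..} (herb) w = x"
		by (intro the_inv_into_f_eq[OF herbrand_inj]) (use x0 in auto)
	thus ?thesis using lower_Dk[OF lx] by (simp add: upper_ram_def)
qed

lemma ulev_ex: assumes "-1 \<le> w" shows "\<exists>a. ulev a w"
proof (cases "w \<le> 0")
	case True thus ?thesis using assms by (intro exI[of _ 0]) (auto simp: ulev_def)
next
	case False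
	show ?thesis
	proof (cases "real l < w")
		case True thus ?thesis using assms by (intro exI[of _ l]) (auto simp: ulev_def)
	next
		case wl: False
		define a where "a = nat (\<lceil>w\<rceil>-1)"
		have c: "0 < \<lceil>w\<rceil>" using False by simp
		hence ra: "real a = of_int \<lceil>w\<rceil>-1" by (simp add: a_def)
		have "of_int \<lceil>w\<rceil>-1 < w" "w \<le> of_int \<lceil>w\<rceil>" by linarith+
		moreover have "a < l"
		proof -
			show ?thesis using ra wl by linarith
		qed
		ultimately show ?thesis using ra assms by (intro exI[of _ a]) (auto simp: ulev_def)
	qed
qed

text \<open>The group equals \<open>Dk (Suc a)\<close> throughout the interval with index
  \<open>a\<close>, and these groups are distinct; so the breaks are the right endpoints
  \<open>a+1\<close>. The last interval is unbounded and contributes none.\<close>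

lemma upper_breaks_TT: "upper_breaks v TT (T 1) = real ` {1..l}"
proof (intro Set.set_eqI iffI)
	fix w assume w: "w \<in> upper_breaks v TT (T 1)"
	hence w1: "-1 \<le> w" and br: "\<And>\<epsilon>. 0 < \<epsilon> ==> upper_ram v TT (T 1) (w+\<epsilon>) \<noteq> upper_ram v TT (T 1) w"
		by (auto simp: upper_breaks_def)
	obtain a where a: "ulev a w" using ulev_ex[OF w1] by blast
	have same: "\<not> ulev a (w+\<epsilon>)" if "0 < \<epsilon>" for \<epsilon> using br[OF that] upper_Dk[OF a] upper_Dk[of a "w+\<epsilon>"] by metis
	have al: "a \<noteq> l" using same[of 1] a by (auto simp: ulev_def)
	have "\<not> w < real (Suc a)"
	proof
		assume lt: "w < real (Suc a)"
		show False using same[of "real (Suc a)-w"] a lt by (auto simp: ulev_def)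
	qed
	hence "w = real (Suc a)" using a al by (auto simp: ulev_def)
	moreover have "Suc a \<in> {1..l}" using a al by (auto simp: ulev_def)
	ultimately show "w \<in> real ` {1..l}" by blast
next
	fix w assume "w \<in> real ` {1..l}"
	then obtain i where i: "w = real i" "1 \<le> i" "i \<le> l" by auto
	define a where "a = i-1"
	have ia: "i = Suc a" using i by (simp add: a_def)
	have ua: "ulev a w" using i ia by (auto simp: ulev_def)
	have "upper_ram v TT (T 1) (w+\<epsilon>) \<noteq> upper_ram v TT (T 1) w" if e: "0 < \<epsilon>" for \<epsilon>
	proof -
		obtain b where b: "ulev b (w+\<epsilon>)" using ulev_ex[of "w+\<epsilon>"] i e by auto
		have "i \<le> b"
		proof (rule ccontr)
			assume "\<not> i \<le> b"
			hence "b \<noteq> l" "Suc b \<le> i" using i by auto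
			hence "w+\<epsilon> \<le> real (Suc b)" using b by (simp add: ulev_def)
			also have "\<dots> \<le> w" using \<open>Suc b \<le> i\<close> i by simp
			finally show False using e by simp
		qed
		hence "Dk (Suc b) \<subseteq> Dk (Suc i)" by (auto simp: Dk_def)
		also have "Dk (Suc i) \<subset> Dk i" by (rule Dk_strict) (use i in auto)
		finally show ?thesis unfolding upper_Dk[OF b] upper_Dk[OF ua] ia by blast
	qed
	thus "w \<in> upper_breaks v TT (T 1)" using i by (auto simp: upper_breaks_def)
qed

declare One_nat_def [simp]

end

subsection \<open>The residue field\<close>

context padic_valuation
begin

context
	fixes K :: "'a set"
	assumes K: "lf K 1"
begin

private lemmas Ks = lf_sfield[OF K]

lemma O_carrier: "(x \<in> carrier (int_ring v K)) = (x \<in> K \<and> vge 0 x)"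
	by (simp add: int_ring_def vge_def zero_ereal_def)

lemma O_ops [simp]: "monoid.mult (int_ring v K) = (*)" "one (int_ring v K) = 1" "ring.zero (int_ring v K) = 0"
	"ring.add (int_ring v K) = (+)"
	by (simp_all add: int_ring_def)

lemma O_cring: "cring (int_ring v K)"
proof -
	have "subring (carrier (int_ring v K)) Omega"
		by (rule Om.subringI)
			(auto simp: O_carrier sf_1[OF Ks] sf_minus[OF Ks] sf_mul[OF Ks] sf_add[OF Ks] vge_add
				dest: vge_mul[of 0 _ 0])
	from Om.subring_is_domain[OF this] have "domain (int_ring v K)" by (simp add: int_ring_def)
	thus ?thesis by (rule domain.axioms)
qed

lemma O_minus: "x \<in> K ==> vge 0 x ==> a_inv (int_ring v K) x = - x"
proof -
	interpret O: cring "int_ring v K" by (rule O_cring)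
	assume "x \<in> K" "vge 0 x"
	thus "a_inv (int_ring v K) x = - x" by (intro O.minus_equality) (simp_all add: O_carrier sf_minus[OF Ks])
qed

lemma vgt_vge_K: "x \<in> K ==> vgt 0 x = vge 1 x"
	using lf_vgt_vge[OF K, of x 0] by (auto intro: vge_vgt)

lemma PIdl_p: "PIdl\<^bsub>int_ring v K\<^esub> (of_nat p) = {x \<in> K. vge 1 x}"
proof
	show "PIdl\<^bsub>int_ring v K\<^esub> (of_nat p) \<subseteq> {x \<in> K. vge 1 x}"
	proof
		fix x assume "x \<in> PIdl\<^bsub>int_ring v K\<^esub> (of_nat p)"
		then obtain y where y: "y \<in> K" "vge 0 y" "x = y * of_nat p" by (auto simp: cgenideal_def O_carrier)
		have "vge (0+1) (y * of_nat p)" by (rule vge_mul[OF y(2)]) (simp add: val_vge[OF val_p'])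
		thus "x \<in> {x \<in> K. vge 1 x}" using y sf_mul[OF Ks y(1) sf_of_nat[OF Ks]] by simp
	qed
	show "{x \<in> K. vge 1 x} \<subseteq> PIdl\<^bsub>int_ring v K\<^esub> (of_nat p)"
	proof
		fix x assume x: "x \<in> {x \<in> K. vge 1 x}"
		have "vge (1-1) (x / of_nat p)" by (rule vge_divide) (use x in auto)
		hence "x / of_nat p \<in> carrier (int_ring v K)" using x by (simp add: O_carrier sf_divide[OF Ks] sf_of_nat[OF Ks])
		thus "x \<in> PIdl\<^bsub>int_ring v K\<^esub> (of_nat p)"
			unfolding cgenideal_def using p_gt_0 by (intro CollectI exI[of _ "x / of_nat p"]) simp
	qed
qed

lemma PIdl_ideal: "ideal (PIdl\<^bsub>int_ring v K\<^esub> (of_nat p)) (int_ring v K)"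
	by (rule cring.cgenideal_ideal[OF O_cring]) (simp add: O_carrier sf_of_nat[OF Ks])

abbreviation "rK \<equiv> residue_field p v K"
abbreviation "red \<equiv> reduction p v K"

lemma res_cring: "cring rK"
	unfolding residue_field_def by (rule ideal.quotient_is_cring[OF PIdl_ideal O_cring])

lemma red_hom: "ring_hom_cring (int_ring v K) rK red"
	using ideal.rcos_ring_hom_cring[OF PIdl_ideal O_cring] by (simp add: residue_field_def reduction_def[abs_def])

lemma res_carrier: "carrier rK = red ` carrier (int_ring v K)"
	by (auto simp: residue_field_def reduction_def FactRing_def A_RCOSETS_def')

lemma res_ex: assumes "z \<in> carrier rK" obtains x where "x \<in> K" "vge 0 x" "z = red x"
	using assms unfolding res_carrier by (auto simp: O_carrier)

lemma red_closed: assumes x: "x \<in> K" "vge 0 x" shows "red x \<in> carrier rK"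
	unfolding res_carrier using x by (simp add: O_carrier)

lemma red_minus: assumes x: "x \<in> K" "vge 0 x" shows "\<ominus>\<^bsub>rK\<^esub> red x = red (- x)"
proof -
	interpret H: ring_hom_cring "int_ring v K" rK red by (rule red_hom)
	show ?thesis using H.hom_a_inv[of x] x by (simp add: O_carrier O_minus)
qed

context
	fixes x y
	assumes x: "x \<in> K" "vge 0 x" and y: "y \<in> K" "vge 0 y"
begin

lemma red_add: "red (x+y) = red x \<oplus>\<^bsub>rK\<^esub> red y"
proof -
	interpret H: ring_hom_cring "int_ring v K" rK red by (rule red_hom)
	show ?thesis using H.hom_add[of x y] x y by (simp add: O_carrier)
qed

lemma red_mult: "red (x*y) = red x \<otimes>\<^bsub>rK\<^esub> red y"
proof -
	interpret H: ring_hom_cring "int_ring v K" rK red by (rule red_hom)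
	show ?thesis using H.hom_mult[of x y] x y by (simp add: O_carrier)
qed

lemma red_eq: "(red x = red y) = vgt 0 (x-y)"
proof -
	interpret I: ideal "PIdl\<^bsub>int_ring v K\<^esub> (of_nat p)" "int_ring v K" by (rule PIdl_ideal)
	have xy: "x \<in> carrier (int_ring v K)" "y \<in> carrier (int_ring v K)" using x y by (simp_all add: O_carrier)
	have d: "x \<ominus>\<^bsub>int_ring v K\<^esub> y = x-y" using y by (simp add: a_minus_def O_minus)
	have "(red x = red y) = (x \<ominus>\<^bsub>int_ring v K\<^esub> y \<in> PIdl\<^bsub>int_ring v K\<^esub> (of_nat p))"
		unfolding reduction_def by (rule I.quotient_eq_iff_same_a_r_cos[OF PIdl_ideal xy, symmetric])
	also have "\<dots> = vgt 0 (x-y)" unfolding d PIdl_p using x y by (simp add: vgt_vge_K sf_diff[OF Ks])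
	finally show ?thesis .
qed

end

lemma red_1: "red 1 = \<one>\<^bsub>rK\<^esub>" and red_0: "red 0 = \<zero>\<^bsub>rK\<^esub>"
proof -
	interpret H: ring_hom_cring "int_ring v K" rK red by (rule red_hom)
	show "red 1 = \<one>\<^bsub>rK\<^esub>" "red 0 = \<zero>\<^bsub>rK\<^esub>" using H.hom_one H.hom_zero by simp_all
qed

lemma red_pow: assumes "x \<in> K" "vge 0 x" shows "red x [^]\<^bsub>rK\<^esub> (n::nat) = red (x^n)"
proof (induction n)
	interpret R: cring rK by (rule res_cring)
	{ case 0 show ?case by (simp add: red_1) }
	case (Suc n)
	have "vge 0 (x^n)" using vge_power[OF assms(2), of n] by simp
	thus ?case using Suc red_mult[OF sf_power[OF Ks assms(1)] _ assms, of n] by (simp add: mult.commute)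
qed

lemma red_nat: assumes "x \<in> K" "vge 0 x" shows "[(n::nat)] \<cdot>\<^bsub>rK\<^esub> red x = red (of_nat n*x)"
proof (induction n)
	interpret R: cring rK by (rule res_cring)
	{ case 0 show ?case by (simp add: red_0) }
	case (Suc n)
	have "vge (0+0) (of_nat n*x)" by (rule vge_mul[OF vge_of_nat assms(2)])
	hence n: "of_nat n*x \<in> K" "vge 0 (of_nat n*x)" using sf_mul[OF Ks sf_of_nat[OF Ks] assms(1)] by simp_all
	have "[Suc n] \<cdot>\<^bsub>rK\<^esub> red x = [n] \<cdot>\<^bsub>rK\<^esub> red x \<oplus>\<^bsub>rK\<^esub> red x" by simp
	also have "\<dots> = red (of_nat n*x+x)" unfolding Suc by (rule red_add[OF n assms, symmetric])
	finally show ?case by (simp add: distrib_right add.commute)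
qed

lemma red_inv: assumes "x \<in> K" "val 0 x" shows "m_inv rK (red x) = red (inverse x)"
proof -
	interpret R: cring rK by (rule res_cring)
	have i: "val (- 0) (inverse x)" by (rule val_inverse[OF assms(2)])
	have x: "x \<in> K" "vge 0 x" "inverse x \<in> K" "vge 0 (inverse x)" using assms i sf_inverse[OF Ks] by (simp_all add: val_vge)
	have "red (inverse x) \<otimes>\<^bsub>rK\<^esub> red x = \<one>\<^bsub>rK\<^esub>"
		unfolding red_mult[OF x(3,4,1,2), symmetric] using val_nonzero[OF assms(2)] by (simp add: red_1)
	thus ?thesis using R.comm_inv_char[of "red x" "red (inverse x)"] R.m_comm red_closed x by metis
qed

end

end

section \<open>The residual equation and the proof of the theorem\<close>

context eis
begin

text \<open>The substitution \<open>w = n*y*x\<close> with \<open>y = (-\<rho>)^l*s\<close> turns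
  \<open>wp w - \<alpha> 0\<close> into \<open>D*P x\<close> modulo the maximal ideal, where the
  unit \<open>D\<close> is the leading term of \<open>\<alpha> 0\<close> and \<open>P\<close>
  reduces to \<open>U\<close>. The residue field of \<open>F\<close> is that of \<open>K\<close>,
  which allows \<open>x\<close> to be taken in \<open>K\<close>.\<close>

lemma splits_iff: "splits = (\<exists>x\<in>K. vge 0 x \<and> vgt 0 ((- (A1/A0))^l*x^p - of_nat l*Am/(A1*A0)*x-1))"
proof -
	obtain n where n: "\<not> p dvd n" "sim (\<alpha> 0) (of_nat n*(- \<rho>)^l * s^p)" using alpha_0 by blast
	have sK: "s \<in> K" "val 0 s" "s*\<eta> = 1"
		using eta val_inverse[OF eta(2)] val_nonzero[OF eta(2)] sf_inverse[OF K_sf] by (simp_all add: s_def)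
	have r: "- \<rho> \<in> K" "val 0 (- \<rho>)" using rho sf_minus[OF K_sf] by simp_all
	define y where "y = (- \<rho>)^l * s"
	have yv: "val 0 y" using val_mul[OF val_power[OF r(2), of l] sK(2)] by (simp add: y_def)
	have yK: "y \<in> K" unfolding y_def by (intro sf_mul[OF K_sf] sf_power[OF K_sf] r sK)
	define D where "D = of_nat n*(- \<rho>)^l * s^p"
	have Dv: "val 0 D" using val_mul[OF val_mul[OF val_of_nat[OF n(1)] val_power[OF r(2), of l]] val_power[OF sK(2), of p]] by (simp add: D_def)
	have aD: "vgt 0 (\<alpha> 0-D)" using simD[OF n(2)] Dv by (simp add: D_def)
	define P where "P x = \<rho>^((p-1)*l)*x^p-\<eta>^(p-1)*x-1" for x
	define A where "A = - (A1/A0)"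
	define B where "B = of_nat l*Am/(A1*A0)"
	have AB: "vgt 0 (A-\<rho>^(p-1))" "vgt 0 (B-\<eta>^(p-1))"
		using simD[OF rho(3)] simD[OF eta(3)] val_power[OF rho(2), of "p-1"] val_power[OF eta(2), of "p-1"]
		by (simp_all add: A_def B_def A0_def A1_def Am_def)
	have ABv: "val 0 A" "val 0 B"
		using sim_val[OF rho(3)] sim_val[OF eta(3)] val_power[OF rho(2), of "p-1"] val_power[OF eta(2), of "p-1"]
		by (simp_all add: A_def B_def A0_def A1_def Am_def)
	have Al: "vgt 0 (A^l-\<rho>^((p-1)*l))"
	proof -
		have s': "sim A (\<rho>^(p-1))" using rho(3) by (simp add: A_def A0_def A1_def)
		have "val 0 ((\<rho>^(p-1))^l)" using val_power[OF rho(2), of "(p-1)*l"] by (simp add: power_mult)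
		from simD[OF sim_power[OF s', of l] this] show ?thesis by (simp add: power_mult)
	qed
	have P_iff: "vgt 0 (P x) = vgt 0 (A^l*x^p-B*x-1)" if x: "vge 0 x" for x
	proof (rule vgt_iff)
		have xp: "vge 0 (x^p)" using vge_power[OF x, of p] by simp
		have "vgt (0+0) ((A^l-\<rho>^((p-1)*l))*x^p)" by (rule vgt_mul[OF Al xp])
		moreover have "vgt (0+0) ((B-\<eta>^(p-1))*x)" by (rule vgt_mul[OF AB(2) x])
		ultimately have "vgt 0 ((A^l-\<rho>^((p-1)*l))*x^p-(B-\<eta>^(p-1))*x)" by (intro vgt_diff) simp_all
		hence "vgt 0 (A^l*x^p-B*x-1-P x)" by (simp add: P_def algebra_simps)
		thus "vgt 0 (P x-(A^l*x^p-B*x-1))" by (rule vgt_minus_commute[THEN iffD1])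
	qed
	have key: "vgt 0 (wp (of_nat n*y*x)-\<alpha> 0) = vgt 0 (P x)" if x: "vge 0 x" for x
	proof -
		have yx: "vge 0 (y^p*x^p)"
			using vge_mul[OF vge_power[OF val_vge[OF yv, THEN iffD2, of 0], of p] vge_power[OF x, of p]] by simp
		have w: "vgt 0 (of_nat n^p - of_nat n :: 'a)" using wp_of_nat[of n] by (simp add: wp_def)
		\<comment> \<open>The sign of \<open>(-\<rho>)^l\<close> survives the p-th power because
		  \<open>p\<close> is odd.\<close>
		have D1: "D*\<rho>^((p-1)*l) = of_nat n*y^p"
		proof -
			have "(- \<rho>)^l*\<rho>^((p-1)*l) = (- \<rho>)^(l*p)"
			proof -
				have e: "(- 1)^(l*p) = ((- 1)^l :: 'a)"
					using odd_p by (cases "even l") simp_all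
				have "(p-1)*l+l = l*p" using p_gt_0 by (metis add.commute mult.commute mult_Suc Suc_diff_1)
				hence r: "\<rho>^l*\<rho>^((p-1)*l) = \<rho>^(l*p)" by (metis add.commute power_add)
				show ?thesis unfolding power_minus[of \<rho>] e r[symmetric] by simp
			qed
			thus ?thesis by (simp add: D_def y_def power_mult_distrib power_mult mult_ac) (simp add: mult_ac flip: power_mult)?
		qed
		have D2: "D*\<eta>^(p-1) = of_nat n*y"
		proof -
			have p_eq: "s^p = s^Suc (p-1)" using p_gt_0 by simp
			have "s^p*\<eta>^(p-1) = s*(s*\<eta>)^(p-1)"
				unfolding power_mult_distrib by (subst p_eq) (simp only: power_Suc mult.assoc)
			thus ?thesis using sK(3) by (simp add: D_def y_def)
		qed
		have "wp (of_nat n*y*x)-D = D*P x+(of_nat n^p - of_nat n)*(y^p*x^p)"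
		proof -
			have "D*P x = (D*\<rho>^((p-1)*l))*x^p-(D*\<eta>^(p-1))*x-D" by (simp add: P_def algebra_simps)
			thus ?thesis unfolding D1 D2 by (simp add: wp_def algebra_simps)
		qed
		hence e: "wp (of_nat n*y*x)-\<alpha> 0-D*P x = (of_nat n^p - of_nat n)*(y^p*x^p)-(\<alpha> 0-D)"
			by (simp add: algebra_simps)
		have "vgt 0 ((of_nat n^p - of_nat n)*(y^p*x^p)-(\<alpha> 0-D))"
			using vgt_diff[OF _ aD] vgt_mul[OF w yx] by simp
		hence "vgt 0 (wp (of_nat n*y*x)-\<alpha> 0-D*P x)" unfolding e .
		hence "vgt 0 (wp (of_nat n*y*x)-\<alpha> 0) = vgt 0 (D*P x)" by (rule vgt_iff)
		also have "\<dots> = vgt 0 (P x)"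
		proof
			assume "vgt 0 (D*P x)"
			from vgt_divide[OF this Dv] show "vgt 0 (P x)" using val_nonzero[OF Dv] by simp
		next
			assume "vgt 0 (P x)"
			from vgt_mul'[OF _ this, of 0 D] Dv show "vgt 0 (D*P x)" by (simp add: val_vge)
		qed
		finally show ?thesis .
	qed
	have nyv: "val 0 (of_nat n*y)" using val_mul[OF val_of_nat[OF n(1)] yv] by simp
	have nyK: "of_nat n*y \<in> K" by (rule sf_mul[OF K_sf sf_of_nat[OF K_sf] yK])
	have "splits = (\<exists>x\<in>K. vge 0 x \<and> vgt 0 (P x))"
	proof
		assume splits
		then obtain w where w: "w \<in> F" "vge 0 w" "vgt 0 (wp w-\<alpha> 0)" by (auto simp: splits_def)
		obtain z where z: "z \<in> K" "vge 0 z" "vgt 0 (w-z)" using F_residue[OF w(1,2)] by blast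
		define x where "x = z/(of_nat n*y)"
		have x: "x \<in> K" "vge 0 x" using sf_divide[OF K_sf z(1) nyK] vge_divide[OF z(2) nyv] by (simp_all add: x_def)
		have "vgt 0 (wp (w-z)-(wp w-wp z))" by (rule wp_diff[OF vge_imp_small[OF w(2)] vge_imp_small[OF z(2)]])
		from vgt_diff[OF vgt_wp[OF z(3)] this] have "vgt 0 (wp w-wp z)" by simp
		from vgt_diff[OF w(3) this] have "vgt 0 (wp z-\<alpha> 0)" by simp
		thus "\<exists>x\<in>K. vge 0 x \<and> vgt 0 (P x)" using key[OF x(2)] x val_nonzero[OF nyv] by (auto simp: x_def)
	next
		assume "\<exists>x\<in>K. vge 0 x \<and> vgt 0 (P x)"
		then obtain x where x: "x \<in> K" "vge 0 x" "vgt 0 (P x)" by blast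
		have "of_nat n*y*x \<in> F" using sf_mul[OF K_sf nyK x(1)] KF by blast
		moreover have "vge 0 (of_nat n*y*x)" using vge_mul[of 0 "of_nat n*y" 0 x] nyv x(2) by (simp add: val_vge)
		ultimately show splits unfolding splits_def using key[OF x(2)] x(3) by blast
	qed
	also have "\<dots> = (\<exists>x\<in>K. vge 0 x \<and> vgt 0 (A^l*x^p-B*x-1))" using P_iff by blast
	finally show ?thesis by (simp only: A_def B_def)
qed

end

lemma ext_generate_field:
	assumes K: "sfield (K :: 'a::field set)" and S: "sfield (ext K z)" shows "generate_field Omega (insert z K) = ext K z"
proof -
	interpret Omf: field "Omega :: 'a ring" by (rule field_from_type_algebra)
	show ?thesis
	proof
		show "generate_field Omega (insert z K) \<subseteq> ext K z"
			by (rule Omf.generate_field_min_subfield1[OF _ S]) (use ext_incl[OF K] ext_mem[OF K] in auto)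
		have "sfield (generate_field Omega (insert z K))" by (rule Omf.generate_field_is_subfield) simp
		thus "ext K z \<subseteq> generate_field Omega (insert z K)"
			by (rule ext_least[OF K]) (auto intro: generate_field.incl)
	qed
qed

theorem theorem3:
	fixes p l r :: nat
		and v :: "'a::{alg_closed_field, field_char_0} \<Rightarrow> ereal"
		and K L Lt :: "'a set"
		and f :: "'a poly"
		and \<pi> :: 'a
		and \<kappa> :: "'a set ring"
		and Fp Fpp Gr \<rho> \<eta> :: "'a set"
		and U :: "'a set \<Rightarrow> 'a set"
	assumes "padic_valuation p v" and "odd p"
		and "unramified_ext v (Qp v) K"
		and "2 \<le> l" and "l \<le> p - 1"
		and r_def: "r = p^2 - (p - 1) * l + p"
		and "Polynomial.degree f = p^2" and "eisenstein v K f"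
		and cond1: "v (co_coeff f p) = 1"
			"\<forall>i \<in> coprime_range p 2 (p - 1). 2 \<le> v (co_coeff f (p * i))"
		and cond2: "\<forall>i \<in> coprime_range p 1 (r - 1). 2 \<le> v (co_coeff f i)"
			"v (co_coeff f r) = 2"
			"\<forall>i \<in> coprime_range p (r + 1) (p^2 - 1). 3 \<le> v (co_coeff f i)"
		and \<kappa>_def: "\<kappa> = residue_field p v K"
		and Fp_def: "Fp = reduction p v K (co_coeff f p / of_nat p)"
		and Fpp_def: "Fpp = reduction p v K (co_coeff f (p^2) / of_nat p)"
		and Gr_def: "Gr = reduction p v K (co_coeff f r / of_nat p ^ 2)"
		and cond3: "\<rho> \<in> carrier \<kappa> - {\<zero>\<^bsub>\<kappa>\<^esub>}"
			"\<ominus>\<^bsub>\<kappa>\<^esub> (Fp \<otimes>\<^bsub>\<kappa>\<^esub> m_inv \<kappa> Fpp) = \<rho> [^]\<^bsub>\<kappa>\<^esub> (p - 1)"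
		and cond4: "\<eta> \<in> carrier \<kappa> - {\<zero>\<^bsub>\<kappa>\<^esub>}"
			"([l] \<cdot>\<^bsub>\<kappa>\<^esub> Gr) \<otimes>\<^bsub>\<kappa>\<^esub> m_inv \<kappa> (Fp \<otimes>\<^bsub>\<kappa>\<^esub> Fpp) = \<eta> [^]\<^bsub>\<kappa>\<^esub> (p - 1)"
		and "poly f \<pi> = 0"
		and L_def: "L = generate_field Omega (insert \<pi> K)"
		and Lt_def: "Lt = normal_closure K L"
		and U_def: "\<And>x. U x =
			(\<ominus>\<^bsub>\<kappa>\<^esub> (Fp \<otimes>\<^bsub>\<kappa>\<^esub> m_inv \<kappa> Fpp)) [^]\<^bsub>\<kappa>\<^esub> l \<otimes>\<^bsub>\<kappa>\<^esub> x [^]\<^bsub>\<kappa>\<^esub> p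
				\<ominus>\<^bsub>\<kappa>\<^esub> (([l] \<cdot>\<^bsub>\<kappa>\<^esub> Gr) \<otimes>\<^bsub>\<kappa>\<^esub> m_inv \<kappa> (Fp \<otimes>\<^bsub>\<kappa>\<^esub> Fpp)) \<otimes>\<^bsub>\<kappa>\<^esub> x
				\<ominus>\<^bsub>\<kappa>\<^esub> \<one>\<^bsub>\<kappa>\<^esub>"
	shows "(\<exists>!F. ext_of_degree p K F \<and> F \<subseteq> L) \<and>
		(\<forall>F. ext_of_degree p K F \<and> F \<subseteq> L \<longrightarrow>
			normal_ext K F \<and>
			split_extension (Gal Lt K) (Gal Lt F) (Gal F K) (\<lambda>\<sigma>. restrict \<sigma> F) \<and>
			elementary_abelian p (Gal Lt F) \<and>
			indecomposable_module (group_algebra (residue_ring (int p)) (Gal F K)) (galois_module K F Lt) \<and>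
			((\<nexists>x. x \<in> carrier \<kappa> \<and> U x = \<zero>\<^bsub>\<kappa>\<^esub>) \<longrightarrow>
				 has_composition_length (group_algebra (residue_ring (int p)) (Gal F K))
					 (galois_module K F Lt) (l + 1) \<and>
				 (\<exists>E. F \<subset> E \<and> E \<subseteq> Lt \<and> unramified_ext v F E \<and> totally_ramified_ext v E Lt \<and>
						upper_breaks v Lt E = real ` {1..l})) \<and>
			((\<exists>x. x \<in> carrier \<kappa> \<and> U x = \<zero>\<^bsub>\<kappa>\<^esub>) \<longrightarrow>
				 has_composition_length (group_algebra (residue_ring (int p)) (Gal F K))
					 (galois_module K F Lt) l \<and>
				 totally_ramified_ext v F Lt \<and> upper_breaks v Lt F = real ` {1..l}))"
proof -
	interpret padic_valuation p v by fact
	have K: "lf K 1" by (rule lf_unramified[OF assms(3)])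
	note Ks = lf_sfield[OF K]
	\<comment> \<open>The ordinary exponent of the term whose coefficient is
	  \<open>f_r\<close>.\<close>
	define m where "m = (p-1)*l-p"
	have p3: "3 \<le> p" using \<open>odd p\<close> p_gt_1 by (cases "p = 2") auto
	have pl: "p \<le> (p-1)*l"
	proof -
		have "p \<le> (p-1)*2" using p3 by simp
		also have "\<dots> \<le> (p-1)*l" using \<open>2 \<le> l\<close> by (rule mult_le_mono2)
		finally show ?thesis .
	qed
	hence mp: "m+p = (p-1)*l" by (simp add: m_def)
	have "(p-1)*l \<le> (p-1)*p" using \<open>l \<le> p - 1\<close> by (intro mult_le_mono2) simp
	also have "\<dots> \<le> p^2" by (simp add: power2_eq_square)
	finally have lp2: "(p-1)*l \<le> p^2" .
	have mr: "m+r = p^2" unfolding r_def using mp lp2 by simp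
	have deg: "pdeg f = p^2" by fact
	have eis: "plead f = 1" "\<And>i. i < p^2 ==> pcoeff f i \<in> max_ideal v K"
		"pcoeff f 0 \<notin> ideal_prod (int_ring v K) (max_ideal v K) (max_ideal v K)"
		using \<open>eisenstein v K f\<close> deg by (auto simp: eisenstein_def)
	have cK: "pcoeff f i \<in> K \<and> vgt 0 (pcoeff f i)" if "i < p^2" for i
		using eis(2)[OF that] by (simp add: max_ideal_def vgt_def zero_ereal_def)
	have co: "co_coeff f i = pcoeff f (p^2-i)" for i by (simp add: co_coeff_def deg)
	have pp: "p^2-p*i = p*(p-i)" for i by (simp add: power2_eq_square right_diff_distrib')
	have p20: "0 < p^2" "p*(p-1) < p^2" using p_gt_0 by (simp_all add: power2_eq_square)
	have f_p: "val 1 (pcoeff f (p*(p-1)))"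
		using cond1(1) pp[of 1] by (simp add: co val_def)
	have p2: "of_nat p \<in> max_ideal v K" using val_p by (simp add: max_ideal_def sf_of_nat[OF Ks])
	have f_0: "val 1 (pcoeff f 0)"
	proof -
		have c: "pcoeff f 0 \<in> K" "vgt 0 (pcoeff f 0)" using cK[OF p20(1)] by auto
		hence "vge 1 (pcoeff f 0)" using vgt_vge_K[OF K] by blast
		\<comment> \<open>If the valuation exceeded 1, the constant term divided by \<open>p\<close> would
		  still be in the maximal ideal, and so the constant term would lie in its square.\<close>
		moreover have "\<not> vgt 1 (pcoeff f 0)"
		proof
			assume "vgt 1 (pcoeff f 0)"
			hence "vgt (1-1) (pcoeff f 0 / of_nat p)" by (rule vgt_divide) simp
			hence "pcoeff f 0 / of_nat p \<in> max_ideal v K"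
				using sf_divide[OF Ks c(1) sf_of_nat[OF Ks]] by (simp add: max_ideal_def vgt_def zero_ereal_def)
			from ideal_prod.prod[OF this p2, of "int_ring v K"] show False
				using eis(3) p_gt_0 by (simp add: int_ring_def)
		qed
		ultimately show ?thesis using vge_cases by blast
	qed
	have f_m: "val 2 (pcoeff f m)"
	proof -
		have "p^2-r = m" using mr by simp
		thus ?thesis using cond2(2) by (simp add: co val_def)
	qed
	have cop: "Rings.coprime i p = (\<not> p dvd i)" for i
	proof
		assume c: "Rings.coprime i p"
		show "\<not> p dvd i"
		proof
			assume "p dvd i"
			hence "is_unit p" by (rule coprime_common_divisor[OF c]) simp
			thus False using p_gt_1 by simp
		qed
	qed (rule coprime_commute[THEN iffD1, OF prime_imp_coprime[OF prime_p]])
	have f_hi: "vge 2 (pcoeff f n)" if n: "m < n" "n < p^2" "\<not> p dvd n" for n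
	proof -
		have "p^2-n \<in> coprime_range p 1 (r-1)" using dvd_diffD1[of p "p^2" n] n mr by (auto simp: coprime_range_def cop)
		hence "2 \<le> v (co_coeff f (p^2-n))" using cond2(1) by blast
		thus ?thesis using n by (simp add: co vge_def)
	qed
	have f_lo: "vge 3 (pcoeff f n)" if n: "n < m" "\<not> p dvd n" for n
	proof -
		have n0: "0 < n" using n by (intro gr0I) simp
		have n2: "n < p^2" using n mr by simp
		have "p^2-n \<in> coprime_range p (r+1) (p^2-1)" using dvd_diffD1[of p "p^2" n] n n2 n0 mr by (auto simp: coprime_range_def cop)
		hence "3 \<le> v (co_coeff f (p^2-n))" using cond2(3) by blast
		thus ?thesis using n2 by (simp add: co vge_def)
	qed
	have f_pj: "vge 2 (pcoeff f (p*j))" if j: "1 \<le> j" "j \<le> p-2" for j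
	proof -
		have "\<not> p dvd p-j" using j by (auto dest: dvd_imp_le)
		hence "p-j \<in> coprime_range p 2 (p-1)" using j by (auto simp: coprime_range_def cop)
		hence "2 \<le> v (co_coeff f (p*(p-j)))" using cond1(2) by blast
		moreover have "p^2-p*(p-j) = p*j" using pp[of "p-j"] j by simp
		ultimately show ?thesis by (simp add: co vge_def)
	qed
	have over: "over_field K f"
		unfolding over_field_def
	proof
		fix i show "pcoeff f i \<in> K"
			using cK[of i] eis(1) deg coeff_eq_0[of f i] sf_0[OF Ks] sf_1[OF Ks] by (cases i "p^2" rule: linorder_cases) auto
	qed
	define a0 where "a0 = pcoeff f 0 / of_nat p"
	define a1 where "a1 = pcoeff f (p*(p-1)) / of_nat p"
	define am where "am = pcoeff f m / of_nat p^2"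
	have inK: "a0 \<in> K" "a1 \<in> K" "am \<in> K"
		using over by (simp_all add: a0_def a1_def am_def over_field_def sf_divide[OF Ks] sf_of_nat[OF Ks] sf_power[OF Ks])
	have "val (1-1) a0" "val (1-1) a1" unfolding a0_def a1_def by (rule val_divide[OF f_0 val_p'] val_divide[OF f_p val_p'])+
	moreover have "val (2-real 2*1) am" unfolding am_def by (rule val_divide[OF f_m val_power[OF val_p', of 2]])
	ultimately have av: "val 0 a0" "val 0 a1" "val 0 am" by simp_all
	have F_red: "Fp = red K a1" "Fpp = red K a0" "Gr = red K am"
	proof -
		have "p^2-r = m" using mr by simp
		thus "Gr = red K am" by (simp add: Gr_def co am_def)
		show "Fp = red K a1" using pp[of 1] by (simp add: Fp_def co a1_def)
		show "Fpp = red K a0" by (simp add: Fpp_def co a0_def)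
	qed
	\<comment> \<open>The powers of \<open>p\<close> cancel in these two quotients, so the conditions
	  on residues can be stated with the coefficients of \<open>f\<close> themselves.\<close>
	define A where "A = - (pcoeff f (p*(p-1))/pcoeff f 0)"
	define B where "B = of_nat l*pcoeff f m/(pcoeff f (p*(p-1))*pcoeff f 0)"
	have A_eq: "- (a1*inverse a0) = A" using p_gt_0 by (simp add: A_def a0_def a1_def)
	have B_eq: "of_nat l*am*inverse (a1*a0) = B"
	proof -
		have "inverse (of_nat p)*(inverse (of_nat p)*(of_nat p * of_nat p)) = (1 :: 'a)" using p_gt_0 by (simp add: field_simps)
		thus ?thesis by (simp add: B_def a0_def a1_def am_def divide_inverse power2_eq_square)
	qed
	have iv: "inverse a0 \<in> K" "vge 0 (inverse a0)" "inverse (a1*a0) \<in> K" "vge 0 (inverse (a1*a0))" "a1*a0 \<in> K" "val 0 (a1*a0)"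
		using val_inverse[OF av(1)] val_mul[OF av(2,1)] val_inverse[OF val_mul[OF av(2,1)]] inK
		by (simp_all add: val_vge sf_inverse[OF Ks] sf_mul[OF Ks])
	have ge: "vge 0 a0" "vge 0 a1" "vge 0 am" "vge 0 (a1*inverse a0)" "vge 0 (of_nat l*am)"
		using av vge_mul[of 0 a1 0 "inverse a0"] iv vge_mul[of 0 "of_nat l" 0 am] by (simp_all add: val_vge)
	have AB: "A \<in> K" "vge 0 A" "B \<in> K" "vge 0 B"
		unfolding A_eq[symmetric] B_eq[symmetric]
		using ge iv vge_mul[OF ge(5) iv(4)] inK by (simp_all add: sf_mul[OF Ks] sf_minus[OF Ks] sf_of_nat[OF Ks])
	have rA: "\<ominus>\<^bsub>\<kappa>\<^esub> (Fp \<otimes>\<^bsub>\<kappa>\<^esub> m_inv \<kappa> Fpp) = red K A"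
		unfolding \<kappa>_def F_red red_inv[OF K inK(1) av(1)] red_mult[OF K inK(2) ge(2) iv(1,2), symmetric]
			red_minus[OF K sf_mul[OF Ks inK(2) iv(1)] ge(4)] A_eq ..
	have rB: "([l] \<cdot>\<^bsub>\<kappa>\<^esub> Gr) \<otimes>\<^bsub>\<kappa>\<^esub> m_inv \<kappa> (Fp \<otimes>\<^bsub>\<kappa>\<^esub> Fpp) = red K B"
		unfolding \<kappa>_def F_red red_nat[OF K inK(3) ge(3)] red_mult[OF K inK(2) ge(2) inK(1) ge(1), symmetric] red_inv[OF K iv(5,6)]
			red_mult[OF K sf_mul[OF Ks sf_of_nat[OF Ks] inK(3)] ge(5) iv(3,4), symmetric] B_eq ..
	have unit: "val 0 x" if "x \<in> K" "vge 0 x" "red K x \<noteq> \<zero>\<^bsub>\<kappa>\<^esub>" for x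
		using that(3) red_eq[OF K that(1,2) sf_0[OF Ks]] vge_cases[OF that(2)] by (auto simp: \<kappa>_def red_0[OF K, symmetric])
	obtain \<rho>' where \<rho>': "\<rho>' \<in> K" "vge 0 \<rho>'" "\<rho> = red K \<rho>'" using res_ex[OF K] cond3(1) unfolding \<kappa>_def by blast
	obtain \<eta>' where \<eta>': "\<eta>' \<in> K" "vge 0 \<eta>'" "\<eta> = red K \<eta>'" using res_ex[OF K] cond4(1) unfolding \<kappa>_def by blast
	have u: "val 0 \<rho>'" "val 0 \<eta>'" using unit \<rho>' \<eta>' cond3(1) cond4(1) by auto
	have pw: "vge 0 (x^n)" if "vge 0 x" for x n using vge_power[OF that, of n] by simp
	have sA: "sim A (\<rho>'^(p-1))"
	proof (rule simI[of 0])
		show "val 0 (\<rho>'^(p-1))" using val_power[OF u(1), of "p-1"] by simp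
		have "red K A = red K (\<rho>'^(p-1))"
			using cond3(2) unfolding rA unfolding \<rho>'(3) \<kappa>_def red_pow[OF K \<rho>'(1,2)] .
		thus "vgt 0 (A-\<rho>'^(p-1))" using red_eq[OF K AB(1,2) sf_power[OF Ks \<rho>'(1)] pw[OF \<rho>'(2)]] by blast
	qed
	have sB: "sim B (\<eta>'^(p-1))"
	proof (rule simI[of 0])
		show "val 0 (\<eta>'^(p-1))" using val_power[OF u(2), of "p-1"] by simp
		have "red K B = red K (\<eta>'^(p-1))"
			using cond4(2) unfolding rB unfolding \<eta>'(3) \<kappa>_def red_pow[OF K \<eta>'(1,2)] .
		thus "vgt 0 (B-\<eta>'^(p-1))" using red_eq[OF K AB(3,4) sf_power[OF Ks \<eta>'(1)] pw[OF \<eta>'(2)]] by blast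
	qed
	interpret E: eis p v K l m f \<pi> \<rho>' \<eta>'
		by unfold_locales
			(use \<open>odd p\<close> K \<open>2 \<le> l\<close> \<open>l \<le> p - 1\<close> mp deg eis(1) over f_0 f_p f_pj f_m f_hi f_lo \<rho>'(1) \<eta>'(1) u sA sB
					\<open>poly f \<pi> = 0\<close> in \<open>simp_all only: A_def B_def not_False_eq_True\<close>)
	have L: "L = E.L"
		unfolding L_def E.L_def by (rule ext_generate_field[OF Ks E.L_sf[unfolded E.L_def]])
	have Lt: "Lt = E.TT" unfolding Lt_def L by (rule E.normal_closure_L)
	\<comment> \<open>Both sides are the same congruence on integral elements of \<open>K\<close>, read
	  once in the residue field and once modulo the maximal ideal.\<close>
	have splits: "(\<exists>x. x \<in> carrier \<kappa> \<and> U x = \<zero>\<^bsub>\<kappa>\<^esub>) = E.splits"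
	proof -
		have Ux: "(U (red K x) = \<zero>\<^bsub>\<kappa>\<^esub>) = vgt 0 (A^l*x^p-B*x-1)" if x: "x \<in> K" "vge 0 x" for x
		proof -
			have Alx: "A^l*x^p \<in> K" "vge 0 (A^l*x^p)"
				using sf_mul[OF Ks sf_power[OF Ks AB(1)] sf_power[OF Ks x(1)]] vge_mul[OF pw[OF AB(2), of l] pw[OF x(2), of p]] by simp_all
			have Bx: "B*x \<in> K" "vge 0 (B*x)" using sf_mul[OF Ks AB(3) x(1)] vge_mul[OF AB(4) x(2)] by simp_all
			have nBx: "- (B*x) \<in> K" "vge 0 (- (B*x))" using Bx sf_minus[OF Ks] by simp_all
			have n1: "- 1 \<in> K" "vge 0 (- 1)" using sf_minus[OF Ks sf_1[OF Ks]] by simp_all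
			have o: "1 \<in> K" "vge 0 1" using sf_1[OF Ks] by simp_all
			have S: "A^l*x^p + - (B*x) \<in> K" "vge 0 (A^l*x^p + - (B*x))"
				by (rule sf_add[OF Ks Alx(1) nBx(1)], rule vge_add[OF Alx(2) nBx(2)])
			have T: "A^l*x^p + - (B*x) + - 1 \<in> K" "vge 0 (A^l*x^p + - (B*x) + - 1)"
				by (rule sf_add[OF Ks S(1) n1(1)], rule vge_add[OF S(2) n1(2)])
			have "U (red K x) = red K (A^l*x^p + - (B*x) + - 1)"
				unfolding U_def rA rB a_minus_def
				unfolding \<kappa>_def red_pow[OF K AB(1,2)] red_pow[OF K x]
					red_mult[OF K sf_power[OF Ks AB(1)] pw[OF AB(2)] sf_power[OF Ks x(1)] pw[OF x(2)], symmetric]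
					red_mult[OF K AB(3,4) x, symmetric] red_minus[OF K Bx] red_1[OF K, symmetric] red_minus[OF K o]
					red_add[OF K Alx nBx, symmetric] red_add[OF K S n1, symmetric] ..
			thus ?thesis using red_eq[OF K T sf_0[OF Ks]] by (simp add: \<kappa>_def red_0[OF K, symmetric])
		qed
		have "(\<exists>x. x \<in> carrier \<kappa> \<and> U x = \<zero>\<^bsub>\<kappa>\<^esub>) = (\<exists>x\<in>K. vge 0 x \<and> U (red K x) = \<zero>\<^bsub>\<kappa>\<^esub>)"
		proof
			assume "\<exists>x. x \<in> carrier \<kappa> \<and> U x = \<zero>\<^bsub>\<kappa>\<^esub>"
			then obtain z where z: "z \<in> carrier \<kappa>" "U z = \<zero>\<^bsub>\<kappa>\<^esub>" by blast
			obtain x where "x \<in> K" "vge 0 x" "z = red K x" using res_ex[OF K] z(1) unfolding \<kappa>_def by blast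
			thus "\<exists>x\<in>K. vge 0 x \<and> U (red K x) = \<zero>\<^bsub>\<kappa>\<^esub>" using z(2) by blast
		next
			assume "\<exists>x\<in>K. vge 0 x \<and> U (red K x) = \<zero>\<^bsub>\<kappa>\<^esub>"
			then obtain x where x: "x \<in> K" "vge 0 x" "U (red K x) = \<zero>\<^bsub>\<kappa>\<^esub>" by blast
			have "red K x \<in> carrier \<kappa>" unfolding \<kappa>_def by (rule red_closed[OF K x(1,2)])
			thus "\<exists>x. x \<in> carrier \<kappa> \<and> U x = \<zero>\<^bsub>\<kappa>\<^esub>" using x(3) by blast
		qed
		also have "\<dots> = (\<exists>x\<in>K. vge 0 x \<and> vgt 0 (A^l*x^p-B*x-1))" using Ux by blast
		also have "\<dots> = E.splits" unfolding E.splits_iff E.A0_def E.A1_def E.Am_def A_def B_def ..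
		finally show ?thesis .
	qed
	have F: "ext_of_degree p K E.F \<and> E.F \<subseteq> L"
		unfolding L using E.F_dim Ks E.F_sf E.KF E.FL by (simp add: ext_of_degree_def field_ext_def)
	have un: "F' = E.F" if "ext_of_degree p K F' \<and> F' \<subseteq> L" for F'
		using E.F_unique that unfolding L by blast
	have len: "has_composition_length E.GM.A (galois_module K E.F E.TT) (if E.splits then l else l+1)"
		by (rule E.comp_length)
	show ?thesis
	proof (intro conjI allI impI)
		show "\<exists>!F. ext_of_degree p K F \<and> F \<subseteq> L" using F un by blast
		fix F' assume F': "ext_of_degree p K F' \<and> F' \<subseteq> L"
		have F'_eq: "F' = E.F" by (rule un[OF F'])
		show "normal_ext K F'" unfolding F'_eq by (rule E.F_normal)
		show "split_extension (Gal Lt K) (Gal Lt F') (Gal F' K) (\<lambda>\<sigma>. restrict \<sigma> F')" unfolding F'_eq Lt by (rule E.split)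
		show "elementary_abelian p (Gal Lt F')" unfolding F'_eq Lt by (rule E.TF_elementary)
		show "indecomposable_module (group_algebra (residue_ring (int p)) (Gal F' K)) (galois_module K F' Lt)"
			unfolding F'_eq Lt by (rule E.indecomposable)
		{ assume "\<nexists>x. x \<in> carrier \<kappa> \<and> U x = \<zero>\<^bsub>\<kappa>\<^esub>"
			hence ns: "\<not> E.splits" using splits by blast
			show "has_composition_length (group_algebra (residue_ring (int p)) (Gal F' K)) (galois_module K F' Lt) (l+1)"
				unfolding F'_eq Lt using len ns by simp
			\<comment> \<open>The intermediate field is generated over \<open>F\<close> by
			  \<open>Y 0\<close>, the root of the equation with unit constant.\<close>
			show "\<exists>E. F' \<subset> E \<and> E \<subseteq> Lt \<and> unramified_ext v F' E \<and> totally_ramified_ext v E Lt \<and> upper_breaks v Lt E = real ` {1..l}"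
				unfolding F'_eq Lt
				by (intro exI[of _ "E.T 1"] conjI E.F_psub_T1[OF ns] E.T1_TT E.T1_unramified[OF ns] E.TT_totally_ramified E.upper_breaks_TT) }
		{ assume "\<exists>x. x \<in> carrier \<kappa> \<and> U x = \<zero>\<^bsub>\<kappa>\<^esub>"
			hence s: E.splits using splits by blast
			show "has_composition_length (group_algebra (residue_ring (int p)) (Gal F' K)) (galois_module K F' Lt) l"
				unfolding F'_eq Lt using len s by simp
			show "totally_ramified_ext v F' Lt" "upper_breaks v Lt F' = real ` {1..l}"
				using E.TT_totally_ramified E.upper_breaks_TT unfolding F'_eq Lt E.T1_splits[OF s] by blast+ }
	qed
qed

end
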